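(* Consider the three-user complex Gaussian interference channel and the auxiliary variables described in the context. Let \begin{align*} A=\frac13\Big\{& I(X_{1G};Y_{1G})+I(X_{2G};Y_{2G},S_{2G}\mid X_{1G})+I(X_{3G};Y_{3G}\mid U_{3G})\\ &+I(X_{2G};Y_{2G})+I(X_{3G};Y_{3G},S_{3G}\mid X_{2G})+I(X_{1G};Y_{1G}\mid U_{1G})\\ &+I(X_{3G};Y_{3G})+I(X_{1G};Y_{1G},S_{1G}\mid X_{3G})+I(X_{2G};Y_{2G}\mid U_{2G})\Big\}, \end{align*} $I_0=\frac13\{I(U_{1G};Y_{1G}+\tilde V_{N_3})+I(U_{2G};Y_{2G}+\tilde V_{N_1})+I(U_{3G};Y_{3G}+\tilde V_{N_2})\}$ and $I_1=\frac13\{I(U_{1G};Y_{1G}+\tilde V'_{N_3})+I(U_{2G};Y_{2G}+\tilde V'_{N_1})+I(U_{3G};Y_{3G}+\tilde V'_{N_2})\}$. (a) If $(N_1,N_2,N_3,W_1,W_2,W_3)$ satisfy $\sigma^2_{V_{W_1}}\ge\sigma^2_{N_2}$, $\sigma^2_{V_{N_2}}\ge|h_{13}|^2\sigma^2_{Z_3-W_3}$; $\sigma^2_{V_{W_2}}\ge\sigma^2_{N_3}$, $\sigma^2_{V_{N_3}}\ge|h_{21}|^2\sigma^2_{Z_1-W_1}$; $\sigma^2_{V_{W_3}}\ge\sigma^2_{N_1}$, $\sigma^2_{V_{N_1}}\ge|h_{32}|^2\sigma^2_{Z_2-W_2}$, then every achievable rate triple satisfies $R_1+R_2+R_3\le A+I_0$.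 (b) If $(N_1,N_2,N_3,W_1,W_2,W_3)$ satisfy $\sigma^2_{V_{W_1}}\ge\sigma^2_{W_1}$, $\sigma^2_{V'_{N_2}}\ge|h_{23}|^2\sigma^2_{Z_3-W_3}$; $\sigma^2_{V_{W_2}}\ge\sigma^2_{W_2}$, $\sigma^2_{V'_{N_3}}\ge|h_{31}|^2\sigma^2_{Z_1-W_1}$; $\sigma^2_{V_{W_3}}\ge\sigma^2_{W_3}$, $\sigma^2_{V'_{N_1}}\ge|h_{12}|^2\sigma^2_{Z_2-W_2}$, then every achievable rate triple satisfies $R_1+R_2+R_3\le A+I_1$. In particular the sum capacity is at most $A+\min\{I_0,I_1\}$ when both sets of conditions hold. Moreover, the same bounds hold after any permutation of the user indices (giving $3!$ such bounds).
   Context: Three-user complex Gaussian interference channel: $Y_1=X_1+h_{12}X_2+h_{13}X_3+Z_1$, $Y_2=X_2+h_{23}X_3+h_{21}X_1+Z_2$, $Y_3=X_3+h_{31}X_1+h_{32}X_2+Z_3$, with constant complex coefficients $h_{ij}$ known to all terminals, noises $Z_k\sim\mathcal{CN}(0,1)$ i.i.d. over time and independent of the inputs, and average power constraints $\sum_{t=1}^n|x_{k,t}|^2\le nP_k$ on transmitter $k$'s codewords. A rate triple is achievable if there exist length-$n$ codes with independent messages uniform on $[1:2^{nR_k}]$ and average error probability tending to $0$; the sum capacity is the supremum of $R_1+R_2+R_3$ over achievable triples. Logarithms are base 2. Gaussian evaluation: $X_{kG}\sim\mathcal{CN}(0,P_k)$, mutually independent and independent of all noises; a subscript $G$ means the variable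 is formed with each $X_k$ replaced by $X_{kG}$. For jointly circularly symmetric complex Gaussian $A,B$: $\sigma^2_A=\mathbb{E}|A|^2$, $\sigma^2_{A|B}=\sigma^2_A-|\mathbb{E}[AB^*]|^2/\sigma^2_B$. Noises: for $k=1,2,3$, $W_k\sim\mathcal{CN}(0,\sigma^2_{W_k})$, $N_k\sim\mathcal{CN}(0,\sigma^2_{N_k})$ with $\sigma^2_{W_k},\sigma^2_{N_k}\le1$; $W_k$ is jointly Gaussian with $Z_k$ with $\mathbb{E}[Z_kW_k^*]=\rho_{W_k}\sigma_{W_k}$ and independent of everything else; $N_k$ is jointly Gaussian with $Z_k$ with $\mathbb{E}[Z_kN_k^*]=\rho_{N_k}\sigma_{N_k}$ and independent of everything else. Genie signals: $U_1=h_{12}X_2+h_{13}X_3+W_1$, $U_2=h_{23}X_3+h_{21}X_1+W_2$, $U_3=h_{31}X_1+h_{32}X_2+W_3$; $S_1=h_{31}X_1+h_{32}X_2+N_1$, $S_2=h_{12}X_2+h_{13}X_3+N_2$, $S_3=h_{23}X_3+h_{21}X_1+N_3$. Variances: $\sigma^2_{V_{W_k}}=\sigma^2_{W_k|Z_k-W_k}$; $\sigma^2_{V_{N_1}}=\sigma^2_{N_1|Z_1-h_{12}h_{32}^{-1}N_1}$, $\sigma^2_{V_{N_2}}=\sigma^2_{N_2|Z_2-h_{23}h_{13}^{-1}N_2}$, $\sigma^2_{V_{N_3}}=\sigma^2_{N_3|Z_3-h_{31}h_{21}^{-1}N_3}$; $\sigma^2_{V'_{N_1}}=\sigma^2_{Z_1|N_1-h_{32}h_{12}^{-1}Z_1}$,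 $\sigma^2_{V'_{N_2}}=\sigma^2_{Z_2|N_2-h_{13}h_{23}^{-1}Z_2}$, $\sigma^2_{V'_{N_3}}=\sigma^2_{Z_3|N_3-h_{21}h_{31}^{-1}Z_3}$. $V_{N_k}\sim\mathcal{CN}(0,\sigma^2_{V_{N_k}})$ and $V'_{N_k}\sim\mathcal{CN}(0,\sigma^2_{V'_{N_k}})$ are independent of all other variables, and $\tilde V_{N_1}=\sqrt{|h_{32}|^{-2}-\sigma^{-2}_{V_{N_1}}\sigma^2_{Z_2-W_2}}\,V_{N_1}$, $\tilde V_{N_2}=\sqrt{|h_{13}|^{-2}-\sigma^{-2}_{V_{N_2}}\sigma^2_{Z_3-W_3}}\,V_{N_2}$, $\tilde V_{N_3}=\sqrt{|h_{21}|^{-2}-\sigma^{-2}_{V_{N_3}}\sigma^2_{Z_1-W_1}}\,V_{N_3}$; $\tilde V'_{N_1}=\sqrt{|h_{12}|^{-2}-\sigma^{-2}_{V'_{N_1}}\sigma^2_{Z_2-W_2}}\,V'_{N_1}$, $\tilde V'_{N_2}=\sqrt{|h_{23}|^{-2}-\sigma^{-2}_{V'_{N_2}}\sigma^2_{Z_3-W_3}}\,V'_{N_2}$, $\tilde V'_{N_3}=\sqrt{|h_{31}|^{-2}-\sigma^{-2}_{V'_{N_3}}\sigma^2_{Z_1-W_1}}\,V'_{N_3}$ (the expressions presuppose the cross coefficients with negative exponents are nonzero). *)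

theory Defs
  imports "HOL-Probability.Probability" "HOL-Combinatorics.Permutations"
begin

text \<open>Users are indexed by 1, 2, 3.  ch_h Q k j is the cross coefficient h_kj (k different from j),
  ch_P Q k the power P_k; the auxiliary noises W_k, N_k have standard deviations
  sW Q k, sN Q k and correlation coefficients rW Q k, rN Q k, i.e.
  E[Z_k W_k^*] = rW_k sW_k and E[Z_k N_k^*] = rN_k sN_k.\<close>

record prm =
  ch_h :: "nat \<Rightarrow> nat \<Rightarrow> complex"
  ch_P :: "nat \<Rightarrow> real"
  sW :: "nat \<Rightarrow> real"
  rW :: "nat \<Rightarrow> complex"
  sN :: "nat \<Rightarrow> real"
  rN :: "nat \<Rightarrow> complex"

definition users :: "nat set" where "users = {1, 2, 3}"

definition cgauss :: "real \<Rightarrow> complex measure" where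
  "cgauss v = density lborel (\<lambda>z. ennreal (exp (- (cmod z)\<^sup>2 / v) / (pi * v)))"

definition noiseM :: "nat \<Rightarrow> (nat \<times> nat \<Rightarrow> complex) measure" where
  "noiseM n = PiM (users \<times> {..<n}) (\<lambda>_. cgauss 1)"

text \<open>Encoders e k w t: codeword symbol at time t of user k for message w.
  Messages m k, received block at receiver k.\<close>
definition rx :: "(nat \<Rightarrow> nat \<Rightarrow> complex) \<Rightarrow> nat \<Rightarrow> (nat \<Rightarrow> nat \<Rightarrow> nat \<Rightarrow> complex)
     \<Rightarrow> (nat \<Rightarrow> nat) \<Rightarrow> (nat \<times> nat \<Rightarrow> complex) \<Rightarrow> nat \<Rightarrow> (nat \<Rightarrow> complex)" where
  "rx h n e m z k = (\<lambda>t\<in>{..<n}. e k (m k) t + (\<Sum>j\<in>users - {k}. h k j * e j (m j) t) + z (k, t))"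

definition is_code :: "(nat \<Rightarrow> real) \<Rightarrow> nat \<Rightarrow> (nat \<Rightarrow> nat)
     \<Rightarrow> (nat \<Rightarrow> nat \<Rightarrow> nat \<Rightarrow> complex) \<Rightarrow> (nat \<Rightarrow> (nat \<Rightarrow> complex) \<Rightarrow> nat) \<Rightarrow> bool" where
  "is_code P n M e d \<longleftrightarrow>
     (\<forall>k\<in>users. \<forall>w<M k. (\<Sum>t<n. (cmod (e k w t))\<^sup>2) \<le> real n * P k) \<and>
     (\<forall>k\<in>users. d k \<in> measurable (PiM {..<n} (\<lambda>_. borel)) (count_space UNIV))"

definition err :: "(nat \<Rightarrow> nat \<Rightarrow> complex) \<Rightarrow> nat \<Rightarrow> (nat \<Rightarrow> nat)
     \<Rightarrow> (nat \<Rightarrow> nat \<Rightarrow> nat \<Rightarrow> complex) \<Rightarrow> (nat \<Rightarrow> (nat \<Rightarrow> complex) \<Rightarrow> nat) \<Rightarrow> real" where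
  "err h n M e d = (1 / real (M 1 * M 2 * M 3)) *
     (\<Sum>m\<in>PiE users (\<lambda>k. {..<M k}).
        measure (noiseM n) {z \<in> space (noiseM n). \<exists>k\<in>users. d k (rx h n e m z k) \<noteq> m k})"

definition msize :: "nat \<Rightarrow> (nat \<Rightarrow> real) \<Rightarrow> nat \<Rightarrow> nat" where
  "msize n R k = nat \<lceil>2 powr (real n * R k)\<rceil>"

definition achievable :: "(nat \<Rightarrow> nat \<Rightarrow> complex) \<Rightarrow> (nat \<Rightarrow> real) \<Rightarrow> (nat \<Rightarrow> real) \<Rightarrow> bool" where
  "achievable h P R \<longleftrightarrow> (\<forall>k\<in>users. 0 \<le> R k) \<and>
     (\<exists>e d. (\<forall>n. is_code P n (msize n R) (e n) (d n)) \<and>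
            (\<lambda>n. err h n (msize n R) (e n) (d n)) \<longlonglongrightarrow> 0)"

definition sum_capacity :: "(nat \<Rightarrow> nat \<Rightarrow> complex) \<Rightarrow> (nat \<Rightarrow> real) \<Rightarrow> ereal" where
  "sum_capacity h P = (SUP R\<in>{R. achievable h P R}. ereal (R 1 + R 2 + R 3))"

text \<open>Independent/primitive jointly Gaussian variables: inputs X_kG, noises Z_k, W_k, N_k,
  and the extra variables V_N (GV) and V'_N (GV'), the latter two indexed by the label
  of the (possibly permuted) user.  A jointly Gaussian variable is represented as a
  complex linear form over these.\<close>

datatype gv = GX nat | GZ nat | GW nat | GN nat | GV nat | GV' nat

type_synonym lin = "gv \<Rightarrow> complex"

definition gbase :: "gv set" where
  "gbase = (\<Union>k\<in>users. {GX k, GZ k, GW k, GN k, GV k, GV' k})"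

definition gcov :: "(gv \<Rightarrow> gv \<Rightarrow> complex) \<Rightarrow> lin \<Rightarrow> lin \<Rightarrow> complex" where
  "gcov K a b = (\<Sum>i\<in>gbase. \<Sum>j\<in>gbase. a i * cnj (b j) * K i j)"

definition K0 :: "prm \<Rightarrow> gv \<Rightarrow> gv \<Rightarrow> complex" where
  "K0 Q i j = (case (i, j) of
      (GX k, GX l) \<Rightarrow> if k = l then complex_of_real (ch_P Q k) else 0
    | (GZ k, GZ l) \<Rightarrow> if k = l then 1 else 0
    | (GW k, GW l) \<Rightarrow> if k = l then complex_of_real ((sW Q k)\<^sup>2) else 0
    | (GN k, GN l) \<Rightarrow> if k = l then complex_of_real ((sN Q k)\<^sup>2) else 0
    | (GZ k, GW l) \<Rightarrow> if k = l then rW Q k * complex_of_real (sW Q k) else 0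
    | (GW k, GZ l) \<Rightarrow> if k = l then cnj (rW Q k) * complex_of_real (sW Q k) else 0
    | (GZ k, GN l) \<Rightarrow> if k = l then rN Q k * complex_of_real (sN Q k) else 0
    | (GN k, GZ l) \<Rightarrow> if k = l then cnj (rN Q k) * complex_of_real (sN Q k) else 0
    | _ \<Rightarrow> 0)"

definition lbase :: "gv \<Rightarrow> lin" where "lbase g = (\<lambda>v. if v = g then 1 else 0)"
definition ladd :: "lin \<Rightarrow> lin \<Rightarrow> lin" where "ladd a b = (\<lambda>v. a v + b v)"
definition lsub :: "lin \<Rightarrow> lin \<Rightarrow> lin" where "lsub a b = (\<lambda>v. a v - b v)"
definition lsc :: "complex \<Rightarrow> lin \<Rightarrow> lin" where "lsc c a = (\<lambda>v. c * a v)"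

definition lI :: "prm \<Rightarrow> nat \<Rightarrow> lin" where
  "lI Q k = (\<lambda>v. case v of GX j \<Rightarrow> if j \<in> users \<and> j \<noteq> k then ch_h Q k j else 0 | _ \<Rightarrow> 0)"

definition lY :: "prm \<Rightarrow> nat \<Rightarrow> lin" where
  "lY Q k = ladd (lbase (GX k)) (ladd (lI Q k) (lbase (GZ k)))"

definition lU :: "prm \<Rightarrow> nat \<Rightarrow> lin" where
  "lU Q k = ladd (lI Q k) (lbase (GW k))"

definition nxt :: "nat \<Rightarrow> nat" where "nxt i = (if i = 3 then 1 else i + 1)"
definition prv :: "nat \<Rightarrow> nat" where "prv i = nxt (nxt i)"

text \<open>S for label i (w.r.t. user relabelling p): interference at receiver p(prv i) plus N_{p i}.
  For p = id: S_1 = h31 X1 + h32 X2 + N1 etc.\<close>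
definition lS :: "prm \<Rightarrow> (nat \<Rightarrow> nat) \<Rightarrow> nat \<Rightarrow> lin" where
  "lS Q p i = ladd (lI Q (p (prv i))) (lbase (GN (p i)))"

definition gvar :: "(gv \<Rightarrow> gv \<Rightarrow> complex) \<Rightarrow> lin \<Rightarrow> real" where
  "gvar K a = Re (gcov K a a)"

definition csv :: "(gv \<Rightarrow> gv \<Rightarrow> complex) \<Rightarrow> lin \<Rightarrow> lin \<Rightarrow> real" where
  "csv K a b = gvar K a - (cmod (gcov K a b))\<^sup>2 / gvar K b"

definition vVW :: "prm \<Rightarrow> nat \<Rightarrow> real" where
  "vVW Q k = csv (K0 Q) (lbase (GW k)) (lsub (lbase (GZ k)) (lbase (GW k)))"

definition vZW :: "prm \<Rightarrow> nat \<Rightarrow> real" where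
  "vZW Q k = gvar (K0 Q) (lsub (lbase (GZ k)) (lbase (GW k)))"

definition vVN :: "prm \<Rightarrow> (nat \<Rightarrow> nat) \<Rightarrow> nat \<Rightarrow> real" where
  "vVN Q p i = csv (K0 Q) (lbase (GN (p i)))
     (lsub (lbase (GZ (p i))) (lsc (ch_h Q (p i) (p (nxt i)) / ch_h Q (p (prv i)) (p (nxt i))) (lbase (GN (p i)))))"

definition vVN' :: "prm \<Rightarrow> (nat \<Rightarrow> nat) \<Rightarrow> nat \<Rightarrow> real" where
  "vVN' Q p i = csv (K0 Q) (lbase (GZ (p i)))
     (lsub (lbase (GN (p i))) (lsc (ch_h Q (p (prv i)) (p (nxt i)) / ch_h Q (p i) (p (nxt i))) (lbase (GZ (p i)))))"

definition Kf :: "prm \<Rightarrow> (nat \<Rightarrow> nat) \<Rightarrow> gv \<Rightarrow> gv \<Rightarrow> complex" where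
  "Kf Q p i j = (case (i, j) of
      (GV k, GV l) \<Rightarrow> if k = l then complex_of_real (vVN Q p k) else 0
    | (GV' k, GV' l) \<Rightarrow> if k = l then complex_of_real (vVN' Q p k) else 0
    | _ \<Rightarrow> K0 Q i j)"

definition tc :: "prm \<Rightarrow> (nat \<Rightarrow> nat) \<Rightarrow> nat \<Rightarrow> real" where
  "tc Q p i = sqrt (1 / (cmod (ch_h Q (p (prv i)) (p (nxt i))))\<^sup>2 - vZW Q (p (nxt i)) / vVN Q p i)"

definition tc' :: "prm \<Rightarrow> (nat \<Rightarrow> nat) \<Rightarrow> nat \<Rightarrow> real" where
  "tc' Q p i = sqrt (1 / (cmod (ch_h Q (p i) (p (nxt i))))\<^sup>2 - vZW Q (p (nxt i)) / vVN' Q p i)"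

text \<open>Conditional variance of A given a list of jointly Gaussian variables (MMSE of the best
  linear estimate, which for jointly Gaussian variables is the conditional variance).\<close>
definition condvar :: "(gv \<Rightarrow> gv \<Rightarrow> complex) \<Rightarrow> lin \<Rightarrow> lin list \<Rightarrow> real" where
  "condvar K a cs = (INF c::nat \<Rightarrow> complex.
      gvar K (\<lambda>v. a v - (\<Sum>i<length cs. c i * (cs ! i) v)))"

text \<open>Mutual information I(A; Bs | Cs) (bits) for jointly circularly symmetric complex
  Gaussian variables, A scalar: log(var(A|Cs)/var(A|Bs,Cs)), with value 0 if A is
  degenerate given Cs and +infinity if A is determined by Bs,Cs but not by Cs.\<close>
definition gmi :: "(gv \<Rightarrow> gv \<Rightarrow> complex) \<Rightarrow> lin \<Rightarrow> lin list \<Rightarrow> lin list \<Rightarrow> ereal" where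
  "gmi K a bs cs = (let s1 = condvar K a cs; s2 = condvar K a (bs @ cs) in
      if s1 = 0 then 0 else if s2 = 0 then \<infinity> else ereal (log 2 (s1 / s2)))"

definition Aterm :: "prm \<Rightarrow> (nat \<Rightarrow> nat) \<Rightarrow> ereal" where
  "Aterm Q p = ereal (1/3) * (\<Sum>i\<in>users.
       gmi (K0 Q) (lbase (GX (p i))) [lY Q (p i)] []
     + gmi (K0 Q) (lbase (GX (p (nxt i)))) [lY Q (p (nxt i)), lS Q p (nxt i)] [lbase (GX (p i))]
     + gmi (K0 Q) (lbase (GX (p (prv i)))) [lY Q (p (prv i))] [lU Q (p (prv i))])"

definition I0term :: "prm \<Rightarrow> (nat \<Rightarrow> nat) \<Rightarrow> ereal" where
  "I0term Q p = ereal (1/3) * (\<Sum>i\<in>users.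
       gmi (Kf Q p) (lU Q (p i)) [ladd (lY Q (p i)) (lsc (complex_of_real (tc Q p (prv i))) (lbase (GV (prv i))))] [])"

definition I1term :: "prm \<Rightarrow> (nat \<Rightarrow> nat) \<Rightarrow> ereal" where
  "I1term Q p = ereal (1/3) * (\<Sum>i\<in>users.
       gmi (Kf Q p) (lU Q (p i)) [ladd (lY Q (p i)) (lsc (complex_of_real (tc' Q p (prv i))) (lbase (GV' (prv i))))] [])"

definition cond_a :: "prm \<Rightarrow> (nat \<Rightarrow> nat) \<Rightarrow> bool" where
  "cond_a Q p \<longleftrightarrow> (\<forall>i\<in>users.
      vVW Q (p i) \<ge> (sN Q (p (nxt i)))\<^sup>2 \<and>
      vVN Q p (nxt i) \<ge> (cmod (ch_h Q (p i) (p (prv i))))\<^sup>2 * vZW Q (p (prv i)))"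

definition cond_b :: "prm \<Rightarrow> (nat \<Rightarrow> nat) \<Rightarrow> bool" where
  "cond_b Q p \<longleftrightarrow> (\<forall>i\<in>users.
      vVW Q (p i) \<ge> (sW Q (p i))\<^sup>2 \<and>
      vVN' Q p (nxt i) \<ge> (cmod (ch_h Q (p (nxt i)) (p (prv i))))\<^sup>2 * vZW Q (p (prv i)))"

end

theory Submission
  imports Defs "HOL-Library.Function_Algebras"
begin

text \<open>
  For a codebook \<open>c\<close> of power \<open>P\<close> let \<open>D(c, v)\<close> be the gap between the Gaussian entropy
  \<open>n ln (\<pi> e (P + v))\<close> and the entropy of a random codeword plus Gaussian noise of variance \<open>v\<close>.
  The gap is non-negative and decreases in \<open>v\<close>.  Fano's inequality is used three times at every
  receiver: with interference treated as noise, with the side information \<open>S\<close> and the previous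
  user's input, and with the noisy interference \<open>U\<close>.  Gaussian cross entropies turn these bounds into the three
  kinds of terms of \<open>A\<close> plus a signed sum of gaps of single codebooks and of interference
  codebooks at various noise levels.  Summed over the three users, the conditions on the auxiliary
  noises make the gaps cancel, so the sum rate is at most \<open>A\<close>, while \<open>I\<^sub>0\<close> and \<open>I\<^sub>1\<close> are non-negative.
  For \<open>U\<close> one needs that Gaussian inputs minimise the mutual information of two signals that are
  coupled only through correlated Gaussian noise; this follows by comparing them with the sums and
  differences of the signals and an independent Gaussian pair.  If the auxiliary noises are degenerate,
  then either a term of \<open>A\<close> is infinite or the bounds survive with a simpler proof.
\<close>

section \<open>Gaussian vectors\<close>

type_synonym cvec = "nat \<Rightarrow> complex"

definition lborelC :: "nat \<Rightarrow> cvec measure" where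
  "lborelC n = PiM {..<n} (\<lambda>_. lborel)"

definition sqnorm :: "nat \<Rightarrow> cvec \<Rightarrow> real" where
  "sqnorm n y = (\<Sum>t<n. (cmod (y t))\<^sup>2)"

definition gauss :: "nat \<Rightarrow> real \<Rightarrow> cvec \<Rightarrow> real" where
  "gauss n v y = exp (- sqnorm n y / v) / (pi * v) ^ n"

definition scale :: "complex \<Rightarrow> cvec \<Rightarrow> cvec" where
  "scale k y = (\<lambda>t. k * y t)"

abbreviation trunc :: "nat \<Rightarrow> cvec \<Rightarrow> cvec" where
  "trunc n y \<equiv> restrict y {..<n}"

lemma scale_apply [simp]: "scale k y t = k * y t"
  by (simp add: scale_def)

lemma scale_simps [simp]:
  "scale k (x + y) = scale k x + scale k y" "scale k (x - y) = scale k x - scale k y"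
  "scale k (scale l y) = scale (k * l) y" "scale 1 y = y" "scale 0 y = 0" "scale k 0 = 0"
  by (auto simp: fun_eq_iff algebra_simps)

lemma scale_add_left: "scale (k + l) y = scale k y + scale l y"
  by (simp add: fun_eq_iff algebra_simps)

lemma sqnorm_nonneg [simp]: "0 \<le> sqnorm n y"
  by (simp add: sqnorm_def sum_nonneg)

lemma sqnorm_trunc [simp]: "sqnorm n (trunc n y) = sqnorm n y"
  by (simp add: sqnorm_def)

lemma sqnorm_trunc_shift [simp]: "sqnorm n (trunc n y - c) = sqnorm n (y - c)" "sqnorm n (trunc n y + c) = sqnorm n (y + c)"
  "sqnorm n (c - trunc n y) = sqnorm n (c - y)"  "sqnorm n (c + trunc n y) = sqnorm n (c + y)"
  by (simp_all add: sqnorm_def)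

lemma sqnorm_scale [simp]: "sqnorm n (scale k y) = (cmod k)\<^sup>2 * sqnorm n y"
  by (simp add: sqnorm_def norm_mult power_mult_distrib sum_distrib_left)

lemma sqnorm_cong: "(\<And>t. t < n \<Longrightarrow> x t = y t) \<Longrightarrow> sqnorm n x = sqnorm n y"
  by (simp add: sqnorm_def)

lemma gauss_cong: "(\<And>t. t < n \<Longrightarrow> x t = y t) \<Longrightarrow> gauss n v x = gauss n v y"
  using sqnorm_cong[of n x y] by (simp add: gauss_def)

lemma gauss_uminus: "gauss n v (- y) = gauss n v y"
  by (simp add: gauss_def sqnorm_def)

lemma gauss_pos [simp]: "0 < v \<Longrightarrow> 0 < gauss n v y"
  by (simp add: gauss_def)

lemma gauss_nonneg [simp]: "0 < v \<Longrightarrow> 0 \<le> gauss n v y"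
  by (simp add: gauss_def)

subsection \<open>Lebesgue measure on complex vectors\<close>

text \<open>Sums of vectors in the space of \<open>lborelC n\<close> need not be extensional, so measurability is stated componentwise.\<close>

definition vec_measurable :: "'a measure \<Rightarrow> nat \<Rightarrow> ('a \<Rightarrow> cvec) \<Rightarrow> bool" where
  "vec_measurable N n f \<longleftrightarrow> (\<forall>t<n. (\<lambda>\<omega>. f \<omega> t) \<in> borel_measurable N)"

lemma vec_measurableI [intro]:
  "vec_measurable N n f \<Longrightarrow> vec_measurable N n g \<Longrightarrow> vec_measurable N n (\<lambda>\<omega>. f \<omega> + g \<omega>)"
  "vec_measurable N n f \<Longrightarrow> vec_measurable N n g \<Longrightarrow> vec_measurable N n (\<lambda>\<omega>. f \<omega> - g \<omega>)"
  "vec_measurable N n f \<Longrightarrow> vec_measurable N n (\<lambda>\<omega>. scale k (f \<omega>))"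
  "vec_measurable N n (\<lambda>\<omega>. c)"
  "vec_measurable N n f \<Longrightarrow> vec_measurable N n (\<lambda>\<omega>. trunc n (f \<omega>))"
  unfolding vec_measurable_def by (simp_all add: borel_measurable_add borel_measurable_diff borel_measurable_times)

lemma vec_measurable_lborelC: "f \<in> measurable N (lborelC n) \<Longrightarrow> vec_measurable N n f"
  unfolding vec_measurable_def lborelC_def
proof (intro allI impI)
  fix t assume "f \<in> measurable N (PiM {..<n} (\<lambda>_. lborel))" "t < n"
  then have "(\<lambda>\<omega>. f \<omega> t) \<in> measurable N lborel"
    using measurable_compose[OF _ measurable_component_singleton[of t "{..<n}" "\<lambda>_. lborel :: complex measure"], of f N]
    by simp
  then show "(\<lambda>\<omega>. f \<omega> t) \<in> borel_measurable N" by simp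
qed

lemma measurable_trunc: "vec_measurable N n f \<Longrightarrow> (\<lambda>\<omega>. trunc n (f \<omega>)) \<in> measurable N (lborelC n)"
  unfolding vec_measurable_def lborelC_def by (intro measurable_restrict) auto

lemma vec_measurable_proj [intro]: "vec_measurable (lborelC n) n (\<lambda>x. x)"
  "vec_measurable (lborelC n \<Otimes>\<^sub>M M') n fst" "vec_measurable (M' \<Otimes>\<^sub>M lborelC n) n snd"
  by (rule vec_measurable_lborelC, simp)+

lemma sqnorm_measurable: "vec_measurable N n f \<Longrightarrow> (\<lambda>\<omega>. sqnorm n (f \<omega>)) \<in> borel_measurable N"
  unfolding vec_measurable_def sqnorm_def by (intro borel_measurable_sum) auto

lemma gauss_measurable: "vec_measurable N n f \<Longrightarrow> (\<lambda>\<omega>. gauss n v (f \<omega>)) \<in> borel_measurable N"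
  unfolding gauss_def using sqnorm_measurable[of N n f] by measurable

lemma gauss_measurable_ennreal: "vec_measurable N n f \<Longrightarrow> (\<lambda>\<omega>. ennreal (gauss n v (f \<omega>))) \<in> borel_measurable N"
  using gauss_measurable[of N n f v] by simp

lemma measurable_component_lborelC: "t < n \<Longrightarrow> (\<lambda>y. y t) \<in> borel_measurable (lborelC n)"
  using vec_measurable_proj(1)[of n] by (simp add: vec_measurable_def)

interpretation lborel_vec: product_sigma_finite "\<lambda>_::nat. lborel :: complex measure"
  by standard

lemma sigma_finite_lborelC [simp]: "sigma_finite_measure (lborelC n)"
  unfolding lborelC_def by (rule lborel_vec.sigma_finite) simp

lemma space_lborelC: "space (lborelC n) = PiE {..<n} (\<lambda>_. UNIV)"
  by (simp add: lborelC_def space_PiM)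

lemma trunc_space_lborelC [simp]: "y \<in> space (lborelC n) \<Longrightarrow> trunc n y = y"
  by (auto simp: space_lborelC PiE_def extensional_restrict)

lemma emeasure_lborelC_box: "(\<And>t. t < n \<Longrightarrow> A t \<in> sets borel) \<Longrightarrow>
    emeasure (lborelC n) (PiE {..<n} A) = (\<Prod>t<n. emeasure lborel (A t))"
  unfolding lborelC_def by (intro lborel_vec.emeasure_PiM) auto

lemma nn_integral_lborelC_componentwise:
  assumes F_meas [measurable]: "F \<in> borel_measurable (lborelC n)"
    and f_meas [measurable]: "\<And>t. f t \<in> borel_measurable borel" and r_pos: "0 < r"
    and substitution: "\<And>t G. G \<in> borel_measurable borel \<Longrightarrow> (\<integral>\<^sup>+z. G (f t z) \<partial>lborel) = ennreal r * (\<integral>\<^sup>+z. G (z::complex) \<partial>lborel)"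
  shows "(\<integral>\<^sup>+y. F (\<lambda>t\<in>{..<n}. f t (y t)) \<partial>lborelC n) = ennreal (r ^ n) * (\<integral>\<^sup>+y. F y \<partial>lborelC n)"
proof -
  let ?f = "\<lambda>y. \<lambda>t\<in>{..<n}. f t (y t)"
  let ?P = "density (distr (lborelC n) (lborelC n) ?f) (\<lambda>_. ennreal (1 / r ^ n))"
  have map_meas [measurable]: "?f \<in> measurable (lborelC n) (lborelC n)"
    using measurable_component_lborelC[of _ n] unfolding lborelC_def[of n]
    by (intro measurable_restrict) (auto simp: lborelC_def[symmetric])
  have "?P = PiM {..<n} (\<lambda>_. lborel)"
  proof (rule lborel_vec.PiM_eqI)
    show "sets ?P = sets (PiM {..<n} (\<lambda>_. lborel))" by (simp add: lborelC_def)
    fix A :: "nat \<Rightarrow> complex set" assume "\<And>i. i \<in> {..<n} \<Longrightarrow> A i \<in> sets lborel"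
    then have A_sets: "A t \<in> sets borel" if "t < n" for t using that by auto
    then have box_sets: "PiE {..<n} A \<in> sets (lborelC n)" by (auto simp: lborelC_def intro!: sets_PiM_I_finite)
    have preimage: "?f -` PiE {..<n} A \<inter> space (lborelC n) = PiE {..<n} (\<lambda>t. f t -` A t)"
      by (auto simp: space_lborelC PiE_iff)
    have preimage_sets: "f t -` A t \<in> sets borel" if "t < n" for t
      using A_sets[OF that] f_meas by (intro measurable_sets_borel[where M = borel]) auto
    have component: "emeasure lborel (f t -` A t) = ennreal r * emeasure lborel (A t)" if t: "t < n" for t
    proof -
      have "indicator (A t) (f t z) = (indicator (f t -` A t) z :: ennreal)" for z by (simp add: indicator_def)
      then have "emeasure lborel (f t -` A t) = (\<integral>\<^sup>+z. indicator (A t) (f t z) \<partial>lborel)"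
        using preimage_sets[OF t] by simp
      also have "\<dots> = ennreal r * (\<integral>\<^sup>+z. indicator (A t) z \<partial>lborel)"
        using A_sets[OF t] by (intro substitution) auto
      finally show ?thesis using A_sets[OF t] by simp
    qed
    have "emeasure ?P (PiE {..<n} A) = ennreal (1 / r ^ n) * emeasure (lborelC n) (PiE {..<n} (\<lambda>t. f t -` A t))"
      using box_sets by (subst emeasure_density_const) (simp_all add: emeasure_distr[OF map_meas] preimage)
    also have "emeasure (lborelC n) (PiE {..<n} (\<lambda>t. f t -` A t)) = (\<Prod>t<n. ennreal r * emeasure lborel (A t))"
      by (subst emeasure_lborelC_box) (auto simp: component preimage_sets)
    also have "ennreal (1 / r ^ n) * \<dots> = (\<Prod>t<n. emeasure lborel (A t))"
      using r_pos by (simp add: prod.distrib ennreal_power mult.assoc[symmetric] ennreal_mult'[symmetric])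
    finally show "emeasure ?P (PiE {..<n} A) = (\<Prod>i<n. emeasure lborel (A i))" .
  qed simp
  then have "(\<integral>\<^sup>+y. F y \<partial>lborelC n) = (\<integral>\<^sup>+y. F y \<partial>?P)" by (simp add: lborelC_def)
  also have "\<dots> = ennreal (1 / r ^ n) * (\<integral>\<^sup>+y. F (?f y) \<partial>lborelC n)"
    by (subst nn_integral_density) (simp_all add: nn_integral_distr nn_integral_cmult)
  finally show ?thesis using r_pos by (simp add: mult.assoc[symmetric] ennreal_mult'[symmetric])
qed

lemma nn_integral_lborelC_translate:
  assumes "F \<in> borel_measurable (lborelC n)"
  shows "(\<integral>\<^sup>+y. F (trunc n (y + c)) \<partial>lborelC n) = (\<integral>\<^sup>+y. F y \<partial>lborelC n)"
proof -
  have "(\<integral>\<^sup>+z. G (z + c t) \<partial>lborel) = ennreal 1 * (\<integral>\<^sup>+z. G z \<partial>lborel)" if [measurable]: "G \<in> borel_measurable borel" for t G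
    by (subst (2) lborel_distr_plus[of "c t", symmetric]) (simp add: nn_integral_distr add.commute)
  from nn_integral_lborelC_componentwise[OF assms, of "\<lambda>t z. z + c t" 1, OF _ _ this]
  show ?thesis by (simp add: plus_fun_def)
qed

lemma lborel_complex_eq_distr:
  "(lborel :: complex measure) = distr (lborel \<Otimes>\<^sub>M lborel) borel (\<lambda>(x, y). Complex x y)"
proof (rule lborel_eqI)
  fix l u :: complex assume "\<And>b. b \<in> Basis \<Longrightarrow> l \<bullet> b \<le> u \<bullet> b"
  from this[of 1] this[of \<i>] have le: "Re l \<le> Re u" "Im l \<le> Im u" by (auto simp: Basis_complex_def)
  have Complex_meas: "(\<lambda>(x, y). Complex x y) \<in> measurable (lborel \<Otimes>\<^sub>M lborel) borel"
    by (simp add: complex_eq_iff borel_measurable_complex_iff split_beta')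
  have "(\<lambda>(x, y). Complex x y) -` box l u \<inter> space (lborel \<Otimes>\<^sub>M lborel) = {Re l<..<Re u} \<times> {Im l<..<Im u}"
    by (auto simp: space_pair_measure box_def Basis_complex_def)
  then have "emeasure (distr (lborel \<Otimes>\<^sub>M lborel) borel (\<lambda>(x, y). Complex x y)) (box l u)
      = emeasure (lborel \<Otimes>\<^sub>M lborel) ({Re l<..<Re u} \<times> {Im l<..<Im u})"
    by (subst emeasure_distr[OF Complex_meas]) auto
  also have "\<dots> = ennreal (Re u - Re l) * ennreal (Im u - Im l)"
    using le by (subst lborel.emeasure_pair_measure_Times) auto
  also have "\<dots> = (\<Prod>b\<in>Basis. (u - l) \<bullet> b)"
    using le by (simp add: Basis_complex_def ennreal_mult'[symmetric])
  finally show "emeasure (distr (lborel \<Otimes>\<^sub>M lborel) borel (\<lambda>(x, y). Complex x y)) (box l u) = (\<Prod>b\<in>Basis. (u - l) \<bullet> b)" .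
qed simp

lemma nn_integral_lborel_complex:
  assumes [measurable]: "F \<in> borel_measurable borel"
  shows "(\<integral>\<^sup>+z. F z \<partial>lborel) = (\<integral>\<^sup>+x. \<integral>\<^sup>+y. F (Complex x y) \<partial>lborel \<partial>lborel)"
proof -
  have Complex_meas: "(\<lambda>(x, y). Complex x y) \<in> measurable (lborel \<Otimes>\<^sub>M lborel) borel"
    by (simp add: complex_eq_iff borel_measurable_complex_iff split_beta')
  have "(\<integral>\<^sup>+z. F z \<partial>lborel) = (\<integral>\<^sup>+p. F ((\<lambda>(x, y). Complex x y) p) \<partial>(lborel \<Otimes>\<^sub>M lborel))"
    by (subst lborel_complex_eq_distr, subst nn_integral_distr[OF Complex_meas]) auto
  also have "\<dots> = (\<integral>\<^sup>+x. \<integral>\<^sup>+y. F (Complex x y) \<partial>lborel \<partial>lborel)"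
    using measurable_compose[OF Complex_meas assms] by (subst lborel.nn_integral_fst[symmetric]) simp_all
  finally show ?thesis .
qed

lemma borel_measurable_Complex: "f \<in> borel_measurable M \<Longrightarrow> g \<in> borel_measurable M \<Longrightarrow>
   (\<lambda>x. Complex (f x) (g x)) \<in> borel_measurable M"
  by (simp add: borel_measurable_complex_iff)

lemma nn_integral_lborel_translate: "f \<in> borel_measurable borel \<Longrightarrow>
  (\<integral>\<^sup>+x. f (x + c) \<partial>lborel) = (\<integral>\<^sup>+x. f (x::real) \<partial>lborel)"
  using nn_integral_real_affine[of f 1 c] by (simp add: add.commute)

lemma nn_integral_lborel_complex_shear:
  assumes [measurable]: "F \<in> borel_measurable borel"
  shows "(\<integral>\<^sup>+z. F (z + of_real (s * Im z)) \<partial>lborel) = (\<integral>\<^sup>+z. F z \<partial>lborel)" (is "?horizontal = _")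
    and "(\<integral>\<^sup>+z. F (z + \<i> * of_real (s * Re z)) \<partial>lborel) = (\<integral>\<^sup>+z. F z \<partial>lborel)" (is "?vertical = _")
proof -
  note [measurable] = borel_measurable_Complex
  have "?horizontal = (\<integral>\<^sup>+x. \<integral>\<^sup>+y. F (Complex (x + s * y) y) \<partial>lborel \<partial>lborel)"
    by (subst nn_integral_lborel_complex) (auto intro!: nn_integral_cong arg_cong[where f=F] simp: complex_eq_iff)
  also have "\<dots> = (\<integral>\<^sup>+y. \<integral>\<^sup>+x. F (Complex (x + s * y) y) \<partial>lborel \<partial>lborel)"
    by (rule lborel_pair.Fubini') measurable
  also have "\<dots> = (\<integral>\<^sup>+y. \<integral>\<^sup>+x. F (Complex x y) \<partial>lborel \<partial>lborel)"
    by (intro nn_integral_cong nn_integral_lborel_translate[of "\<lambda>x. F (Complex x _)"]) measurable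
  also have "\<dots> = (\<integral>\<^sup>+x. \<integral>\<^sup>+y. F (Complex x y) \<partial>lborel \<partial>lborel)"
    by (rule lborel_pair.Fubini'[symmetric]) measurable
  finally show "?horizontal = (\<integral>\<^sup>+z. F z \<partial>lborel)" by (simp add: nn_integral_lborel_complex)
  have "?vertical = (\<integral>\<^sup>+x. \<integral>\<^sup>+y. F (Complex x (y + s * x)) \<partial>lborel \<partial>lborel)"
    by (subst nn_integral_lborel_complex) (auto intro!: nn_integral_cong arg_cong[where f=F] simp: complex_eq_iff)
  also have "\<dots> = (\<integral>\<^sup>+x. \<integral>\<^sup>+y. F (Complex x y) \<partial>lborel \<partial>lborel)"
    by (intro nn_integral_cong nn_integral_lborel_translate[of "\<lambda>y. F (Complex _ y)"]) measurable
  finally show "?vertical = (\<integral>\<^sup>+z. F z \<partial>lborel)" by (simp add: nn_integral_lborel_complex)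
qed

lemma nn_integral_lborel_complex_scaleR:
  assumes [measurable]: "F \<in> borel_measurable borel" and r_nonzero: "r \<noteq> 0"
  shows "(\<integral>\<^sup>+z. F (of_real r * z) \<partial>lborel) = ennreal (1 / r\<^sup>2) * (\<integral>\<^sup>+z. F (z::complex) \<partial>lborel)"
proof -
  have [measurable]: "(\<lambda>x::complex. r *\<^sub>R x) \<in> borel_measurable borel" by simp
  have "(\<integral>\<^sup>+z. F z \<partial>lborel) = (\<integral>\<^sup>+z. ennreal (r\<^sup>2) * F (of_real r * z) \<partial>lborel)"
    by (subst lborel_affine[OF r_nonzero, of 0], subst nn_integral_density)
      (auto simp: nn_integral_distr scaleR_conv_of_real)
  also have "\<dots> = ennreal (r\<^sup>2) * (\<integral>\<^sup>+z. F (of_real r * z) \<partial>lborel)"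
    by (subst nn_integral_cmult) auto
  finally show ?thesis using r_nonzero
    by (simp add: mult.assoc[symmetric] ennreal_mult'[symmetric])
qed

lemma rotation_eq_shears:
  fixes u z :: complex
  assumes unit: "cmod u = 1" and nonreal: "Im u \<noteq> 0"
  defines "s \<equiv> (Re u - 1) / Im u"
  defines "horizontal \<equiv> \<lambda>z. z + complex_of_real (s * Im z)"
  defines "vertical \<equiv> \<lambda>z. z + \<i> * complex_of_real (Im u * Re z)"
  shows "u * z = horizontal (vertical (horizontal z))"
proof -
  have "(Re u)\<^sup>2 + (Im u)\<^sup>2 = 1" using unit by (metis cmod_power2 one_power2)
  then have "(Re u - 1) * (Re u + 1) = - Im u * Im u" by (simp add: algebra_simps power2_eq_square)
  then have s: "s * Im u = Re u - 1" "s * (Re u + 1) = - Im u"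
    using nonreal by (simp_all add: s_def field_simps)
  have Im_eq: "Im z + Im u * (Re z + s * Im z) = Im u * Re z + Re u * Im z"
    using arg_cong[OF s(1), of "\<lambda>r. r * Im z"] by (simp add: algebra_simps)
  have "Re z + s * Im z + s * (Im u * Re z + Re u * Im z) = Re z * (1 + s * Im u) + Im z * (s * (Re u + 1))"
    by (simp add: algebra_simps)
  also have "\<dots> = Re u * Re z - Im u * Im z" unfolding s by (simp add: algebra_simps)
  finally show ?thesis using Im_eq by (simp add: complex_eq_iff horizontal_def vertical_def)
qed

lemma nn_integral_lborel_complex_rotate:
  fixes u :: complex
  assumes [measurable]: "F \<in> borel_measurable borel" and unit: "cmod u = 1"
  shows "(\<integral>\<^sup>+z. F (u * z) \<partial>lborel) = (\<integral>\<^sup>+z. F z \<partial>lborel)"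
proof (cases "Im u = 0")
  case True
  then have u_real: "u = of_real (Re u)" by (simp add: complex_eq_iff)
  then have "\<bar>Re u\<bar> = 1" using unit by (metis norm_of_real)
  then show ?thesis using nn_integral_lborel_complex_scaleR[OF assms(1), of "Re u"] u_real[symmetric]
    by (auto simp: abs_if split: if_splits)
next
  case False
  define s where "s = (Re u - 1) / Im u"
  have "(\<integral>\<^sup>+z. F (u * z) \<partial>lborel) = (\<integral>\<^sup>+z. (\<lambda>y. F ((y + \<i> * of_real (Im u * Re y)) + of_real (s * Im (y + \<i> * of_real (Im u * Re y))))) (z + of_real (s * Im z)) \<partial>lborel)"
    unfolding rotation_eq_shears[OF unit False] s_def ..
  also have "\<dots> = (\<integral>\<^sup>+z. (\<lambda>y. F (y + of_real (s * Im y))) (z + \<i> * of_real (Im u * Re z)) \<partial>lborel)"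
    by (subst nn_integral_lborel_complex_shear(1)) simp_all
  also have "\<dots> = (\<integral>\<^sup>+z. F (z + of_real (s * Im z)) \<partial>lborel)"
    by (subst nn_integral_lborel_complex_shear(2)) simp_all
  also have "\<dots> = (\<integral>\<^sup>+z. F z \<partial>lborel)"
    by (subst nn_integral_lborel_complex_shear(1)) simp_all
  finally show ?thesis .
qed

lemma nn_integral_lborel_complex_scale:
  assumes [measurable]: "F \<in> borel_measurable borel" and k_nonzero: "k \<noteq> 0"
  shows "(\<integral>\<^sup>+z. F (k * z) \<partial>lborel) = ennreal (1 / (cmod k)\<^sup>2) * (\<integral>\<^sup>+z. F (z::complex) \<partial>lborel)"
proof -
  have "(\<integral>\<^sup>+z. F (k * z) \<partial>lborel) = (\<integral>\<^sup>+z. (\<lambda>z. F (of_real (cmod k) * z)) (sgn k * z) \<partial>lborel)"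
    using k_nonzero by (simp add: sgn_eq mult.assoc[symmetric])
  also have "\<dots> = (\<integral>\<^sup>+z. F (of_real (cmod k) * z) \<partial>lborel)"
    using k_nonzero by (intro nn_integral_lborel_complex_rotate) (auto simp: norm_sgn)
  also have "\<dots> = ennreal (1 / (cmod k)\<^sup>2) * (\<integral>\<^sup>+z. F (z::complex) \<partial>lborel)"
    using k_nonzero by (intro nn_integral_lborel_complex_scaleR) auto
  finally show ?thesis .
qed

lemma nn_integral_lborelC_scale:
  assumes F_meas: "F \<in> borel_measurable (lborelC n)" and k_nonzero: "k \<noteq> 0"
  shows "(\<integral>\<^sup>+y. F (trunc n (scale k y)) \<partial>lborelC n) = ennreal (1 / (cmod k)^(2*n)) * (\<integral>\<^sup>+y. F y \<partial>lborelC n)"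
proof -
  have "0 < 1 / (cmod k)\<^sup>2" using k_nonzero by simp
  from nn_integral_lborelC_componentwise[OF F_meas, of "\<lambda>_. (*) k", OF _ this nn_integral_lborel_complex_scale[OF _ k_nonzero]]
  show ?thesis by (simp add: scale_def power_mult power_one_over)
qed

lemma nn_integral_lborelC_affine:
  assumes F_meas: "F \<in> borel_measurable (lborelC n)" and k_nonzero: "k \<noteq> 0"
  shows "(\<integral>\<^sup>+y. F y \<partial>lborelC n) = ennreal ((cmod k)^(2*n)) * (\<integral>\<^sup>+s. F (trunc n (p + scale k s)) \<partial>lborelC n)"
proof -
  have shifted_meas: "(\<lambda>y. F (trunc n (y + p))) \<in> borel_measurable (lborelC n)"
    by (intro measurable_compose[OF measurable_trunc F_meas] vec_measurableI vec_measurable_proj)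
  have "trunc n (p + scale k s) = trunc n (trunc n (scale k s) + p)" for s
    by (auto simp: fun_eq_iff restrict_def add.commute)
  then have "(\<integral>\<^sup>+s. F (trunc n (p + scale k s)) \<partial>lborelC n) = ennreal (1 / (cmod k)^(2*n)) * (\<integral>\<^sup>+y. F (trunc n (y + p)) \<partial>lborelC n)"
    using nn_integral_lborelC_scale[OF shifted_meas k_nonzero] by (simp only:)
  then show ?thesis using k_nonzero
    by (simp add: nn_integral_lborelC_translate[OF F_meas] mult.assoc[symmetric] ennreal_mult'[symmetric])
qed

subsection \<open>Integrals of Gaussian densities\<close>

definition gauss1 :: "real \<Rightarrow> complex \<Rightarrow> real" where
  "gauss1 v z = exp (- (cmod z)\<^sup>2 / v) / (pi * v)"

lemma gauss_eq_prod: "gauss n v y = (\<Prod>t<n. gauss1 v (y t))"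
  by (simp add: gauss_def gauss1_def sqnorm_def prod_dividef exp_sum[symmetric] sum_divide_distrib sum_negf)

lemma gauss1_measurable [measurable]: "gauss1 v \<in> borel_measurable borel"
  unfolding gauss1_def by measurable

lemma gauss1_nonneg: "0 < v \<Longrightarrow> 0 \<le> gauss1 v z"
  by (simp add: gauss1_def)

lemma gauss1_eq_normal_density: "0 < v \<Longrightarrow> gauss1 v (Complex x y) = normal_density 0 (sqrt (v/2)) x * normal_density 0 (sqrt (v/2)) y"
proof -
  assume v_pos: "0 < v"
  have density_eq: "normal_density 0 (sqrt (v/2)) x = exp (- (x\<^sup>2 / v)) / sqrt (pi * v)" for x
    using v_pos by (simp add: normal_density_def)
  have "exp (- (x\<^sup>2 / v)) * exp (- (y\<^sup>2 / v)) = exp (- (cmod (Complex x y))\<^sup>2 / v)"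
    unfolding exp_add[symmetric] cmod_power2 by (simp add: add_divide_distrib diff_divide_distrib)
  then show ?thesis using v_pos by (simp add: density_eq gauss1_def real_sqrt_mult_self)
qed

lemma nn_integral_normal_density: "0 < s \<Longrightarrow> (\<integral>\<^sup>+x. normal_density 0 s x \<partial>lborel) = 1"
  by (subst nn_integral_eq_integral) (auto simp: normal_density_nonneg)

lemma nn_integral_normal_density_sq: "0 < s \<Longrightarrow> (\<integral>\<^sup>+x. normal_density 0 s x * x\<^sup>2 \<partial>lborel) = ennreal (s\<^sup>2)"
  using normal_moment_even[of s 0 1]
  by (subst nn_integral_eq_integral)
     (auto simp: normal_density_nonneg has_bochner_integral_iff numeral_2_eq_2)

lemma nn_integral_gauss1: "0 < v \<Longrightarrow> (\<integral>\<^sup>+z. gauss1 v z \<partial>lborel) = 1"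
  by (subst nn_integral_lborel_complex)
     (simp_all add: gauss1_eq_normal_density ennreal_mult normal_density_nonneg nn_integral_cmult nn_integral_normal_density)

lemma nn_integral_gauss1_sq: assumes v_pos: "0 < v" shows "(\<integral>\<^sup>+z. gauss1 v z * (cmod z)\<^sup>2 \<partial>lborel) = ennreal v"
proof -
  let ?N = "normal_density 0 (sqrt (v/2))"
  have s_pos: "0 < sqrt (v/2)" using v_pos by simp
  have "(\<integral>\<^sup>+z. gauss1 v z * (cmod z)\<^sup>2 \<partial>lborel)
     = (\<integral>\<^sup>+x. \<integral>\<^sup>+y. ennreal (?N x * x\<^sup>2) * ennreal (?N y) + ennreal (?N x) * ennreal (?N y * y\<^sup>2) \<partial>lborel \<partial>lborel)"
    by (subst nn_integral_lborel_complex)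
      (auto intro!: nn_integral_cong simp: gauss1_eq_normal_density[OF v_pos] ennreal_mult[symmetric] ennreal_plus[symmetric]
        cmod_power2 algebra_simps simp del: ennreal_plus)
  also have "\<dots> = (\<integral>\<^sup>+x. ennreal (?N x * x\<^sup>2) + ennreal (?N x) * ennreal (v/2) \<partial>lborel)"
    using v_pos by (intro nn_integral_cong)
      (simp add: nn_integral_add nn_integral_cmult nn_integral_normal_density[OF s_pos] nn_integral_normal_density_sq[OF s_pos])
  also have "\<dots> = ennreal (v/2) + ennreal (v/2)"
    using v_pos by (simp add: nn_integral_add nn_integral_multc nn_integral_normal_density[OF s_pos] nn_integral_normal_density_sq[OF s_pos])
  also have "\<dots> = ennreal v" using v_pos by (simp add: ennreal_plus[symmetric] del: ennreal_plus)
  finally show ?thesis .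
qed

lemma vec_measurable_shift [intro]: "vec_measurable (lborelC n) n (\<lambda>y. y - c)" "vec_measurable (lborelC n) n (\<lambda>y. y + c)" "vec_measurable (lborelC n) n (\<lambda>y. scale k y)"
  by (rule vec_measurableI vec_measurable_proj)+

lemma nn_integral_gauss: assumes v_pos: "0 < v" shows "(\<integral>\<^sup>+y. gauss n v (y - c) \<partial>lborelC n) = 1"
proof -
  have "(\<integral>\<^sup>+y. gauss n v (y - c) \<partial>lborelC n) = (\<integral>\<^sup>+y. (\<lambda>y. ennreal (gauss n v y)) (trunc n (y + (- c))) \<partial>lborelC n)"
    by (intro nn_integral_cong arg_cong[where f=ennreal] gauss_cong) simp_all
  also have "\<dots> = (\<integral>\<^sup>+y. gauss n v y \<partial>lborelC n)"
    by (rule nn_integral_lborelC_translate[OF gauss_measurable_ennreal[OF vec_measurable_proj(1)]])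
  also have "\<dots> = (\<integral>\<^sup>+y. (\<Prod>t<n. ennreal (gauss1 v (y t))) \<partial>PiM {..<n} (\<lambda>_. lborel))"
    by (simp add: gauss_eq_prod lborelC_def prod_ennreal gauss1_nonneg v_pos)
  also have "\<dots> = 1"
    by (subst lborel_vec.product_nn_integral_prod) (simp_all add: nn_integral_gauss1 v_pos)
  finally show ?thesis .
qed

lemma nn_integral_gauss_component_sq:
  assumes v_pos: "0 < v" and t: "t < n"
  shows "(\<integral>\<^sup>+y. gauss n v y * (cmod (y t))\<^sup>2 \<partial>lborelC n) = ennreal v"
proof -
  let ?factor = "\<lambda>s z. if s = t then gauss1 v z * (cmod z)\<^sup>2 else gauss1 v z"
  have "gauss n v y * (cmod (y t))\<^sup>2 = (\<Prod>s<n. ?factor s (y s))" for y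
    using t unfolding gauss_eq_prod by (subst (1 2) prod.remove[of _ t]) (auto intro!: prod.cong)
  then have "(\<integral>\<^sup>+y. gauss n v y * (cmod (y t))\<^sup>2 \<partial>lborelC n) = (\<integral>\<^sup>+y. (\<Prod>s<n. ennreal (?factor s (y s))) \<partial>PiM {..<n} (\<lambda>_. lborel))"
    by (simp add: lborelC_def prod_ennreal gauss1_nonneg v_pos)
  also have "\<dots> = (\<Prod>s<n. \<integral>\<^sup>+z. ennreal (?factor s z) \<partial>lborel)"
    by (subst lborel_vec.product_nn_integral_prod) auto
  also have "\<dots> = (\<Prod>s<n. if s = t then ennreal v else 1)"
    by (intro prod.cong) (auto simp: nn_integral_gauss1 nn_integral_gauss1_sq v_pos)
  also have "\<dots> = ennreal v" using t by (subst prod.delta) auto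
  finally show ?thesis .
qed

definition re_inner :: "nat \<Rightarrow> cvec \<Rightarrow> cvec \<Rightarrow> real" where
  "re_inner n x y = (\<Sum>t<n. Re (x t * cnj (y t)))"

lemma cmod_add_power2: "(cmod (a + b))\<^sup>2 = (cmod a)\<^sup>2 + 2 * Re (a * cnj b) + (cmod b)\<^sup>2"
  unfolding cmod_power2 by (simp add: power2_eq_square algebra_simps)

lemma sqnorm_add: "sqnorm n (x + y) = sqnorm n x + 2 * re_inner n x y + sqnorm n y"
  by (simp add: sqnorm_def re_inner_def cmod_add_power2 sum.distrib sum_distrib_left)

lemma sqnorm_minus [simp]: "sqnorm n (- x) = sqnorm n x"
  by (simp add: sqnorm_def)

lemma re_inner_linear: "re_inner n (x + y) z = re_inner n x z + re_inner n y z" "re_inner n z (x + y) = re_inner n z x + re_inner n z y"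
  "re_inner n (x - y) z = re_inner n x z - re_inner n y z" "re_inner n z (x - y) = re_inner n z x - re_inner n z y"
  "re_inner n (- x) z = - re_inner n x z" "re_inner n z (- x) = - re_inner n z x"
  by (simp_all add: re_inner_def sum.distrib sum_subtractf sum_negf algebra_simps)

lemma sqnorm_diff: "sqnorm n (x - y) = sqnorm n x - 2 * re_inner n x y + sqnorm n y"
  using sqnorm_add[of n x "- y"] by (simp add: re_inner_linear)

lemma re_inner_commute: "re_inner n x y = re_inner n y x"
  by (simp add: re_inner_def algebra_simps)

lemma re_inner_scale_left: "re_inner n (scale k x) y = re_inner n x (scale (cnj k) y)"
  by (simp add: re_inner_def algebra_simps)

lemma re_inner_scale_real: "re_inner n x (scale (of_real r) y) = r * re_inner n x y" "re_inner n x (scale (of_real r * k) y) = r * re_inner n x (scale k y)"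
  by (simp_all add: re_inner_def sum_distrib_left algebra_simps)

lemma sqnorm_add_le: "sqnorm n (x + y) \<le> 2 * sqnorm n x + 2 * sqnorm n y"
  using sqnorm_nonneg[of n "x - y"] by (simp add: sqnorm_add sqnorm_diff)

lemma sqnorm_diff_le: "sqnorm n (x - y) \<le> 2 * sqnorm n x + 2 * sqnorm n y"
  using sqnorm_nonneg[of n "x + y"] by (simp add: sqnorm_add sqnorm_diff)

lemma complete_square_two_quadratics:
  fixes s u w K X Y J :: real
  assumes s_pos: "0 < s" and u_pos: "0 < u" and w_pos: "0 < w" and w: "w = u + K * s"
  shows "X / s + (Y - 2 * J + K * X) / u = Y / w + (X - 2 * (s / w * J) + (s / w)\<^sup>2 * K * Y) / (s * u / w)"
proof -
  have "X / s + K * X / u = X * w / (s * u)"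
    using s_pos u_pos by (simp add: w field_simps)
  moreover have "Y / u = Y / w + (s / w)\<^sup>2 * K * Y * w / (s * u)"
  proof -
    have "Y / w + (s / w)\<^sup>2 * K * Y * w / (s * u) = Y / w * (1 + K * s / u)"
      using s_pos u_pos w_pos by (simp add: power2_eq_square field_simps)
    also have "1 + K * s / u = w / u" using u_pos by (simp add: w field_simps)
    finally show ?thesis using w_pos by simp
  qed
  moreover have "2 * (s / w * J) * w / (s * u) = 2 * J / u" using s_pos w_pos by simp
  moreover have "(X - 2 * (s / w * J) + (s / w)\<^sup>2 * K * Y) / (s * u / w)
     = X * w / (s * u) - 2 * (s / w * J) * w / (s * u) + (s / w)\<^sup>2 * K * Y * w / (s * u)"
    using s_pos u_pos w_pos by (simp add: add_divide_distrib diff_divide_distrib algebra_simps)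
  ultimately show ?thesis by (simp add: add_divide_distrib diff_divide_distrib)
qed

text \<open>Bayes' rule: the density of a Gaussian \<open>x\<close> times that of \<open>y = k x + noise\<close> given \<open>x\<close>
  is the density of \<open>y\<close> times the posterior density of \<open>x\<close>.\<close>

lemma gauss_mult_swap:
  assumes s_pos: "0 < s" and u_pos: "0 < u" and w: "w = u + (cmod k)\<^sup>2 * s" and k': "k' = of_real (s / w) * cnj k"
  shows "gauss n s x * gauss n u (y - scale k x) = gauss n w y * gauss n (s * u / w) (x - scale k' y)"
proof -
  have w_pos: "0 < w" using s_pos u_pos w by (simp add: add_pos_nonneg)
  have inner: "re_inner n x (scale k' y) = s / w * re_inner n y (scale k x)"
    unfolding k' re_inner_scale_real by (simp add: re_inner_scale_left[symmetric] re_inner_commute)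
  have "(cmod k')\<^sup>2 = (s / w)\<^sup>2 * (cmod k)\<^sup>2"
    using s_pos w_pos by (simp add: k' norm_mult norm_divide power_mult_distrib power_divide)
  then have exponents: "sqnorm n x / s + sqnorm n (y - scale k x) / u = sqnorm n y / w + sqnorm n (x - scale k' y) / (s * u / w)"
    using complete_square_two_quadratics[OF s_pos u_pos w_pos w, of "sqnorm n x" "sqnorm n y" "re_inner n y (scale k x)"]
    by (simp add: sqnorm_diff inner)
  have constants: "(pi * s) ^ n * (pi * u) ^ n = (pi * w) ^ n * (pi * (s * u / w)) ^ n"
    using w_pos by (simp add: power_mult_distrib[symmetric] mult_ac)
  have gauss_mult: "gauss n a x' * gauss n b y' = exp (- (sqnorm n x' / a + sqnorm n y' / b)) / ((pi * a) ^ n * (pi * b) ^ n)"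
    for a b x' y'
    by (simp add: gauss_def exp_add[symmetric] exp_diff exp_minus field_simps)
  show ?thesis unfolding gauss_mult exponents constants ..
qed

lemma nn_integral_gauss_conv:
  assumes s_pos: "0 < s" and u_pos: "0 < u"
  shows "(\<integral>\<^sup>+x. ennreal (gauss n s (x - m)) * ennreal (gauss n u (y - scale k x)) \<partial>lborelC n) = ennreal (gauss n (u + (cmod k)\<^sup>2 * s) (y - scale k m))"
proof -
  define w k' where "w = u + (cmod k)\<^sup>2 * s" and "k' = complex_of_real (s / w) * cnj k"
  have w_pos: "0 < w" using s_pos u_pos by (simp add: w_def add_pos_nonneg)
  have "gauss n s (x - m) * gauss n u (y - scale k x) = gauss n w (y - scale k m) * gauss n (s * u / w) (x - (m + scale k' (y - scale k m)))"
    for x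
    using gauss_mult_swap[OF s_pos u_pos w_def k'_def, of n "x - m" "y - scale k m"] by (simp add: algebra_simps)
  then have "(\<integral>\<^sup>+x. ennreal (gauss n s (x - m)) * ennreal (gauss n u (y - scale k x)) \<partial>lborelC n)
     = (\<integral>\<^sup>+x. ennreal (gauss n w (y - scale k m)) * ennreal (gauss n (s * u / w) (x - (m + scale k' (y - scale k m)))) \<partial>lborelC n)"
    using s_pos u_pos w_pos by (simp add: ennreal_mult[symmetric])
  also have "\<dots> = ennreal (gauss n w (y - scale k m))"
    using s_pos u_pos w_pos by (subst nn_integral_cmult[OF gauss_measurable_ennreal[OF vec_measurable_shift(1)]])
      (simp_all only: nn_integral_gauss mult_1_right divide_pos_pos mult_pos_pos)
  finally show ?thesis by (simp add: w_def)
qed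

lemma integral_push_density:
  fixes p :: "'a \<Rightarrow> real" and r g :: "'b \<Rightarrow> real"
  assumes X_meas [measurable]: "X \<in> measurable M N" and p_meas [measurable]: "p \<in> borel_measurable M"
    and r_meas [measurable]: "r \<in> borel_measurable N"
    and p_nonneg: "\<And>x. 0 \<le> p x" and r_nonneg: "\<And>y. 0 \<le> r y"
    and pushforward: "\<And>F. F \<in> borel_measurable N \<Longrightarrow> (\<integral>\<^sup>+x. ennreal (p x) * F (X x) \<partial>M) = (\<integral>\<^sup>+y. ennreal (r y) * F y \<partial>N)"
    and g_meas [measurable]: "g \<in> borel_measurable N"
  shows "integrable M (\<lambda>x. p x * g (X x)) \<longleftrightarrow> integrable N (\<lambda>y. r y * g y)"
    and "(\<integral>x. p x * g (X x) \<partial>M) = (\<integral>y. r y * g y \<partial>N)"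
proof -
  let ?P = "density M (\<lambda>x. ennreal (p x))"
  have X_meas': "X \<in> measurable ?P N" by simp
  have distr_eq: "distr ?P N X = density N (\<lambda>y. ennreal (r y))"
  proof (rule measure_eqI)
    fix A assume "A \<in> sets (distr ?P N X)"
    then have A_sets [measurable]: "A \<in> sets N" by simp
    have preimage_sets: "X -` A \<inter> space M \<in> sets M" by measurable
    have "emeasure (distr ?P N X) A = emeasure ?P (X -` A \<inter> space M)"
      using A_sets by (simp add: emeasure_distr[OF X_meas'])
    also have "\<dots> = (\<integral>\<^sup>+x. ennreal (p x) * indicator A (X x) \<partial>M)"
      using preimage_sets by (subst emeasure_density) (auto intro!: nn_integral_cong simp: indicator_def)
    also have "\<dots> = (\<integral>\<^sup>+y. ennreal (r y) * indicator A y \<partial>N)" using A_sets by (intro pushforward) simp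
    also have "\<dots> = emeasure (density N (\<lambda>y. ennreal (r y))) A" using A_sets by (simp add: emeasure_density)
    finally show "emeasure (distr ?P N X) A = emeasure (density N (\<lambda>y. ennreal (r y))) A" .
  qed simp
  have gX_meas: "(\<lambda>x. g (X x)) \<in> borel_measurable M" by measurable
  show "integrable M (\<lambda>x. p x * g (X x)) \<longleftrightarrow> integrable N (\<lambda>y. r y * g y)"
    using integrable_distr_eq[OF X_meas' g_meas] integrable_real_density[OF p_meas _ gX_meas] integrable_real_density[OF r_meas _ g_meas] p_nonneg r_nonneg
    by (simp add: distr_eq)
  show "(\<integral>x. p x * g (X x) \<partial>M) = (\<integral>y. r y * g y \<partial>N)"
    using integral_distr[OF X_meas' g_meas] integral_real_density[OF p_meas _ gX_meas] integral_real_density[OF r_meas _ g_meas] p_nonneg r_nonneg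
    by (simp add: distr_eq)
qed

lemma integral_lborelC_translate:
  fixes F :: "cvec \<Rightarrow> real"
  assumes F_meas: "F \<in> borel_measurable (lborelC n)"
  shows "integrable (lborelC n) (\<lambda>y. F (trunc n (y + c))) \<longleftrightarrow> integrable (lborelC n) F"
    and "(\<integral>y. F (trunc n (y + c)) \<partial>lborelC n) = (\<integral>y. F y \<partial>lborelC n)"
proof -
  have "(\<lambda>y. trunc n (y + c)) \<in> measurable (lborelC n) (lborelC n)" by (rule measurable_trunc) auto
  note push = integral_push_density[OF this, of "\<lambda>_. 1" "\<lambda>_. 1" F]
  show "integrable (lborelC n) (\<lambda>y. F (trunc n (y + c))) \<longleftrightarrow> integrable (lborelC n) F"
    "(\<integral>y. F (trunc n (y + c)) \<partial>lborelC n) = (\<integral>y. F y \<partial>lborelC n)"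
    using push F_meas by (simp_all add: nn_integral_lborelC_translate)
qed

lemma gibbs_inequality:
  fixes p q :: "'a \<Rightarrow> real"
  assumes q_meas[measurable]: "q \<in> borel_measurable M" and p_pos: "\<And>x. 0 < p x" and q_pos: "\<And>x. 0 < q x"
    and p_density: "integrable M p" "(\<integral>x. p x \<partial>M) = 1" and q_subdensity: "(\<integral>\<^sup>+x. ennreal (q x) \<partial>M) \<le> 1"
    and p_ln_p_integrable: "integrable M (\<lambda>x. p x * ln (p x))" and p_ln_q_integrable: "integrable M (\<lambda>x. p x * ln (q x))"
  shows "(\<integral>x. p x * ln (q x) \<partial>M) \<le> (\<integral>x. p x * ln (p x) \<partial>M)"
proof -
  have q_integrable: "integrable M q" using q_subdensity q_pos
    by (intro integrableI_nonneg) (auto simp: less_imp_le intro: le_less_trans)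
  have "ennreal (\<integral>x. q x \<partial>M) \<le> 1" using q_subdensity
    by (subst nn_integral_eq_integral[symmetric, OF q_integrable]) (auto simp: q_pos less_imp_le)
  then have integral_q_le_1: "(\<integral>x. q x \<partial>M) \<le> 1" by (simp add: ennreal_le_1)
  have pointwise: "p x * ln (q x) - p x * ln (p x) \<le> q x - p x" for x
  proof -
    have "ln (q x / p x) \<le> q x / p x - 1" using p_pos q_pos by (intro ln_le_minus_one) simp
    then have "p x * ln (q x / p x) \<le> p x * (q x / p x - 1)" using p_pos[of x] by (intro mult_left_mono) auto
    then show ?thesis using p_pos[of x] q_pos[of x] by (simp add: ln_div algebra_simps)
  qed
  have "(\<integral>x. p x * ln (q x) - p x * ln (p x) \<partial>M) \<le> (\<integral>x. q x - p x \<partial>M)"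
    using pointwise p_ln_p_integrable p_ln_q_integrable q_integrable p_density by (intro integral_mono) auto
  then show ?thesis using p_ln_p_integrable p_ln_q_integrable q_integrable p_density integral_q_le_1 by simp
qed

lemma has_bochner_integral_gauss: "0 < v \<Longrightarrow> has_bochner_integral (lborelC n) (\<lambda>y. gauss n v (y - m)) 1"
  using nn_integral_gauss[of v n m] gauss_measurable[OF vec_measurable_shift(1), of n v m]
  by (intro has_bochner_integral_nn_integral) (auto simp: less_imp_le)

lemma nn_integral_gauss_sqnorm:
  assumes v_pos: "0 < v"
  shows "(\<integral>\<^sup>+y. ennreal (gauss n v y * sqnorm n y) \<partial>lborelC n) = ennreal (real n * v)"
proof -
  have "(\<integral>\<^sup>+y. ennreal (gauss n v y * sqnorm n y) \<partial>lborelC n) = (\<integral>\<^sup>+y. (\<Sum>t<n. ennreal (gauss n v y * (cmod (y t))\<^sup>2)) \<partial>lborelC n)"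
    using v_pos by (simp add: sqnorm_def sum_distrib_left)
  also have "\<dots> = (\<Sum>t<n. \<integral>\<^sup>+y. ennreal (gauss n v y * (cmod (y t))\<^sup>2) \<partial>lborelC n)"
    using gauss_measurable[OF vec_measurable_proj(1), of n v] measurable_component_lborelC[of _ n]
    by (intro nn_integral_sum) simp
  also have "\<dots> = (\<Sum>t<n. ennreal v)"
    by (intro sum.cong refl nn_integral_gauss_component_sq v_pos) simp
  also have "\<dots> = ennreal (real n * v)" using v_pos by (subst sum_ennreal) simp_all
  finally show ?thesis .
qed

text \<open>By the symmetry \<open>y \<mapsto> -y\<close> the cross terms of \<open>\<bar>k y + m\<bar>\<^sup>2\<close> and \<open>\<bar>k y - m\<bar>\<^sup>2\<close> cancel.\<close>

lemma nn_integral_gauss_sqnorm_affine: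
  assumes v_pos: "0 < v"
  shows "(\<integral>\<^sup>+y. ennreal (gauss n v y * sqnorm n (scale k y + m)) \<partial>lborelC n) = ennreal ((cmod k)\<^sup>2 * real n * v + sqnorm n m)"
proof -
  let ?I = "\<lambda>m. \<integral>\<^sup>+y. ennreal (gauss n v y * sqnorm n (scale k y + m)) \<partial>lborelC n"
  have meas: "(\<lambda>y. ennreal (gauss n v y * sqnorm n (scale k y + m))) \<in> borel_measurable (lborelC n)" for m
    by (intro measurable_compose[OF _ measurable_ennreal] borel_measurable_times gauss_measurable sqnorm_measurable vec_measurableI vec_measurable_proj)
  have "?I m = (\<integral>\<^sup>+y. ennreal (gauss n v (trunc n (scale (-1) y)) * sqnorm n (scale k (trunc n (scale (-1) y)) + m)) \<partial>lborelC n)"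
    using nn_integral_lborelC_scale[OF meas, of "-1" m] by simp
  also have "\<dots> = ?I (- m)"
  proof (intro nn_integral_cong arg_cong[where f=ennreal] arg_cong2[where f="(*)"])
    show "gauss n v (trunc n (scale (-1) y)) = gauss n v y" for y
      by (simp add: gauss_def)
    have "sqnorm n (scale k (trunc n (scale (-1) y)) + m) = sqnorm n (- (scale k y + - m))" for y
      by (rule sqnorm_cong) simp
    then show "sqnorm n (scale k (trunc n (scale (-1) y)) + m) = sqnorm n (scale k y + - m)" for y
      by (simp only: sqnorm_minus)
  qed
  finally have "2 * ?I m = ?I m + ?I (- m)" by (simp add: mult_2)
  also have "\<dots> = (\<integral>\<^sup>+y. ennreal (2 * (cmod k)\<^sup>2) * ennreal (gauss n v y * sqnorm n y) + ennreal (2 * sqnorm n m) * ennreal (gauss n v (y - 0)) \<partial>lborelC n)"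
  proof (subst nn_integral_add[symmetric, OF meas meas], rule nn_integral_cong)
    fix y
    have "gauss n v y * sqnorm n (scale k y + m) + gauss n v y * sqnorm n (scale k y + - m)
      = 2 * (cmod k)\<^sup>2 * (gauss n v y * sqnorm n y) + 2 * sqnorm n m * gauss n v (y - 0)"
      by (simp add: sqnorm_add sqnorm_diff re_inner_commute[of n "scale k y"] algebra_simps)
    then show "ennreal (gauss n v y * sqnorm n (scale k y + m)) + ennreal (gauss n v y * sqnorm n (scale k y + - m))
      = ennreal (2 * (cmod k)\<^sup>2) * ennreal (gauss n v y * sqnorm n y) + ennreal (2 * sqnorm n m) * ennreal (gauss n v (y - 0))"
      using v_pos by (simp only: ennreal_mult'[symmetric] ennreal_plus[symmetric] gauss_nonneg sqnorm_nonneg mult_nonneg_nonneg zero_le_numeral zero_le_power2)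
  qed
  also have "\<dots> = ennreal (2 * (cmod k)\<^sup>2) * ennreal (real n * v) + ennreal (2 * sqnorm n m) * 1"
  proof -
    have sq_meas: "(\<lambda>y. ennreal (gauss n v y * sqnorm n y)) \<in> borel_measurable (lborelC n)"
      by (intro measurable_compose[OF _ measurable_ennreal] borel_measurable_times gauss_measurable sqnorm_measurable vec_measurable_proj)
    have gauss_meas: "(\<lambda>y. ennreal (gauss n v (y - 0))) \<in> borel_measurable (lborelC n)"
      by (intro gauss_measurable_ennreal vec_measurable_shift)
    show ?thesis
      by (simp only: nn_integral_add nn_integral_cmult borel_measurable_times_ennreal measurable_const sq_meas gauss_meas
        nn_integral_gauss_sqnorm[OF v_pos] nn_integral_gauss[OF v_pos] space_borel UNIV_I)
  qed
  also have "\<dots> = 2 * ennreal ((cmod k)\<^sup>2 * real n * v + sqnorm n m)"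
    using v_pos by (simp add: ennreal_mult'[symmetric] ennreal_plus[symmetric] ennreal_numeral[symmetric] algebra_simps del: ennreal_plus ennreal_numeral)
  finally show ?thesis by (simp add: ennreal_mult_cancel_left)
qed

lemma gauss_second_moment:
  assumes v_pos: "0 < v"
  shows "has_bochner_integral (lborelC n) (\<lambda>y. gauss n v (y - c) * sqnorm n (scale k y + m)) ((cmod k)\<^sup>2 * real n * v + sqnorm n (scale k c + m))"
proof (rule has_bochner_integral_nn_integral)
  let ?F = "\<lambda>y. gauss n v (y - c) * sqnorm n (scale k y + m)"
  show F_meas: "?F \<in> borel_measurable (lborelC n)"
    by (intro borel_measurable_times gauss_measurable sqnorm_measurable vec_measurableI vec_measurable_proj)
  have "?F (trunc n (y + c)) = gauss n v y * sqnorm n (scale k y + (scale k c + m))" for y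
    by (intro arg_cong2[where f="(*)"] gauss_cong sqnorm_cong) (simp_all add: algebra_simps)
  moreover have "(\<integral>\<^sup>+y. ennreal (?F y) \<partial>lborelC n) = (\<integral>\<^sup>+y. ennreal (?F (trunc n (y + c))) \<partial>lborelC n)"
    using F_meas by (intro nn_integral_lborelC_translate[symmetric]) simp
  ultimately show "(\<integral>\<^sup>+y. ennreal (?F y) \<partial>lborelC n) = ennreal ((cmod k)\<^sup>2 * real n * v + sqnorm n (scale k c + m))"
    by (simp only: nn_integral_gauss_sqnorm_affine[OF v_pos])
qed (use v_pos in auto)

section \<open>Gaussian mixtures and their entropies\<close>

definition mixture :: "nat \<Rightarrow> 'w set \<Rightarrow> ('w \<Rightarrow> cvec) \<Rightarrow> real \<Rightarrow> cvec \<Rightarrow> real" where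
  "mixture n J c v y = (\<Sum>w\<in>J. gauss n v (y - c w)) / real (card J)"

definition entropy :: "nat \<Rightarrow> 'w set \<Rightarrow> ('w \<Rightarrow> cvec) \<Rightarrow> real \<Rightarrow> real" where
  "entropy n J c v = - (\<integral>y. mixture n J c v y * ln (mixture n J c v y) \<partial>lborelC n)"

definition gauss_entropy :: "nat \<Rightarrow> real \<Rightarrow> real" where
  "gauss_entropy n v = real n * ln (pi * exp 1 * v)"

lemma gauss_entropy_eq: "0 < v \<Longrightarrow> gauss_entropy n v = real n * ln (pi * v) + real n"
  by (simp add: gauss_entropy_def ln_mult distrib_left)

lemma gauss_entropy_mult: "0 < c \<Longrightarrow> 0 < v \<Longrightarrow> gauss_entropy n (c * v) = gauss_entropy n v + real n * ln c"
  by (simp add: gauss_entropy_def ln_mult distrib_left)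

lemma gauss_entropy_eq_ln: "0 < v \<Longrightarrow> gauss_entropy n v = real n * (ln pi + 1 + ln v)"
  by (simp add: gauss_entropy_def ln_mult)

lemma gauss_entropy_quotient:
  "\<lbrakk>0 < a; 0 < b; 0 < c; 0 < d\<rbrakk> \<Longrightarrow> real n * ln (a * b / (c * d)) = gauss_entropy n a + gauss_entropy n b - gauss_entropy n c - gauss_entropy n d"
  by (simp add: gauss_entropy_eq_ln ln_div ln_mult_pos algebra_simps)

lemma gauss_entropy_add_cong:
  assumes "0 < a" "0 < b" "0 < c" "0 < d" "a * b = c * d"
  shows "gauss_entropy n a + gauss_entropy n b = gauss_entropy n c + gauss_entropy n d"
  using gauss_entropy_quotient[OF assms(1-4), of n] assms by simp

lemma gauss_entropy_diff: "0 < a \<Longrightarrow> 0 < b \<Longrightarrow> gauss_entropy n a - gauss_entropy n b = real n * ln (a / b)"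
  using gauss_entropy_mult[of "a / b" b n] by simp

lemma mixture_pos: "finite J \<Longrightarrow> J \<noteq> {} \<Longrightarrow> 0 < v \<Longrightarrow> 0 < mixture n J c v y"
  unfolding mixture_def by (intro divide_pos_pos sum_pos) (auto simp: card_gt_0_iff)

lemma mixture_nonneg: "0 < v \<Longrightarrow> 0 \<le> mixture n J c v y"
  unfolding mixture_def by (intro divide_nonneg_nonneg sum_nonneg) auto

lemma mixture_measurable: "vec_measurable N n f \<Longrightarrow> (\<lambda>\<omega>. mixture n J c v (f \<omega>)) \<in> borel_measurable N"
  unfolding mixture_def by (intro borel_measurable_divide borel_measurable_sum gauss_measurable vec_measurableI) auto

lemma mixture_measurable_ennreal: "vec_measurable N n f \<Longrightarrow> (\<lambda>\<omega>. ennreal (mixture n J c v (f \<omega>))) \<in> borel_measurable N"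
  using mixture_measurable[of N n f J c v] by simp

lemma ln_mixture_measurable: "vec_measurable N n f \<Longrightarrow> (\<lambda>\<omega>. ln (mixture n J c v (f \<omega>))) \<in> borel_measurable N"
  using mixture_measurable[of N n f J c v] by simp

lemmas density_measurable = borel_measurable_times borel_measurable_times_ennreal borel_measurable_divide borel_measurable_const
  gauss_measurable gauss_measurable_ennreal mixture_measurable mixture_measurable_ennreal ln_mixture_measurable
  sqnorm_measurable vec_measurableI vec_measurable_proj

lemma mixture_cong: "(\<And>t. t < n \<Longrightarrow> x t = y t) \<Longrightarrow> mixture n J c v x = mixture n J c v y"
  unfolding mixture_def by (intro arg_cong2[where f="(/)"] sum.cong gauss_cong) auto

lemma mixture_trunc [simp]: "mixture n J c v (trunc n y) = mixture n J c v y"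
  by (rule mixture_cong) simp

lemma mixture_shift: "mixture n J c v (y - m) = mixture n J (\<lambda>w. c w + m) v y"
  unfolding mixture_def by (simp add: algebra_simps)

lemma mixture_singleton [simp]: "mixture n {()} (\<lambda>_. 0) v = gauss n v"
  by (simp add: mixture_def fun_eq_iff)

lemma nn_integral_average:
  assumes "finite J" "J \<noteq> {}" "\<And>w. w \<in> J \<Longrightarrow> f w \<in> borel_measurable M" "\<And>w. w \<in> J \<Longrightarrow> (\<integral>\<^sup>+x. ennreal (f w x) \<partial>M) = ennreal (g w)"
    "\<And>w x. 0 \<le> f w x" "\<And>w. 0 \<le> g w"
  shows "(\<integral>\<^sup>+x. ennreal ((\<Sum>w\<in>J. f w x) / real (card J)) \<partial>M) = ennreal ((\<Sum>w\<in>J. g w) / real (card J))"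
proof -
  have "(\<integral>\<^sup>+x. ennreal ((\<Sum>w\<in>J. f w x) / real (card J)) \<partial>M) = (\<integral>\<^sup>+x. ennreal (1 / real (card J)) * (\<Sum>w\<in>J. ennreal (f w x)) \<partial>M)"
    using assms by (intro nn_integral_cong) (simp add: sum_ennreal ennreal_mult[symmetric] sum_nonneg)
  also have "\<dots> = ennreal (1 / real (card J)) * (\<Sum>w\<in>J. \<integral>\<^sup>+x. ennreal (f w x) \<partial>M)"
    using assms by (subst nn_integral_cmult) (auto simp: nn_integral_sum simp del: sum_ennreal)
  also have "\<dots> = ennreal (1 / real (card J)) * (\<Sum>w\<in>J. ennreal (g w))" using assms by simp
  also have "\<dots> = ennreal ((\<Sum>w\<in>J. g w) / real (card J))"
    using assms by (simp add: sum_ennreal ennreal_mult[symmetric] sum_nonneg)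
  finally show ?thesis .
qed

lemma nn_integral_mixture:
  assumes "finite J" "J \<noteq> {}" "0 < v" shows "(\<integral>\<^sup>+y. mixture n J c v (y - m) \<partial>lborelC n) = 1"
proof -
  have "(\<integral>\<^sup>+y. mixture n J (\<lambda>w. c w + m) v y \<partial>lborelC n) = ennreal ((\<Sum>w\<in>J. 1) / real (card J))"
    unfolding mixture_def using assms
    by (intro nn_integral_average) (simp_all add: nn_integral_gauss gauss_measurable vec_measurable_shift)
  also have "\<dots> = 1" using assms by simp
  finally show ?thesis by (simp add: mixture_shift)
qed

lemma has_bochner_integral_mixture:
  assumes "finite J" "J \<noteq> {}" "0 < v" shows "has_bochner_integral (lborelC n) (\<lambda>y. mixture n J c v (y - m)) 1"
  using nn_integral_mixture[OF assms, of n c m] mixture_measurable[OF vec_measurable_shift(1), of n J c v m] mixture_nonneg[OF assms(3), of n J c]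
  by (intro has_bochner_integral_nn_integral) auto

lemma nn_integral_mixture_conv:
  assumes "finite J" "J \<noteq> {}" "0 < s" "0 < u"
  shows "(\<integral>\<^sup>+x. ennreal (gauss n s (x - m)) * ennreal (mixture n J c u (y - scale k x)) \<partial>lborelC n) = ennreal (mixture n J c (u + (cmod k)\<^sup>2 * s) (y - scale k m))"
    (is "?lhs = _")
proof -
  let ?w = "u + (cmod k)\<^sup>2 * s"
  have w_pos: "0 < ?w" using assms by (simp add: add_pos_nonneg)
  have "?lhs = (\<integral>\<^sup>+x. ennreal ((\<Sum>w\<in>J. gauss n s (x - m) * gauss n u ((y - c w) - scale k x)) / real (card J)) \<partial>lborelC n)"
    using assms unfolding mixture_def
    by (intro nn_integral_cong) (simp add: ennreal_mult[symmetric] sum_nonneg sum_distrib_left algebra_simps)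
  also have "\<dots> = ennreal ((\<Sum>w\<in>J. gauss n ?w ((y - c w) - scale k m)) / real (card J))"
  proof (intro nn_integral_average)
    fix w
    show "(\<lambda>x. gauss n s (x - m) * gauss n u (y - c w - scale k x)) \<in> borel_measurable (lborelC n)"
      by (intro density_measurable)
    show "(\<integral>\<^sup>+x. ennreal (gauss n s (x - m) * gauss n u (y - c w - scale k x)) \<partial>lborelC n) = ennreal (gauss n ?w (y - c w - scale k m))"
      using nn_integral_gauss_conv[of s u n m "y - c w" k] assms by (simp add: ennreal_mult)
  qed (use assms w_pos in auto)
  also have "\<dots> = ennreal (mixture n J c ?w (y - scale k m))"
    unfolding mixture_def by (simp add: algebra_simps)
  finally show ?thesis .
qed

lemma mixture_second_moment:
  assumes "finite J" "J \<noteq> {}" "0 < v"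
  shows "has_bochner_integral (lborelC n) (\<lambda>y. mixture n J c v y * sqnorm n (scale k y + m)) ((cmod k)\<^sup>2 * real n * v + (\<Sum>w\<in>J. sqnorm n (scale k (c w) + m)) / real (card J))"
proof -
  have "(cmod k)\<^sup>2 * real n * v + (\<Sum>w\<in>J. sqnorm n (scale k (c w) + m)) / real (card J) = (\<Sum>w\<in>J. (cmod k)\<^sup>2 * real n * v + sqnorm n (scale k (c w) + m)) / real (card J)"
    using assms by (simp add: sum.distrib add_divide_distrib)
  moreover have "mixture n J c v y * sqnorm n (scale k y + m) = (\<Sum>w\<in>J. gauss n v (y - c w) * sqnorm n (scale k y + m)) / real (card J)"
    for y
    unfolding mixture_def by (simp add: sum_distrib_right)
  ultimately show ?thesis
    by (simp only:) (intro has_bochner_integral_divide_zero has_bochner_integral_sum gauss_second_moment assms)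
qed

lemma gauss_le: "0 < v \<Longrightarrow> gauss n v y \<le> 1 / (pi * v)^n"
  unfolding gauss_def by (intro divide_right_mono) auto

lemma mixture_le: assumes "finite A" "A \<noteq> {}" "0 < v" shows "mixture n A x v y \<le> 1 / (pi * v)^n"
proof -
  have "(\<Sum>a\<in>A. gauss n v (y - x a)) \<le> real (card A) * (1 / (pi * v)^n)"
    using gauss_le[OF assms(3)] by (intro sum_bounded_above) auto
  then show ?thesis using assms unfolding mixture_def by (simp add: pos_divide_le_eq card_gt_0_iff mult.commute)
qed

lemma ln_gauss: "0 < v \<Longrightarrow> ln (gauss n v y) = - sqnorm n y / v - real n * ln (pi * v)"
  by (simp add: gauss_def ln_div ln_realpow)

lemma ln_mixture_le:
  assumes J_fin: "finite J" "J \<noteq> {}" and v_pos: "0 < v"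
  shows "ln (mixture n J c v y) \<le> - (real n * ln (pi * v))"
proof -
  have "ln (mixture n J c v y) \<le> ln (1 / (pi * v)^n)"
    using mixture_pos[OF J_fin v_pos] mixture_le[OF J_fin v_pos] v_pos by (subst ln_le_cancel_iff) auto
  then show ?thesis using v_pos by (simp add: ln_div ln_realpow)
qed

lemma ln_mixture_ge:
  assumes J_fin: "finite J" "J \<noteq> {}" and v_pos: "0 < v" and w: "w \<in> J"
  shows "- sqnorm n (y - c w) / v - real n * ln (pi * v) - ln (real (card J)) \<le> ln (mixture n J c v y)"
proof -
  have card_pos: "0 < real (card J)" using J_fin by (simp add: card_gt_0_iff)
  have "gauss n v (y - c w) / real (card J) \<le> mixture n J c v y"
    unfolding mixture_def using J_fin w v_pos by (intro divide_right_mono member_le_sum) auto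
  then have "ln (gauss n v (y - c w) / real (card J)) \<le> ln (mixture n J c v y)"
    using card_pos v_pos mixture_pos[OF J_fin v_pos] by (subst ln_le_cancel_iff) auto
  then show ?thesis
    using card_pos v_pos gauss_pos[OF v_pos, of n "y - c w"] by (simp add: ln_div ln_gauss)
qed

lemma ln_mixture_bound:
  assumes J_fin: "finite J" "J \<noteq> {}" and v_pos: "0 < v"
  obtains C where "0 \<le> C" "\<And>y. \<bar>ln (mixture n J c v y)\<bar> \<le> C * (1 + sqnorm n y)"
proof -
  obtain w where w: "w \<in> J" using J_fin by auto
  have "1 \<le> real (card J)" using J_fin by (simp add: Suc_leI card_gt_0_iff)
  then have ln_card_nonneg: "0 \<le> ln (real (card J))" by simp
  define L where "L = real n * ln (pi * v)"
  define B where "B = \<bar>L\<bar> + ln (real (card J)) + 2 * sqnorm n (c w) / v"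
  have B_nonneg: "0 \<le> B" using ln_card_nonneg v_pos by (simp add: B_def)
  have "\<bar>ln (mixture n J c v y)\<bar> \<le> (B + 2 / v) * (1 + sqnorm n y)" for y
  proof -
    have "sqnorm n (y - c w) / v \<le> 2 * sqnorm n (c w) / v + 2 / v * sqnorm n y"
      using divide_right_mono[OF sqnorm_diff_le[of n y "c w"], of v] v_pos by (simp add: add_divide_distrib)
    moreover have "0 \<le> 2 * sqnorm n (c w) / v" "0 \<le> 2 / v * sqnorm n y" using v_pos by simp_all
    ultimately have "\<bar>ln (mixture n J c v y)\<bar> \<le> B + 2 / v * sqnorm n y"
      using ln_mixture_le[OF J_fin v_pos, of n c y] ln_mixture_ge[OF J_fin v_pos w, of n y c] ln_card_nonneg
      unfolding B_def L_def by linarith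
    also have "\<dots> \<le> (B + 2 / v) * (1 + sqnorm n y)"
      using B_nonneg v_pos by (simp add: distrib_left distrib_right)
    finally show ?thesis .
  qed
  then show thesis using that[of "B + 2 / v"] B_nonneg v_pos by simp
qed

lemma integrable_mixture_mult:
  assumes "finite J" "J \<noteq> {}" "0 < v" and g_meas: "g \<in> borel_measurable (lborelC n)"
    and g_bound: "\<And>y. \<bar>g y\<bar> \<le> C * (1 + sqnorm n y)"
  shows "integrable (lborelC n) (\<lambda>y. mixture n J c v y * g y)"
proof (rule Bochner_Integration.integrable_bound)
  let ?bound = "\<lambda>y. C * (mixture n J c v (y - 0) + mixture n J c v y * sqnorm n (scale 1 y + 0))"
  show "integrable (lborelC n) ?bound"
    using has_bochner_integral_mixture[OF assms(1-3)] mixture_second_moment[OF assms(1-3)]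
    by (intro integrable_mult_right Bochner_Integration.integrable_add) (auto simp only: has_bochner_integral_iff)
  show "(\<lambda>y. mixture n J c v y * g y) \<in> borel_measurable (lborelC n)"
    using g_meas by (intro density_measurable)
  have "\<bar>mixture n J c v y * g y\<bar> \<le> ?bound y" for y
    using mult_left_mono[OF g_bound[of y] mixture_nonneg[OF assms(3), of n J c y]] mixture_nonneg[OF assms(3), of n J c y]
    by (simp add: abs_mult algebra_simps)
  then show "AE y in lborelC n. norm (mixture n J c v y * g y) \<le> norm (?bound y)"
    by (intro AE_I2) (auto intro: order_trans[OF _ abs_ge_self])
qed

lemma integrable_mixture_ln_mixture:
  assumes "finite J" "J \<noteq> {}" "0 < v" and "finite A" "A \<noteq> {}" "0 < u"
  shows "integrable (lborelC n) (\<lambda>y. mixture n J c v (y - m) * ln (mixture n A d u y))"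
proof -
  obtain C where "0 \<le> C" "\<And>y. \<bar>ln (mixture n A d u y)\<bar> \<le> C * (1 + sqnorm n y)" using ln_mixture_bound[OF assms(4-6)] by blast
  then show ?thesis
    unfolding mixture_shift[of n J] using assms by (intro integrable_mixture_mult[where C=C] density_measurable) auto
qed

lemma has_bochner_integral_entropy:
  assumes J_fin: "finite J" "J \<noteq> {}" and v_pos: "0 < v"
  shows "has_bochner_integral (lborelC n) (\<lambda>y. mixture n J c v (y - m) * ln (mixture n J c v (y - m))) (- entropy n J c v)"
proof -
  have "(\<lambda>y. mixture n J c v y * ln (mixture n J c v y)) \<in> borel_measurable (lborelC n)" by (intro density_measurable)
  from integral_lborelC_translate[OF this, of "- m"] integrable_mixture_ln_mixture[OF assms assms, of n c 0 c] show ?thesis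
    by (simp add: has_bochner_integral_iff entropy_def)
qed

lemma mixture_cross_entropy_gauss:
  assumes "finite J" "J \<noteq> {}" "0 < v" "0 < u"
  shows "has_bochner_integral (lborelC n) (\<lambda>y. mixture n J c v y * ln (gauss n u (scale k y + m)))
    (- (((cmod k)\<^sup>2 * real n * v + (\<Sum>w\<in>J. sqnorm n (scale k (c w) + m)) / real (card J)) / u) - real n * ln (pi * u))"
    (is "has_bochner_integral _ _ (- (?V / u) - _)")
proof -
  have expand: "mixture n J c v y * ln (gauss n u (scale k y + m)) = (- 1 / u) * (mixture n J c v y * sqnorm n (scale k y + m)) - real n * ln (pi * u) * mixture n J c v (y - 0)"
    for y
    using assms by (simp add: ln_gauss algebra_simps)
  have "has_bochner_integral (lborelC n) (\<lambda>y. mixture n J c v y * ln (gauss n u (scale k y + m))) ((-1 / u) * ?V - real n * ln (pi * u) * 1)"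
    unfolding expand
    by (intro has_bochner_integral_diff has_bochner_integral_mult_right mixture_second_moment has_bochner_integral_mixture assms)
  then show ?thesis by simp
qed

lemma entropy_le_gauss:
  assumes J_fin: "finite J" "J \<noteq> {}" and v_pos: "0 < v" and power_nonneg: "0 \<le> \<epsilon>"
    and power: "(\<Sum>w\<in>J. sqnorm n (c w)) \<le> real (card J) * (real n * \<epsilon>)"
  shows "entropy n J c v \<le> gauss_entropy n (\<epsilon> + v)"
proof -
  let ?p = "mixture n J c v" and ?u = "\<epsilon> + v" and ?S = "(\<Sum>w\<in>J. sqnorm n (c w)) / real (card J)"
  have u_pos: "0 < ?u" using v_pos power_nonneg by simp
  have cross: "has_bochner_integral (lborelC n) (\<lambda>y. ?p y * ln (gauss n ?u y)) (- ((real n * v + ?S) / ?u) - real n * ln (pi * ?u))"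
    using mixture_cross_entropy_gauss[OF J_fin v_pos u_pos, of n c 1 0] by simp
  have "(\<integral>y. ?p y * ln (gauss n ?u y) \<partial>lborelC n) \<le> (\<integral>y. ?p y * ln (?p y) \<partial>lborelC n)"
  proof (rule gibbs_inequality)
    show "gauss n ?u \<in> borel_measurable (lborelC n)" by (intro density_measurable)
    show "(\<integral>\<^sup>+y. ennreal (gauss n ?u y) \<partial>lborelC n) \<le> 1" using nn_integral_gauss[OF u_pos, of n 0] by simp
  qed (use J_fin v_pos u_pos mixture_pos[OF J_fin v_pos] has_bochner_integral_mixture[OF J_fin v_pos, of n c 0]
      has_bochner_integral_entropy[OF J_fin v_pos, of n c 0] cross in \<open>auto simp: has_bochner_integral_iff\<close>)
  then have "entropy n J c v \<le> (real n * v + ?S) / ?u + real n * ln (pi * ?u)"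
    using has_bochner_integral_integral_eq[OF cross] by (simp add: entropy_def)
  also have "?S \<le> real n * \<epsilon>"
    using power J_fin by (simp add: pos_divide_le_eq card_gt_0_iff mult.commute)
  then have "(real n * v + ?S) / ?u \<le> real n"
    using u_pos by (simp add: pos_divide_le_eq algebra_simps)
  finally show ?thesis using gauss_entropy_eq[OF u_pos, of n] by simp
qed

lemma entropy_cong: "(\<And>w t. w \<in> J \<Longrightarrow> t < n \<Longrightarrow> c w t = c' w t) \<Longrightarrow> entropy n J c v = entropy n J c' v"
proof -
  assume agree: "\<And>w t. w \<in> J \<Longrightarrow> t < n \<Longrightarrow> c w t = c' w t"
  have "mixture n J c v = mixture n J c' v"
    unfolding mixture_def by (intro ext arg_cong2[where f="(/)"] sum.cong gauss_cong) (auto simp: agree)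
  then show ?thesis by (simp add: entropy_def)
qed

lemma entropy_gauss:
  assumes "finite J" "J \<noteq> {}" "0 < v" shows "entropy n J (\<lambda>_. 0) v = gauss_entropy n v"
proof -
  have "mixture n J (\<lambda>_. 0) v = gauss n v" using assms by (simp add: mixture_def fun_eq_iff)
  then have "- entropy n J (\<lambda>_. 0) v = (\<integral>y. mixture n J (\<lambda>_. 0) v y * ln (gauss n v (scale 1 y + 0)) \<partial>lborelC n)"
    by (simp add: entropy_def)
  also have "\<dots> = - gauss_entropy n v"
    using has_bochner_integral_integral_eq[OF mixture_cross_entropy_gauss[OF assms(1-3,3), of n "\<lambda>_. 0" 1 0]] assms(3)
    by (simp add: sqnorm_def gauss_entropy_eq)
  finally show ?thesis by simp
qed

lemma gauss_scale: "k \<noteq> 0 \<Longrightarrow> 0 < v \<Longrightarrow> gauss n ((cmod k)\<^sup>2 * v) (scale k y) = gauss n v y / (cmod k)^(2*n)"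
  by (simp add: gauss_def power_mult_distrib mult_ac) (simp add: power_mult[symmetric] mult.commute)

lemma mixture_scale: assumes "k \<noteq> 0" "0 < v"
  shows "mixture n J (\<lambda>w. scale k (c w)) ((cmod k)\<^sup>2 * v) (scale k y) = mixture n J c v y / (cmod k)^(2*n)"
proof -
  have "gauss n ((cmod k)\<^sup>2 * v) (scale k y - scale k (c w)) = gauss n v (y - c w) / (cmod k)^(2*n)" for w
    using gauss_scale[OF assms, of n "y - c w"] by simp
  then show ?thesis unfolding mixture_def by (simp add: sum_divide_distrib mult.commute)
qed

lemma nn_integral_mixture_scale:
  assumes k_nonzero: "k \<noteq> 0" and v_pos: "0 < v" and F_meas: "F \<in> borel_measurable (lborelC n)"
  shows "(\<integral>\<^sup>+y. ennreal (mixture n J c v y) * F (trunc n (scale k y)) \<partial>lborelC n)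
    = (\<integral>\<^sup>+y. ennreal (mixture n J (\<lambda>w. scale k (c w)) ((cmod k)\<^sup>2 * v) y) * F y \<partial>lborelC n)"
proof -
  let ?q = "mixture n J (\<lambda>w. scale k (c w)) ((cmod k)\<^sup>2 * v)" and ?r = "(cmod k)^(2*n)"
  let ?G = "\<lambda>y. ennreal ?r * (ennreal (?q y) * F y)"
  have G_meas: "?G \<in> borel_measurable (lborelC n)" using F_meas by (intro density_measurable)
  have "ennreal (mixture n J c v y) = ennreal ?r * ennreal (?q (trunc n (scale k y)))" for y
    using k_nonzero mixture_nonneg[OF v_pos, of n J c y]
    by (simp add: mixture_scale[OF k_nonzero v_pos] ennreal_mult'[symmetric])
  then have "(\<integral>\<^sup>+y. ennreal (mixture n J c v y) * F (trunc n (scale k y)) \<partial>lborelC n) = (\<integral>\<^sup>+y. ?G (trunc n (scale k y)) \<partial>lborelC n)"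
    by (simp only: mult.assoc)
  also have "\<dots> = ennreal (1 / ?r) * (\<integral>\<^sup>+y. ?G y \<partial>lborelC n)" by (rule nn_integral_lborelC_scale[OF G_meas k_nonzero])
  also have "\<dots> = (\<integral>\<^sup>+y. ennreal (?q y) * F y \<partial>lborelC n)"
    using k_nonzero F_meas mixture_measurable_ennreal[OF vec_measurable_proj(1), of n J "\<lambda>w. scale k (c w)" "(cmod k)\<^sup>2 * v"]
    by (subst nn_integral_cmult) (simp_all add: mult.assoc[symmetric] ennreal_mult'[symmetric])
  finally show ?thesis .
qed

lemma entropy_scale:
  assumes J_fin: "finite J" "J \<noteq> {}" and v_pos: "0 < v" and k_nonzero: "k \<noteq> 0"
  shows "entropy n J (\<lambda>w. scale k (c w)) ((cmod k)\<^sup>2 * v) = entropy n J c v + real n * ln ((cmod k)\<^sup>2)"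
proof -
  let ?p = "mixture n J c v" and ?q = "mixture n J (\<lambda>w. scale k (c w)) ((cmod k)\<^sup>2 * v)"
  have kv_pos: "0 < (cmod k)\<^sup>2 * v" using k_nonzero v_pos by simp
  have scale_meas: "(\<lambda>y. trunc n (scale k y)) \<in> measurable (lborelC n) (lborelC n)"
    by (intro measurable_trunc density_measurable)
  have "(\<integral>y. ?p y * ln (?q (trunc n (scale k y))) \<partial>lborelC n) = (\<integral>y. ?q y * ln (?q y) \<partial>lborelC n)"
    using kv_pos v_pos by (intro integral_push_density(2)[OF scale_meas])
      (auto intro!: density_measurable mixture_nonneg nn_integral_mixture_scale[OF k_nonzero v_pos])
  then have "entropy n J (\<lambda>w. scale k (c w)) ((cmod k)\<^sup>2 * v) = - (\<integral>y. ?p y * ln (?q (scale k y)) \<partial>lborelC n)"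
    by (simp add: entropy_def)
  also have "(\<integral>y. ?p y * ln (?q (scale k y)) \<partial>lborelC n) = (\<integral>y. ?p (y - 0) * ln (?p (y - 0)) - real n * ln ((cmod k)\<^sup>2) * ?p (y - 0) \<partial>lborelC n)"
  proof (intro Bochner_Integration.integral_cong refl)
    fix y
    have "ln (?q (scale k y)) = ln (?p y) - real n * ln ((cmod k)\<^sup>2)"
      using mixture_pos[OF J_fin v_pos, of n c y] k_nonzero
      by (simp add: mixture_scale[OF k_nonzero v_pos] ln_div ln_realpow power_mult)
    then show "?p y * ln (?q (scale k y)) = ?p (y - 0) * ln (?p (y - 0)) - real n * ln ((cmod k)\<^sup>2) * ?p (y - 0)"
      by (simp only: diff_zero right_diff_distrib) (simp only: mult_ac)
  qed
  also have "\<dots> = - entropy n J c v - real n * ln ((cmod k)\<^sup>2) * 1"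
    by (intro has_bochner_integral_integral_eq has_bochner_integral_diff has_bochner_integral_mult_right
        has_bochner_integral_entropy has_bochner_integral_mixture J_fin v_pos)
  finally show ?thesis by linarith
qed

section \<open>Pairs with correlated noise\<close>

abbreviation lborelC2 :: "nat \<Rightarrow> (cvec \<times> cvec) measure" where
  "lborelC2 n \<equiv> lborelC n \<Otimes>\<^sub>M lborelC n"

lemma pair_sigma_finite_lborelC: "pair_sigma_finite (lborelC n) (lborelC n)"
  by (intro pair_sigma_finite.intro) simp_all

lemma nn_integral_lborelC2: "F \<in> borel_measurable (lborelC2 n) \<Longrightarrow> (\<integral>\<^sup>+z. F z \<partial>lborelC2 n) = (\<integral>\<^sup>+x. \<integral>\<^sup>+y. F (x, y) \<partial>lborelC n \<partial>lborelC n)"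
  using sigma_finite_measure.nn_integral_fst[OF sigma_finite_lborelC, of F "lborelC n" n] by simp

lemma nn_integral_lborelC2': "F \<in> borel_measurable (lborelC2 n) \<Longrightarrow> (\<integral>\<^sup>+z. F z \<partial>lborelC2 n) = (\<integral>\<^sup>+y. \<integral>\<^sup>+x. F (x, y) \<partial>lborelC n \<partial>lborelC n)"
  using pair_sigma_finite.nn_integral_snd[OF pair_sigma_finite_lborelC, of F n] by simp

lemma nn_integral_lborelC_commute:
  assumes "(\<lambda>p. f (fst p) (snd p)) \<in> borel_measurable (lborelC2 n)"
  shows "(\<integral>\<^sup>+y. \<integral>\<^sup>+c. f c y \<partial>lborelC n \<partial>lborelC n) = (\<integral>\<^sup>+c. \<integral>\<^sup>+y. f c y \<partial>lborelC n \<partial>lborelC n)"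
  using pair_sigma_finite.Fubini'[OF pair_sigma_finite_lborelC, of f n] assms by (simp add: split_beta')

text \<open>The joint density of \<open>\<eta>0 + E\<close> and \<open>\<sigma>0 + \<iota> w + g E + V\<close>, where \<open>E\<close> and \<open>V\<close> are independent Gaussian with variances \<open>e\<close> and \<open>v\<close> and \<open>w\<close> is uniform.\<close>

definition pair_density :: "nat \<Rightarrow> real \<Rightarrow> 'w set \<Rightarrow> ('w \<Rightarrow> cvec) \<Rightarrow> real \<Rightarrow> cvec \<Rightarrow> cvec \<Rightarrow> complex \<Rightarrow> cvec \<times> cvec \<Rightarrow> real" where
  "pair_density n e J \<iota> v \<eta>0 \<sigma>0 g z = gauss n e (fst z - \<eta>0) * mixture n J \<iota> v (snd z - \<sigma>0 - scale g (fst z - \<eta>0))"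

lemma pair_density_measurable: "pair_density n e J \<iota> v \<eta>0 \<sigma>0 g \<in> borel_measurable (lborelC2 n)"
  unfolding pair_density_def by (intro density_measurable)

locale noisy_pair =
  fixes n :: nat and e :: real and J :: "'w set" and \<iota> :: "'w \<Rightarrow> cvec" and v :: real and g :: complex
  assumes J_fin: "finite J" "J \<noteq> {}" and e_pos: "0 < e" and v_pos: "0 < v"
begin

abbreviation "pair \<eta>0 \<sigma>0 \<equiv> pair_density n e J \<iota> v \<eta>0 \<sigma>0 g"

text \<open>The law of \<open>\<alpha> Y\<^sub>1 + \<beta> Y\<^sub>2\<close> for a pair \<open>(Y\<^sub>1, Y\<^sub>2)\<close> with density \<open>pair \<eta>0 \<sigma>0\<close>.\<close>

abbreviation "combination_density \<alpha> \<beta> \<eta>0 \<sigma>0 y \<equiv>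
  mixture n J (\<lambda>w. scale \<beta> (\<iota> w)) ((cmod \<beta>)\<^sup>2 * v + (cmod (\<alpha> + \<beta> * g))\<^sup>2 * e) (y - (scale \<alpha> \<eta>0 + scale \<beta> \<sigma>0))"

lemma pair_density_pos: "0 < pair \<eta>0 \<sigma>0 z"
  unfolding pair_density_def using e_pos v_pos J_fin by (intro mult_pos_pos gauss_pos mixture_pos)

lemma snd_variance_pos: "0 < v + (cmod g)\<^sup>2 * e"
  using e_pos v_pos by (simp add: add_pos_nonneg)

lemma combination_variance_pos:
  assumes "\<alpha> \<noteq> 0 \<or> \<beta> \<noteq> 0" shows "0 < (cmod \<beta>)\<^sup>2 * v + (cmod (\<alpha> + \<beta> * g))\<^sup>2 * e"
  using assms e_pos v_pos by (cases "\<beta> = 0") (auto intro!: add_pos_nonneg)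

lemma nn_integral_pair_density:
  assumes G_meas: "G \<in> borel_measurable (lborelC2 n)"
  shows "(\<integral>\<^sup>+z. ennreal (pair \<eta>0 \<sigma>0 z) * G z \<partial>lborelC2 n) =
    (\<integral>\<^sup>+\<eta>. ennreal (gauss n e (\<eta> - \<eta>0)) * (\<integral>\<^sup>+s. ennreal (mixture n J \<iota> v s) * G (\<eta>, trunc n (s + (\<sigma>0 + scale g (\<eta> - \<eta>0)))) \<partial>lborelC n) \<partial>lborelC n)"
proof -
  have product_meas: "(\<lambda>z. ennreal (pair \<eta>0 \<sigma>0 z) * G z) \<in> borel_measurable (lborelC2 n)"
    using pair_density_measurable[of n e J \<iota> v \<eta>0 \<sigma>0 g] G_meas by simp
  show ?thesis unfolding nn_integral_lborelC2[OF product_meas]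
  proof (intro nn_integral_cong)
    fix \<eta> assume \<eta>: "\<eta> \<in> space (lborelC n)"
    let ?u = "\<sigma>0 + scale g (\<eta> - \<eta>0)"
    have section_meas: "(\<lambda>s. G (\<eta>, s)) \<in> borel_measurable (lborelC n)"
      using G_meas \<eta> by simp
    have mixture_meas: "(\<lambda>s. ennreal (mixture n J \<iota> v (s - ?u))) \<in> borel_measurable (lborelC n)"
      by (intro density_measurable)
    have "(\<integral>\<^sup>+s. ennreal (pair \<eta>0 \<sigma>0 (\<eta>, s)) * G (\<eta>, s) \<partial>lborelC n)
       = (\<integral>\<^sup>+s. ennreal (gauss n e (\<eta> - \<eta>0)) * (ennreal (mixture n J \<iota> v (s - ?u)) * G (\<eta>, s)) \<partial>lborelC n)"
      using e_pos mixture_nonneg[OF v_pos]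
      by (intro nn_integral_cong) (simp add: pair_density_def ennreal_mult' mult.assoc diff_diff_eq del: scale_simps)
    also have "\<dots> = ennreal (gauss n e (\<eta> - \<eta>0)) * (\<integral>\<^sup>+s. ennreal (mixture n J \<iota> v (s - ?u)) * G (\<eta>, s) \<partial>lborelC n)"
      using section_meas mixture_meas by (intro nn_integral_cmult borel_measurable_times_ennreal)
    also have "(\<integral>\<^sup>+s. ennreal (mixture n J \<iota> v (s - ?u)) * G (\<eta>, s) \<partial>lborelC n)
        = (\<integral>\<^sup>+s. ennreal (mixture n J \<iota> v (trunc n (s + ?u) - ?u)) * G (\<eta>, trunc n (s + ?u)) \<partial>lborelC n)"
      using section_meas mixture_meas by (intro nn_integral_lborelC_translate[symmetric] borel_measurable_times_ennreal)
    also have "\<dots> = (\<integral>\<^sup>+s. ennreal (mixture n J \<iota> v s) * G (\<eta>, trunc n (s + ?u)) \<partial>lborelC n)"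
      by (intro nn_integral_cong arg_cong2[where f="(*)"] arg_cong[where f=ennreal] mixture_cong) auto
    finally show "(\<integral>\<^sup>+s. ennreal (pair \<eta>0 \<sigma>0 (\<eta>, s)) * G (\<eta>, s) \<partial>lborelC n) =
      ennreal (gauss n e (\<eta> - \<eta>0)) * (\<integral>\<^sup>+s. ennreal (mixture n J \<iota> v s) * G (\<eta>, trunc n (s + ?u)) \<partial>lborelC n)" .
  qed
qed

lemma nn_integral_pair_density_fst:
  assumes F_meas: "F \<in> borel_measurable (lborelC n)"
  shows "(\<integral>\<^sup>+z. ennreal (pair \<eta>0 \<sigma>0 z) * F (fst z) \<partial>lborelC2 n) = (\<integral>\<^sup>+\<eta>. ennreal (gauss n e (\<eta> - \<eta>0)) * F \<eta> \<partial>lborelC n)"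
proof -
  have "(\<lambda>z. F (fst z)) \<in> borel_measurable (lborelC2 n)" using F_meas by simp
  moreover have "(\<integral>\<^sup>+s. ennreal (mixture n J \<iota> v s) * F \<eta> \<partial>lborelC n) = F \<eta>" for \<eta>
    using nn_integral_mixture[OF J_fin v_pos, of n \<iota> 0] by (subst nn_integral_multc) (auto intro!: density_measurable)
  ultimately show ?thesis by (simp add: nn_integral_pair_density)
qed

lemma nn_integral_mixture_affine_noise:
  assumes F_meas: "F \<in> borel_measurable (lborelC n)" and \<beta>: "\<beta> \<noteq> 0"
  shows "(\<integral>\<^sup>+s. ennreal (mixture n J \<iota> v s) * F (trunc n (scale \<alpha> \<eta> + scale \<beta> (trunc n (s + (\<sigma>0 + scale g (\<eta> - \<eta>0)))))) \<partial>lborelC n)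
     = (\<integral>\<^sup>+y. ennreal (mixture n J (\<lambda>w. scale \<beta> (\<iota> w)) ((cmod \<beta>)\<^sup>2 * v) ((y - (scale \<beta> \<sigma>0 - scale (\<beta> * g) \<eta>0)) - scale (\<alpha> + \<beta> * g) \<eta>)) * F y \<partial>lborelC n)"
    (is "?lhs = _")
proof -
  let ?f = "mixture n J (\<lambda>w. scale \<beta> (\<iota> w)) ((cmod \<beta>)\<^sup>2 * v)" and ?u = "scale \<alpha> \<eta> + scale \<beta> (\<sigma>0 + scale g (\<eta> - \<eta>0))"
  have shifted_meas: "(\<lambda>y. F (trunc n (y + ?u))) \<in> borel_measurable (lborelC n)"
    by (intro measurable_compose[OF measurable_trunc F_meas] density_measurable)
  have "trunc n (scale \<alpha> \<eta> + scale \<beta> (trunc n (s + (\<sigma>0 + scale g (\<eta> - \<eta>0))))) = trunc n (trunc n (scale \<beta> s) + ?u)" for s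
    by (auto simp: fun_eq_iff restrict_def algebra_simps)
  then have "?lhs = (\<integral>\<^sup>+y. ennreal (?f y) * F (trunc n (y + ?u)) \<partial>lborelC n)"
    using nn_integral_mixture_scale[OF \<beta> v_pos shifted_meas] by (simp only:)
  also have "\<dots> = (\<integral>\<^sup>+y. (\<lambda>y. ennreal (?f (y - ?u)) * F y) (trunc n (y + ?u)) \<partial>lborelC n)"
    by (intro nn_integral_cong arg_cong2[where f="(*)"] arg_cong[where f=ennreal] mixture_cong) auto
  also have "\<dots> = (\<integral>\<^sup>+y. ennreal (?f (y - ?u)) * F y \<partial>lborelC n)"
    using F_meas by (intro nn_integral_lborelC_translate density_measurable)
  finally show ?thesis by (simp add: algebra_simps scale_add_left)
qed

lemma nn_integral_pair_density_combine:
  assumes F_meas: "F \<in> borel_measurable (lborelC n)" and nontrivial: "\<alpha> \<noteq> 0 \<or> \<beta> \<noteq> 0"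
  shows "(\<integral>\<^sup>+z. ennreal (pair \<eta>0 \<sigma>0 z) * F (trunc n (scale \<alpha> (fst z) + scale \<beta> (snd z))) \<partial>lborelC2 n) =
    (\<integral>\<^sup>+y. ennreal (combination_density \<alpha> \<beta> \<eta>0 \<sigma>0 y) * F y \<partial>lborelC n)" (is "?lhs = _")
proof (cases "\<beta> = 0")
  case True
  then have \<alpha>: "\<alpha> \<noteq> 0" using nontrivial by simp
  have "?lhs = (\<integral>\<^sup>+\<eta>. ennreal (mixture n {()} (\<lambda>_. \<eta>0) e \<eta>) * F (trunc n (scale \<alpha> \<eta>)) \<partial>lborelC n)"
    using True nn_integral_pair_density_fst[of "\<lambda>y. F (trunc n (scale \<alpha> y))" \<eta>0 \<sigma>0]
    by (simp add: mixture_def measurable_compose[OF measurable_trunc F_meas] vec_measurable_shift)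
  also have "\<dots> = (\<integral>\<^sup>+y. ennreal (gauss n ((cmod \<alpha>)\<^sup>2 * e) (y - scale \<alpha> \<eta>0)) * F y \<partial>lborelC n)"
    unfolding nn_integral_mixture_scale[OF \<alpha> e_pos F_meas] by (simp add: mixture_def)
  finally show ?thesis using True J_fin by (simp add: mixture_def)
next
  case False
  let ?f = "mixture n J (\<lambda>w. scale \<beta> (\<iota> w)) ((cmod \<beta>)\<^sup>2 * v)" and ?y0 = "scale \<beta> \<sigma>0 - scale (\<beta> * g) \<eta>0" and ?a = "\<alpha> + \<beta> * g"
  let ?K = "\<lambda>\<eta> y. ennreal (gauss n e (\<eta> - \<eta>0)) * ennreal (?f ((y - ?y0) - scale ?a \<eta>))"
  have \<beta>v_pos: "0 < (cmod \<beta>)\<^sup>2 * v" using False v_pos by simp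
  have G_meas: "(\<lambda>z. F (trunc n (scale \<alpha> (fst z) + scale \<beta> (snd z)))) \<in> borel_measurable (lborelC2 n)"
    by (intro measurable_compose[OF measurable_trunc F_meas] density_measurable)
  have "?lhs = (\<integral>\<^sup>+\<eta>. ennreal (gauss n e (\<eta> - \<eta>0)) * (\<integral>\<^sup>+y. ennreal (?f ((y - ?y0) - scale ?a \<eta>)) * F y \<partial>lborelC n) \<partial>lborelC n)"
    unfolding nn_integral_pair_density[OF G_meas]
    by (simp only: fst_conv snd_conv nn_integral_mixture_affine_noise[OF F_meas False])
  also have "\<dots> = (\<integral>\<^sup>+\<eta>. \<integral>\<^sup>+y. ?K \<eta> y * F y \<partial>lborelC n \<partial>lborelC n)"
    using F_meas by (subst nn_integral_cmult[symmetric]) (auto intro!: density_measurable simp: mult.assoc)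
  also have "\<dots> = (\<integral>\<^sup>+y. \<integral>\<^sup>+\<eta>. ?K \<eta> y * F y \<partial>lborelC n \<partial>lborelC n)"
    by (rule nn_integral_lborelC_commute) (intro density_measurable measurable_compose[OF measurable_fst F_meas])
  also have "\<dots> = (\<integral>\<^sup>+y. (\<integral>\<^sup>+\<eta>. ?K \<eta> y \<partial>lborelC n) * F y \<partial>lborelC n)"
    by (intro nn_integral_cong nn_integral_multc density_measurable)
  also have "\<dots> = (\<integral>\<^sup>+y. ennreal (mixture n J (\<lambda>w. scale \<beta> (\<iota> w)) ((cmod \<beta>)\<^sup>2 * v + (cmod ?a)\<^sup>2 * e) ((y - ?y0) - scale ?a \<eta>0)) * F y \<partial>lborelC n)"
    by (subst nn_integral_mixture_conv[of J e "(cmod \<beta>)\<^sup>2 * v"]) (use J_fin e_pos \<beta>v_pos in auto)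
  also have "(\<lambda>y. (y - ?y0) - scale ?a \<eta>0) = (\<lambda>y. y - (scale \<alpha> \<eta>0 + scale \<beta> \<sigma>0))"
    by (simp add: fun_eq_iff algebra_simps)
  finally show ?thesis .
qed

lemma has_bochner_integral_pair_density_combine:
  fixes \<phi> :: "cvec \<Rightarrow> real"
  assumes \<phi>_meas: "\<phi> \<in> borel_measurable (lborelC n)" and \<phi>_trunc: "\<And>y. \<phi> (trunc n y) = \<phi> y" and nontrivial: "\<alpha> \<noteq> 0 \<or> \<beta> \<noteq> 0"
    and V: "has_bochner_integral (lborelC n) (\<lambda>y. combination_density \<alpha> \<beta> \<eta>0 \<sigma>0 y * \<phi> y) V"
  shows "has_bochner_integral (lborelC2 n) (\<lambda>z. pair \<eta>0 \<sigma>0 z * \<phi> (scale \<alpha> (fst z) + scale \<beta> (snd z))) V"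
proof -
  have combine_meas: "(\<lambda>z. trunc n (scale \<alpha> (fst z) + scale \<beta> (snd z))) \<in> measurable (lborelC2 n) (lborelC n)"
    by (intro measurable_trunc density_measurable)
  have density_meas: "combination_density \<alpha> \<beta> \<eta>0 \<sigma>0 \<in> borel_measurable (lborelC n)" by (intro density_measurable)
  show ?thesis
    using integral_push_density[where r="combination_density \<alpha> \<beta> \<eta>0 \<sigma>0", OF combine_meas pair_density_measurable density_meas
        less_imp_le[OF pair_density_pos] mixture_nonneg[OF combination_variance_pos[OF nontrivial]]
        nn_integral_pair_density_combine[OF _ nontrivial] \<phi>_meas] V
    by (simp only: \<phi>_trunc has_bochner_integral_iff)
qed

lemma has_bochner_integral_pair_density: "has_bochner_integral (lborelC2 n) (pair \<eta>0 \<sigma>0) 1"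
  using has_bochner_integral_pair_density_combine[of "\<lambda>_. 1" 1 0 \<eta>0 \<sigma>0 1]
    has_bochner_integral_mixture[OF J_fin e_pos, of n "\<lambda>_. 0" \<eta>0] by simp

lemma pair_density_cross_entropy_gauss:
  assumes u_pos: "0 < u" and nontrivial: "\<alpha> \<noteq> 0 \<or> \<beta> \<noteq> 0"
  shows "has_bochner_integral (lborelC2 n) (\<lambda>z. pair \<eta>0 \<sigma>0 z * ln (gauss n u (scale \<alpha> (fst z) + scale \<beta> (snd z) + m)))
     (- (((cmod (\<alpha> + \<beta> * g))\<^sup>2 * real n * e + (cmod \<beta>)\<^sup>2 * real n * v + (\<Sum>w\<in>J. sqnorm n (scale \<alpha> \<eta>0 + scale \<beta> (\<sigma>0 + \<iota> w) + m)) / real (card J)) / u) - real n * ln (pi * u))"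
proof (rule has_bochner_integral_pair_density_combine[OF _ _ nontrivial])
  show "(\<lambda>y. ln (gauss n u (y + m))) \<in> borel_measurable (lborelC n)"
    using gauss_measurable[OF vec_measurable_shift(2), of n u m] by simp
  show "ln (gauss n u (trunc n y + m)) = ln (gauss n u (y + m))" for y by (simp add: gauss_def)
  show "has_bochner_integral (lborelC n) (\<lambda>y. combination_density \<alpha> \<beta> \<eta>0 \<sigma>0 y * ln (gauss n u (y + m)))
     (- (((cmod (\<alpha> + \<beta> * g))\<^sup>2 * real n * e + (cmod \<beta>)\<^sup>2 * real n * v + (\<Sum>w\<in>J. sqnorm n (scale \<alpha> \<eta>0 + scale \<beta> (\<sigma>0 + \<iota> w) + m)) / real (card J)) / u) - real n * ln (pi * u))"
    using mixture_cross_entropy_gauss[OF J_fin combination_variance_pos[OF nontrivial] u_pos, of n "\<lambda>w. scale \<beta> (\<iota> w) + (scale \<alpha> \<eta>0 + scale \<beta> \<sigma>0)" 1 m]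
    by (simp add: mixture_shift algebra_simps)
qed

lemma pair_density_ln_mixture_snd:
  assumes "finite A" "A \<noteq> {}" "0 < u"
  shows "has_bochner_integral (lborelC2 n) (\<lambda>z. pair \<eta>0 \<sigma>0 z * ln (mixture n A c u (snd z)))
    (\<integral>s. mixture n J \<iota> (v + (cmod g)\<^sup>2 * e) (s - \<sigma>0) * ln (mixture n A c u s) \<partial>lborelC n)"
  using has_bochner_integral_pair_density_combine[of "\<lambda>s. ln (mixture n A c u s)" 0 1 \<eta>0 \<sigma>0]
    integrable_mixture_ln_mixture[OF J_fin snd_variance_pos assms, of n \<iota> \<sigma>0 c]
  by (simp add: has_bochner_integral_iff ln_mixture_measurable vec_measurable_proj)

lemma ln_pair_density:
  "ln (pair \<eta>0 \<sigma>0 z) = ln (gauss n e (scale 1 (fst z) + scale 0 (snd z) + (- \<eta>0)))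
    + ln (mixture n J \<iota> v (scale (- g) (fst z) + scale 1 (snd z) + (scale g \<eta>0 - \<sigma>0)))"
proof -
  have "mixture n J \<iota> v (snd z - \<sigma>0 - scale g (fst z - \<eta>0)) = mixture n J \<iota> v (scale (- g) (fst z) + scale 1 (snd z) + (scale g \<eta>0 - \<sigma>0))"
    by (rule mixture_cong) (simp add: algebra_simps)
  then show ?thesis
    unfolding pair_density_def using e_pos mixture_pos[OF J_fin v_pos] by (simp add: ln_mult_pos)
qed

lemma pair_density_entropy:
  "has_bochner_integral (lborelC2 n) (\<lambda>z. pair \<eta>0 \<sigma>0 z * ln (pair \<eta>0 \<sigma>0 z)) (- gauss_entropy n e + - entropy n J \<iota> v)"
proof -
  let ?d = "scale g \<eta>0 - \<sigma>0"
  have "has_bochner_integral (lborelC2 n) (\<lambda>z. pair \<eta>0 \<sigma>0 z * ln (gauss n e (scale 1 (fst z) + scale 0 (snd z) + (- \<eta>0)))) (- gauss_entropy n e)"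
    using pair_density_cross_entropy_gauss[OF e_pos, of 1 0 \<eta>0 \<sigma>0 "- \<eta>0"] J_fin e_pos gauss_entropy_eq[OF e_pos, of n]
    by (simp add: sqnorm_def algebra_simps)
  moreover have "has_bochner_integral (lborelC2 n) (\<lambda>z. pair \<eta>0 \<sigma>0 z * ln (mixture n J \<iota> v (scale (- g) (fst z) + scale 1 (snd z) + ?d))) (- entropy n J \<iota> v)"
  proof (rule has_bochner_integral_pair_density_combine)
    show "(\<lambda>y. ln (mixture n J \<iota> v (y + ?d))) \<in> borel_measurable (lborelC n)" by (intro density_measurable)
    show "ln (mixture n J \<iota> v (trunc n y + ?d)) = ln (mixture n J \<iota> v (y + ?d))" for y
      by (intro arg_cong[where f=ln] mixture_cong) simp
    show "has_bochner_integral (lborelC n) (\<lambda>y. combination_density (- g) 1 \<eta>0 \<sigma>0 y * ln (mixture n J \<iota> v (y + ?d))) (- entropy n J \<iota> v)"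
    proof -
      have shift: "y + ?d = y - (scale (- g) \<eta>0 + scale 1 \<sigma>0)" for y by (simp add: fun_eq_iff)
      show ?thesis unfolding shift
        using has_bochner_integral_entropy[OF J_fin v_pos, of n \<iota> "scale (- g) \<eta>0 + scale 1 \<sigma>0"] by simp
    qed
  qed simp
  ultimately show ?thesis unfolding ln_pair_density distrib_left[of "pair \<eta>0 \<sigma>0 _"] by (rule has_bochner_integral_add)
qed

end

subsection \<open>Worst additive noise\<close>

lemma nn_integral_mixture_mult_gauss:
  assumes "finite A" "A \<noteq> {}" "0 < u" and \<tau>_pos: "0 < \<tau>"
  shows "(\<integral>\<^sup>+z. ennreal (mixture n A c u (snd z) * gauss n \<tau> (scale 1 (fst z) + scale k (snd z) + m)) \<partial>lborelC2 n) = 1"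
proof -
  let ?q = "\<lambda>z. mixture n A c u (snd z) * gauss n \<tau> (scale 1 (fst z) + scale k (snd z) + m)"
  have "?q \<in> borel_measurable (lborelC2 n)" by (intro density_measurable)
  then have "(\<integral>\<^sup>+z. ennreal (?q z) \<partial>lborelC2 n) = (\<integral>\<^sup>+s. \<integral>\<^sup>+x. ennreal (?q (x, s)) \<partial>lborelC n \<partial>lborelC n)"
    by (intro nn_integral_lborelC2') simp
  also have "\<dots> = (\<integral>\<^sup>+s. ennreal (mixture n A c u s) * (\<integral>\<^sup>+x. ennreal (gauss n \<tau> (x - (- scale k s - m))) \<partial>lborelC n) \<partial>lborelC n)"
    using mixture_nonneg[OF assms(3), of n A c] \<tau>_pos
    by (subst nn_integral_cmult[symmetric]) (auto intro!: density_measurable nn_integral_cong simp: ennreal_mult algebra_simps)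
  also have "\<dots> = 1" using nn_integral_mixture[OF assms(1-3), of n c 0] by (simp add: nn_integral_gauss[OF \<tau>_pos])
  finally show ?thesis .
qed

lemma (in noisy_pair) pair_density_cross_entropy_mixture_gauss:
  assumes A_fin: "finite A" "A \<noteq> {}" and u_pos: "0 < u" and \<tau>_pos: "0 < \<tau>"
  shows "has_bochner_integral (lborelC2 n)
    (\<lambda>z. pair \<eta>0 \<sigma>0 z * ln (mixture n A c u (snd z) * gauss n \<tau> (scale 1 (fst z) + scale k (snd z) + m)))
    ((\<integral>s. mixture n J \<iota> (v + (cmod g)\<^sup>2 * e) (s - \<sigma>0) * ln (mixture n A c u s) \<partial>lborelC n)
     + (- (((cmod (1 + k * g))\<^sup>2 * real n * e + (cmod k)\<^sup>2 * real n * v + (\<Sum>w\<in>J. sqnorm n (scale 1 \<eta>0 + scale k (\<sigma>0 + \<iota> w) + m)) / real (card J)) / \<tau>) - real n * ln (pi * \<tau>)))"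
proof -
  have "pair \<eta>0 \<sigma>0 z * ln (mixture n A c u (snd z) * gauss n \<tau> (scale 1 (fst z) + scale k (snd z) + m))
      = pair \<eta>0 \<sigma>0 z * ln (mixture n A c u (snd z)) + pair \<eta>0 \<sigma>0 z * ln (gauss n \<tau> (scale 1 (fst z) + scale k (snd z) + m))" for z
    using mixture_pos[OF A_fin u_pos, of n c "snd z"] \<tau>_pos by (subst ln_mult_pos) (auto simp: distrib_left)
  then show ?thesis
    by (simp only:) (intro has_bochner_integral_add pair_density_ln_mixture_snd pair_density_cross_entropy_gauss A_fin u_pos \<tau>_pos, simp)
qed

lemma mmse_eq:
  fixes P \<eta> :: real
  assumes "P + \<eta> \<noteq> 0" shows "(1 - P / (P + \<eta>))\<^sup>2 * P + (P / (P + \<eta>))\<^sup>2 * \<eta> = P * \<eta> / (P + \<eta>)"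
proof -
  have "1 - P / (P + \<eta>) = \<eta> / (P + \<eta>)" using assms by (simp add: field_simps)
  then have "(1 - P / (P + \<eta>))\<^sup>2 * P + (P / (P + \<eta>))\<^sup>2 * \<eta> = (P * \<eta> * (P + \<eta>)) / (P + \<eta>)\<^sup>2"
    by (simp add: power_divide add_divide_distrib[symmetric]) (simp add: power2_eq_square algebra_simps)
  then show ?thesis using assms by (simp add: power2_eq_square)
qed

text \<open>Gibbs' inequality for the pair of the extra noise and the noisier observation, against the
  law under which the former is estimated linearly from the latter with a Gaussian error.\<close>

lemma gauss_worst_noise:
  assumes J_fin: "finite J" "J \<noteq> {}" and noise: "0 < v1" "v1 \<le> v2" and power_nonneg: "0 \<le> \<epsilon>"
    and power: "(\<Sum>w\<in>J. sqnorm n (c w)) \<le> real (card J) * (real n * \<epsilon>)"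
  shows "entropy n J c v1 - gauss_entropy n (\<epsilon> + v1) \<le> entropy n J c v2 - gauss_entropy n (\<epsilon> + v2)"
proof (cases "v1 = v2")
  case False
  define d where "d = v2 - v1"
  have d_pos: "0 < d" using False noise by (simp add: d_def)
  define \<kappa> \<tau> where "\<kappa> = d / (\<epsilon> + v2)" and "\<tau> = d * (\<epsilon> + v1) / (\<epsilon> + v2)"
  have total_pos: "0 < \<epsilon> + v2" "0 < \<epsilon> + v1" and v2_pos: "0 < v2" using power_nonneg noise by auto
  have \<tau>_pos: "0 < \<tau>" using d_pos total_pos by (simp add: \<tau>_def)
  interpret noisy_pair n d J c v1 1 by unfold_locales (use J_fin d_pos noise in auto)
  let ?q = "\<lambda>z. mixture n J c v2 (snd z) * gauss n \<tau> (scale 1 (fst z) + scale (- of_real \<kappa>) (snd z) + 0)"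
  let ?B = "(1 - \<kappa>)\<^sup>2 * real n * d + \<kappa>\<^sup>2 * real n * v1 + \<kappa>\<^sup>2 * ((\<Sum>w\<in>J. sqnorm n (c w)) / real (card J))"
  have "(cmod (1 + - complex_of_real \<kappa> * 1))\<^sup>2 = (1 - \<kappa>)\<^sup>2"
    by (metis add_uminus_conv_diff mult_1_right norm_of_real of_real_1 of_real_diff power2_abs)
  then have cross: "has_bochner_integral (lborelC2 n) (\<lambda>z. pair 0 0 z * ln (?q z)) (- entropy n J c v2 + (- (?B / \<tau>) - real n * ln (pi * \<tau>)))"
    using pair_density_cross_entropy_mixture_gauss[OF J_fin v2_pos \<tau>_pos, of 0 0 c "- of_real \<kappa>" 0]
    by (simp add: d_def sum_distrib_left[symmetric] entropy_def)
  have "(\<integral>z. pair 0 0 z * ln (?q z) \<partial>lborelC2 n) \<le> (\<integral>z. pair 0 0 z * ln (pair 0 0 z) \<partial>lborelC2 n)"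
  proof (rule gibbs_inequality)
    show "?q \<in> borel_measurable (lborelC2 n)" by (intro density_measurable)
    show "0 < ?q z" for z using mixture_pos[OF J_fin v2_pos] \<tau>_pos by simp
  qed (use has_bochner_integral_pair_density pair_density_entropy[of 0 0] pair_density_pos cross
      nn_integral_mixture_mult_gauss[OF J_fin v2_pos \<tau>_pos, of n c "- of_real \<kappa>" 0] in \<open>simp_all add: has_bochner_integral_iff\<close>)
  then have bound: "- entropy n J c v2 - ?B / \<tau> - real n * ln (pi * \<tau>) \<le> - gauss_entropy n d - entropy n J c v1"
    using has_bochner_integral_integral_eq[OF cross] has_bochner_integral_integral_eq[OF pair_density_entropy[of 0 0]]
    by simp
  have "?B \<le> (1 - \<kappa>)\<^sup>2 * real n * d + \<kappa>\<^sup>2 * real n * v1 + \<kappa>\<^sup>2 * (real n * \<epsilon>)"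
    using power J_fin by (intro add_left_mono mult_left_mono) (auto simp: pos_divide_le_eq card_gt_0_iff mult.commute)
  also have "\<dots> = real n * ((1 - \<kappa>)\<^sup>2 * d + \<kappa>\<^sup>2 * (\<epsilon> + v1))" by (simp add: algebra_simps)
  also have "(1 - \<kappa>)\<^sup>2 * d + \<kappa>\<^sup>2 * (\<epsilon> + v1) = \<tau>"
    using mmse_eq[of d "\<epsilon> + v1"] total_pos by (simp add: \<kappa>_def \<tau>_def d_def algebra_simps)
  finally have "?B / \<tau> \<le> real n" using \<tau>_pos by (simp add: pos_divide_le_eq)
  moreover have "gauss_entropy n d + gauss_entropy n (\<epsilon> + v1) = gauss_entropy n \<tau> + gauss_entropy n (\<epsilon> + v2)"
    using d_pos total_pos \<tau>_pos by (intro gauss_entropy_add_cong) (auto simp: \<tau>_def)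
  ultimately show ?thesis using bound gauss_entropy_eq[OF \<tau>_pos, of n] by linarith
qed simp

section \<open>Codebooks and entropy gaps\<close>

definition centred :: "nat \<Rightarrow> 'w set \<Rightarrow> ('w \<Rightarrow> cvec) \<Rightarrow> bool" where
  "centred n A x \<longleftrightarrow> (\<forall>t<n. (\<Sum>a\<in>A. x a t) = 0)"

lemma centred_sum_re_inner: assumes "centred n A x" shows "(\<Sum>a\<in>A. re_inner n m (scale k (x a))) = 0"
proof -
  have "(\<Sum>a\<in>A. re_inner n m (scale k (x a))) = (\<Sum>t<n. Re (m t * cnj (k * (\<Sum>a\<in>A. x a t))))"
    unfolding re_inner_def by (subst sum.swap) (simp only: sum_distrib_left cnj_sum Re_sum scale_apply)
  also have "\<dots> = 0" using assms by (intro sum.neutral) (auto simp: centred_def)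
  finally show ?thesis .
qed

lemma centred_sum_sqnorm: assumes "centred n A x"
  shows "(\<Sum>a\<in>A. sqnorm n (m + scale k (x a))) = real (card A) * sqnorm n m + (cmod k)\<^sup>2 * (\<Sum>a\<in>A. sqnorm n (x a))"
  by (simp add: sqnorm_add sum.distrib centred_sum_re_inner[OF assms] sum_distrib_left[symmetric])

definition codebook :: "nat \<Rightarrow> 'w set \<Rightarrow> ('w \<Rightarrow> cvec) \<Rightarrow> real \<Rightarrow> bool" where
  "codebook n A x P \<longleftrightarrow> finite A \<and> A \<noteq> {} \<and> centred n A x \<and> 0 \<le> P \<and> (\<Sum>a\<in>A. sqnorm n (x a)) \<le> real (card A) * (real n * P)"

lemma codebook_pair:
  assumes x: "codebook n A x P" and y: "codebook n B y R"
  shows "codebook n (A \<times> B) (\<lambda>(a, b). scale j (x a) + scale k (y b)) ((cmod j)\<^sup>2 * P + (cmod k)\<^sup>2 * R)"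
    and "(\<Sum>a\<in>A. \<Sum>b\<in>B. sqnorm n (scale j (x a) + scale k (y b))) \<le> real (card A) * real (card B) * (real n * ((cmod j)\<^sup>2 * P + (cmod k)\<^sup>2 * R))"
proof -
  have "(\<Sum>a\<in>A. \<Sum>b\<in>B. sqnorm n (scale j (x a) + scale k (y b))) = (cmod j)\<^sup>2 * (real (card B) * (\<Sum>a\<in>A. sqnorm n (x a))) + (cmod k)\<^sup>2 * (real (card A) * (\<Sum>b\<in>B. sqnorm n (y b)))"
    using y by (simp add: codebook_def centred_sum_sqnorm sum.distrib sum_distrib_left mult_ac)
  also have "\<dots> \<le> (cmod j)\<^sup>2 * (real (card B) * (real (card A) * (real n * P))) + (cmod k)\<^sup>2 * (real (card A) * (real (card B) * (real n * R)))"
    using x y by (intro add_mono mult_left_mono) (auto simp: codebook_def)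
  finally show power: "(\<Sum>a\<in>A. \<Sum>b\<in>B. sqnorm n (scale j (x a) + scale k (y b))) \<le> real (card A) * real (card B) * (real n * ((cmod j)\<^sup>2 * P + (cmod k)\<^sup>2 * R))"
    by (simp add: algebra_simps)
  have "(\<Sum>p\<in>A \<times> B. (case p of (a, b) \<Rightarrow> scale j (x a) + scale k (y b)) t) = 0" if t: "t < n" for t
  proof -
    have "(\<Sum>p\<in>A \<times> B. (case p of (a, b) \<Rightarrow> scale j (x a) + scale k (y b)) t) = (\<Sum>a\<in>A. \<Sum>b\<in>B. j * x a t + k * y b t)"
      by (simp add: sum.cartesian_product split_beta')
    also have "\<dots> = (\<Sum>a\<in>A. of_nat (card B) * (j * x a t) + k * (\<Sum>b\<in>B. y b t))"
      by (simp add: sum.distrib sum_distrib_left)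
    also have "\<dots> = of_nat (card B) * j * (\<Sum>a\<in>A. x a t)"
      using y t by (simp add: codebook_def centred_def sum_distrib_left mult.assoc)
    finally show ?thesis using x t by (simp add: codebook_def centred_def)
  qed
  then show "codebook n (A \<times> B) (\<lambda>(a, b). scale j (x a) + scale k (y b)) ((cmod j)\<^sup>2 * P + (cmod k)\<^sup>2 * R)"
    using x y power by (auto simp: codebook_def centred_def sum.cartesian_product split_beta' card_cartesian_product)
qed

lemma codebook_zero_power: assumes "codebook n A x 0" "a \<in> A" "t < n" shows "x a t = 0"
proof -
  have "(\<Sum>w\<in>A. sqnorm n (x w)) \<le> 0" using assms by (simp add: codebook_def)
  then have "(\<Sum>w\<in>A. sqnorm n (x w)) = 0" using sum_nonneg[of A "\<lambda>w. sqnorm n (x w)"] by simp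
  then have "sqnorm n (x a) = 0" using assms by (subst (asm) sum_nonneg_eq_0_iff) (auto simp: codebook_def)
  then show ?thesis using assms(3) by (auto simp: sqnorm_def sum_nonneg_eq_0_iff)
qed

definition entropy_gap :: "nat \<Rightarrow> 'w set \<Rightarrow> ('w \<Rightarrow> cvec) \<Rightarrow> real \<Rightarrow> real \<Rightarrow> real" where
  "entropy_gap n J c v \<epsilon> = gauss_entropy n (\<epsilon> + v) - entropy n J c v"

lemma entropy_gap_nonneg: "codebook n J c \<epsilon> \<Longrightarrow> 0 < v \<Longrightarrow> 0 \<le> entropy_gap n J c v \<epsilon>"
  using entropy_le_gauss[of J v \<epsilon> n c] by (simp add: entropy_gap_def codebook_def)

lemma entropy_gap_antimono: "codebook n J c \<epsilon> \<Longrightarrow> 0 < v1 \<Longrightarrow> v1 \<le> v2 \<Longrightarrow> entropy_gap n J c v2 \<epsilon> \<le> entropy_gap n J c v1 \<epsilon>"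
  using gauss_worst_noise[of J v1 v2 \<epsilon> n c] by (simp add: entropy_gap_def codebook_def)

lemma entropy_gap_cong: "(\<And>w t. w \<in> J \<Longrightarrow> t < n \<Longrightarrow> c w t = c' w t) \<Longrightarrow> entropy_gap n J c v \<epsilon> = entropy_gap n J c' v \<epsilon>"
  using entropy_cong[of J n c c' v] by (simp add: entropy_gap_def)

lemma entropy_gap_zero_power: assumes "codebook n J c 0" "0 < v" shows "entropy_gap n J c v 0 = 0"
proof -
  have "entropy n J c v = entropy n J (\<lambda>_. 0) v" using codebook_zero_power[OF assms(1)] by (intro entropy_cong) auto
  then show ?thesis using assms by (simp add: entropy_gap_def entropy_gauss codebook_def)
qed

lemma entropy_gap_scale:
  assumes "finite J" "J \<noteq> {}" "0 < v" "k \<noteq> 0" "0 \<le> \<epsilon>"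
  shows "entropy_gap n J (\<lambda>w. scale k (c w)) ((cmod k)\<^sup>2 * v) ((cmod k)\<^sup>2 * \<epsilon>) = entropy_gap n J c v \<epsilon>"
  using assms gauss_entropy_mult[of "(cmod k)\<^sup>2" "\<epsilon> + v" n] entropy_scale[of J v k n c]
  by (simp add: entropy_gap_def distrib_left)

section \<open>Fano's inequality\<close>

definition fano_rate :: "real \<Rightarrow> nat \<Rightarrow> real" where
  "fano_rate e M = (1 - e) * ln (real M) - ln 2"

text \<open>Here \<open>i\<close> indicates correct decoding; \<open>q (1 + M i) / 2\<close> is the reference density.\<close>

lemma fano_pointwise:
  fixes p q M i :: real
  assumes p_pos: "0 < p" and q_pos: "0 < q" and M_ge_1: "1 \<le> M" and i: "i = 0 \<or> i = 1"
  shows "p * ln q + ln M * (p * i) - ln 2 * p - p * ln p \<le> 1 / 2 * q + M / 2 * (q * i) - p"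
proof -
  define r where "r = 1 / 2 + M / 2 * i"
  have r_pos: "0 < r" using M_ge_1 i by (auto simp: r_def)
  have "ln M * i - ln 2 \<le> ln r"
  proof (cases "i = 1")
    case True
    have "ln (M / 2) \<le> ln r" using True M_ge_1 by (simp add: r_def)
    then show ?thesis using True M_ge_1 by (simp add: ln_div)
  qed (use i in \<open>simp add: r_def ln_div\<close>)
  then have "p * (ln q + (ln M * i - ln 2)) \<le> p * ln (q * r)"
    using p_pos q_pos r_pos by (intro mult_left_mono) (auto simp: ln_mult)
  moreover have "p * ln (q * r / p) \<le> p * (q * r / p - 1)"
    using p_pos q_pos r_pos by (intro mult_left_mono ln_le_minus_one) auto
  then have "p * ln (q * r) - p * ln p \<le> q * r - p"
    using p_pos q_pos r_pos by (simp add: ln_div right_diff_distrib)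
  ultimately show ?thesis by (simp add: r_def algebra_simps)
qed

lemma borel_measurable_indicator_eq:
  assumes "\<psi> \<in> measurable M (count_space UNIV)"
  shows "(\<lambda>z. indicator {z. \<psi> z = a} z :: real) \<in> borel_measurable M"
proof -
  have "(\<lambda>z. (if \<psi> z = a then 1 else 0 :: real)) \<in> borel_measurable M"
    by (rule measurable_compose[OF assms, of "\<lambda>i. if i = a then 1 else 0"]) simp
  then show ?thesis by (simp add: indicator_def of_bool_def cong: if_cong)
qed

lemma integrable_mult_indicator_eq:
  fixes f :: "'z \<Rightarrow> real"
  assumes "\<psi> \<in> measurable M (count_space UNIV)" "integrable M f"
  shows "integrable M (\<lambda>z. f z * indicator {z. \<psi> z = a} z)"
  using assms borel_measurable_indicator_eq[OF assms(1), of a]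
  by (intro Bochner_Integration.integrable_bound[OF assms(2)]) (auto simp: indicator_def)

lemma sum_integral_indicator_le:
  fixes q :: "'z \<Rightarrow> real" and \<psi> :: "'z \<Rightarrow> nat"
  assumes \<psi>: "\<psi> \<in> measurable M (count_space UNIV)" and q_integrable: "integrable M q" and q_nonneg: "\<And>z. 0 \<le> q z"
  shows "(\<Sum>a<N. \<integral>z. q z * indicator {z. \<psi> z = a} z \<partial>M) \<le> (\<integral>z. q z \<partial>M)"
proof -
  have "(\<Sum>a<N. \<integral>z. q z * indicator {z. \<psi> z = a} z \<partial>M) = (\<integral>z. (\<Sum>a<N. q z * indicator {z. \<psi> z = a} z) \<partial>M)"
    using integrable_mult_indicator_eq[OF \<psi> q_integrable] by (subst Bochner_Integration.integral_sum) auto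
  also have "\<dots> \<le> (\<integral>z. q z \<partial>M)"
  proof (rule integral_mono)
    show "integrable M (\<lambda>z. \<Sum>a<N. q z * indicator {z. \<psi> z = a} z)"
      by (intro Bochner_Integration.integrable_sum integrable_mult_indicator_eq \<psi> q_integrable)
    show "(\<Sum>a<N. q z * indicator {z. \<psi> z = a} z) \<le> q z" for z
    proof -
      have "(\<Sum>a<N. q z * indicator {z. \<psi> z = a} z) = (\<Sum>a<N. if a = \<psi> z then q z else 0)"
        by (intro sum.cong) (auto simp: indicator_def)
      also have "\<dots> \<le> q z" using q_nonneg[of z] by (auto simp: sum.delta)
      finally show ?thesis .
    qed
  qed (rule q_integrable)
  finally show ?thesis .
qed

lemma fano_single_message:
  fixes p q :: "'z \<Rightarrow> real"
  assumes N_ge_1: "1 \<le> N" and p_pos: "\<And>z. 0 < p z" and q_pos: "\<And>z. 0 < q z"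
    and p_density: "has_bochner_integral M p 1" and q_integrable: "integrable M q" and q_le_1: "(\<integral>z. q z \<partial>M) \<le> 1"
    and \<psi>: "\<psi> \<in> measurable M (count_space UNIV)"
    and p_ln_p: "integrable M (\<lambda>z. p z * ln (p z))" and p_ln_q: "integrable M (\<lambda>z. p z * ln (q z))"
  shows "(\<integral>z. p z * ln (q z) \<partial>M) + ln (real N) * (\<integral>z. p z * indicator {z. \<psi> z = a} z \<partial>M) - ln 2 - (\<integral>z. p z * ln (p z) \<partial>M)
    \<le> real N / 2 * (\<integral>z. q z * indicator {z. \<psi> z = a} z \<partial>M) - 1 / 2"
proof -
  let ?I = "indicator {z. \<psi> z = a} :: 'z \<Rightarrow> real"
  have p_integral: "integrable M p" "(\<integral>z. p z \<partial>M) = 1" using p_density by (auto simp: has_bochner_integral_iff)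
  note indicator_integrable = integrable_mult_indicator_eq[OF \<psi>, of _ a]
  have "(\<integral>z. p z * ln (q z) + ln (real N) * (p z * ?I z) - ln 2 * p z - p z * ln (p z) \<partial>M)
     \<le> (\<integral>z. 1 / 2 * q z + real N / 2 * (q z * ?I z) - p z \<partial>M)"
    using p_ln_p p_ln_q q_integrable p_integral indicator_integrable[OF p_integral(1)] indicator_integrable[OF q_integrable] N_ge_1 p_pos q_pos
    by (intro integral_mono fano_pointwise) (auto simp: indicator_def)
  then show ?thesis
    using p_ln_p p_ln_q q_integrable q_le_1 p_integral indicator_integrable[OF p_integral(1)] indicator_integrable[OF q_integrable]
    by simp
qed

lemma fano_inequality:
  fixes p :: "nat \<Rightarrow> 'c \<Rightarrow> 'z \<Rightarrow> real" and q :: "'c \<Rightarrow> 'z \<Rightarrow> real" and \<psi> :: "'z \<Rightarrow> nat" and s :: "nat \<Rightarrow> 'c \<Rightarrow> 'b \<Rightarrow> real"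
  assumes C_fin: "finite C" "C \<noteq> {}" and B_fin: "finite B" "B \<noteq> {}" and N_ge_1: "1 \<le> N"
    and p_pos: "\<And>a c z. 0 < p a c z" and q_pos: "\<And>c z. 0 < q c z"
    and p_density: "\<And>a c. has_bochner_integral M (p a c) 1"
    and q_meas: "\<And>c. q c \<in> borel_measurable M" and q_subdensity: "\<And>c. (\<integral>\<^sup>+z. ennreal (q c z) \<partial>M) \<le> 1"
    and \<psi>: "\<psi> \<in> measurable M (count_space UNIV)"
    and p_ln_p: "\<And>a c. has_bochner_integral M (\<lambda>z. p a c z * ln (p a c z)) h"
    and p_ln_q: "\<And>a c. integrable M (\<lambda>z. p a c z * ln (q c z))"
    and success: "\<And>a c. (\<integral>z. p a c z * indicator {z. \<psi> z = a} z \<partial>M) = (\<Sum>b\<in>B. s a c b) / real (card B)"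
    and decoding: "(1 - e) * (real N * (real (card B) * real (card C))) \<le> (\<Sum>a<N. \<Sum>c\<in>C. \<Sum>b\<in>B. s a c b)"
  shows "fano_rate e N \<le> h - (\<Sum>a<N. \<Sum>c\<in>C. \<integral>z. p a c z * ln (q c z) \<partial>M) / (real N * real (card C))"
proof -
  define Q where "Q a c = (\<integral>z. p a c z * ln (q c z) \<partial>M)" for a c
  define T where "T = real N * real (card C)"
  have card_pos: "0 < real (card B)" "0 < real (card C)" "0 < T" using B_fin C_fin N_ge_1 by (auto simp: T_def card_gt_0_iff)
  have q_integrable: "integrable M (q c)" for c
    using q_subdensity[of c] q_pos q_meas by (intro integrableI_nonneg) (auto simp: less_imp_le intro: le_less_trans)
  have q_le_1: "(\<integral>z. q c z \<partial>M) \<le> 1" for c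
    using q_subdensity[of c] nn_integral_eq_integral[OF q_integrable[of c]] q_pos by (simp add: less_imp_le)
  have "(\<Sum>a<N. \<Sum>c\<in>C. Q a c + ln (real N) * ((\<Sum>b\<in>B. s a c b) / real (card B)) - ln 2 - h)
      \<le> (\<Sum>a<N. \<Sum>c\<in>C. real N / 2 * (\<integral>z. q c z * indicator {z. \<psi> z = a} z \<partial>M) - 1 / 2)"
    unfolding Q_def success[symmetric] using p_ln_p
    by (intro sum_mono order_trans[OF _ fano_single_message[OF N_ge_1 p_pos q_pos p_density q_integrable q_le_1 \<psi> _ p_ln_q]])
      (auto simp: has_bochner_integral_iff)
  also have "\<dots> = (\<Sum>c\<in>C. real N / 2 * (\<Sum>a<N. \<integral>z. q c z * indicator {z. \<psi> z = a} z \<partial>M) - real N / 2)"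
    by (subst sum.swap) (simp add: sum_subtractf sum_distrib_left)
  also have "\<dots> \<le> (\<Sum>c\<in>C. real N / 2 * 1 - real N / 2)"
    using q_pos by (intro sum_mono diff_right_mono mult_left_mono order_trans[OF sum_integral_indicator_le[OF \<psi> q_integrable] q_le_1]) (auto simp: less_imp_le)
  finally have "ln (real N) * ((\<Sum>a<N. \<Sum>c\<in>C. \<Sum>b\<in>B. s a c b) / real (card B)) - T * ln 2 \<le> T * h - (\<Sum>a<N. \<Sum>c\<in>C. Q a c)"
    by (simp add: sum.distrib sum_subtractf sum_distrib_left sum_divide_distrib T_def algebra_simps)
  moreover have "(1 - e) * T \<le> (\<Sum>a<N. \<Sum>c\<in>C. \<Sum>b\<in>B. s a c b) / real (card B)"
    using decoding card_pos by (simp add: T_def pos_le_divide_eq mult_ac)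
  then have "ln (real N) * ((1 - e) * T) \<le> ln (real N) * ((\<Sum>a<N. \<Sum>c\<in>C. \<Sum>b\<in>B. s a c b) / real (card B))"
    using N_ge_1 by (intro mult_left_mono) auto
  ultimately have "fano_rate e N * T \<le> h * T - (\<Sum>a<N. \<Sum>c\<in>C. Q a c)" by (simp add: fano_rate_def algebra_simps)
  then have "fano_rate e N \<le> (h * T - (\<Sum>a<N. \<Sum>c\<in>C. Q a c)) / T" using card_pos by (simp add: pos_le_divide_eq)
  also have "\<dots> = h - (\<Sum>a<N. \<Sum>c\<in>C. Q a c) / T" using card_pos by (simp add: diff_divide_distrib)
  finally show ?thesis unfolding Q_def T_def .
qed

subsection \<open>Decoding a codeword in interference\<close>

definition decode_prob :: "nat \<Rightarrow> (cvec \<Rightarrow> nat) \<Rightarrow> nat \<Rightarrow> cvec \<Rightarrow> real" where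
  "decode_prob n \<psi> a m = (\<integral>y. gauss n 1 (y - m) * indicator {y. \<psi> y = a} y \<partial>lborelC n)"

definition decodable :: "nat \<Rightarrow> nat \<Rightarrow> (nat \<Rightarrow> cvec) \<Rightarrow> 'w set \<Rightarrow> ('w \<Rightarrow> cvec) \<Rightarrow> (cvec \<Rightarrow> nat) \<Rightarrow> real \<Rightarrow> bool" where
  "decodable n N x J \<iota> \<psi> e \<longleftrightarrow> \<psi> \<in> measurable (lborelC n) (count_space UNIV) \<and>
     (1 - e) * (real N * real (card J)) \<le> (\<Sum>a<N. \<Sum>b\<in>J. decode_prob n \<psi> a (x a + \<iota> b))"

lemma decodable_Times:
  assumes "decodable n N x (B \<times> C) (\<lambda>(b, c). \<beta> b + d c) \<psi> e"
  shows "(1 - e) * (real N * (real (card B) * real (card C))) \<le> (\<Sum>a<N. \<Sum>c\<in>C. \<Sum>b\<in>B. decode_prob n \<psi> a (x a + (\<beta> b + d c)))"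
proof -
  have "(\<Sum>bc\<in>B \<times> C. decode_prob n \<psi> a (x a + (\<lambda>(b, c). \<beta> b + d c) bc)) = (\<Sum>c\<in>C. \<Sum>b\<in>B. decode_prob n \<psi> a (x a + (\<beta> b + d c)))"
    for a
    by (subst sum.swap) (simp only: sum.cartesian_product split_beta')
  then show ?thesis using assms unfolding decodable_def by (simp only: card_cartesian_product of_nat_mult)
qed

lemma integral_mixture_indicator:
  assumes \<psi>: "\<psi> \<in> measurable (lborelC n) (count_space UNIV)"
  shows "(\<integral>y. mixture n J \<iota> 1 (y - m) * indicator {y. \<psi> y = a} y \<partial>lborelC n) = (\<Sum>b\<in>J. decode_prob n \<psi> a (m + \<iota> b)) / real (card J)"
proof -
  have "mixture n J \<iota> 1 (y - m) * indicator {y. \<psi> y = a} y = (\<Sum>b\<in>J. gauss n 1 (y - (m + \<iota> b)) * indicator {y. \<psi> y = a} y) / real (card J)"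
    for y
    unfolding mixture_def by (simp add: sum_distrib_right diff_diff_eq)
  moreover have "integrable (lborelC n) (\<lambda>y. gauss n 1 (y - m) * indicator {y. \<psi> y = a} y)" for m
    using has_bochner_integral_gauss[of 1 n m]
    by (intro integrable_mult_indicator_eq[OF \<psi>]) (simp add: has_bochner_integral_iff)
  ultimately show ?thesis by (simp add: decode_prob_def Bochner_Integration.integral_sum)
qed

lemma sum_mixture_shift:
  assumes "finite A" "finite B"
  shows "(\<Sum>a\<in>A. mixture n B c v (y - d a)) = real (card A) * mixture n (A \<times> B) (\<lambda>(a, b). d a + c b) v y"
proof (cases "A = {} \<or> B = {}")
  case False
  have "mixture n (A \<times> B) (\<lambda>(a, b). d a + c b) v y = (\<Sum>a\<in>A. \<Sum>b\<in>B. gauss n v (y - (d a + c b))) / (real (card A) * real (card B))"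
    unfolding mixture_def by (simp add: sum.cartesian_product split_beta' card_cartesian_product)
  moreover have "(\<Sum>a\<in>A. mixture n B c v (y - d a)) = (\<Sum>a\<in>A. \<Sum>b\<in>B. gauss n v (y - (d a + c b))) / real (card B)"
    unfolding mixture_def by (simp add: sum_divide_distrib[symmetric] diff_diff_eq)
  moreover have "real (card A) \<noteq> 0" using False assms by simp
  ultimately show ?thesis by simp
qed (auto simp: mixture_def)

lemma sum_integral_mixture_shift:
  fixes \<phi> :: "cvec \<Rightarrow> real"
  assumes "finite A" "finite B" and integrable: "\<And>a. a \<in> A \<Longrightarrow> integrable (lborelC n) (\<lambda>y. mixture n B c v (y - d a) * \<phi> y)"
  shows "(\<Sum>a\<in>A. \<integral>y. mixture n B c v (y - d a) * \<phi> y \<partial>lborelC n)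
    = real (card A) * (\<integral>y. mixture n (A \<times> B) (\<lambda>(a, b). d a + c b) v y * \<phi> y \<partial>lborelC n)"
proof -
  have "(\<Sum>a\<in>A. \<integral>y. mixture n B c v (y - d a) * \<phi> y \<partial>lborelC n) = (\<integral>y. (\<Sum>a\<in>A. mixture n B c v (y - d a) * \<phi> y) \<partial>lborelC n)"
    using integrable by (simp add: Bochner_Integration.integral_sum)
  also have "\<dots> = (\<integral>y. real (card A) * (mixture n (A \<times> B) (\<lambda>(a, b). d a + c b) v y * \<phi> y) \<partial>lborelC n)"
    by (simp only: sum_distrib_right[symmetric] sum_mixture_shift[OF assms(1,2)] mult.assoc)
  finally show ?thesis by simp
qed

lemma fano_mixture:
  assumes C_fin: "finite C" "C \<noteq> {}" and N_ge_1: "1 \<le> N" and B_fin: "finite B" "B \<noteq> {}"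
    and \<psi>: "\<psi> \<in> measurable (lborelC n) (count_space UNIV)"
    and decoding: "(1 - e) * (real N * (real (card B) * real (card C))) \<le> (\<Sum>a<N. \<Sum>c\<in>C. \<Sum>b\<in>B. decode_prob n \<psi> a ((x a + d c) + \<beta> b))"
  shows "fano_rate e N \<le> entropy n ({..<N} \<times> B) (\<lambda>(a, b). x a + \<beta> b) 1 - entropy n B \<beta> 1"
proof -
  let ?AB = "{..<N} \<times> B" and ?f = "mixture n ({..<N} \<times> B) (\<lambda>(a, b). x a + \<beta> b) 1"
  have AB_fin: "finite ?AB" "?AB \<noteq> {}" using B_fin N_ge_1 by (auto simp: lessThan_empty_iff)
  let ?p = "\<lambda>a c y. mixture n B \<beta> 1 (y - (x a + d c))" and ?q = "\<lambda>c y. ?f (y - d c)"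
  have p_ln_q: "integrable (lborelC n) (\<lambda>y. ?p a c y * ln (?q c y))" for a c
    unfolding mixture_shift[of n ?AB] by (rule integrable_mixture_ln_mixture[OF B_fin zero_less_one AB_fin zero_less_one])
  have "fano_rate e N \<le> - entropy n B \<beta> 1 - (\<Sum>a<N. \<Sum>c\<in>C. \<integral>z. ?p a c z * ln (?q c z) \<partial>lborelC n) / (real N * real (card C))"
    using mixture_pos[OF B_fin zero_less_one] mixture_pos[OF AB_fin zero_less_one] nn_integral_mixture[OF AB_fin zero_less_one]
    by (intro fano_inequality[OF C_fin B_fin N_ge_1 _ _ has_bochner_integral_mixture[OF B_fin zero_less_one] _ _ \<psi>
          has_bochner_integral_entropy[OF B_fin zero_less_one] p_ln_q integral_mixture_indicator[OF \<psi>] decoding] density_measurable) auto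
  also have "(\<Sum>a<N. \<Sum>c\<in>C. \<integral>z. ?p a c z * ln (?q c z) \<partial>lborelC n) = (\<Sum>c\<in>C. - real N * entropy n ?AB (\<lambda>(a, b). x a + \<beta> b) 1)"
  proof (subst sum.swap, intro sum.cong refl)
    fix c
    have "(\<lambda>(a, b). (x a + d c) + \<beta> b) = (\<lambda>w. (\<lambda>(a, b). x a + \<beta> b) w + d c)" by (auto simp: fun_eq_iff)
    then have "(\<Sum>a<N. \<integral>z. ?p a c z * ln (?q c z) \<partial>lborelC n) = real N * (\<integral>z. ?f (z - d c) * ln (?f (z - d c)) \<partial>lborelC n)"
      using sum_integral_mixture_shift[where A="{..<N}" and d="\<lambda>a. x a + d c" and \<phi>="\<lambda>y. ln (?q c y)", OF _ B_fin(1) p_ln_q]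
      by (simp add: mixture_shift)
    then show "(\<Sum>a<N. \<integral>z. ?p a c z * ln (?q c z) \<partial>lborelC n) = - real N * entropy n ?AB (\<lambda>(a, b). x a + \<beta> b) 1"
      using has_bochner_integral_integral_eq[OF has_bochner_integral_entropy[OF AB_fin zero_less_one, of n "\<lambda>(a, b). x a + \<beta> b" "d c"]]
      by simp
  qed
  finally show ?thesis using N_ge_1 C_fin by simp
qed

lemma fano_mixture_decodable:
  assumes x: "codebook n {..<N} x P" and B_fin: "finite B" "B \<noteq> {}" and C_fin: "finite C" "C \<noteq> {}"
    and dec: "decodable n N x (B \<times> C) (\<lambda>(b, c). \<beta> b + d c) \<psi> e"
  shows "fano_rate e N \<le> entropy n ({..<N} \<times> B) (\<lambda>(a, b). x a + \<beta> b) 1 - entropy n B \<beta> 1"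
proof (rule fano_mixture[OF C_fin _ B_fin])
  show "1 \<le> N" "\<psi> \<in> measurable (lborelC n) (count_space UNIV)"
    using x dec by (auto simp: codebook_def decodable_def lessThan_empty_iff)
  show "(1 - e) * (real N * (real (card B) * real (card C))) \<le> (\<Sum>a<N. \<Sum>c\<in>C. \<Sum>b\<in>B. decode_prob n \<psi> a ((x a + d c) + \<beta> b))"
    using decodable_Times[OF dec] by (simp only: add.assoc add.commute[of "d _"])
qed

lemma decodable_reindex:
  assumes "bij_betw f K J" shows "decodable n N x J \<iota> \<psi> e \<longleftrightarrow> decodable n N x K (\<lambda>k. \<iota> (f k)) \<psi> e"
  unfolding decodable_def bij_betw_same_card[OF assms]
  by (simp only: sum.reindex_bij_betw[OF assms, of "\<lambda>b. decode_prob n \<psi> _ (x _ + \<iota> b)"])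

lemma rate_le_known_interference:
  assumes x: "codebook n {..<N} x P" and J_fin: "finite J" "J \<noteq> {}" and dec: "decodable n N x J \<iota> \<psi> e"
  shows "fano_rate e N \<le> - entropy_gap n {..<N} x 1 P + real n * ln (P + 1)"
proof -
  have P_nonneg: "0 \<le> P" using x by (simp add: codebook_def)
  have "bij_betw snd ({()} \<times> J) J" by (rule bij_betwI[where g="Pair ()"]) auto
  from decodable_reindex[OF this] dec have "decodable n N x ({()} \<times> J) (\<lambda>(u, c). 0 + \<iota> c) \<psi> e"
    by (simp add: split_beta')
  from fano_mixture_decodable[OF x _ _ J_fin this]
  have "fano_rate e N \<le> entropy n ({..<N} \<times> {()}) (\<lambda>(a, u). x a) 1 - gauss_entropy n 1" by (simp add: entropy_gauss)
  also have "entropy n ({..<N} \<times> {()}) (\<lambda>(a, u). x a) 1 = entropy n {..<N} x 1"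
  proof -
    have "(\<Sum>w\<in>{..<N} \<times> {()}. gauss n 1 (y - (case w of (a, u) \<Rightarrow> x a))) = (\<Sum>a<N. gauss n 1 (y - x a))" for y
      by (rule sum.reindex_bij_witness[of _ "\<lambda>a. (a, ())" fst]) auto
    then show ?thesis by (simp add: entropy_def mixture_def card_cartesian_product)
  qed
  also have "entropy n {..<N} x 1 - gauss_entropy n 1 = - entropy_gap n {..<N} x 1 P + real n * ln (P + 1)"
    using gauss_entropy_diff[of "P + 1" 1 n] P_nonneg by (simp add: entropy_gap_def)
  finally show ?thesis .
qed

lemma rate_le_interference_as_noise:
  assumes x: "codebook n {..<N} x P" and \<iota>: "codebook n J \<iota> \<epsilon>" and dec: "decodable n N x J \<iota> \<psi> e"
  shows "fano_rate e N \<le> entropy_gap n J \<iota> 1 \<epsilon> + real n * ln ((P + \<epsilon> + 1) / (\<epsilon> + 1))"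
proof -
  have J_fin: "finite J" "J \<noteq> {}" and powers: "0 \<le> P" "0 \<le> \<epsilon>" using x \<iota> by (auto simp: codebook_def)
  have "bij_betw fst (J \<times> {()}) J" by (rule bij_betwI[where g="\<lambda>b. (b, ())"]) auto
  from decodable_reindex[OF this] dec have "decodable n N x (J \<times> {()}) (\<lambda>(b, u). \<iota> b + 0) \<psi> e"
    by (simp add: split_beta')
  from fano_mixture_decodable[OF x J_fin _ _ this]
  have "fano_rate e N \<le> entropy n ({..<N} \<times> J) (\<lambda>(a, b). x a + \<iota> b) 1 - entropy n J \<iota> 1" by simp
  moreover have "entropy n ({..<N} \<times> J) (\<lambda>(a, b). x a + \<iota> b) 1 \<le> gauss_entropy n ((P + \<epsilon>) + 1)"
    using codebook_pair(1)[OF x \<iota>, of 1 1] by (intro entropy_le_gauss) (auto simp: codebook_def)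
  moreover have "gauss_entropy n ((P + \<epsilon>) + 1) - gauss_entropy n (\<epsilon> + 1) = real n * ln ((P + \<epsilon> + 1) / (\<epsilon> + 1))"
    using powers by (intro gauss_entropy_diff) (auto simp: add_nonneg_pos)
  ultimately show ?thesis by (simp add: entropy_gap_def)
qed

lemma rate_le_zero_power:
  assumes x: "codebook n {..<N} x 0" and J_fin: "finite J" "J \<noteq> {}" and dec: "decodable n N x J \<iota> \<psi> e"
  shows "fano_rate e N \<le> 0"
  using rate_le_known_interference[OF x J_fin dec] entropy_gap_zero_power[OF x] by simp

lemma rate_le_side_info_degenerate:
  fixes b0 h31 h32 h12 :: complex and d :: "'c \<Rightarrow> cvec"
  assumes x: "codebook n {..<N} x P" and \<beta>: "codebook n B \<beta> Pb" and C_fin: "finite C" "C \<noteq> {}"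
    and dec: "decodable n N x (B \<times> C) (\<lambda>(b, c). scale h12 (\<beta> b) + d c) \<psi> e"
    and b0: "b0 \<noteq> 0" and h12: "h12 \<noteq> 0" and h31: "P = 0 \<or> h31 = b0" and h32: "Pb = 0 \<or> h32 = b0 * h12"
  shows "fano_rate e N \<le> - entropy_gap n ({..<N} \<times> B) (\<lambda>(a, b). scale h31 (x a) + scale h32 (\<beta> b)) ((cmod b0)\<^sup>2) ((cmod h31)\<^sup>2 * P + (cmod h32)\<^sup>2 * Pb)
      + entropy_gap n B \<beta> (1 / (cmod h12)\<^sup>2) Pb + real n * ln ((P + (cmod h12)\<^sup>2 * Pb + 1) / ((cmod h12)\<^sup>2 * Pb + 1))"
proof -
  have B_fin: "finite B" "B \<noteq> {}" and AB_fin: "finite ({..<N} \<times> B)" "{..<N} \<times> B \<noteq> {}" and powers: "0 \<le> P" "0 \<le> Pb"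
    using x \<beta> by (auto simp: codebook_def)
  define \<epsilon> where "\<epsilon> = P + (cmod h12)\<^sup>2 * Pb"
  have \<epsilon>_nonneg: "0 \<le> \<epsilon>" using powers by (simp add: \<epsilon>_def)
  have "entropy_gap n ({..<N} \<times> B) (\<lambda>(a, b). x a + scale h12 (\<beta> b)) 1 \<epsilon>
      = entropy_gap n ({..<N} \<times> B) (\<lambda>w. scale b0 ((\<lambda>(a, b). x a + scale h12 (\<beta> b)) w)) ((cmod b0)\<^sup>2) ((cmod b0)\<^sup>2 * \<epsilon>)"
    using entropy_gap_scale[OF AB_fin zero_less_one b0 \<epsilon>_nonneg, of n "\<lambda>(a, b). x a + scale h12 (\<beta> b)"] by simp
  also have "\<dots> = entropy_gap n ({..<N} \<times> B) (\<lambda>(a, b). scale h31 (x a) + scale h32 (\<beta> b)) ((cmod b0)\<^sup>2) ((cmod b0)\<^sup>2 * \<epsilon>)"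
  proof (rule entropy_gap_cong)
    fix w t assume w: "w \<in> {..<N} \<times> B" and t: "t < n"
    obtain a b where ab: "w = (a, b)" "a \<in> {..<N}" "b \<in> B" using w by auto
    have "b0 * x a t = h31 * x a t" using h31 x codebook_zero_power[of n "{..<N}" x a t] ab t by auto
    moreover have "b0 * h12 * \<beta> b t = h32 * \<beta> b t" using h32 \<beta> codebook_zero_power[of n B \<beta> b t] ab t by auto
    ultimately have "b0 * x a t + b0 * h12 * \<beta> b t = h31 * x a t + h32 * \<beta> b t" by (simp only:)
    then show "scale b0 (case w of (a, b) \<Rightarrow> x a + scale h12 (\<beta> b)) t = (case w of (a, b) \<Rightarrow> scale h31 (x a) + scale h32 (\<beta> b)) t"
      by (simp only: ab(1) prod.case scale_apply plus_fun_apply) (simp add: distrib_left mult.assoc)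
  qed
  also have "(cmod b0)\<^sup>2 * \<epsilon> = (cmod h31)\<^sup>2 * P + (cmod h32)\<^sup>2 * Pb"
    using h31 h32 by (auto simp: \<epsilon>_def norm_mult power_mult_distrib algebra_simps)
  finally have signal_gap: "entropy_gap n ({..<N} \<times> B) (\<lambda>(a, b). x a + scale h12 (\<beta> b)) 1 \<epsilon>
    = entropy_gap n ({..<N} \<times> B) (\<lambda>(a, b). scale h31 (x a) + scale h32 (\<beta> b)) ((cmod b0)\<^sup>2) ((cmod h31)\<^sup>2 * P + (cmod h32)\<^sup>2 * Pb)" .
  have "entropy_gap n B (\<lambda>b. scale h12 (\<beta> b)) 1 ((cmod h12)\<^sup>2 * Pb) = entropy_gap n B \<beta> (1 / (cmod h12)\<^sup>2) Pb"
    using entropy_gap_scale[OF B_fin, of "1 / (cmod h12)\<^sup>2" h12 Pb n \<beta>] h12 powers by simp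
  moreover have "gauss_entropy n (\<epsilon> + 1) - gauss_entropy n ((cmod h12)\<^sup>2 * Pb + 1) = real n * ln ((\<epsilon> + 1) / ((cmod h12)\<^sup>2 * Pb + 1))"
    using \<epsilon>_nonneg powers by (intro gauss_entropy_diff) (auto simp: add_nonneg_pos)
  ultimately show ?thesis
    using fano_mixture_decodable[OF x B_fin C_fin dec] unfolding signal_gap[symmetric] by (simp add: entropy_gap_def \<epsilon>_def)
qed

subsection \<open>Decoding from a pair with correlated noise\<close>

lemma (in noisy_pair) fano_pair:
  assumes C_fin: "finite C" "C \<noteq> {}" and N_ge_1: "1 \<le> N" and \<psi>: "\<psi> \<in> measurable (lborelC n) (count_space UNIV)"
    and unit_noise: "(cmod k)\<^sup>2 * v + (cmod (1 + k * g))\<^sup>2 * e = 1"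
    and decoding: "(1 - \<delta>) * (real N * (real (card J) * real (card C)))
      \<le> (\<Sum>a<N. \<Sum>c\<in>C. \<Sum>b\<in>J. decode_prob n \<psi> a ((scale 1 (\<eta> a c) + scale k (\<sigma> a c)) + scale k (\<iota> b)))"
    and q_meas: "\<And>c. q c \<in> borel_measurable (lborelC2 n)" and q_pos: "\<And>c z. 0 < q c z"
    and q_subdensity: "\<And>c. (\<integral>\<^sup>+z. ennreal (q c z) \<partial>lborelC2 n) \<le> 1"
    and p_ln_q: "\<And>a c. integrable (lborelC2 n) (\<lambda>z. pair (\<eta> a c) (\<sigma> a c) z * ln (q c z))"
  shows "fano_rate \<delta> N \<le> (- gauss_entropy n e + - entropy n J \<iota> v)
    - (\<Sum>a<N. \<Sum>c\<in>C. \<integral>z. pair (\<eta> a c) (\<sigma> a c) z * ln (q c z) \<partial>lborelC2 n) / (real N * real (card C))"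
proof (rule fano_inequality[OF C_fin J_fin N_ge_1 pair_density_pos q_pos has_bochner_integral_pair_density q_meas q_subdensity _ pair_density_entropy p_ln_q _ decoding])
  let ?decoder = "\<lambda>z. \<psi> (trunc n (scale 1 (fst z) + scale k (snd z)))"
  show "?decoder \<in> measurable (lborelC2 n) (count_space UNIV)"
    by (rule measurable_compose[OF measurable_trunc \<psi>]) (intro density_measurable)
  fix a c
  let ?m = "scale 1 (\<eta> a c) + scale k (\<sigma> a c)" and ?\<phi> = "\<lambda>y. indicator {y. \<psi> (trunc n y) = a} y :: real"
  let ?f = "mixture n J (\<lambda>w. scale k (\<iota> w)) 1"
  have \<psi>_trunc: "(\<lambda>y. \<psi> (trunc n y)) \<in> measurable (lborelC n) (count_space UNIV)"
    by (rule measurable_compose[OF measurable_trunc \<psi>]) (intro density_measurable)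
  have "integrable (lborelC n) (\<lambda>y. ?f (y - ?m) * ?\<phi> y)"
    using has_bochner_integral_mixture[OF J_fin zero_less_one, of n "\<lambda>w. scale k (\<iota> w)" ?m]
    by (intro integrable_mult_indicator_eq[OF \<psi>_trunc]) (simp only: has_bochner_integral_iff)
  moreover have "(\<integral>y. ?f (y - ?m) * ?\<phi> y \<partial>lborelC n) = (\<integral>y. ?f (y - ?m) * indicator {y. \<psi> y = a} y \<partial>lborelC n)"
    by (rule Bochner_Integration.integral_cong) (simp_all add: indicator_def)
  ultimately have "has_bochner_integral (lborelC n) (\<lambda>y. ?f (y - ?m) * ?\<phi> y)
      ((\<Sum>b\<in>J. decode_prob n \<psi> a (?m + scale k (\<iota> b))) / real (card J))"
    using integral_mixture_indicator[OF \<psi>, of J "\<lambda>w. scale k (\<iota> w)" ?m a] by (simp only: has_bochner_integral_iff)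
  then have "has_bochner_integral (lborelC2 n) (\<lambda>z. pair (\<eta> a c) (\<sigma> a c) z * ?\<phi> (scale 1 (fst z) + scale k (snd z)))
      ((\<Sum>b\<in>J. decode_prob n \<psi> a (?m + scale k (\<iota> b))) / real (card J))"
    using borel_measurable_indicator_eq[OF \<psi>_trunc, of a]
    by (intro has_bochner_integral_pair_density_combine) (simp_all only: unit_noise restrict_restrict Int_absorb mem_Collect_eq indicator_def norm_one power_one mult_1 one_neq_zero simp_thms)
  then show "(\<integral>z. pair (\<eta> a c) (\<sigma> a c) z * indicator {z. ?decoder z = a} z \<partial>lborelC2 n)
      = (\<Sum>b\<in>J. decode_prob n \<psi> a (?m + scale k (\<iota> b))) / real (card J)"
    by (simp add: has_bochner_integral_iff indicator_def del: scale_simps)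
qed

lemma (in noisy_pair) fano_pair_mixture_gauss:
  assumes C_fin: "finite C" "C \<noteq> {}" and N_ge_1: "1 \<le> N" and \<psi>: "\<psi> \<in> measurable (lborelC n) (count_space UNIV)"
    and unit_noise: "(cmod k)\<^sup>2 * v + (cmod (1 + k * g))\<^sup>2 * e = 1"
    and decoding: "(1 - \<delta>) * (real N * (real (card J) * real (card C)))
      \<le> (\<Sum>a<N. \<Sum>c\<in>C. \<Sum>b\<in>J. decode_prob n \<psi> a ((scale 1 (\<eta> a c) + scale k (\<sigma> a c)) + scale k (\<iota> b)))"
    and I_fin: "finite I" "I \<noteq> {}" and u_pos: "0 < u" and \<tau>_pos: "0 < \<tau>"
  shows "fano_rate \<delta> N \<le> (- gauss_entropy n e + - entropy n J \<iota> v)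
    - (\<Sum>a<N. \<Sum>c\<in>C. \<integral>z. pair (\<eta> a c) (\<sigma> a c) z * ln (mixture n I f u (snd z) * gauss n \<tau> (scale 1 (fst z) + scale l (snd z) + m c)) \<partial>lborelC2 n) / (real N * real (card C))"
proof (rule fano_pair[OF C_fin N_ge_1 \<psi> unit_noise decoding])
  let ?q = "\<lambda>c z. mixture n I f u (snd z) * gauss n \<tau> (scale 1 (fst z) + scale l (snd z) + m c)"
  show "?q c \<in> borel_measurable (lborelC2 n)" for c by (intro density_measurable)
  show "0 < ?q c z" for c z using mixture_pos[OF I_fin u_pos] \<tau>_pos by (intro mult_pos_pos gauss_pos)
  show "(\<integral>\<^sup>+z. ennreal (?q c z) \<partial>lborelC2 n) \<le> 1" for c by (simp only: nn_integral_mixture_mult_gauss[OF I_fin u_pos \<tau>_pos])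
  show "integrable (lborelC2 n) (\<lambda>z. pair (\<eta> a c) (\<sigma> a c) z * ln (?q c z))" for a c
    using pair_density_cross_entropy_mixture_gauss[OF I_fin u_pos \<tau>_pos] by (simp only: has_bochner_integral_iff)
qed

lemma average_sqnorm_le:
  assumes x: "codebook n A x P" and \<beta>: "codebook n B \<beta> Q"
  shows "(\<Sum>a\<in>A. (\<Sum>b\<in>B. sqnorm n (scale j (x a) + scale k (\<beta> b))) / real (card B)) / real (card A) \<le> real n * ((cmod j)\<^sup>2 * P + (cmod k)\<^sup>2 * Q)"
proof -
  have cards: "0 < real (card A)" "0 < real (card B)" using x \<beta> by (auto simp: codebook_def card_gt_0_iff)
  have "(\<Sum>a\<in>A. (\<Sum>b\<in>B. sqnorm n (scale j (x a) + scale k (\<beta> b))) / real (card B)) / real (card A)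
      = (\<Sum>a\<in>A. \<Sum>b\<in>B. sqnorm n (scale j (x a) + scale k (\<beta> b))) / (real (card A) * real (card B))"
    by (simp add: sum_divide_distrib[symmetric] mult.commute)
  then show ?thesis using codebook_pair(2)[OF x \<beta>, of j k] cards by (simp add: pos_divide_le_eq mult_ac)
qed

lemma average_affine:
  fixes u w :: "nat \<Rightarrow> real"
  assumes "finite C" "C \<noteq> {}" "1 \<le> N"
  shows "(\<Sum>a<N. \<Sum>c\<in>C. u a + (- ((W + w a) / \<tau>) - K)) / (real N * real (card C))
    = (\<Sum>a<N. u a) / real N - (W + (\<Sum>a<N. w a) / real N) / \<tau> - K"
proof -
  have "(\<Sum>a<N. \<Sum>c\<in>C. u a + (- ((W + w a) / \<tau>) - K)) / (real N * real (card C)) = (\<Sum>a<N. u a + (- ((W + w a) / \<tau>) - K)) / real N"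
    using assms by (simp add: sum_distrib_left[symmetric])
  also have "(\<Sum>a<N. u a + (- ((W + w a) / \<tau>) - K)) = (\<Sum>a<N. u a) - (real N * W + (\<Sum>a<N. w a)) / \<tau> - real N * K"
    by (simp add: sum.distrib sum_subtractf sum_negf sum_divide_distrib[symmetric])
  also have "\<dots> / real N = (\<Sum>a<N. u a) / real N - (W + (\<Sum>a<N. w a) / real N) / \<tau> - K"
    using assms(3) by (simp add: diff_divide_distrib add_divide_distrib)
  finally show ?thesis .
qed

text \<open>The receiver observes its output \<open>Y = X + k h32 X\<^sub>b + D + Z\<close> with \<open>D\<close> known, and
  \<open>S = h31 X + h32 X\<^sub>b + N\<close>. In terms of the independent parts \<open>E = Z - k N\<close> and \<open>N - g E\<close> of the
  noises, \<open>Y - k S\<close> and \<open>S\<close> form a noisy pair, and \<open>\<tau>\<close> is the error of estimating \<open>Y - D\<close> by \<open>\<kappa> S\<close>.\<close>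

lemma rate_le_side_info_entropy:
  fixes h31 h32 k g \<kappa> :: complex and d :: "'c \<Rightarrow> cvec"
  assumes x: "codebook n {..<N} x P" and \<beta>: "codebook n B \<beta> Pb" and C_fin: "finite C" "C \<noteq> {}"
    and dec: "decodable n N x (B \<times> C) (\<lambda>(b, c). scale (k * h32) (\<beta> b) + d c) \<psi> \<delta>"
    and e_pos: "0 < e" and v_pos: "0 < v"
    and unit_noise: "(cmod k)\<^sup>2 * v + (cmod (1 + k * g))\<^sup>2 * e = 1" and side_noise: "v + (cmod g)\<^sup>2 * e = u"
    and \<tau>: "\<tau> = (cmod (1 + (k - \<kappa>) * g))\<^sup>2 * e + (cmod (k - \<kappa>))\<^sup>2 * v + (cmod (1 - \<kappa> * h31))\<^sup>2 * P + (cmod (k * h32 - \<kappa> * h32))\<^sup>2 * Pb"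
    and \<tau>_pos: "0 < \<tau>"
  shows "fano_rate \<delta> N \<le> entropy n ({..<N} \<times> B) (\<lambda>(a, b). scale h31 (x a) + scale h32 (\<beta> b)) u
    - entropy n B (\<lambda>b. scale h32 (\<beta> b)) v + gauss_entropy n \<tau> - gauss_entropy n e"
proof -
  have B_fin: "finite B" "B \<noteq> {}" and N_ge_1: "1 \<le> N" and AB_fin: "finite ({..<N} \<times> B)" "{..<N} \<times> B \<noteq> {}"
    and \<psi>: "\<psi> \<in> measurable (lborelC n) (count_space UNIV)"
    using x \<beta> dec by (auto simp: codebook_def decodable_def lessThan_empty_iff)
  interpret noisy_pair n e B "\<lambda>b. scale h32 (\<beta> b)" v g by unfold_locales (use B_fin e_pos v_pos in auto)
  have u_pos: "0 < u" using snd_variance_pos by (simp add: side_noise)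
  define \<eta> where "\<eta> a c = scale (1 - k * h31) (x a) + d c" for a c
  let ?f = "mixture n ({..<N} \<times> B) (\<lambda>(a, b). scale h31 (x a) + scale h32 (\<beta> b)) u"
  let ?q = "\<lambda>c z. ?f (snd z) * gauss n \<tau> (scale 1 (fst z) + scale (k - \<kappa>) (snd z) + (- d c))"
  let ?I = "\<lambda>a. \<integral>s. mixture n B (\<lambda>b. scale h32 (\<beta> b)) u (s - scale h31 (x a)) * ln (?f s) \<partial>lborelC n"
  define w where "w a = (\<Sum>b\<in>B. sqnorm n (scale (1 - \<kappa> * h31) (x a) + scale (k * h32 - \<kappa> * h32) (\<beta> b))) / real (card B)" for a
  define W where "W = (cmod (1 + (k - \<kappa>) * g))\<^sup>2 * real n * e + (cmod (k - \<kappa>))\<^sup>2 * real n * v"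
  have cross: "has_bochner_integral (lborelC2 n) (\<lambda>z. pair (\<eta> a c) (scale h31 (x a)) z * ln (?q c z)) (?I a + (- ((W + w a) / \<tau>) - real n * ln (pi * \<tau>)))"
    for a c
  proof -
    have "(\<Sum>b\<in>B. sqnorm n (scale 1 (\<eta> a c) + scale (k - \<kappa>) (scale h31 (x a) + scale h32 (\<beta> b)) + - d c)) / real (card B) = w a"
      unfolding w_def by (intro arg_cong2[where f="(/)"] sum.cong refl sqnorm_cong) (simp add: \<eta>_def algebra_simps)
    then show ?thesis
      using pair_density_cross_entropy_mixture_gauss[OF AB_fin u_pos \<tau>_pos, of "\<eta> a c" "scale h31 (x a)" "\<lambda>(a, b). scale h31 (x a) + scale h32 (\<beta> b)" "k - \<kappa>" "- d c"]
      by (simp only: side_noise W_def)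
  qed
  have "fano_rate \<delta> N \<le> (- gauss_entropy n e + - entropy n B (\<lambda>b. scale h32 (\<beta> b)) v)
    - (\<Sum>a<N. \<Sum>c\<in>C. \<integral>z. pair (\<eta> a c) (scale h31 (x a)) z * ln (?q c z) \<partial>lborelC2 n) / (real N * real (card C))"
  proof (rule fano_pair_mixture_gauss[OF C_fin N_ge_1 \<psi> unit_noise _ AB_fin u_pos \<tau>_pos])
    have "x a + (scale (k * h32) (\<beta> b) + d c) = (scale 1 (\<eta> a c) + scale k (scale h31 (x a))) + scale k (scale h32 (\<beta> b))"
      for a b c
      by (simp add: \<eta>_def fun_eq_iff algebra_simps)
    then show "(1 - \<delta>) * (real N * (real (card B) * real (card C))) \<le> (\<Sum>a<N. \<Sum>c\<in>C. \<Sum>b\<in>B. decode_prob n \<psi> a ((scale 1 (\<eta> a c) + scale k (scale h31 (x a))) + scale k (scale h32 (\<beta> b))))"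
      using decodable_Times[OF dec] by (simp only:)
  qed
  also have "\<dots> = (- gauss_entropy n e + - entropy n B (\<lambda>b. scale h32 (\<beta> b)) v)
      - ((\<Sum>a<N. ?I a) / real N - (W + (\<Sum>a<N. w a) / real N) / \<tau> - real n * ln (pi * \<tau>))"
    by (simp only: has_bochner_integral_integral_eq[OF cross] average_affine[OF C_fin N_ge_1])
  also have "(\<Sum>a<N. ?I a) / real N = - entropy n ({..<N} \<times> B) (\<lambda>(a, b). scale h31 (x a) + scale h32 (\<beta> b)) u"
    using N_ge_1 by (subst sum_integral_mixture_shift[OF _ B_fin(1) integrable_mixture_ln_mixture[OF B_fin u_pos AB_fin u_pos]]) (simp_all add: entropy_def)
  also have "(W + (\<Sum>a<N. w a) / real N) / \<tau> \<le> real n"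
  proof -
    have "(\<Sum>a<N. w a) / real N \<le> real n * ((cmod (1 - \<kappa> * h31))\<^sup>2 * P + (cmod (k * h32 - \<kappa> * h32))\<^sup>2 * Pb)"
      using average_sqnorm_le[OF x \<beta>, of "1 - \<kappa> * h31" "k * h32 - \<kappa> * h32"] by (simp add: w_def)
    then have "W + (\<Sum>a<N. w a) / real N \<le> real n * \<tau>" unfolding \<tau> W_def by (simp add: algebra_simps)
    then show ?thesis using \<tau>_pos by (simp add: pos_divide_le_eq)
  qed
  finally show ?thesis using gauss_entropy_eq[OF \<tau>_pos, of n] by linarith
qed

lemma rate_le_side_info:
  fixes h31 h32 k g \<kappa> :: complex and d :: "'c \<Rightarrow> cvec"
  assumes x: "codebook n {..<N} x P" and \<beta>: "codebook n B \<beta> Pb" and C_fin: "finite C" "C \<noteq> {}"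
    and dec: "decodable n N x (B \<times> C) (\<lambda>(b, c). scale (k * h32) (\<beta> b) + d c) \<psi> \<delta>"
    and e_pos: "0 < e" and v_pos: "0 < v" and h32: "h32 \<noteq> 0"
    and unit_noise: "(cmod k)\<^sup>2 * v + (cmod (1 + k * g))\<^sup>2 * e = 1" and side_noise: "v + (cmod g)\<^sup>2 * e = u"
    and \<tau>: "\<tau> = (cmod (1 + (k - \<kappa>) * g))\<^sup>2 * e + (cmod (k - \<kappa>))\<^sup>2 * v + (cmod (1 - \<kappa> * h31))\<^sup>2 * P + (cmod (k * h32 - \<kappa> * h32))\<^sup>2 * Pb"
    and \<tau>_pos: "0 < \<tau>"
  shows "fano_rate \<delta> N \<le> - entropy_gap n ({..<N} \<times> B) (\<lambda>(a, b). scale h31 (x a) + scale h32 (\<beta> b)) u ((cmod h31)\<^sup>2 * P + (cmod h32)\<^sup>2 * Pb)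
      + entropy_gap n B \<beta> (v / (cmod h32)\<^sup>2) Pb + real n * ln (((cmod h31)\<^sup>2 * P + (cmod h32)\<^sup>2 * Pb + u) * \<tau> / (e * ((cmod h32)\<^sup>2 * Pb + v)))"
proof -
  have powers: "0 \<le> P" "0 \<le> Pb" and B_fin: "finite B" "B \<noteq> {}" using x \<beta> by (auto simp: codebook_def)
  have "0 < u" using side_noise v_pos e_pos by (metis add_pos_nonneg less_imp_le mult_nonneg_nonneg zero_le_power2)
  then have variances: "0 < (cmod h31)\<^sup>2 * P + (cmod h32)\<^sup>2 * Pb + u" "0 < (cmod h32)\<^sup>2 * Pb + v"
    using powers v_pos by (auto intro!: add_nonneg_pos)
  have "entropy_gap n B \<beta> (v / (cmod h32)\<^sup>2) Pb = entropy_gap n B (\<lambda>b. scale h32 (\<beta> b)) v ((cmod h32)\<^sup>2 * Pb)"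
    using entropy_gap_scale[of B "v / (cmod h32)\<^sup>2" h32 Pb n \<beta>] B_fin powers v_pos h32 by simp
  moreover have "real n * ln (((cmod h31)\<^sup>2 * P + (cmod h32)\<^sup>2 * Pb + u) * \<tau> / (e * ((cmod h32)\<^sup>2 * Pb + v)))
      = gauss_entropy n ((cmod h31)\<^sup>2 * P + (cmod h32)\<^sup>2 * Pb + u) + gauss_entropy n \<tau> - gauss_entropy n e - gauss_entropy n ((cmod h32)\<^sup>2 * Pb + v)"
    by (rule gauss_entropy_quotient[OF variances(1) \<tau>_pos e_pos variances(2)])
  ultimately show ?thesis using rate_le_side_info_entropy[OF x \<beta> C_fin dec e_pos v_pos unit_noise side_noise \<tau> \<tau>_pos]
    unfolding entropy_gap_def by linarith
qed

section \<open>A noisy codeword with noisy interference\<close>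

definition quad_bounded :: "nat \<Rightarrow> (cvec \<times> cvec \<Rightarrow> real) \<Rightarrow> bool" where
  "quad_bounded n f \<longleftrightarrow> (\<exists>C\<ge>0. \<forall>z. \<bar>f z\<bar> \<le> C * (1 + sqnorm n (fst z) + sqnorm n (snd z)))"

lemma quad_bounded_add: "quad_bounded n f \<Longrightarrow> quad_bounded n g \<Longrightarrow> quad_bounded n (\<lambda>z. f z + g z)"
proof -
  assume "quad_bounded n f" "quad_bounded n g"
  then obtain C D where C: "0 \<le> C" "\<And>z. \<bar>f z\<bar> \<le> C * (1 + sqnorm n (fst z) + sqnorm n (snd z))"
    and D: "0 \<le> D" "\<And>z. \<bar>g z\<bar> \<le> D * (1 + sqnorm n (fst z) + sqnorm n (snd z))" unfolding quad_bounded_def by metis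
  have "\<bar>f z + g z\<bar> \<le> (C + D) * (1 + sqnorm n (fst z) + sqnorm n (snd z))" for z
    using C(2)[of z] D(2)[of z] by (simp add: distrib_right)
  then show ?thesis using C(1) D(1) unfolding quad_bounded_def by (intro exI[of _ "C + D"]) auto
qed

lemma sqnorm_affine_le:
  "sqnorm n (scale a x + scale b y + m) \<le> (4 * (cmod a)\<^sup>2 + 4 * (cmod b)\<^sup>2 + 2 * sqnorm n m) * (1 + sqnorm n x + sqnorm n y)"
proof -
  have "sqnorm n (scale a x + scale b y + m) \<le> 4 * ((cmod a)\<^sup>2 * sqnorm n x) + 4 * ((cmod b)\<^sup>2 * sqnorm n y) + 2 * sqnorm n m"
    using sqnorm_add_le[of n "scale a x + scale b y" m] sqnorm_add_le[of n "scale a x" "scale b y"] by simp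
  also have "\<dots> \<le> (4 * (cmod a)\<^sup>2 + 4 * (cmod b)\<^sup>2 + 2 * sqnorm n m) * (1 + sqnorm n x + sqnorm n y)"
    by (simp add: algebra_simps)
  finally show ?thesis .
qed

lemma quad_bounded_ln_mixture:
  assumes J_fin: "finite J" "J \<noteq> {}" and v_pos: "0 < v"
  shows "quad_bounded n (\<lambda>z. ln (mixture n J c v (scale a (fst z) + scale b (snd z) + m)))"
proof -
  obtain C where C: "0 \<le> C" "\<And>y. \<bar>ln (mixture n J c v y)\<bar> \<le> C * (1 + sqnorm n y)"
    using ln_mixture_bound[OF J_fin v_pos, of n c] by blast
  define D where "D = 4 * (cmod a)\<^sup>2 + 4 * (cmod b)\<^sup>2 + 2 * sqnorm n m"
  have D_nonneg: "0 \<le> D" by (simp add: D_def)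
  have "\<bar>ln (mixture n J c v (scale a (fst z) + scale b (snd z) + m))\<bar> \<le> C * (1 + D) * (1 + sqnorm n (fst z) + sqnorm n (snd z))"
    for z :: "cvec \<times> cvec"
  proof -
    have "1 + sqnorm n (scale a (fst z) + scale b (snd z) + m) \<le> 1 + D * (1 + sqnorm n (fst z) + sqnorm n (snd z))"
      using sqnorm_affine_le[of n a "fst z" b "snd z" m] by (simp add: D_def)
    also have "\<dots> \<le> (1 + D) * (1 + sqnorm n (fst z) + sqnorm n (snd z))" by (simp add: algebra_simps)
    finally show ?thesis using order_trans[OF C(2) mult_left_mono[OF _ C(1)]] by (simp only: mult.assoc)
  qed
  then show ?thesis using C(1) D_nonneg unfolding quad_bounded_def by (intro exI[of _ "C * (1 + D)"]) auto
qed

context noisy_pair begin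

lemma quad_bounded_ln_pair_density: "quad_bounded n (\<lambda>z. ln (pair \<eta>0 \<sigma>0 z))"
  unfolding ln_pair_density mixture_singleton[symmetric]
  by (intro quad_bounded_add quad_bounded_ln_mixture J_fin v_pos e_pos) auto

lemma integrable_pair_density_mult:
  assumes \<phi>_meas: "\<phi> \<in> borel_measurable (lborelC2 n)" and \<phi>_bounded: "quad_bounded n \<phi>"
  shows "integrable (lborelC2 n) (\<lambda>z. pair \<eta>0 \<sigma>0 z * \<phi> z)"
proof -
  obtain C where C: "\<And>z. \<bar>\<phi> z\<bar> \<le> C * (1 + sqnorm n (fst z) + sqnorm n (snd z))"
    using \<phi>_bounded unfolding quad_bounded_def by blast
  let ?bound = "\<lambda>z. C * (pair \<eta>0 \<sigma>0 z + pair \<eta>0 \<sigma>0 z * sqnorm n (fst z) + pair \<eta>0 \<sigma>0 z * sqnorm n (snd z))"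
  have sqnorm_integrable: "integrable (lborelC2 n) (\<lambda>z. pair \<eta>0 \<sigma>0 z * sqnorm n (scale \<alpha> (fst z) + scale \<beta> (snd z)))"
    if "\<alpha> \<noteq> 0 \<or> \<beta> \<noteq> 0" for \<alpha> \<beta>
    using has_bochner_integral_pair_density_combine[OF _ _ that, of "sqnorm n" \<eta>0 \<sigma>0]
      mixture_second_moment[OF J_fin combination_variance_pos[OF that], of n "\<lambda>w. scale \<beta> (\<iota> w) + (scale \<alpha> \<eta>0 + scale \<beta> \<sigma>0)" 1 0]
    by (simp add: has_bochner_integral_iff mixture_shift sqnorm_measurable vec_measurable_proj)
  show ?thesis
  proof (rule Bochner_Integration.integrable_bound)
    show "integrable (lborelC2 n) ?bound"
      using has_bochner_integral_pair_density sqnorm_integrable[of 1 0] sqnorm_integrable[of 0 1]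
      by (intro integrable_mult_right Bochner_Integration.integrable_add) (simp_all add: has_bochner_integral_iff)
    show "(\<lambda>z. pair \<eta>0 \<sigma>0 z * \<phi> z) \<in> borel_measurable (lborelC2 n)"
      using pair_density_measurable \<phi>_meas by (intro borel_measurable_times)
    have "\<bar>pair \<eta>0 \<sigma>0 z * \<phi> z\<bar> \<le> ?bound z" for z
      using mult_left_mono[OF C[of z] less_imp_le[OF pair_density_pos[of \<eta>0 \<sigma>0 z]]] pair_density_pos[of \<eta>0 \<sigma>0 z]
      by (simp add: abs_mult algebra_simps)
    then show "AE z in lborelC2 n. norm (pair \<eta>0 \<sigma>0 z * \<phi> z) \<le> norm (?bound z)"
      by (intro AE_I2) (auto intro: order_trans[OF _ abs_ge_self])
  qed
qed

end

lemma abs_ln_average_le: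
  assumes A_fin: "finite A" "A \<noteq> {}" and f_pos: "\<And>a. a \<in> A \<Longrightarrow> 0 < f a" and f_bound: "\<And>a. a \<in> A \<Longrightarrow> \<bar>ln (f a)\<bar> \<le> (B::real)"
  shows "\<bar>ln ((\<Sum>a\<in>A. f a) / real (card A))\<bar> \<le> B"
proof -
  have card_pos: "0 < real (card A)" using A_fin by (simp add: card_gt_0_iff)
  have f_le: "f a \<le> exp B" and f_ge: "exp (- B) \<le> f a" if "a \<in> A" for a
  proof -
    have "ln (f a) \<le> B" "- B \<le> ln (f a)" using f_bound[OF that] by auto
    then show "f a \<le> exp B" "exp (- B) \<le> f a" using f_pos[OF that] by (metis exp_le_cancel_iff exp_ln)+
  qed
  have "(\<Sum>a\<in>A. f a) / real (card A) \<le> exp B"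
    using sum_bounded_above[of A f "exp B"] f_le card_pos by (simp add: pos_divide_le_eq mult.commute)
  moreover have lower: "exp (- B) \<le> (\<Sum>a\<in>A. f a) / real (card A)"
    using sum_bounded_below[of A "exp (- B)" f] f_ge card_pos by (simp add: pos_le_divide_eq mult.commute)
  moreover have "0 < (\<Sum>a\<in>A. f a) / real (card A)" using lower exp_gt_zero[of "- B"] by linarith
  ultimately have "ln ((\<Sum>a\<in>A. f a) / real (card A)) \<le> B" "- B \<le> ln ((\<Sum>a\<in>A. f a) / real (card A))"
    by (metis ln_exp ln_le_cancel_iff exp_gt_zero)+
  then show ?thesis by simp
qed

definition joint_density :: "nat \<Rightarrow> 'a set \<Rightarrow> ('a \<Rightarrow> cvec) \<Rightarrow> 'w set \<Rightarrow> ('w \<Rightarrow> cvec) \<Rightarrow> real \<Rightarrow> real \<Rightarrow> complex \<Rightarrow> cvec \<times> cvec \<Rightarrow> real"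
  where
  "joint_density n A x J \<iota> e v g z = (\<Sum>a\<in>A. pair_density n e J \<iota> v (x a) 0 g z) / real (card A)"

definition joint_entropy :: "nat \<Rightarrow> 'a set \<Rightarrow> ('a \<Rightarrow> cvec) \<Rightarrow> 'w set \<Rightarrow> ('w \<Rightarrow> cvec) \<Rightarrow> real \<Rightarrow> real \<Rightarrow> complex \<Rightarrow> real" where
  "joint_entropy n A x J \<iota> e v g = - (\<integral>z. joint_density n A x J \<iota> e v g z * ln (joint_density n A x J \<iota> e v g z) \<partial>lborelC2 n)"

lemma joint_density_measurable: "joint_density n A x J \<iota> e v g \<in> borel_measurable (lborelC2 n)"
  unfolding joint_density_def
  by (intro borel_measurable_divide borel_measurable_sum pair_density_measurable borel_measurable_const)

lemma joint_density_measurable_comp: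
  "vec_measurable M n f \<Longrightarrow> vec_measurable M n h \<Longrightarrow> (\<lambda>z. joint_density n A x J \<iota> e v g (f z, h z)) \<in> borel_measurable M"
  unfolding joint_density_def pair_density_def fst_conv snd_conv by (intro borel_measurable_sum density_measurable)

lemma joint_density_cong: "(\<And>t. t < n \<Longrightarrow> fst z t = fst z' t) \<Longrightarrow> (\<And>t. t < n \<Longrightarrow> snd z t = snd z' t) \<Longrightarrow> joint_density n A x J \<iota> e v g z = joint_density n A x J \<iota> e v g z'"
  unfolding joint_density_def pair_density_def
  by (intro arg_cong2[where f="(/)"] sum.cong arg_cong2[where f="(*)"] gauss_cong mixture_cong) auto

locale noisy_codeword_pair = noisy_pair n e J \<iota> v g
  for n :: nat and e :: real and J :: "'w set" and \<iota> :: "'w \<Rightarrow> cvec" and v :: real and g :: complex +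
  fixes A :: "'a set" and x :: "'a \<Rightarrow> cvec"
  assumes A_fin: "finite A" "A \<noteq> {}"
begin

abbreviation "joint \<equiv> joint_density n A x J \<iota> e v g"

lemma joint_density_pos: "0 < joint z"
  unfolding joint_density_def using A_fin by (intro divide_pos_pos sum_pos pair_density_pos) (auto simp: card_gt_0_iff)

lemma has_bochner_integral_joint_density_mult:
  assumes "\<And>a. a \<in> A \<Longrightarrow> has_bochner_integral (lborelC2 n) (\<lambda>z. pair (x a) 0 z * \<phi> z) (V a)"
  shows "has_bochner_integral (lborelC2 n) (\<lambda>z. joint z * \<phi> z) ((\<Sum>a\<in>A. V a) / real (card A))"
proof -
  have "has_bochner_integral (lborelC2 n) (\<lambda>z. (\<Sum>a\<in>A. pair (x a) 0 z * \<phi> z) / real (card A)) ((\<Sum>a\<in>A. V a) / real (card A))"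
    by (intro has_bochner_integral_divide_zero has_bochner_integral_sum assms)
  then show ?thesis by (simp add: joint_density_def sum_distrib_right)
qed

lemma has_bochner_integral_joint_density: "has_bochner_integral (lborelC2 n) joint 1"
  using has_bochner_integral_joint_density_mult[of "\<lambda>_. 1" "\<lambda>_. 1"] has_bochner_integral_pair_density A_fin by simp

lemma nn_integral_joint_density: "(\<integral>\<^sup>+z. ennreal (joint z) \<partial>lborelC2 n) = 1"
  using has_bochner_integral_joint_density joint_density_pos
  by (subst nn_integral_eq_integral) (auto simp: has_bochner_integral_iff less_imp_le)

lemma quad_bounded_ln_joint_density: "quad_bounded n (\<lambda>z. ln (joint z))"
proof -
  let ?quad = "\<lambda>z. 1 + sqnorm n (fst z) + sqnorm n (snd z)"
  obtain C where C: "\<And>a. 0 \<le> C a" "\<And>a z. \<bar>ln (pair (x a) 0 z)\<bar> \<le> C a * ?quad z"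
    using quad_bounded_ln_pair_density[of "x _" 0] choice[of "\<lambda>a C. 0 \<le> C \<and> (\<forall>z. \<bar>ln (pair (x a) 0 z)\<bar> \<le> C * ?quad z)"]
    unfolding quad_bounded_def by blast
  have "\<bar>ln (joint z)\<bar> \<le> (\<Sum>a\<in>A. C a) * ?quad z" for z
    unfolding joint_density_def
  proof (rule abs_ln_average_le[OF A_fin pair_density_pos])
    fix a assume "a \<in> A"
    then have "C a * ?quad z \<le> (\<Sum>a\<in>A. C a) * ?quad z"
      using C(1) A_fin by (intro mult_right_mono member_le_sum) (auto simp: add_nonneg_nonneg)
    then show "\<bar>ln (pair (x a) 0 z)\<bar> \<le> (\<Sum>a\<in>A. C a) * ?quad z" using C(2)[of a z] by linarith
  qed
  then show ?thesis using C(1) unfolding quad_bounded_def by (intro exI[of _ "\<Sum>a\<in>A. C a"]) (auto intro: sum_nonneg)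
qed

lemma integrable_pair_density_ln_joint_density: "integrable (lborelC2 n) (\<lambda>z. pair \<eta>0 \<sigma>0 z * ln (joint z))"
  using joint_density_measurable by (intro integrable_pair_density_mult quad_bounded_ln_joint_density borel_measurable_ln)

lemma has_bochner_integral_joint_entropy: "has_bochner_integral (lborelC2 n) (\<lambda>z. joint z * ln (joint z)) (- joint_entropy n A x J \<iota> e v g)"
  using has_bochner_integral_joint_density_mult[OF has_bochner_integral_integrable[OF integrable_pair_density_ln_joint_density]]
  by (simp add: joint_entropy_def has_bochner_integral_iff)

lemma joint_density_ln_fst: "has_bochner_integral (lborelC2 n) (\<lambda>z. joint z * ln (mixture n A x e (fst z))) (- entropy n A x e)"
proof -
  let ?ln = "\<lambda>y. ln (mixture n A x e y)"
  have gauss_ln: "integrable (lborelC n) (\<lambda>y. gauss n e (y - m) * ?ln y)" for m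
    using integrable_mixture_ln_mixture[of "{()}" e A e n "\<lambda>_. 0" m x] A_fin e_pos by simp
  have "has_bochner_integral (lborelC2 n) (\<lambda>z. pair (x a) 0 z * ?ln (scale 1 (fst z) + scale 0 (snd z))) (\<integral>y. gauss n e (y - x a) * ?ln y \<partial>lborelC n)"
    for a
  proof (rule has_bochner_integral_pair_density_combine)
    show "?ln (trunc n y) = ?ln y" for y by (simp add: mixture_def gauss_def)
    have "combination_density 1 0 (x a) 0 y = gauss n e (y - x a)" for y
      using J_fin by (simp add: mixture_def)
    then show "has_bochner_integral (lborelC n) (\<lambda>y. combination_density 1 0 (x a) 0 y * ?ln y) (\<integral>y. gauss n e (y - x a) * ?ln y \<partial>lborelC n)"
      using has_bochner_integral_integrable[OF gauss_ln] by (simp only:)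
  qed (simp_all add: ln_mixture_measurable vec_measurable_proj)
  then have "has_bochner_integral (lborelC2 n) (\<lambda>z. pair (x a) 0 z * ?ln (fst z)) (\<integral>y. gauss n e (y - x a) * ?ln y \<partial>lborelC n)"
    for a
    by simp
  from has_bochner_integral_joint_density_mult[OF this]
  have "has_bochner_integral (lborelC2 n) (\<lambda>z. joint z * ?ln (fst z)) ((\<Sum>a\<in>A. \<integral>y. gauss n e (y - x a) * ?ln y \<partial>lborelC n) / real (card A))" .
  also have "(\<Sum>a\<in>A. \<integral>y. gauss n e (y - x a) * ?ln y \<partial>lborelC n) / real (card A) = (\<integral>y. (\<Sum>a\<in>A. gauss n e (y - x a) * ?ln y) / real (card A) \<partial>lborelC n)"
    using gauss_ln by (simp add: Bochner_Integration.integral_sum)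
  also have "\<dots> = - entropy n A x e" by (simp add: entropy_def mixture_def sum_distrib_right[symmetric])
  finally show ?thesis .
qed

lemma joint_density_ln_snd:
  assumes w: "w = v + (cmod g)\<^sup>2 * e"
  shows "has_bochner_integral (lborelC2 n) (\<lambda>z. joint z * ln (mixture n J \<iota> w (snd z))) (- entropy n J \<iota> w)"
proof -
  have "0 < w" using snd_variance_pos by (simp add: w)
  then have "has_bochner_integral (lborelC2 n) (\<lambda>z. pair (x a) 0 z * ln (mixture n J \<iota> w (snd z))) (- entropy n J \<iota> w)" for a
    using pair_density_ln_mixture_snd[OF J_fin, of w "x a" 0 \<iota>] by (simp add: w entropy_def)
  from has_bochner_integral_joint_density_mult[OF this] show ?thesis using A_fin by simp
qed

end

lemma joint_entropy_gauss:
  assumes "0 < e" "0 < v"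
  shows "joint_entropy n {()} (\<lambda>_. 0) {()} (\<lambda>_. 0) e v k = gauss_entropy n e + gauss_entropy n v"
proof -
  interpret noisy_pair n e "{()}" "\<lambda>_. 0" v k by unfold_locales (use assms in auto)
  show ?thesis
    using has_bochner_integral_integral_eq[OF pair_density_entropy[of 0 0]] assms
    by (simp add: joint_entropy_def joint_density_def[abs_def] entropy_gauss)
qed

lemma rate_le_genie_entropy:
  assumes x: "codebook n {..<N} x P" and J_fin: "finite J" "J \<noteq> {}" and dec: "decodable n N x J \<iota> \<psi> \<delta>"
    and e_pos: "0 < e" and v_pos: "0 < v" and unit_noise: "v + (cmod (1 + g))\<^sup>2 * e = 1"
  shows "fano_rate \<delta> N \<le> joint_entropy n {..<N} x J \<iota> e v g - gauss_entropy n e - entropy n J \<iota> v"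
proof -
  have N_ge_1: "1 \<le> N" and \<psi>: "\<psi> \<in> measurable (lborelC n) (count_space UNIV)"
    using x dec by (auto simp: codebook_def decodable_def lessThan_empty_iff)
  interpret noisy_codeword_pair n e J \<iota> v g "{..<N}" x
    by unfold_locales (use J_fin e_pos v_pos N_ge_1 in \<open>auto simp: lessThan_empty_iff\<close>)
  have "fano_rate \<delta> N \<le> (- gauss_entropy n e + - entropy n J \<iota> v) - (\<Sum>a<N. \<Sum>c\<in>{()}. \<integral>z. pair (x a) 0 z * ln (joint z) \<partial>lborelC2 n) / (real N * real (card {()}))"
    using N_ge_1 \<psi> unit_noise dec nn_integral_joint_density joint_density_pos joint_density_measurable integrable_pair_density_ln_joint_density
    by (intro fano_pair[where k=1 and \<psi>=\<psi> and C="{()}"]) (auto simp: decodable_def)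
  also have "(\<Sum>a<N. \<Sum>c\<in>{()}. \<integral>z. pair (x a) 0 z * ln (joint z) \<partial>lborelC2 n) / (real N * real (card {()})) = (\<integral>z. joint z * ln (joint z) \<partial>lborelC2 n)"
    using has_bochner_integral_integral_eq[OF has_bochner_integral_joint_density_mult[OF has_bochner_integral_integrable[OF integrable_pair_density_ln_joint_density]]]
    by simp
  finally show ?thesis by (simp add: joint_entropy_def)
qed

section \<open>Codewords in correlated noise\<close>

text \<open>The parameters \<open>e\<close>, \<open>w\<close> are the variances of the two noises and \<open>r\<close> is the expectation of the
  second noise times the conjugate of the first.\<close>

definition cov_density :: "nat \<Rightarrow> 'a set \<Rightarrow> ('a \<Rightarrow> cvec) \<Rightarrow> 'w set \<Rightarrow> ('w \<Rightarrow> cvec) \<Rightarrow> real \<Rightarrow> real \<Rightarrow> complex \<Rightarrow> cvec \<times> cvec \<Rightarrow> real"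
  where
  "cov_density n A x J \<iota> e w r = joint_density n A x J \<iota> e (w - (cmod r)\<^sup>2 / e) (r / of_real e)"

definition cov_entropy :: "nat \<Rightarrow> 'a set \<Rightarrow> ('a \<Rightarrow> cvec) \<Rightarrow> 'w set \<Rightarrow> ('w \<Rightarrow> cvec) \<Rightarrow> real \<Rightarrow> real \<Rightarrow> complex \<Rightarrow> real" where
  "cov_entropy n A x J \<iota> e w r = joint_entropy n A x J \<iota> e (w - (cmod r)\<^sup>2 / e) (r / of_real e)"

definition information :: "nat \<Rightarrow> 'a set \<Rightarrow> ('a \<Rightarrow> cvec) \<Rightarrow> 'w set \<Rightarrow> ('w \<Rightarrow> cvec) \<Rightarrow> real \<Rightarrow> real \<Rightarrow> complex \<Rightarrow> real" where
  "information n A x J \<iota> e w r = entropy n A x e + entropy n J \<iota> w - cov_entropy n A x J \<iota> e w r"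

lemma cov_density_cong:
  "(\<And>t. t < n \<Longrightarrow> fst z t = fst z' t) \<Longrightarrow> (\<And>t. t < n \<Longrightarrow> snd z t = snd z' t) \<Longrightarrow> cov_density n A x J \<iota> e w r z = cov_density n A x J \<iota> e w r z'"
  unfolding cov_density_def by (rule joint_density_cong)

lemma cov_density_measurable:
  "vec_measurable M n f \<Longrightarrow> vec_measurable M n h \<Longrightarrow> (\<lambda>z. cov_density n A x J \<iota> e w r (f z, h z)) \<in> borel_measurable M"
  unfolding cov_density_def by (rule joint_density_measurable_comp)

lemma cov_density_uminus: "cov_density n {()} (\<lambda>_. 0) {()} (\<lambda>_. 0) e w r (- y, - z) = cov_density n {()} (\<lambda>_. 0) {()} (\<lambda>_. 0) e w r (y, z)"
proof -
  have "- z - scale k (- y) = - (z - scale k y)" for k by (auto simp: fun_eq_iff)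
  then have "gauss n v (- z - scale k (- y)) = gauss n v (z - scale k y)" for v k by (simp only: gauss_uminus)
  then show ?thesis by (simp add: cov_density_def joint_density_def pair_density_def gauss_uminus)
qed

locale correlated_pair =
  fixes n :: nat and A :: "'a set" and x :: "'a \<Rightarrow> cvec" and J :: "'w set" and \<iota> :: "'w \<Rightarrow> cvec"
    and e w :: real and r :: complex
  assumes signal_fin: "finite A" "A \<noteq> {}" and interference_fin: "finite J" "J \<noteq> {}"
    and fst_noise_pos: "0 < e" and cross_lt: "(cmod r)\<^sup>2 < e * w"
begin

lemma residual_pos: "0 < w - (cmod r)\<^sup>2 / e"
  using fst_noise_pos cross_lt by (simp add: pos_divide_less_eq mult.commute)

sublocale joint: noisy_codeword_pair n e J \<iota> "w - (cmod r)\<^sup>2 / e" "r / of_real e" A x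
  using signal_fin interference_fin fst_noise_pos residual_pos by unfold_locales

lemma snd_noise_pos: "0 < w"
  using residual_pos fst_noise_pos by (smt (verit) divide_nonneg_nonneg zero_le_power2)

abbreviation "pdf \<equiv> cov_density n A x J \<iota> e w r"
abbreviation "pdf_fst \<equiv> mixture n A x e"
abbreviation "pdf_snd \<equiv> mixture n J \<iota> w"
abbreviation "info z \<equiv> ln (pdf z) - ln (pdf_fst (fst z)) - ln (pdf_snd (snd z))"

lemma pdf_pos: "0 < pdf z"
  unfolding cov_density_def by (rule joint.joint_density_pos)

lemma pdf_measurable: "pdf \<in> borel_measurable (lborelC2 n)"
  unfolding cov_density_def by (rule joint_density_measurable)

lemma info_measurable: "(\<lambda>z. info z) \<in> borel_measurable (lborelC2 n)"
  using pdf_measurable by (intro borel_measurable_diff borel_measurable_ln density_measurable)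

lemma nn_integral_pdf: "(\<integral>\<^sup>+z. ennreal (pdf z) \<partial>lborelC2 n) = 1"
  unfolding cov_density_def by (rule joint.nn_integral_joint_density)

lemma has_bochner_integral_info: "has_bochner_integral (lborelC2 n) (\<lambda>z. pdf z * info z) (information n A x J \<iota> e w r)"
proof -
  have "w = w - (cmod r)\<^sup>2 / e + (cmod (r / of_real e))\<^sup>2 * e"
    using fst_noise_pos by (simp add: norm_divide power_divide power2_eq_square)
  from has_bochner_integral_diff[OF has_bochner_integral_diff[OF joint.has_bochner_integral_joint_entropy joint.joint_density_ln_fst] joint.joint_density_ln_snd[OF this]]
  show ?thesis by (simp add: cov_density_def information_def cov_entropy_def right_diff_distrib diff_add_eq del: of_real_divide)
qed

end

lemma information_gauss:
  assumes e_pos: "0 < e" and cross_lt: "(cmod r)\<^sup>2 < e * w"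
  shows "information n {()} (\<lambda>_. 0) {()} (\<lambda>_. 0) e w r = - (real n * ln (1 - (cmod r)\<^sup>2 / (e * w)))"
proof -
  interpret correlated_pair n "{()}" "\<lambda>_. 0" "{()}" "\<lambda>_. 0" e w r by unfold_locales (use assms in auto)
  have "w - (cmod r)\<^sup>2 / e = w * (1 - (cmod r)\<^sup>2 / (e * w))" using snd_noise_pos by (simp add: field_simps)
  then have "gauss_entropy n (w - (cmod r)\<^sup>2 / e) = gauss_entropy n w + real n * ln (1 - (cmod r)\<^sup>2 / (e * w))"
    using snd_noise_pos residual_pos by (simp add: gauss_entropy_eq_ln ln_mult_pos zero_less_mult_iff distrib_left)
  then show ?thesis
    using joint_entropy_gauss[OF e_pos residual_pos] snd_noise_pos e_pos
    by (simp add: information_def cov_entropy_def entropy_gauss)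
qed

lemma ennreal_mixture: "0 < v \<Longrightarrow> ennreal (mixture n A x v y) = ennreal (1 / real (card A)) * (\<Sum>a\<in>A. ennreal (gauss n v (y - x a)))"
  unfolding mixture_def by (simp add: sum_ennreal ennreal_mult[symmetric] sum_nonneg)

lemma gauss_common_noise:
  assumes J_fin: "finite J" "J \<noteq> {}" and c_pos: "0 < c" and b_pos: "0 < b" and a_pos: "0 < a"
  shows "(\<integral>\<^sup>+y. ennreal (gauss n c y) * (ennreal (gauss n b (t - y)) * ennreal (mixture n J \<iota> a (u - scale g y))) \<partial>lborelC n)
    = ennreal (gauss n (b + c) t * mixture n J \<iota> (a + (cmod g)\<^sup>2 * (c * b / (b + c))) (u - scale (g * of_real (c / (b + c))) t))" (is "?lhs = _")
proof -
  let ?e = "b + c" and ?s = "c * b / (b + c)" and ?k = "complex_of_real (c / (b + c))"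
  have s_pos: "0 < ?s" using b_pos c_pos by simp
  have v_pos: "0 < a + (cmod g)\<^sup>2 * ?s" using a_pos s_pos by (intro add_pos_nonneg mult_nonneg_nonneg) auto
  have swap: "gauss n c y * gauss n b (t - y) = gauss n ?e t * gauss n ?s (y - scale ?k t)" for y
    using gauss_mult_swap[OF c_pos b_pos, of ?e 1 ?k n y t] by simp
  have "?lhs = (\<integral>\<^sup>+y. ennreal (gauss n ?e t) * (ennreal (gauss n ?s (y - scale ?k t)) * ennreal (mixture n J \<iota> a (u - scale g y))) \<partial>lborelC n)"
    using b_pos c_pos s_pos by (simp only: mult.assoc[symmetric] ennreal_mult[symmetric] gauss_nonneg add_pos_pos swap)
  also have "\<dots> = ennreal (gauss n ?e t) * (\<integral>\<^sup>+y. ennreal (gauss n ?s (y - scale ?k t)) * ennreal (mixture n J \<iota> a (u - scale g y)) \<partial>lborelC n)"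
    by (intro nn_integral_cmult density_measurable)
  also have "\<dots> = ennreal (gauss n ?e t) * ennreal (mixture n J \<iota> (a + (cmod g)\<^sup>2 * ?s) (u - scale (g * ?k) t))"
    by (simp only: nn_integral_mixture_conv[OF J_fin s_pos a_pos] scale_simps(3))
  finally show ?thesis using b_pos c_pos by (simp only: ennreal_mult gauss_nonneg mixture_nonneg[OF v_pos] add_pos_pos)
qed

lemma cov_density_common_noise:
  assumes J_fin: "finite J" "J \<noteq> {}" and c_pos: "0 < c" and b_pos: "0 < b" and a_pos: "0 < a"
  shows "ennreal (cov_density n A x J \<iota> (b + c) (a + (cmod g)\<^sup>2 * c) (g * of_real c) (t, u)) =
    (\<integral>\<^sup>+y. ennreal (gauss n c y) * (ennreal (mixture n A x b (t - y)) * ennreal (mixture n J \<iota> a (u - scale g y))) \<partial>lborelC n)" (is "_ = ?rhs")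
proof -
  let ?v = "a + (cmod g)\<^sup>2 * (c * b / (b + c))" and ?k = "g * of_real (c / (b + c))"
  let ?integrand = "\<lambda>m y. ennreal (gauss n c y) * (ennreal (gauss n b (t - x m - y)) * ennreal (mixture n J \<iota> a (u - scale g y)))"
  interpret noisy_pair n "b + c" J \<iota> ?v ?k
    using J_fin c_pos b_pos a_pos by unfold_locales (auto intro!: add_pos_nonneg)
  have "(cmod g)\<^sup>2 * c - (cmod (g * of_real c))\<^sup>2 / (b + c) = (cmod g)\<^sup>2 * (c * b / (b + c))"
    using b_pos c_pos by (simp add: norm_mult field_simps power2_eq_square)
  then have density: "cov_density n A x J \<iota> (b + c) (a + (cmod g)\<^sup>2 * c) (g * of_real c) = joint_density n A x J \<iota> (b + c) ?v ?k"
    by (simp add: cov_density_def add_diff_eq[symmetric])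
  have "?rhs = (\<integral>\<^sup>+y. ennreal (1 / real (card A)) * (\<Sum>m\<in>A. ?integrand m y) \<partial>lborelC n)"
    unfolding ennreal_mixture[OF b_pos] cancel_ab_semigroup_add_class.diff_right_commute[of t _ "x _"]
    by (simp only: sum_distrib_left sum_distrib_right mult_ac)
  also have "\<dots> = ennreal (1 / real (card A)) * (\<Sum>m\<in>A. \<integral>\<^sup>+y. ?integrand m y \<partial>lborelC n)"
    by (subst nn_integral_cmult) (auto intro!: borel_measurable_sum density_measurable nn_integral_sum arg_cong2[where f="(*)"])
  also have "\<dots> = ennreal (1 / real (card A)) * (\<Sum>m\<in>A. ennreal (pair (x m) 0 (t, u)))"
    by (simp only: gauss_common_noise[OF J_fin c_pos b_pos a_pos] pair_density_def fst_conv snd_conv diff_zero)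
  also have "\<dots> = ennreal (joint_density n A x J \<iota> (b + c) ?v ?k (t, u))"
    unfolding joint_density_def
    using pair_density_pos by (simp add: sum_ennreal ennreal_mult[symmetric] sum_nonneg less_imp_le)
  finally show ?thesis by (simp only: density)
qed

section \<open>Sums and differences of two copies\<close>

definition half_sumdiff :: "nat \<Rightarrow> cvec \<times> cvec \<Rightarrow> cvec \<times> cvec" where
  "half_sumdiff n z = (trunc n (scale (1/2) (fst z + snd z)), trunc n (scale (1/2) (fst z - snd z)))"

lemma half_sumdiff_measurable: "half_sumdiff n \<in> measurable (lborelC2 n) (lborelC2 n)"
  unfolding half_sumdiff_def by (intro measurable_Pair measurable_trunc vec_measurableI vec_measurable_proj)

lemma nn_integral_half_sumdiff_snd:
  assumes "(\<lambda>m. F (half_sumdiff n (p, m))) \<in> borel_measurable (lborelC n)"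
  shows "(\<integral>\<^sup>+m. F (half_sumdiff n (p, m)) \<partial>lborelC n) = ennreal (4^n) * (\<integral>\<^sup>+s. F (trunc n (p - s), s) \<partial>lborelC n)"
proof -
  have "half_sumdiff n (p, trunc n (p + scale (- 2) s)) = (trunc n (p - s), s)" if "s \<in> space (lborelC n)" for s
  proof -
    have "trunc n (scale (1/2) (p - trunc n (p + scale (- 2) s))) = trunc n s"
      by (auto simp: fun_eq_iff restrict_def field_simps)
    moreover have "trunc n (scale (1/2) (p + trunc n (p + scale (- 2) s))) = trunc n (p - s)"
      by (auto simp: fun_eq_iff restrict_def algebra_simps)
    ultimately show ?thesis using that by (simp only: half_sumdiff_def fst_conv snd_conv trunc_space_lborelC)
  qed
  then show ?thesis
    by (subst nn_integral_lborelC_affine[OF assms, of "- 2" p]) (auto intro!: nn_integral_cong arg_cong2[where f="(*)"] simp: power_mult)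
qed

lemma nn_integral_half_sumdiff:
  assumes F_meas: "F \<in> borel_measurable (lborelC2 n)"
  shows "(\<integral>\<^sup>+z. F (half_sumdiff n z) \<partial>lborelC2 n) = ennreal (4^n) * (\<integral>\<^sup>+z. F z \<partial>lborelC2 n)"
proof -
  have half_meas: "(\<lambda>z. F (half_sumdiff n z)) \<in> borel_measurable (lborelC2 n)"
    by (rule measurable_compose[OF half_sumdiff_measurable F_meas])
  have shear_meas: "(\<lambda>z. F (trunc n (fst z - snd z), snd z)) \<in> borel_measurable (lborelC2 n)"
    by (intro measurable_compose[OF _ F_meas] measurable_Pair measurable_trunc vec_measurableI vec_measurable_proj measurable_snd)
  then have shear_integral_meas: "(\<lambda>p. \<integral>\<^sup>+s. F (trunc n (p - s), s) \<partial>lborelC n) \<in> borel_measurable (lborelC n)"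
    using sigma_finite_measure.borel_measurable_nn_integral[OF sigma_finite_lborelC, of "\<lambda>p s. F (trunc n (p - s), s)" "lborelC n" n]
    by (simp add: split_beta')
  have "(\<integral>\<^sup>+z. F (half_sumdiff n z) \<partial>lborelC2 n) = (\<integral>\<^sup>+p. ennreal (4^n) * (\<integral>\<^sup>+s. F (trunc n (p - s), s) \<partial>lborelC n) \<partial>lborelC n)"
    unfolding nn_integral_lborelC2[OF half_meas]
    using half_meas by (intro nn_integral_cong nn_integral_half_sumdiff_snd) simp
  also have "\<dots> = ennreal (4^n) * (\<integral>\<^sup>+z. F (trunc n (fst z - snd z), snd z) \<partial>lborelC2 n)"
    unfolding nn_integral_lborelC2[OF shear_meas] fst_conv snd_conv by (rule nn_integral_cmult[OF shear_integral_meas])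
  also have "(\<integral>\<^sup>+z. F (trunc n (fst z - snd z), snd z) \<partial>lborelC2 n) = (\<integral>\<^sup>+s. \<integral>\<^sup>+p. F (p, s) \<partial>lborelC n \<partial>lborelC n)"
    unfolding nn_integral_lborelC2'[OF shear_meas] fst_conv snd_conv
  proof (rule nn_integral_cong)
    fix s assume "s \<in> space (lborelC n)"
    then have "(\<lambda>p. F (p, s)) \<in> borel_measurable (lborelC n)" using F_meas by simp
    from nn_integral_lborelC_translate[OF this, of "- s"] show "(\<integral>\<^sup>+p. F (trunc n (p - s), s) \<partial>lborelC n) = (\<integral>\<^sup>+p. F (p, s) \<partial>lborelC n)"
      by simp
  qed
  also have "\<dots> = (\<integral>\<^sup>+z. F z \<partial>lborelC2 n)" by (rule nn_integral_lborelC2'[OF F_meas, symmetric])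
  finally show ?thesis .
qed

text \<open>The density of \<open>(Y\<^sub>1 + Y\<^sub>2, Y\<^sub>1 - Y\<^sub>2)\<close> for independent \<open>Y\<^sub>1\<close>, \<open>Y\<^sub>2\<close>, the first a noisy codeword and the second Gaussian.\<close>

definition sumdiff_density :: "nat \<Rightarrow> 'a set \<Rightarrow> ('a \<Rightarrow> cvec) \<Rightarrow> real \<Rightarrow> real \<Rightarrow> cvec \<times> cvec \<Rightarrow> real" where
  "sumdiff_density n A x b1 b2 z = mixture n A x b1 (scale (1/2) (fst z + snd z)) * gauss n b2 (scale (1/2) (fst z - snd z)) / 4^n"

lemma sumdiff_density_measurable:
  assumes "vec_measurable M n f" "vec_measurable M n h"
  shows "(\<lambda>z. sumdiff_density n A x b1 b2 (f z, h z)) \<in> borel_measurable M"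
    and "(\<lambda>z. ennreal (sumdiff_density n A x b1 b2 (f z, h z))) \<in> borel_measurable M"
proof -
  show "(\<lambda>z. sumdiff_density n A x b1 b2 (f z, h z)) \<in> borel_measurable M"
    unfolding sumdiff_density_def fst_conv snd_conv using assms by (intro density_measurable)
  then show "(\<lambda>z. ennreal (sumdiff_density n A x b1 b2 (f z, h z))) \<in> borel_measurable M" by simp
qed

lemma sumdiff_density_pos: "finite A \<Longrightarrow> A \<noteq> {} \<Longrightarrow> 0 < b1 \<Longrightarrow> 0 < b2 \<Longrightarrow> 0 < sumdiff_density n A x b1 b2 z"
  unfolding sumdiff_density_def by (intro divide_pos_pos mult_pos_pos mixture_pos gauss_pos) auto

lemma nn_integral_sumdiff_density_snd:
  assumes A_fin: "finite A" "A \<noteq> {}" and b_pos: "0 < b1" "0 < b2"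
  shows "(\<integral>\<^sup>+m. ennreal (sumdiff_density n A x b1 b2 (p, m - s)) \<partial>lborelC n) = ennreal (mixture n A x (b1 + b2) p)"
proof -
  let ?m = "\<lambda>y. trunc n (p + s + scale (- 2) y)"
  have "(\<integral>\<^sup>+m. ennreal (sumdiff_density n A x b1 b2 (p, m - s)) \<partial>lborelC n) = ennreal ((cmod (- 2))^(2*n)) * (\<integral>\<^sup>+y. ennreal (sumdiff_density n A x b1 b2 (p, ?m y - s)) \<partial>lborelC n)"
    by (intro nn_integral_lborelC_affine sumdiff_density_measurable density_measurable) simp
  also have "\<dots> = (\<integral>\<^sup>+y. ennreal ((cmod (- 2))^(2*n)) * ennreal (sumdiff_density n A x b1 b2 (p, ?m y - s)) \<partial>lborelC n)"
    by (intro nn_integral_cmult[symmetric] sumdiff_density_measurable density_measurable)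
  also have "\<dots> = (\<integral>\<^sup>+y. ennreal (gauss n b2 (y - 0)) * ennreal (mixture n A x b1 (p - scale 1 y)) \<partial>lborelC n)"
  proof (intro nn_integral_cong)
    fix y
    have sum: "mixture n A x b1 (scale (1/2) (p + (?m y - s))) = mixture n A x b1 (p - scale 1 y)"
      by (rule mixture_cong) (simp add: field_simps)
    have diff: "gauss n b2 (scale (1/2) (p - (?m y - s))) = gauss n b2 (y - 0)" by (rule gauss_cong) (simp add: field_simps)
    have jacobian: "(cmod (- 2))^(2*n) = 4^n" by (simp add: power_mult)
    show "ennreal ((cmod (- 2))^(2*n)) * ennreal (sumdiff_density n A x b1 b2 (p, ?m y - s)) = ennreal (gauss n b2 (y - 0)) * ennreal (mixture n A x b1 (p - scale 1 y))"
      unfolding sumdiff_density_def fst_conv snd_conv sum diff jacobian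
      using mixture_nonneg[OF b_pos(1)] gauss_nonneg[OF b_pos(2)]
      by (subst (1 2) ennreal_mult[symmetric]) (auto intro!: divide_nonneg_nonneg mult_nonneg_nonneg simp: mult.commute)
  qed
  also have "\<dots> = ennreal (mixture n A x (b1 + (cmod 1)\<^sup>2 * b2) (p - scale 1 0))"
    by (rule nn_integral_mixture_conv[OF A_fin b_pos(2,1)])
  finally show ?thesis by simp
qed

lemma sumdiff_density_commute: "sumdiff_density n A x b1 b2 (p, m) = sumdiff_density n A x b1 b2 (m, p)"
proof -
  have "scale (1/2) (p - m) = - scale (1/2) (m - p)" by (auto simp: fun_eq_iff algebra_simps)
  then show ?thesis unfolding sumdiff_density_def fst_conv snd_conv by (simp only: gauss_uminus add.commute)
qed

lemma nn_integral_sumdiff_density_fst: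
  assumes "finite A" "A \<noteq> {}" "0 < b1" "0 < b2"
  shows "(\<integral>\<^sup>+p. ennreal (sumdiff_density n A x b1 b2 (p - s, m)) \<partial>lborelC n) = ennreal (mixture n A x (b1 + b2) m)"
  using nn_integral_sumdiff_density_snd[OF assms, of n x m s] by (simp only: sumdiff_density_commute[of _ _ _ _ _ _ m])

lemma sumdiff_density_le:
  assumes A_fin: "finite A" "A \<noteq> {}" and b_pos: "0 < b1" "0 < b2"
  shows "sumdiff_density n A x b1 b2 z \<le> 1 / (pi * b1)^n * (1 / (pi * b2)^n)"
proof -
  have "sumdiff_density n A x b1 b2 z \<le> mixture n A x b1 (scale (1/2) (fst z + snd z)) * gauss n b2 (scale (1/2) (fst z - snd z)) / 1"
    unfolding sumdiff_density_def
    using mixture_nonneg[OF b_pos(1)] gauss_nonneg[OF b_pos(2)] by (intro divide_left_mono mult_nonneg_nonneg) auto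
  also have "\<dots> \<le> 1 / (pi * b1)^n * (1 / (pi * b2)^n)"
    unfolding div_by_1
    using mixture_nonneg[OF b_pos(1)] gauss_nonneg[OF b_pos(2)] b_pos by (intro mult_mono mixture_le gauss_le A_fin) auto
  finally show ?thesis .
qed

lemma mixture_mult_gauss_half_sumdiff:
  "mixture n A x b1 (scale (1/2) (p + m) - scale k (fst (half_sumdiff n z))) * gauss n b2 (scale (1/2) (p - m) - scale k (snd (half_sumdiff n z)))
    = 4^n * sumdiff_density n A x b1 b2 (p - scale k (fst z), m - scale k (snd z))"
proof -
  have "mixture n A x b1 (scale (1/2) (p + m) - scale k (fst (half_sumdiff n z))) = mixture n A x b1 (scale (1/2) ((p - scale k (fst z)) + (m - scale k (snd z))))"
    unfolding half_sumdiff_def fst_conv by (rule mixture_cong) (simp add: field_simps)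
  moreover have "gauss n b2 (scale (1/2) (p - m) - scale k (snd (half_sumdiff n z))) = gauss n b2 (scale (1/2) ((p - scale k (fst z)) - (m - scale k (snd z))))"
    unfolding half_sumdiff_def snd_conv by (rule gauss_cong) (simp add: field_simps)
  ultimately show ?thesis by (simp only: sumdiff_density_def fst_conv snd_conv) simp
qed

lemma gauss_mult_gauss_half_sumdiff:
  "gauss n c (fst (half_sumdiff n z)) * gauss n c (snd (half_sumdiff n z)) = 4^n * (gauss n (2 * c) (fst z) * gauss n (2 * c) (snd z))"
proof -
  let ?p = "fst z" and ?m = "snd z"
  have "sqnorm n (scale (1/2) (?p + ?m)) + sqnorm n (scale (1/2) (?p - ?m)) = (sqnorm n ?p + sqnorm n ?m) / 2"
    unfolding sqnorm_scale sqnorm_add sqnorm_diff by (simp add: power2_eq_square field_simps)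
  then have "- (sqnorm n (fst (half_sumdiff n z)) + sqnorm n (snd (half_sumdiff n z))) / c = - ((sqnorm n ?p + sqnorm n ?m) / 2) / c"
    by (simp only: half_sumdiff_def fst_conv snd_conv sqnorm_trunc)
  then have "- sqnorm n (fst (half_sumdiff n z)) / c + - sqnorm n (snd (half_sumdiff n z)) / c = - sqnorm n ?p / (2 * c) + - sqnorm n ?m / (2 * c)"
    by (simp add: add_divide_distrib diff_divide_distrib)
  then have exponents: "exp (- sqnorm n (fst (half_sumdiff n z)) / c) * exp (- sqnorm n (snd (half_sumdiff n z)) / c) = exp (- sqnorm n ?p / (2 * c)) * exp (- sqnorm n ?m / (2 * c))"
    by (simp only: exp_add[symmetric])
  have "(pi * (2 * c))^n * (pi * (2 * c))^n = 4^n * ((pi * c)^n * (pi * c)^n)"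
    unfolding power_mult_distrib[symmetric] by (simp add: mult_ac)
  then show ?thesis unfolding gauss_def times_divide_times_eq exponents by simp
qed

lemma nn_integral_lborelC2_mult:
  assumes "P \<in> borel_measurable (lborelC n)" "Q \<in> borel_measurable (lborelC n)"
  shows "(\<integral>\<^sup>+z. P (fst z) * Q (snd z) \<partial>lborelC2 n) = (\<integral>\<^sup>+y. P y \<partial>lborelC n) * (\<integral>\<^sup>+y. Q y \<partial>lborelC n)"
  using assms by (subst nn_integral_lborelC2) (auto simp: nn_integral_cmult nn_integral_multc)

abbreviation "lborelC4 n \<equiv> lborelC2 n \<Otimes>\<^sub>M lborelC2 n"

lemma pair_sigma_finite_lborelC2: "pair_sigma_finite (lborelC2 n) (lborelC n)" "pair_sigma_finite (lborelC2 n) (lborelC2 n)"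
  by (auto intro!: pair_sigma_finite.intro sigma_finite_pair_measure)

lemma sigma_finite_lborelC2: "sigma_finite_measure (lborelC2 n)"
  by (rule sigma_finite_pair_measure) simp_all

lemma nn_integral_lborelC2_commute:
  assumes "(\<lambda>p. f (fst p) (snd p)) \<in> borel_measurable (lborelC2 n \<Otimes>\<^sub>M lborelC n)"
  shows "(\<integral>\<^sup>+y. \<integral>\<^sup>+z. f z y \<partial>lborelC2 n \<partial>lborelC n) = (\<integral>\<^sup>+z. \<integral>\<^sup>+y. f z y \<partial>lborelC n \<partial>lborelC2 n)"
  using pair_sigma_finite.Fubini'[OF pair_sigma_finite_lborelC2(1), of f n] assms by (simp add: split_beta')

lemma nn_integral_lborelC4:
  "F \<in> borel_measurable (lborelC4 n) \<Longrightarrow> (\<integral>\<^sup>+w. F w \<partial>lborelC4 n) = (\<integral>\<^sup>+y. \<integral>\<^sup>+z. F (y, z) \<partial>lborelC2 n \<partial>lborelC2 n)"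
  by (rule sigma_finite_measure.nn_integral_fst[OF sigma_finite_lborelC2, symmetric])

lemma nn_integral_snd_measurable:
  "F \<in> borel_measurable (M \<Otimes>\<^sub>M lborelC2 n) \<Longrightarrow> (\<lambda>y. \<integral>\<^sup>+z. F (y, z) \<partial>lborelC2 n) \<in> borel_measurable M"
  using sigma_finite_measure.borel_measurable_nn_integral[OF sigma_finite_lborelC2, of "\<lambda>y z. F (y, z)" M n] by simp

lemma nn_integral_lborelC4_transpose:
  assumes F_meas: "F \<in> borel_measurable (lborelC4 n)"
  shows "(\<integral>\<^sup>+w. F w \<partial>lborelC4 n) = (\<integral>\<^sup>+y. \<integral>\<^sup>+z. F ((fst y, fst z), (snd y, snd z)) \<partial>lborelC2 n \<partial>lborelC2 n)" (is "_ = ?plus_minus")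
    and "(\<integral>\<^sup>+w. F w \<partial>lborelC4 n) = (\<integral>\<^sup>+z. \<integral>\<^sup>+y. F ((fst y, fst z), (snd y, snd z)) \<partial>lborelC2 n \<partial>lborelC2 n)" (is "_ = ?minus_plus")
proof -
  have transposed_meas: "(\<lambda>p. F ((fst (fst p), fst (snd p)), (snd (fst p), snd (snd p)))) \<in> borel_measurable (lborelC4 n)"
    by (intro measurable_compose[OF _ F_meas]) simp
  have section_meas: "(\<lambda>U. F (T, U)) \<in> borel_measurable (lborelC2 n)" if "T \<in> space (lborelC2 n)" for T
    using F_meas that by simp
  have inner_meas: "(\<lambda>p. \<integral>\<^sup>+m. F ((t, fst p), (snd p, m)) \<partial>lborelC n) \<in> borel_measurable (lborelC2 n)"
    if "t \<in> space (lborelC n)" for t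
  proof -
    have "(\<lambda>q. F ((t, fst (fst q)), (snd (fst q), snd q))) \<in> borel_measurable (lborelC2 n \<Otimes>\<^sub>M lborelC n)"
      using that by (intro measurable_compose[OF _ F_meas]) simp
    then show ?thesis
      using sigma_finite_measure.borel_measurable_nn_integral[OF sigma_finite_lborelC, of "\<lambda>p m. F ((t, fst p), (snd p, m))" "lborelC2 n" n]
      by (simp add: split_beta')
  qed
  have "(\<integral>\<^sup>+w. F w \<partial>lborelC4 n) = (\<integral>\<^sup>+t. \<integral>\<^sup>+s. \<integral>\<^sup>+U. F ((t, s), U) \<partial>lborelC2 n \<partial>lborelC n \<partial>lborelC n)"
    unfolding nn_integral_lborelC4[OF F_meas] by (rule nn_integral_lborelC2[OF nn_integral_snd_measurable[OF F_meas]])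
  also have "\<dots> = (\<integral>\<^sup>+t. \<integral>\<^sup>+s. \<integral>\<^sup>+u. \<integral>\<^sup>+m. F ((t, s), (u, m)) \<partial>lborelC n \<partial>lborelC n \<partial>lborelC n \<partial>lborelC n)"
    by (rule nn_integral_cong, rule nn_integral_cong, rule nn_integral_lborelC2, rule section_meas) (simp add: space_pair_measure)
  also have "\<dots> = (\<integral>\<^sup>+t. \<integral>\<^sup>+u. \<integral>\<^sup>+s. \<integral>\<^sup>+m. F ((t, s), (u, m)) \<partial>lborelC n \<partial>lborelC n \<partial>lborelC n \<partial>lborelC n)"
    by (rule nn_integral_cong, rule nn_integral_lborelC_commute[symmetric]) (rule inner_meas)
  also have "\<dots> = (\<integral>\<^sup>+t. \<integral>\<^sup>+u. \<integral>\<^sup>+z. F ((t, fst z), (u, snd z)) \<partial>lborelC2 n \<partial>lborelC n \<partial>lborelC n)"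
  proof (intro nn_integral_cong)
    fix t u assume "t \<in> space (lborelC n)" "u \<in> space (lborelC n)"
    then have "(\<lambda>z. F ((t, fst z), (u, snd z))) \<in> borel_measurable (lborelC2 n)"
      by (intro measurable_compose[OF _ F_meas]) simp
    from nn_integral_lborelC2[OF this]
    show "(\<integral>\<^sup>+s. \<integral>\<^sup>+m. F ((t, s), (u, m)) \<partial>lborelC n \<partial>lborelC n) = (\<integral>\<^sup>+z. F ((t, fst z), (u, snd z)) \<partial>lborelC2 n)" by simp
  qed
  also have "\<dots> = ?plus_minus"
    using nn_integral_lborelC2[OF nn_integral_snd_measurable[OF transposed_meas]] by simp
  finally show plus_minus: "(\<integral>\<^sup>+w. F w \<partial>lborelC4 n) = ?plus_minus" .
  also have "\<dots> = ?minus_plus"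
    using pair_sigma_finite.Fubini'[OF pair_sigma_finite_lborelC2(2), of "\<lambda>y z. F ((fst y, fst z), (snd y, snd z))" n] transposed_meas
    by (simp add: split_beta')
  finally show "(\<integral>\<^sup>+w. F w \<partial>lborelC4 n) = ?minus_plus" .
qed

lemma nn_integral_lborelC4_half_sumdiff:
  assumes F_meas: "F \<in> borel_measurable (lborelC4 n)"
  shows "(\<integral>\<^sup>+w. F (half_sumdiff n (fst w), half_sumdiff n (snd w)) \<partial>lborelC4 n) = ennreal (16^n) * (\<integral>\<^sup>+w. F w \<partial>lborelC4 n)"
proof -
  let ?G = "\<lambda>y. \<integral>\<^sup>+z. F (y, z) \<partial>lborelC2 n"
  have half_meas: "(\<lambda>w. F (half_sumdiff n (fst w), half_sumdiff n (snd w))) \<in> borel_measurable (lborelC4 n)"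
    by (intro measurable_compose[OF _ F_meas] measurable_Pair measurable_compose[OF _ half_sumdiff_measurable] measurable_fst measurable_snd)
  have "(\<integral>\<^sup>+w. F (half_sumdiff n (fst w), half_sumdiff n (snd w)) \<partial>lborelC4 n) = (\<integral>\<^sup>+y. ennreal (4^n) * ?G (half_sumdiff n y) \<partial>lborelC2 n)"
    unfolding nn_integral_lborelC4[OF half_meas] fst_conv snd_conv
    using F_meas measurable_space[OF half_sumdiff_measurable] by (intro nn_integral_cong nn_integral_half_sumdiff) simp
  also have "\<dots> = ennreal (4^n) * (\<integral>\<^sup>+y. ?G (half_sumdiff n y) \<partial>lborelC2 n)"
    by (rule nn_integral_cmult) (rule measurable_compose[OF half_sumdiff_measurable nn_integral_snd_measurable[OF F_meas]])
  also have "\<dots> = ennreal (4^n) * (ennreal (4^n) * (\<integral>\<^sup>+w. F w \<partial>lborelC4 n))"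
    unfolding nn_integral_half_sumdiff[OF nn_integral_snd_measurable[OF F_meas]] nn_integral_lborelC4[OF F_meas] ..
  finally show ?thesis by (simp add: mult.assoc[symmetric] ennreal_mult'[symmetric] power_mult_distrib[symmetric])
qed

abbreviation "sum_pair w \<equiv> (fst (fst w), fst (snd w))"
abbreviation "diff_pair w \<equiv> (snd (fst w), snd (snd w))"
abbreviation "half_sums n w \<equiv> (fst (half_sumdiff n (fst w)), fst (half_sumdiff n (snd w)))"
abbreviation "half_diffs n w \<equiv> (snd (half_sumdiff n (fst w)), snd (half_sumdiff n (snd w)))"

lemma half_sums_measurable: "(\<lambda>w. half_sums n w) \<in> measurable (lborelC4 n) (lborelC2 n)" "(\<lambda>w. half_diffs n w) \<in> measurable (lborelC4 n) (lborelC2 n)"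
  by (auto intro!: measurable_Pair measurable_compose[OF _ measurable_fst] measurable_compose[OF _ measurable_snd] measurable_compose[OF _ half_sumdiff_measurable])

lemma nn_integral_half_sums_half_diffs:
  assumes F_meas: "F \<in> borel_measurable (lborelC2 n)" and G_meas: "G \<in> borel_measurable (lborelC2 n)"
  shows "(\<integral>\<^sup>+w. F (half_sums n w) * G (half_diffs n w) \<partial>lborelC4 n) = ennreal (16^n) * ((\<integral>\<^sup>+z. F z \<partial>lborelC2 n) * (\<integral>\<^sup>+z. G z \<partial>lborelC2 n))"
proof -
  have product_meas: "(\<lambda>w. F (sum_pair w) * G (diff_pair w)) \<in> borel_measurable (lborelC4 n)" using F_meas G_meas by simp
  have "(\<integral>\<^sup>+w. F (sum_pair w) * G (diff_pair w) \<partial>lborelC4 n) = (\<integral>\<^sup>+y. \<integral>\<^sup>+z. F y * G z \<partial>lborelC2 n \<partial>lborelC2 n)"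
    using nn_integral_lborelC4_transpose(1)[OF product_meas] by simp
  also have "\<dots> = (\<integral>\<^sup>+z. F z \<partial>lborelC2 n) * (\<integral>\<^sup>+z. G z \<partial>lborelC2 n)"
    using F_meas G_meas by (simp add: nn_integral_cmult nn_integral_multc)
  finally show ?thesis using nn_integral_lborelC4_half_sumdiff[OF product_meas] by simp
qed

lemma vec_measurable_compose: "vec_measurable N n f \<Longrightarrow> h \<in> measurable M N \<Longrightarrow> vec_measurable M n (\<lambda>x. f (h x))"
  unfolding vec_measurable_def by (auto intro: measurable_compose)

lemma vec_measurable_pair_proj:
  "vec_measurable (lborelC2 n \<Otimes>\<^sub>M M') n (\<lambda>p. fst (fst p))" "vec_measurable (lborelC2 n \<Otimes>\<^sub>M M') n (\<lambda>p. snd (fst p))"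
  "vec_measurable (M' \<Otimes>\<^sub>M lborelC2 n) n (\<lambda>p. fst (snd p))" "vec_measurable (M' \<Otimes>\<^sub>M lborelC2 n) n (\<lambda>p. snd (snd p))"
  by (auto intro: vec_measurable_compose[OF vec_measurable_proj(2)] vec_measurable_compose[OF vec_measurable_proj(3)])

lemmas sumdiff_measurable = density_measurable sumdiff_density_measurable cov_density_measurable vec_measurable_pair_proj

text \<open>The first copy has noises \<open>C + B\<close> and \<open>g C + A\<close> with independent components of variances \<open>c\<close>, \<open>b1\<close>, \<open>a1\<close>;
  the second copy is a Gaussian pair of the same form.\<close>

locale two_copies =
  fixes n :: nat and A :: "'a set" and x :: "'a \<Rightarrow> cvec" and J :: "'w set" and \<iota> :: "'w \<Rightarrow> cvec"
    and b1 b2 a1 a2 c :: real and g :: complex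
  assumes A_fin: "finite A" "A \<noteq> {}" and J_fin: "finite J" "J \<noteq> {}"
    and b_pos: "0 < b1" "0 < b2" and a_pos: "0 < a1" "0 < a2" and c_pos: "0 < c"
begin

lemma common_noise_cross_lt:
  assumes "0 < a" "0 < b" "0 < (c'::real)"
  shows "(cmod (g * of_real c'))\<^sup>2 < (b + c') * (a + (cmod g)\<^sup>2 * c')"
proof -
  have "0 < (b + c') * a + b * ((cmod g)\<^sup>2 * c')" using assms by (intro add_pos_nonneg mult_pos_pos mult_nonneg_nonneg) auto
  then show ?thesis using assms by (simp add: norm_mult power_mult_distrib algebra_simps power2_eq_square)
qed

lemma sum_noise_pos: "0 < 2 * c" "0 < b1 + b2" "0 < a1 + a2" using c_pos a_pos b_pos by auto

sublocale first: correlated_pair n A x J \<iota> "b1 + c" "a1 + (cmod g)\<^sup>2 * c" "g * of_real c"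
  by unfold_locales (use A_fin J_fin b_pos c_pos common_noise_cross_lt a_pos in auto)

sublocale second: correlated_pair n "{()}" "\<lambda>_. 0" "{()}" "\<lambda>_. 0" "b2 + c" "a2 + (cmod g)\<^sup>2 * c" "g * of_real c"
  by unfold_locales (use b_pos c_pos common_noise_cross_lt a_pos in auto)

sublocale total: correlated_pair n A x J \<iota> "b1 + b2 + 2 * c" "a1 + a2 + (cmod g)\<^sup>2 * (2 * c)" "g * of_real (2 * c)"
  by unfold_locales (use A_fin J_fin sum_noise_pos common_noise_cross_lt[OF sum_noise_pos(3,2,1)] in auto)

text \<open>The density of the sums and differences of the two copies at \<open>((T\<^sub>+, T\<^sub>-), (U\<^sub>+, U\<^sub>-))\<close>.\<close>

definition sumdiff_pdf :: "(cvec \<times> cvec) \<times> cvec \<times> cvec \<Rightarrow> real" where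
  "sumdiff_pdf w = first.pdf (scale (1/2) (fst (fst w) + snd (fst w)), scale (1/2) (fst (snd w) + snd (snd w)))
    * second.pdf (scale (1/2) (fst (fst w) - snd (fst w)), scale (1/2) (fst (snd w) - snd (snd w))) / 16^n"

lemma sumdiff_pdf_half_sumdiff: "sumdiff_pdf w = first.pdf (half_sums n w) * second.pdf (half_diffs n w) / 16^n"
  unfolding sumdiff_pdf_def
  by (intro arg_cong2[where f="(/)"] arg_cong2[where f="(*)"] cov_density_cong refl) (simp_all add: half_sumdiff_def)

lemma sumdiff_pdf_pos: "0 < sumdiff_pdf w"
  unfolding sumdiff_pdf_def using first.pdf_pos second.pdf_pos by simp

lemma sumdiff_pdf_measurable_vec:
  assumes "vec_measurable M n f1" "vec_measurable M n f2" "vec_measurable M n f3" "vec_measurable M n f4"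
  shows "(\<lambda>z. sumdiff_pdf ((f1 z, f2 z), (f3 z, f4 z))) \<in> borel_measurable M"
  unfolding sumdiff_pdf_def fst_conv snd_conv using assms by (intro sumdiff_measurable)

lemma sumdiff_pdf_measurable: "sumdiff_pdf \<in> borel_measurable (lborelC4 n)"
  using sumdiff_pdf_measurable_vec[OF vec_measurable_pair_proj] by simp

lemma pdf_common_noise:
  "ennreal (first.pdf (t, u)) = (\<integral>\<^sup>+y. ennreal (gauss n c y) * (ennreal (mixture n A x b1 (t - y)) * ennreal (mixture n J \<iota> a1 (u - scale g y))) \<partial>lborelC n)"
  "ennreal (second.pdf (t, u)) = (\<integral>\<^sup>+y. ennreal (gauss n c y) * (ennreal (gauss n b2 (t - y)) * ennreal (gauss n a2 (u - scale g y))) \<partial>lborelC n)"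
  "ennreal (total.pdf (t, u)) = (\<integral>\<^sup>+y. ennreal (gauss n (2 * c) y) * (ennreal (mixture n A x (b1 + b2) (t - y)) * ennreal (mixture n J \<iota> (a1 + a2) (u - scale g y))) \<partial>lborelC n)"
  using cov_density_common_noise[OF J_fin c_pos b_pos(1) a_pos(1), of n A x \<iota> g t u]
    cov_density_common_noise[of "{()}" c b2 a2 n "{()}" "\<lambda>_. 0" "\<lambda>_. 0" g t u]
    cov_density_common_noise[OF J_fin sum_noise_pos, of n A x \<iota> g t u] a_pos b_pos c_pos
  by simp_all

abbreviation "noise z \<equiv> ennreal (gauss n (2 * c) (fst z)) * ennreal (gauss n (2 * c) (snd z))"
abbreviation "signal T z \<equiv> ennreal (sumdiff_density n A x b1 b2 (fst T - fst z, snd T - snd z))"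
abbreviation "interference U z \<equiv> ennreal (sumdiff_density n J \<iota> a1 a2 (fst U - scale g (fst z), snd U - scale g (snd z)))"

lemma common_noise_half_sumdiff:
  fixes T U z
  defines "t \<equiv> half_sumdiff n z"
  shows "ennreal (gauss n c (fst t)) * (ennreal (mixture n A x b1 (scale (1/2) (fst T + snd T) - fst t)) * ennreal (mixture n J \<iota> a1 (scale (1/2) (fst U + snd U) - scale g (fst t))))
      * (ennreal (gauss n c (snd t)) * (ennreal (gauss n b2 (scale (1/2) (fst T - snd T) - snd t)) * ennreal (gauss n a2 (scale (1/2) (fst U - snd U) - scale g (snd t)))))
    = ennreal (64^n) * (noise z * (signal T z * interference U z))" (is "ennreal ?n1 * (ennreal ?s1 * ennreal ?i1) * (ennreal ?n2 * (ennreal ?s2 * ennreal ?i2)) = _")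
proof -
  let ?S = "sumdiff_density n A x b1 b2 (fst T - fst z, snd T - snd z)"
    and ?I = "sumdiff_density n J \<iota> a1 a2 (fst U - scale g (fst z), snd U - scale g (snd z))"
  let ?N = "gauss n (2 * c) (fst z) * gauss n (2 * c) (snd z)"
  have nonneg: "0 \<le> ?S" "0 \<le> ?I" "0 \<le> ?N"
    using sumdiff_density_pos[OF A_fin b_pos] sumdiff_density_pos[OF J_fin a_pos] c_pos by (auto simp: less_imp_le)
  have "ennreal ?n1 * (ennreal ?s1 * ennreal ?i1) * (ennreal ?n2 * (ennreal ?s2 * ennreal ?i2)) = ennreal (?n1 * ?n2) * (ennreal (?s1 * ?s2) * ennreal (?i1 * ?i2))"
    using c_pos b_pos a_pos by (simp only: ennreal_mult gauss_nonneg mixture_nonneg) (simp only: mult_ac)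
  also have "\<dots> = ennreal (4^n * ?N) * (ennreal (4^n * ?S) * ennreal (4^n * ?I))"
    using gauss_mult_gauss_half_sumdiff[of n c z] mixture_mult_gauss_half_sumdiff[of n A x b1 "fst T" "snd T" 1 z b2]
      mixture_mult_gauss_half_sumdiff[of n J \<iota> a1 "fst U" "snd U" g z a2] by (simp add: t_def)
  also have "\<dots> = (ennreal (4^n) * ennreal (4^n) * ennreal (4^n)) * (ennreal ?N * (ennreal ?S * ennreal ?I))"
    using nonneg by (simp only: ennreal_mult zero_le_power zero_le_numeral) (simp only: mult_ac)
  also have "ennreal (4^n) * ennreal (4^n) * ennreal (4^n) = ennreal (64^n)"
    by (simp add: ennreal_mult'[symmetric] power_mult_distrib[symmetric])
  finally show ?thesis using c_pos by (simp only: ennreal_mult gauss_nonneg sum_noise_pos)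
qed

lemma ennreal_sumdiff_pdf: "ennreal (sumdiff_pdf (T, U)) = (\<integral>\<^sup>+z. noise z * (signal T z * interference U z) \<partial>lborelC2 n)" (is "_ = ?rhs")
proof -
  let ?t1 = "scale (1/2) (fst T + snd T)" and ?t2 = "scale (1/2) (fst T - snd T)" and ?u1 = "scale (1/2) (fst U + snd U)"
    and ?u2 = "scale (1/2) (fst U - snd U)"
  let ?P = "\<lambda>y. ennreal (gauss n c y) * (ennreal (mixture n A x b1 (?t1 - y)) * ennreal (mixture n J \<iota> a1 (?u1 - scale g y)))"
  let ?Q = "\<lambda>y. ennreal (gauss n c y) * (ennreal (gauss n b2 (?t2 - y)) * ennreal (gauss n a2 (?u2 - scale g y)))"
  have PQ_meas: "?P \<in> borel_measurable (lborelC n)" "?Q \<in> borel_measurable (lborelC n)" by (intro density_measurable)+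
  have product_meas: "(\<lambda>z. ?P (fst z) * ?Q (snd z)) \<in> borel_measurable (lborelC2 n)" by (intro density_measurable)
  have "ennreal (16^n) * ennreal (sumdiff_pdf (T, U)) = ennreal (first.pdf (?t1, ?u1)) * ennreal (second.pdf (?t2, ?u2))"
    using first.pdf_pos second.pdf_pos by (simp add: sumdiff_pdf_def ennreal_mult[symmetric] less_imp_le)
  also have "\<dots> = (\<integral>\<^sup>+z. ?P (fst z) * ?Q (snd z) \<partial>lborelC2 n)"
    unfolding pdf_common_noise by (rule nn_integral_lborelC2_mult[OF PQ_meas, symmetric])
  finally have "ennreal (4^n) * (ennreal (16^n) * ennreal (sumdiff_pdf (T, U))) = ennreal (4^n) * (\<integral>\<^sup>+z. ?P (fst z) * ?Q (snd z) \<partial>lborelC2 n)"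
    by (simp only:)
  also have "\<dots> = (\<integral>\<^sup>+z. ennreal (64^n) * (noise z * (signal T z * interference U z)) \<partial>lborelC2 n)"
    unfolding nn_integral_half_sumdiff[OF product_meas, symmetric] by (simp only: common_noise_half_sumdiff)
  also have "\<dots> = ennreal (64^n) * ?rhs" by (intro nn_integral_cmult sumdiff_measurable)
  finally have "ennreal (64^n) * ennreal (sumdiff_pdf (T, U)) = ennreal (64^n) * ?rhs"
    by (simp add: mult.assoc[symmetric] ennreal_mult'[symmetric] power_mult_distrib[symmetric])
  then show ?thesis by (simp add: ennreal_mult_cancel_left)
qed

text \<open>The density of \<open>((T\<^sub>+, T\<^sub>-), U\<^sub>-)\<close>.\<close>

definition marginal_nn :: "cvec \<times> cvec \<Rightarrow> cvec \<Rightarrow> ennreal" where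
  "marginal_nn T u = (\<integral>\<^sup>+q. ennreal (sumdiff_pdf (T, (q, u))) \<partial>lborelC n)"

definition marginal :: "cvec \<times> cvec \<Rightarrow> cvec \<Rightarrow> real" where
  "marginal T u = enn2real (marginal_nn T u)"

lemma marginal_nn_eq:
  "marginal_nn T u = (\<integral>\<^sup>+z. noise z * (signal T z * ennreal (mixture n J \<iota> (a1 + a2) (u - scale g (snd z)))) \<partial>lborelC2 n)"
proof -
  have "marginal_nn T u = (\<integral>\<^sup>+z. \<integral>\<^sup>+q. noise z * (signal T z * interference (q, u) z) \<partial>lborelC n \<partial>lborelC2 n)"
    unfolding marginal_nn_def ennreal_sumdiff_pdf fst_conv snd_conv
    by (rule nn_integral_lborelC2_commute) (intro sumdiff_measurable)
  also have "\<dots> = (\<integral>\<^sup>+z. noise z * (signal T z * ennreal (mixture n J \<iota> (a1 + a2) (u - scale g (snd z)))) \<partial>lborelC2 n)"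
    unfolding mult.assoc[symmetric] fst_conv snd_conv
    by (intro nn_integral_cong) (subst nn_integral_cmult, auto simp: nn_integral_sumdiff_density_fst[OF J_fin a_pos] intro!: sumdiff_measurable)
  finally show ?thesis .
qed

lemma nn_integral_marginal_nn:
  assumes T_meas: "vec_measurable (lborelC n) n (\<lambda>m. fst (T m))" "vec_measurable (lborelC n) n (\<lambda>m. snd (T m))"
    and signal: "\<And>z. (\<integral>\<^sup>+m. signal (T m) z \<partial>lborelC n) = S z"
  shows "(\<integral>\<^sup>+m. marginal_nn (T m) u \<partial>lborelC n) = (\<integral>\<^sup>+z. noise z * (S z * ennreal (mixture n J \<iota> (a1 + a2) (u - scale g (snd z)))) \<partial>lborelC2 n)"
proof -
  let ?I = "\<lambda>z. ennreal (mixture n J \<iota> (a1 + a2) (u - scale g (snd z)))"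
  note T_meas' = T_meas[THEN vec_measurable_compose, OF measurable_snd]
  have "(\<integral>\<^sup>+m. marginal_nn (T m) u \<partial>lborelC n) = (\<integral>\<^sup>+z. \<integral>\<^sup>+m. noise z * (signal (T m) z * ?I z) \<partial>lborelC n \<partial>lborelC2 n)"
    unfolding marginal_nn_eq by (rule nn_integral_lborelC2_commute) (intro sumdiff_measurable T_meas')
  also have "\<dots> = (\<integral>\<^sup>+z. noise z * (S z * ?I z) \<partial>lborelC2 n)"
  proof (intro nn_integral_cong)
    fix z
    have "(\<integral>\<^sup>+m. noise z * (signal (T m) z * ?I z) \<partial>lborelC n) = (\<integral>\<^sup>+m. (noise z * ?I z) * signal (T m) z \<partial>lborelC n)"
      by (simp only: mult_ac)
    also have "\<dots> = (noise z * ?I z) * S z"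
      unfolding signal[symmetric] by (intro nn_integral_cmult sumdiff_measurable T_meas)
    finally show "(\<integral>\<^sup>+m. noise z * (signal (T m) z * ?I z) \<partial>lborelC n) = noise z * (S z * ?I z)" by (simp only: mult_ac)
  qed
  finally show ?thesis .
qed

text \<open>\<open>T\<^sub>+\<close> and \<open>U\<^sub>-\<close> are independent.\<close>

lemma nn_integral_marginal_nn_snd: "(\<integral>\<^sup>+m. marginal_nn (t, m) u \<partial>lborelC n) = ennreal (total.pdf_fst t) * ennreal (total.pdf_snd u)"
proof -
  let ?F = "\<lambda>y. ennreal (gauss n (2 * c) (y - 0)) * ennreal (mixture n A x (b1 + b2) (t - scale 1 y))"
  let ?G = "\<lambda>y. ennreal (gauss n (2 * c) (y - 0)) * ennreal (mixture n J \<iota> (a1 + a2) (u - scale g y))"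
  have "(\<integral>\<^sup>+m. marginal_nn (t, m) u \<partial>lborelC n)
      = (\<integral>\<^sup>+z. noise z * (ennreal (mixture n A x (b1 + b2) (t - fst z)) * ennreal (mixture n J \<iota> (a1 + a2) (u - scale g (snd z)))) \<partial>lborelC2 n)"
    by (rule nn_integral_marginal_nn) (auto simp: nn_integral_sumdiff_density_snd[OF A_fin b_pos])
  also have "\<dots> = (\<integral>\<^sup>+z. ?F (fst z) * ?G (snd z) \<partial>lborelC2 n)"
    by (intro nn_integral_cong) (simp add: mult_ac)
  also have "\<dots> = (\<integral>\<^sup>+y. ?F y \<partial>lborelC n) * (\<integral>\<^sup>+y. ?G y \<partial>lborelC n)"
    by (rule nn_integral_lborelC2_mult) (intro density_measurable)+
  also have "\<dots> = ennreal (mixture n A x (b1 + b2 + (cmod 1)\<^sup>2 * (2 * c)) (t - scale 1 0)) * ennreal (total.pdf_snd (u - scale g 0))"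
    by (simp only: nn_integral_mixture_conv[OF A_fin sum_noise_pos(1,2)] nn_integral_mixture_conv[OF J_fin sum_noise_pos(1,3)])
  finally show ?thesis by simp
qed

lemma nn_integral_noise: "(\<integral>\<^sup>+y. ennreal (gauss n (2 * c) y) \<partial>lborelC n) = 1"
  using nn_integral_gauss[OF sum_noise_pos(1), of n 0] by simp

lemma nn_integral_marginal_nn_fst: "(\<integral>\<^sup>+p. marginal_nn (p, t) u \<partial>lborelC n) = ennreal (total.pdf (t, u))"
proof -
  let ?G = "\<lambda>y. ennreal (gauss n (2 * c) y) * (ennreal (mixture n A x (b1 + b2) (t - y)) * ennreal (mixture n J \<iota> (a1 + a2) (u - scale g y)))"
  have "(\<integral>\<^sup>+p. marginal_nn (p, t) u \<partial>lborelC n)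
      = (\<integral>\<^sup>+z. noise z * (ennreal (mixture n A x (b1 + b2) (t - snd z)) * ennreal (mixture n J \<iota> (a1 + a2) (u - scale g (snd z)))) \<partial>lborelC2 n)"
    by (rule nn_integral_marginal_nn) (auto simp: nn_integral_sumdiff_density_fst[OF A_fin b_pos])
  also have "\<dots> = (\<integral>\<^sup>+z. ennreal (gauss n (2 * c) (fst z)) * ?G (snd z) \<partial>lborelC2 n)"
    by (simp only: mult.assoc)
  also have "\<dots> = (\<integral>\<^sup>+y. ennreal (gauss n (2 * c) y) \<partial>lborelC n) * (\<integral>\<^sup>+y. ?G y \<partial>lborelC n)"
    by (rule nn_integral_lborelC2_mult) (intro density_measurable)+
  finally show ?thesis by (simp only: nn_integral_noise pdf_common_noise mult_1_left)
qed

lemma marginal_nn_finite: "marginal_nn T u < \<infinity>"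
proof -
  let ?K = "1 / (pi * b1)^n * (1 / (pi * b2)^n)" and ?L = "1 / (pi * (a1 + a2))^n"
  have "marginal_nn T u \<le> (\<integral>\<^sup>+z. noise z * (ennreal ?K * ennreal ?L) \<partial>lborelC2 n)"
    unfolding marginal_nn_eq
    by (intro nn_integral_mono mult_left_mono mult_mono ennreal_leI sumdiff_density_le mixture_le A_fin J_fin b_pos sum_noise_pos) auto
  also have "\<dots> = (\<integral>\<^sup>+z. noise z \<partial>lborelC2 n) * (ennreal ?K * ennreal ?L)" by (intro nn_integral_multc density_measurable)
  also have "(\<integral>\<^sup>+z. noise z \<partial>lborelC2 n) = 1"
    using nn_integral_lborelC2_mult[of "\<lambda>y. ennreal (gauss n (2 * c) y)" n "\<lambda>y. ennreal (gauss n (2 * c) y)"]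
      gauss_measurable_ennreal[OF vec_measurable_proj(1)] by (simp add: nn_integral_noise)
  also have "1 * (ennreal ?K * ennreal ?L) < \<infinity>" by (simp add: ennreal_mult_less_top)
  finally show ?thesis .
qed

lemma marginal_nn_pos: "0 < marginal_nn T u"
proof (rule ccontr)
  assume "\<not> 0 < marginal_nn T u"
  then have "(\<integral>\<^sup>+q. ennreal (sumdiff_pdf (T, (q, u))) \<partial>lborelC n) = 0" by (simp add: marginal_nn_def)
  moreover have "(\<lambda>q. ennreal (sumdiff_pdf (T, (q, u)))) \<in> borel_measurable (lborelC n)"
    using sumdiff_pdf_measurable_vec[of "lborelC n" "\<lambda>_. fst T" "\<lambda>_. snd T" "\<lambda>q. q" "\<lambda>_. u"]
    by (simp add: vec_measurableI vec_measurable_proj)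
  ultimately have "AE q in lborelC n. False"
    using sumdiff_pdf_pos by (simp add: nn_integral_0_iff_AE ennreal_eq_0_iff not_le[symmetric])
  then have "(\<integral>\<^sup>+y. ennreal (gauss n (2 * c) y) \<partial>lborelC n) = (\<integral>\<^sup>+y. 0 \<partial>lborelC n)" by (intro nn_integral_cong_AE) auto
  then show False using nn_integral_noise by simp
qed

lemma marginal_pos_finite: "0 < marginal T u" "ennreal (marginal T u) = marginal_nn T u"
  using marginal_nn_finite[of T u] marginal_nn_pos[of T u] unfolding marginal_def by (auto simp: enn2real_positive_iff)

lemma marginal_nn_measurable: "(\<lambda>p. marginal_nn (fst p) (snd p)) \<in> borel_measurable (lborelC2 n \<Otimes>\<^sub>M lborelC n)"
proof -
  have "(\<lambda>q. ((fst (fst q)), (snd q, snd (fst q)))) \<in> measurable ((lborelC2 n \<Otimes>\<^sub>M lborelC n) \<Otimes>\<^sub>M lborelC n) (lborelC4 n)"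
    by simp
  from measurable_compose[OF this sumdiff_pdf_measurable] show ?thesis
    unfolding marginal_nn_def
    using sigma_finite_measure.borel_measurable_nn_integral[OF sigma_finite_lborelC, of "\<lambda>p u. ennreal (sumdiff_pdf (fst p, (u, snd p)))" "lborelC2 n \<Otimes>\<^sub>M lborelC n" n]
    by (simp add: split_beta')
qed

lemma nn_integral_sumdiff_pdf_mult_fst:
  "(\<integral>\<^sup>+q. ennreal (sumdiff_pdf (T, (q, u))) * k \<partial>lborelC n) = marginal_nn T u * k"
  unfolding marginal_nn_def
  using sumdiff_pdf_measurable_vec[of "lborelC n" "\<lambda>_. fst T" "\<lambda>_. snd T" "\<lambda>q. q" "\<lambda>_. u"]
  by (intro nn_integral_multc) (simp add: vec_measurableI vec_measurable_proj)

end

lemma has_bochner_integral_mono: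
  fixes f g :: "'a \<Rightarrow> real"
  shows "has_bochner_integral M f a \<Longrightarrow> has_bochner_integral M g b \<Longrightarrow> (\<And>x. f x \<le> g x) \<Longrightarrow> a \<le> b"
  unfolding has_bochner_integral_iff using integral_mono[of M f g] by auto

context two_copies begin

lemma nn_integral_sumdiff_pdf_diff_pair:
  assumes F_meas: "F \<in> borel_measurable (lborelC2 n)"
  shows "(\<integral>\<^sup>+w. ennreal (sumdiff_pdf w) * F (diff_pair w) \<partial>lborelC4 n) = (\<integral>\<^sup>+z. ennreal (total.pdf z) * F z \<partial>lborelC2 n)"
proof -
  have product_meas: "(\<lambda>w. ennreal (sumdiff_pdf w) * F (diff_pair w)) \<in> borel_measurable (lborelC4 n)"
    using F_meas sumdiff_pdf_measurable by simp
  have inner_meas: "(\<lambda>y. ennreal (sumdiff_pdf ((fst y, fst z), (snd y, snd z)))) \<in> borel_measurable (lborelC2 n)" for z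
    using sumdiff_pdf_measurable_vec[of "lborelC2 n" fst "\<lambda>_. fst z" snd "\<lambda>_. snd z"]
    by (simp add: vec_measurableI vec_measurable_proj)
  have "(\<integral>\<^sup>+y. ennreal (sumdiff_pdf ((fst y, fst z), (snd y, snd z))) \<partial>lborelC2 n) = ennreal (total.pdf z)" for z
    using nn_integral_lborelC2[OF inner_meas[of z]] by (simp add: marginal_nn_def[symmetric] nn_integral_marginal_nn_fst)
  then show ?thesis
    unfolding nn_integral_lborelC4_transpose(2)[OF product_meas]
    using inner_meas by (intro nn_integral_cong) (simp add: nn_integral_multc)
qed

lemma sumdiff_pdf_swap: "sumdiff_pdf ((m, p), (v, u)) = sumdiff_pdf ((p, m), (u, v))"
proof -
  have negate: "scale (1/2) (b - a) = - scale (1/2) (a - b)" for a b by (auto simp: fun_eq_iff algebra_simps)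
  show ?thesis unfolding sumdiff_pdf_def fst_conv snd_conv negate[of m p] negate[of v u]
    by (simp only: add.commute cov_density_uminus)
qed

lemma nn_integral_sumdiff_pdf_sum_pair:
  assumes F_meas: "F \<in> borel_measurable (lborelC2 n)"
  shows "(\<integral>\<^sup>+w. ennreal (sumdiff_pdf w) * F (sum_pair w) \<partial>lborelC4 n) = (\<integral>\<^sup>+z. ennreal (total.pdf z) * F z \<partial>lborelC2 n)"
proof -
  have sum_meas: "(\<lambda>w. ennreal (sumdiff_pdf w) * F (sum_pair w)) \<in> borel_measurable (lborelC4 n)"
    and diff_meas: "(\<lambda>w. ennreal (sumdiff_pdf w) * F (diff_pair w)) \<in> borel_measurable (lborelC4 n)"
    using F_meas sumdiff_pdf_measurable by simp_all
  have "(\<integral>\<^sup>+w. ennreal (sumdiff_pdf w) * F (sum_pair w) \<partial>lborelC4 n) = (\<integral>\<^sup>+w. ennreal (sumdiff_pdf w) * F (diff_pair w) \<partial>lborelC4 n)"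
    unfolding nn_integral_lborelC4_transpose(1)[OF sum_meas] nn_integral_lborelC4_transpose(2)[OF diff_meas] fst_conv snd_conv
    by (intro nn_integral_cong arg_cong2[where f="(*)"] arg_cong[where f=ennreal] sumdiff_pdf_swap refl)
  then show ?thesis using nn_integral_sumdiff_pdf_diff_pair[OF F_meas] by (simp only:)
qed

lemma nn_integral_sumdiff_pdf_halves:
  assumes F_meas: "F \<in> borel_measurable (lborelC2 n)"
  shows "(\<integral>\<^sup>+w. ennreal (sumdiff_pdf w) * F (half_sums n w) \<partial>lborelC4 n) = (\<integral>\<^sup>+z. ennreal (first.pdf z) * F z \<partial>lborelC2 n)"
    and "(\<integral>\<^sup>+w. ennreal (sumdiff_pdf w) * F (half_diffs n w) \<partial>lborelC4 n) = (\<integral>\<^sup>+z. ennreal (second.pdf z) * F z \<partial>lborelC2 n)"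
proof -
  have pdf_meas: "(\<lambda>z. ennreal (first.pdf z)) \<in> borel_measurable (lborelC2 n)" "(\<lambda>z. ennreal (second.pdf z)) \<in> borel_measurable (lborelC2 n)"
    using first.pdf_measurable second.pdf_measurable by simp_all
  have product: "(\<integral>\<^sup>+w. ennreal (sumdiff_pdf w) * (K (half_sums n w) * L (half_diffs n w)) \<partial>lborelC4 n)
      = (\<integral>\<^sup>+z. ennreal (first.pdf z) * K z \<partial>lborelC2 n) * (\<integral>\<^sup>+z. ennreal (second.pdf z) * L z \<partial>lborelC2 n)" (is "?lhs = ?rhs")
    if KL_meas: "K \<in> borel_measurable (lborelC2 n)" "L \<in> borel_measurable (lborelC2 n)" for K L
  proof -
    let ?K = "\<lambda>z. ennreal (first.pdf z) * K z" and ?L = "\<lambda>z. ennreal (second.pdf z) * L z"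
    have KL_prod_meas: "?K \<in> borel_measurable (lborelC2 n)" "?L \<in> borel_measurable (lborelC2 n)"
      using pdf_meas KL_meas by auto
    have "ennreal (sumdiff_pdf w) = ennreal (1 / 16^n) * (ennreal (first.pdf (half_sums n w)) * ennreal (second.pdf (half_diffs n w)))"
      for w
      unfolding sumdiff_pdf_half_sumdiff
      using first.pdf_pos second.pdf_pos by (simp add: ennreal_mult[symmetric] less_imp_le)
    then have "?lhs = (\<integral>\<^sup>+w. ennreal (1 / 16^n) * (?K (half_sums n w) * ?L (half_diffs n w)) \<partial>lborelC4 n)"
      by (simp only: mult_ac)
    also have "\<dots> = ennreal (1 / 16^n) * (ennreal (16^n) * ?rhs)"
      unfolding nn_integral_half_sums_half_diffs[OF KL_prod_meas, symmetric]
      by (intro nn_integral_cmult borel_measurable_times_ennreal measurable_compose[OF half_sums_measurable(1) KL_prod_meas(1)] measurable_compose[OF half_sums_measurable(2) KL_prod_meas(2)])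
    finally show ?thesis by (simp add: mult.assoc[symmetric] ennreal_mult'[symmetric])
  qed
  show "(\<integral>\<^sup>+w. ennreal (sumdiff_pdf w) * F (half_sums n w) \<partial>lborelC4 n) = (\<integral>\<^sup>+z. ennreal (first.pdf z) * F z \<partial>lborelC2 n)"
    using product[OF F_meas, of "\<lambda>_. 1"] second.nn_integral_pdf by simp
  show "(\<integral>\<^sup>+w. ennreal (sumdiff_pdf w) * F (half_diffs n w) \<partial>lborelC4 n) = (\<integral>\<^sup>+z. ennreal (second.pdf z) * F z \<partial>lborelC2 n)"
    using product[OF _ F_meas, of "\<lambda>_. 1"] first.nn_integral_pdf by simp
qed

lemma has_bochner_integral_sumdiff_pdf_mult:
  assumes X_meas: "X \<in> measurable (lborelC4 n) (lborelC2 n)" and r_meas: "r \<in> borel_measurable (lborelC2 n)"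
    and r_nonneg: "\<And>z. 0 \<le> r z"
    and L_meas: "L \<in> borel_measurable (lborelC2 n)" and V: "has_bochner_integral (lborelC2 n) (\<lambda>z. r z * L z) V"
    and pushforward: "\<And>F. F \<in> borel_measurable (lborelC2 n) \<Longrightarrow> (\<integral>\<^sup>+w. ennreal (sumdiff_pdf w) * F (X w) \<partial>lborelC4 n) = (\<integral>\<^sup>+z. ennreal (r z) * F z \<partial>lborelC2 n)"
  shows "has_bochner_integral (lborelC4 n) (\<lambda>w. sumdiff_pdf w * L (X w)) V"
  using integral_push_density[OF X_meas sumdiff_pdf_measurable r_meas less_imp_le[OF sumdiff_pdf_pos] r_nonneg pushforward L_meas] V
  by (simp add: has_bochner_integral_iff)

text \<open>The logarithm of \<open>ratio1 * ratio2\<close> integrates to the difference of informations to be bounded. Each factor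
  has mean one, and \<open>marginal\<close>, which has no closed form, cancels in the product.\<close>

abbreviation "sumdiff_fst \<equiv> sumdiff_density n A x (b1 + c) (b2 + c)"
abbreviation "sumdiff_snd \<equiv> sumdiff_density n J \<iota> (a1 + (cmod g)\<^sup>2 * c) (a2 + (cmod g)\<^sup>2 * c)"
definition ratio1 :: "(cvec \<times> cvec) \<times> cvec \<times> cvec \<Rightarrow> real" where
  "ratio1 w = sumdiff_fst (fst w) * total.pdf (diff_pair w) / (total.pdf_fst (snd (fst w)) * marginal (fst w) (snd (snd w)))"

definition ratio2 :: "(cvec \<times> cvec) \<times> cvec \<times> cvec \<Rightarrow> real" where
  "ratio2 w = total.pdf (sum_pair w) * sumdiff_snd (snd w) * marginal (fst w) (snd (snd w))
  / (total.pdf_snd (fst (snd w)) * total.pdf_fst (fst (fst w)) * total.pdf_snd (snd (snd w)) * sumdiff_pdf w)"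

lemma factors_pos: "0 < sumdiff_fst z" "0 < sumdiff_snd z" "0 < total.pdf_fst y" "0 < total.pdf_snd y"
  using sumdiff_density_pos[OF A_fin first.fst_noise_pos second.fst_noise_pos] sumdiff_density_pos[OF J_fin first.snd_noise_pos second.snd_noise_pos]
    mixture_pos[OF A_fin total.fst_noise_pos] mixture_pos[OF J_fin total.snd_noise_pos] by auto

lemma ratio_pos: "0 < ratio1 w" "0 < ratio2 w"
  unfolding ratio1_def ratio2_def
  by (intro divide_pos_pos mult_pos_pos factors_pos total.pdf_pos marginal_pos_finite(1) sumdiff_pdf_pos)+

lemma ratio_measurable: "ratio1 \<in> borel_measurable (lborelC4 n)" "ratio2 \<in> borel_measurable (lborelC4 n)"
proof -
  have "(\<lambda>w. (fst w, snd (snd w))) \<in> measurable (lborelC4 n) (lborelC2 n \<Otimes>\<^sub>M lborelC n)" by simp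
  from measurable_compose[OF this marginal_nn_measurable]
  have marginal_meas: "(\<lambda>w. marginal (fst w) (snd (snd w))) \<in> borel_measurable (lborelC4 n)" unfolding marginal_def by simp
  have sumdiff_meas: "(\<lambda>w. sumdiff_fst (fst w)) \<in> borel_measurable (lborelC4 n)" "(\<lambda>w. sumdiff_snd (snd w)) \<in> borel_measurable (lborelC4 n)"
    using sumdiff_density_measurable(1)[OF vec_measurable_pair_proj(1,2)] sumdiff_density_measurable(1)[OF vec_measurable_pair_proj(3,4)]
    by simp_all
  show "ratio1 \<in> borel_measurable (lborelC4 n)" "ratio2 \<in> borel_measurable (lborelC4 n)"
    unfolding ratio1_def[abs_def] ratio2_def[abs_def]
    by (intro sumdiff_meas marginal_meas sumdiff_pdf_measurable sumdiff_measurable)+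
qed

lemma nn_integral_ratio1_inner:
  "(\<integral>\<^sup>+q. ennreal (sumdiff_pdf ((p, fst z), (q, snd z)) * ratio1 ((p, fst z), (q, snd z))) \<partial>lborelC n)
    = ennreal (total.pdf z / total.pdf_fst (fst z)) * ennreal (sumdiff_fst (p - 0, fst z))"
proof -
  let ?T = "(p, fst z)" and ?u = "snd z"
  let ?k = "sumdiff_fst ?T * total.pdf z / (total.pdf_fst (fst z) * marginal ?T ?u)"
  note positive = factors_pos(1)[of ?T] total.pdf_pos[of z] factors_pos(3)[of "fst z"] marginal_pos_finite(1)[of ?T ?u]
  have k_nonneg: "0 \<le> ?k" using positive by simp
  have "(\<integral>\<^sup>+q. ennreal (sumdiff_pdf (?T, (q, ?u)) * ratio1 (?T, (q, ?u))) \<partial>lborelC n) = (\<integral>\<^sup>+q. ennreal (sumdiff_pdf (?T, (q, ?u))) * ennreal ?k \<partial>lborelC n)"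
    unfolding ratio1_def fst_conv snd_conv prod.collapse
    using k_nonneg by (intro nn_integral_cong ennreal_mult less_imp_le[OF sumdiff_pdf_pos])
  also have "\<dots> = ennreal (marginal ?T ?u * ?k)"
    unfolding nn_integral_sumdiff_pdf_mult_fst marginal_pos_finite(2)[symmetric]
    using positive k_nonneg by (simp only: ennreal_mult less_imp_le)
  also have "marginal ?T ?u * ?k = total.pdf z / total.pdf_fst (fst z) * sumdiff_fst ?T" using positive by simp
  also have "ennreal \<dots> = ennreal (total.pdf z / total.pdf_fst (fst z)) * ennreal (sumdiff_fst (p - 0, fst z))"
    unfolding diff_zero using positive by (intro ennreal_mult) auto
  finally show ?thesis .
qed

lemma nn_integral_ratio1: "(\<integral>\<^sup>+w. ennreal (sumdiff_pdf w * ratio1 w) \<partial>lborelC4 n) = 1"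
proof -
  let ?F = "\<lambda>z y. ennreal (sumdiff_pdf ((fst y, fst z), (snd y, snd z)) * ratio1 ((fst y, fst z), (snd y, snd z)))"
  have product_meas: "(\<lambda>w. ennreal (sumdiff_pdf w * ratio1 w)) \<in> borel_measurable (lborelC4 n)"
    using ratio_measurable sumdiff_pdf_measurable by simp
  have "(\<integral>\<^sup>+y. ?F z y \<partial>lborelC2 n) = ennreal (total.pdf z)" if "z \<in> space (lborelC2 n)" for z
  proof -
    have "?F z \<in> borel_measurable (lborelC2 n)"
      using that by (intro measurable_compose[OF _ product_meas]) (auto simp: space_pair_measure)
    from nn_integral_lborelC2[OF this]
    have "(\<integral>\<^sup>+y. ?F z y \<partial>lborelC2 n) = (\<integral>\<^sup>+p. ennreal (total.pdf z / total.pdf_fst (fst z)) * ennreal (sumdiff_fst (p - 0, fst z)) \<partial>lborelC n)"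
      by (simp only: fst_conv snd_conv nn_integral_ratio1_inner)
    also have "\<dots> = ennreal (total.pdf z / total.pdf_fst (fst z)) * (\<integral>\<^sup>+p. ennreal (sumdiff_fst (p - 0, fst z)) \<partial>lborelC n)"
      by (intro nn_integral_cmult sumdiff_measurable)
    also have "\<dots> = ennreal (total.pdf z)"
      using total.pdf_pos[of z] factors_pos(3)[of "fst z"]
      by (simp only: nn_integral_sumdiff_density_fst[OF A_fin first.fst_noise_pos second.fst_noise_pos]) (simp add: ennreal_mult[symmetric] algebra_simps)
    finally show ?thesis .
  qed
  then show ?thesis
    unfolding nn_integral_lborelC4_transpose(2)[OF product_meas] total.nn_integral_pdf[symmetric] by (intro nn_integral_cong)
qed

abbreviation "ratio2_factor y u \<equiv> total.pdf y * sumdiff_snd (snd y, u) / (total.pdf_snd (snd y) * total.pdf_fst (fst y) * total.pdf_snd u)"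

lemma ratio2_factor_nonneg: "0 \<le> ratio2_factor y u"
  using factors_pos total.pdf_pos by (intro divide_nonneg_nonneg mult_nonneg_nonneg less_imp_le) auto

lemma ennreal_sumdiff_pdf_ratio2: "ennreal (sumdiff_pdf w * ratio2 w) = marginal_nn (fst w) (snd (snd w)) * ennreal (ratio2_factor (sum_pair w) (snd (snd w)))"
proof -
  have "sumdiff_pdf w * ratio2 w = marginal (fst w) (snd (snd w)) * ratio2_factor (sum_pair w) (snd (snd w))"
    using sumdiff_pdf_pos[of w] by (simp add: ratio2_def mult_ac)
  then show ?thesis using ratio2_factor_nonneg marginal_pos_finite by (simp only: ennreal_mult less_imp_le)
qed

lemma nn_integral_ratio2_inner:
  assumes y: "y \<in> space (lborelC2 n)" and u: "u \<in> space (lborelC n)"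
  shows "(\<integral>\<^sup>+p. marginal_nn (fst y, p) u * ennreal (ratio2_factor y u) \<partial>lborelC n) = ennreal (total.pdf y / total.pdf_snd (snd y)) * ennreal (sumdiff_snd (snd y, u - 0))"
proof -
  note positive = factors_pos(2)[of "(snd y, u)"] total.pdf_pos[of y] factors_pos(3)[of "fst y"] factors_pos(4)[of "snd y"] factors_pos(4)[of u]
  have "(\<lambda>p. ((fst y, p), u)) \<in> measurable (lborelC n) (lborelC2 n \<Otimes>\<^sub>M lborelC n)"
    using y u by (auto simp: space_pair_measure)
  from measurable_compose[OF this marginal_nn_measurable] have "(\<lambda>p. marginal_nn (fst y, p) u) \<in> borel_measurable (lborelC n)"
    by simp
  then have "(\<integral>\<^sup>+p. marginal_nn (fst y, p) u * ennreal (ratio2_factor y u) \<partial>lborelC n) = ennreal (total.pdf_fst (fst y)) * ennreal (total.pdf_snd u) * ennreal (ratio2_factor y u)"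
    by (simp only: nn_integral_multc nn_integral_marginal_nn_snd)
  also have "\<dots> = ennreal (total.pdf_fst (fst y) * total.pdf_snd u * ratio2_factor y u)"
    using positive ratio2_factor_nonneg[of y u] by (simp only: ennreal_mult less_imp_le mult_pos_pos)
  also have "total.pdf_fst (fst y) * total.pdf_snd u * ratio2_factor y u = total.pdf y / total.pdf_snd (snd y) * sumdiff_snd (snd y, u - 0)"
    using positive by simp
  also have "ennreal \<dots> = ennreal (total.pdf y / total.pdf_snd (snd y)) * ennreal (sumdiff_snd (snd y, u - 0))"
    unfolding diff_zero using positive by (intro ennreal_mult) auto
  finally show ?thesis .
qed

lemma nn_integral_ratio2: "(\<integral>\<^sup>+w. ennreal (sumdiff_pdf w * ratio2 w) \<partial>lborelC4 n) = 1"
proof -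
  let ?F = "\<lambda>y z. ennreal (sumdiff_pdf ((fst y, fst z), (snd y, snd z)) * ratio2 ((fst y, fst z), (snd y, snd z)))"
  have product_meas: "(\<lambda>w. ennreal (sumdiff_pdf w * ratio2 w)) \<in> borel_measurable (lborelC4 n)"
    using ratio_measurable sumdiff_pdf_measurable by simp
  have "(\<integral>\<^sup>+z. ?F y z \<partial>lborelC2 n) = ennreal (total.pdf y)" if y: "y \<in> space (lborelC2 n)" for y
  proof -
    have "?F y \<in> borel_measurable (lborelC2 n)"
      using y by (intro measurable_compose[OF _ product_meas]) (auto simp: space_pair_measure)
    from nn_integral_lborelC2'[OF this]
    have "(\<integral>\<^sup>+z. ?F y z \<partial>lborelC2 n) = (\<integral>\<^sup>+u. \<integral>\<^sup>+p. marginal_nn (fst y, p) u * ennreal (ratio2_factor y u) \<partial>lborelC n \<partial>lborelC n)"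
      by (simp only: ennreal_sumdiff_pdf_ratio2 fst_conv snd_conv prod.collapse)
    also have "\<dots> = (\<integral>\<^sup>+u. ennreal (total.pdf y / total.pdf_snd (snd y)) * ennreal (sumdiff_snd (snd y, u - 0)) \<partial>lborelC n)"
      by (rule nn_integral_cong) (rule nn_integral_ratio2_inner[OF y])
    also have "\<dots> = ennreal (total.pdf y / total.pdf_snd (snd y)) * (\<integral>\<^sup>+u. ennreal (sumdiff_snd (snd y, u - 0)) \<partial>lborelC n)"
      by (intro nn_integral_cmult sumdiff_measurable)
    also have "\<dots> = ennreal (total.pdf y)"
      using total.pdf_pos[of y] factors_pos(4)[of "snd y"]
      by (simp only: nn_integral_sumdiff_density_snd[OF J_fin first.snd_noise_pos second.snd_noise_pos]) (simp add: ennreal_mult[symmetric] algebra_simps)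
    finally show ?thesis .
  qed
  then show ?thesis
    unfolding nn_integral_lborelC4_transpose(1)[OF product_meas] total.nn_integral_pdf[symmetric] by (intro nn_integral_cong)
qed

lemma info_le_ratios:
  "total.info (sum_pair w) + total.info (diff_pair w) - first.info (half_sums n w) - second.info (half_diffs n w) \<le> ratio1 w + ratio2 w - 2"
proof -
  have sumdiff_fst: "sumdiff_fst (fst w) = first.pdf_fst (fst (half_sums n w)) * second.pdf_fst (fst (half_diffs n w)) / 4^n"
    unfolding sumdiff_density_def fst_conv mixture_singleton
    by (intro arg_cong2[where f="(/)"] arg_cong2[where f="(*)"] mixture_cong gauss_cong refl) (simp_all add: half_sumdiff_def)
  have sumdiff_snd: "sumdiff_snd (snd w) = first.pdf_snd (snd (half_sums n w)) * second.pdf_snd (snd (half_diffs n w)) / 4^n"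
    unfolding sumdiff_density_def snd_conv mixture_singleton
    by (intro arg_cong2[where f="(/)"] arg_cong2[where f="(*)"] mixture_cong gauss_cong refl) (simp_all add: half_sumdiff_def)
  have halves_pos: "0 < first.pdf_fst y" "0 < first.pdf_snd y" "0 < second.pdf_fst y" "0 < second.pdf_snd y" for y
    using mixture_pos[OF A_fin first.fst_noise_pos] mixture_pos[OF J_fin first.snd_noise_pos] second.fst_noise_pos second.snd_noise_pos
    by auto
  have "ln (ratio1 w) = ln (sumdiff_fst (fst w)) + ln (total.pdf (diff_pair w)) - (ln (total.pdf_fst (snd (fst w))) + ln (marginal (fst w) (snd (snd w))))"
    unfolding ratio1_def
    using factors_pos total.pdf_pos marginal_pos_finite(1) by (simp only: ln_divide_pos ln_mult_pos mult_pos_pos)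
  moreover have "ln (ratio2 w) = ln (total.pdf (sum_pair w)) + ln (sumdiff_snd (snd w)) + ln (marginal (fst w) (snd (snd w)))
      - (ln (total.pdf_snd (fst (snd w))) + ln (total.pdf_fst (fst (fst w))) + ln (total.pdf_snd (snd (snd w))) + ln (sumdiff_pdf w))"
    unfolding ratio2_def using factors_pos total.pdf_pos marginal_pos_finite(1) sumdiff_pdf_pos
    by (simp only: ln_divide_pos ln_mult_pos mult_pos_pos)
  moreover have "ln (sumdiff_pdf w) = ln (first.pdf (half_sums n w)) + ln (second.pdf (half_diffs n w)) - real n * ln 16"
    unfolding sumdiff_pdf_half_sumdiff using first.pdf_pos second.pdf_pos
    by (simp only: ln_divide_pos ln_mult_pos mult_pos_pos ln_realpow zero_less_power zero_less_numeral)
  moreover have "ln (sumdiff_fst (fst w)) = ln (first.pdf_fst (fst (half_sums n w))) + ln (second.pdf_fst (fst (half_diffs n w))) - real n * ln 4"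
    "ln (sumdiff_snd (snd w)) = ln (first.pdf_snd (snd (half_sums n w))) + ln (second.pdf_snd (snd (half_diffs n w))) - real n * ln 4"
    unfolding sumdiff_fst sumdiff_snd using halves_pos
    by (simp_all only: ln_divide_pos ln_mult_pos mult_pos_pos ln_realpow zero_less_power zero_less_numeral)
  moreover have "ln (16::real) = 2 * ln 4" using ln_realpow[of "4::real" 2] by simp
  ultimately have "total.info (sum_pair w) + total.info (diff_pair w) - first.info (half_sums n w) - second.info (half_diffs n w) = ln (ratio1 w) + ln (ratio2 w)"
    by (simp only: fst_conv snd_conv)
  also have "\<dots> \<le> (ratio1 w - 1) + (ratio2 w - 1)" using ratio_pos by (intro add_mono ln_le_minus_one)
  finally show ?thesis by simp
qed

lemma information_sumdiff_le:
  "2 * information n A x J \<iota> (b1 + b2 + 2 * c) (a1 + a2 + (cmod g)\<^sup>2 * (2 * c)) (g * of_real (2 * c))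
    \<le> information n A x J \<iota> (b1 + c) (a1 + (cmod g)\<^sup>2 * c) (g * of_real c)
      + information n {()} (\<lambda>_. 0) {()} (\<lambda>_. 0) (b2 + c) (a2 + (cmod g)\<^sup>2 * c) (g * of_real c)" (is "2 * ?total \<le> ?first + ?second")
proof -
  let ?info = "\<lambda>w. total.info (sum_pair w) + total.info (diff_pair w) - first.info (half_sums n w) - second.info (half_diffs n w)"
  have sum_meas: "sum_pair \<in> measurable (lborelC4 n) (lborelC2 n)"
    and diff_meas: "diff_pair \<in> measurable (lborelC4 n) (lborelC2 n)" by simp_all
  note push_total = has_bochner_integral_sumdiff_pdf_mult[OF _ total.pdf_measurable less_imp_le[OF total.pdf_pos]]
  have info: "has_bochner_integral (lborelC4 n) (\<lambda>w. sumdiff_pdf w * ?info w) (?total + ?total - ?first - ?second)"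
    unfolding distrib_left[of "sumdiff_pdf _"] right_diff_distrib[of "sumdiff_pdf _" "_ + _"] right_diff_distrib[of "sumdiff_pdf _" "_ - first.info _"]
      right_diff_distrib[of "sumdiff_pdf _" "_ + _" "first.info _"]
    by (intro has_bochner_integral_add has_bochner_integral_diff
        push_total[OF sum_meas total.info_measurable total.has_bochner_integral_info nn_integral_sumdiff_pdf_sum_pair]
        push_total[OF diff_meas total.info_measurable total.has_bochner_integral_info nn_integral_sumdiff_pdf_diff_pair]
        has_bochner_integral_sumdiff_pdf_mult[OF half_sums_measurable(1) first.pdf_measurable less_imp_le[OF first.pdf_pos] first.info_measurable first.has_bochner_integral_info nn_integral_sumdiff_pdf_halves(1)]
        has_bochner_integral_sumdiff_pdf_mult[OF half_sums_measurable(2) second.pdf_measurable less_imp_le[OF second.pdf_pos] second.info_measurable second.has_bochner_integral_info nn_integral_sumdiff_pdf_halves(2)])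
  have "(\<integral>\<^sup>+w. ennreal (sumdiff_pdf w) \<partial>lborelC4 n) = 1"
    using nn_integral_sumdiff_pdf_sum_pair[of "\<lambda>_. 1"] total.nn_integral_pdf by simp
  then have ratios: "has_bochner_integral (lborelC4 n) (\<lambda>w. sumdiff_pdf w * ratio1 w + sumdiff_pdf w * ratio2 w - 2 * sumdiff_pdf w) (1 + 1 - 2 * 1)"
    using nn_integral_ratio1 nn_integral_ratio2 ratio_measurable sumdiff_pdf_measurable less_imp_le[OF sumdiff_pdf_pos] less_imp_le[OF ratio_pos(1)] less_imp_le[OF ratio_pos(2)]
    by (intro has_bochner_integral_add has_bochner_integral_diff has_bochner_integral_mult_right has_bochner_integral_nn_integral borel_measurable_times) auto
  have "?total + ?total - ?first - ?second \<le> 1 + 1 - 2 * 1"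
  proof (rule has_bochner_integral_mono[OF info ratios])
    fix w
    have "sumdiff_pdf w * ?info w \<le> sumdiff_pdf w * (ratio1 w + ratio2 w - 2)"
      using sumdiff_pdf_pos[of w] info_le_ratios[of w] by (intro mult_left_mono) auto
    then show "sumdiff_pdf w * ?info w \<le> sumdiff_pdf w * ratio1 w + sumdiff_pdf w * ratio2 w - 2 * sumdiff_pdf w"
      by (simp only: distrib_left right_diff_distrib[of "sumdiff_pdf w" _ 2] mult.commute[of _ 2])
  qed
  then show ?thesis by simp
qed

end

theorem information_doubling_le:
  assumes A_fin: "finite A" "A \<noteq> {}" and J_fin: "finite J" "J \<noteq> {}" and variances_pos: "0 < e1" "0 < e2" "0 < w1" "0 < w2"
    and cross_lt: "(cmod r)\<^sup>2 < min e1 e2 * min w1 w2"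
  shows "2 * information n A x J \<iota> (e1 + e2) (w1 + w2) (2 * r) \<le> information n A x J \<iota> e1 w1 r - real n * ln (1 - (cmod r)\<^sup>2 / (e2 * w2))"
proof -
  have min_pos: "0 < min w1 w2" using variances_pos by simp
  then have "(cmod r)\<^sup>2 / min w1 w2 < min e1 e2" using cross_lt by (simp only: pos_divide_less_eq)
  then obtain c where c: "(cmod r)\<^sup>2 / min w1 w2 < c" "c < min e1 e2" using dense by blast
  have c_pos: "0 < c" using c(1) min_pos by (smt (verit) divide_nonneg_nonneg zero_le_power2)
  define g where "g = r / of_real c"
  have r: "g * of_real c = r" "g * of_real (2 * c) = 2 * r" and g_sq: "(cmod g)\<^sup>2 * c = (cmod r)\<^sup>2 / c"
    using c_pos by (simp_all add: g_def norm_divide power_divide power2_eq_square)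
  have "(cmod r)\<^sup>2 < c * min w1 w2" using c(1) min_pos by (simp add: pos_divide_less_eq)
  then have residual_pos: "(cmod r)\<^sup>2 / c < w1" "(cmod r)\<^sup>2 / c < w2"
    using c_pos by (auto simp: pos_divide_less_eq mult.commute min_def split: if_splits intro: order.strict_trans2 mult_right_mono)
  interpret two_copies n A x J \<iota> "e1 - c" "e2 - c" "w1 - (cmod r)\<^sup>2 / c" "w2 - (cmod r)\<^sup>2 / c" c g
    by unfold_locales (use A_fin J_fin c c_pos residual_pos in auto)
  have "(cmod r)\<^sup>2 < e2 * w2" using cross_lt mult_mono[of "min e1 e2" e2 "min w1 w2" w2] variances_pos by auto
  from information_sumdiff_le information_gauss[OF variances_pos(2) this, of n] show ?thesis
    by (simp add: r g_sq mult.left_commute[of _ 2])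
qed

section \<open>Gaussian codebooks minimise the information through correlated noise\<close>

lemma exp_le_quadratic: fixes x :: real assumes "x \<le> 1" shows "exp x \<le> 1 + x + x\<^sup>2"
proof (cases "0 \<le> x")
  case True
  then show ?thesis using exp_bound[of x] assms by simp
next
  case False
  have "1 - x \<le> exp (- x)" using exp_ge_add_one_self[of "- x"] by simp
  then have "(1 - x) * exp x \<le> 1" using mult_right_mono[of "1 - x" "exp (- x)" "exp x"] by (simp add: exp_minus)
  also have "1 \<le> 1 - x^3" using False by (simp add: power3_eq_cube mult_nonneg_nonpos mult_nonpos_nonpos)
  also have "1 - x^3 = (1 - x) * (1 + x + x\<^sup>2)" by (simp add: algebra_simps power2_eq_square power3_eq_cube)
  finally show ?thesis using False by simp
qed

lemma gauss_product_quotient: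
  assumes v_pos: "0 < v"
  shows "gauss n v (y - m) * gauss n v (y - m') / gauss n v y = gauss n v (y - (m + m')) * exp (2 * re_inner n m m' / v)"
proof -
  have "- sqnorm n (y - m) + - sqnorm n (y - m') - - sqnorm n y = - sqnorm n (y - (m + m')) + 2 * re_inner n m m'"
    unfolding sqnorm_diff sqnorm_add re_inner_linear by simp
  then have "(- sqnorm n (y - m) + - sqnorm n (y - m') - - sqnorm n y) / v = (- sqnorm n (y - (m + m')) + 2 * re_inner n m m') / v"
    by (simp only:)
  then have "- sqnorm n (y - m) / v + - sqnorm n (y - m') / v - - sqnorm n y / v = - sqnorm n (y - (m + m')) / v + 2 * re_inner n m m' / v"
    by (simp only: add_divide_distrib diff_divide_distrib)
  then have exponents: "exp (- sqnorm n (y - m) / v) * exp (- sqnorm n (y - m') / v) / exp (- sqnorm n y / v) = exp (- sqnorm n (y - (m + m')) / v) * exp (2 * re_inner n m m' / v)"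
    by (simp only: exp_add[symmetric] exp_diff[symmetric])
  have normalisation: "A / p * (B / p) / (C / p) = A * B / C / p" if "p \<noteq> 0" for A B C p :: real using that by simp
  have "(pi * v)^n \<noteq> 0" using v_pos by simp
  then show ?thesis unfolding gauss_def normalisation[OF \<open>(pi * v)^n \<noteq> 0\<close>] exponents by simp
qed

lemma has_bochner_integral_mixture_chi_square:
  assumes v_pos: "0 < v"
  shows "has_bochner_integral (lborelC n) (\<lambda>y. mixture n A x v y * (mixture n A x v y / gauss n v y))
    ((\<Sum>a\<in>A. \<Sum>b\<in>A. exp (2 * re_inner n (x a) (x b) / v)) / (real (card A) * real (card A)))"
proof -
  have "mixture n A x v y * (mixture n A x v y / gauss n v y) = (\<Sum>a\<in>A. \<Sum>b\<in>A. gauss n v (y - x a) * gauss n v (y - x b) / gauss n v y) / (real (card A) * real (card A))"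
    for y
    unfolding mixture_def by (simp add: sum_product sum_divide_distrib mult_ac)
  moreover have "has_bochner_integral (lborelC n) (\<lambda>y. gauss n v (y - (x a + x b)) * exp (2 * re_inner n (x a) (x b) / v)) (1 * exp (2 * re_inner n (x a) (x b) / v))"
    for a b
    by (intro has_bochner_integral_mult_left has_bochner_integral_gauss v_pos)
  ultimately show ?thesis
    unfolding gauss_product_quotient[OF v_pos]
    by (simp only: mult_1) (intro has_bochner_integral_divide_zero has_bochner_integral_sum)
qed

lemma sum_exp_re_inner_le:
  assumes centred: "centred n A x" and v_pos: "0 < v" and M: "\<And>a b. a \<in> A \<Longrightarrow> b \<in> A \<Longrightarrow> \<bar>2 * re_inner n (x a) (x b)\<bar> \<le> M" "M \<le> v"
  shows "(\<Sum>a\<in>A. \<Sum>b\<in>A. exp (2 * re_inner n (x a) (x b) / v)) \<le> real (card A) * real (card A) * (1 + (M / v)\<^sup>2)"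
proof -
  have "(\<Sum>a\<in>A. \<Sum>b\<in>A. exp (2 * re_inner n (x a) (x b) / v)) \<le> (\<Sum>a\<in>A. \<Sum>b\<in>A. 1 + 2 / v * re_inner n (x a) (x b) + (M / v)\<^sup>2)"
  proof (intro sum_mono)
    fix a b assume "a \<in> A" "b \<in> A"
    let ?t = "2 * re_inner n (x a) (x b) / v"
    have abs_le: "\<bar>?t\<bar> \<le> M / v" using M(1)[OF \<open>a \<in> A\<close> \<open>b \<in> A\<close>] v_pos by (simp add: abs_divide divide_right_mono)
    have "?t \<le> 1" using abs_le M(2) v_pos by (smt (verit) divide_le_eq_1)
    then have "exp ?t \<le> 1 + ?t + ?t\<^sup>2" by (rule exp_le_quadratic)
    also have "?t\<^sup>2 \<le> (M / v)\<^sup>2" using power_mono[OF abs_le abs_ge_zero, of 2] by (simp only: power2_abs)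
    finally show "exp ?t \<le> 1 + 2 / v * re_inner n (x a) (x b) + (M / v)\<^sup>2" by simp
  qed
  also have "\<dots> = real (card A) * real (card A) * (1 + (M / v)\<^sup>2) + 2 / v * (\<Sum>a\<in>A. \<Sum>b\<in>A. re_inner n (x a) (x b))"
    by (simp add: sum.distrib sum_distrib_left algebra_simps)
  also have "(\<Sum>a\<in>A. \<Sum>b\<in>A. re_inner n (x a) (x b)) = 0"
    using centred_sum_re_inner[OF centred, where k=1] by simp
  finally show ?thesis by simp
qed

lemma entropy_ge_high_noise:
  assumes A_fin: "finite A" "A \<noteq> {}" and centred: "centred n A x" and v_pos: "0 < v" and P_nonneg: "0 \<le> P"
    and power: "(\<Sum>a\<in>A. sqnorm n (x a)) = real (card A) * (real n * P)"
    and M: "\<And>a b. a \<in> A \<Longrightarrow> b \<in> A \<Longrightarrow> \<bar>2 * re_inner n (x a) (x b)\<bar> \<le> M" "M \<le> v"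
  shows "gauss_entropy n (P + v) - (M / v)\<^sup>2 \<le> entropy n A x v"
proof -
  let ?f = "mixture n A x v" and ?g = "gauss n v"
  let ?S = "(\<Sum>a\<in>A. \<Sum>b\<in>A. exp (2 * re_inner n (x a) (x b) / v)) / (real (card A) * real (card A))"
  have card_pos: "0 < real (card A)" using A_fin by (simp add: card_gt_0_iff)
  have cross: "has_bochner_integral (lborelC n) (\<lambda>y. ?f y * ln (?g y)) (- ((real n * v + real n * P) / v) - real n * ln (pi * v))"
    using mixture_cross_entropy_gauss[OF A_fin v_pos v_pos, of n x 1 0] power card_pos by simp
  have "- entropy n A x v \<le> ?S - 1 + (- ((real n * v + real n * P) / v) - real n * ln (pi * v))"
  proof (rule has_bochner_integral_mono)
    show "has_bochner_integral (lborelC n) (\<lambda>y. ?f y * ln (?f y)) (- entropy n A x v)"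
      using has_bochner_integral_entropy[OF A_fin v_pos, of n x 0] by simp
    show "has_bochner_integral (lborelC n) (\<lambda>y. ?f y * (?f y / ?g y) - ?f y + ?f y * ln (?g y)) (?S - 1 + (- ((real n * v + real n * P) / v) - real n * ln (pi * v)))"
      using has_bochner_integral_mixture[OF A_fin v_pos, of n x 0]
      by (intro has_bochner_integral_add has_bochner_integral_diff has_bochner_integral_mixture_chi_square v_pos cross) simp
    fix y
    have f_pos: "0 < ?f y" and g_pos: "0 < ?g y" using mixture_pos[OF A_fin v_pos] v_pos by auto
    have "ln (?f y / ?g y) \<le> ?f y / ?g y - 1" using f_pos g_pos by (intro ln_le_minus_one) simp
    then have "?f y * ln (?f y) \<le> ?f y * (?f y / ?g y - 1 + ln (?g y))"
      using f_pos g_pos by (intro mult_left_mono) (simp_all add: ln_div)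
    then show "?f y * ln (?f y) \<le> ?f y * (?f y / ?g y) - ?f y + ?f y * ln (?g y)"
      by (simp only: distrib_left right_diff_distrib mult_1_right)
  qed
  moreover have "?S \<le> 1 + (M / v)\<^sup>2"
    using sum_exp_re_inner_le[OF centred v_pos M] card_pos by (simp add: divide_le_eq mult.commute)
  moreover have "(real n * v + real n * P) / v = real n + real n * (P / v)" using v_pos by (simp add: field_simps)
  moreover have "gauss_entropy n (P + v) \<le> gauss_entropy n v + real n * (P / v)"
  proof -
    have "P + v = (1 + P / v) * v" using v_pos by (simp add: field_simps)
    then have "gauss_entropy n (P + v) = gauss_entropy n v + real n * ln (1 + P / v)"
      using v_pos P_nonneg by (simp only:) (intro gauss_entropy_mult add_pos_nonneg, auto)
    also have "real n * ln (1 + P / v) \<le> real n * (P / v)"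
      using v_pos P_nonneg by (intro mult_left_mono ln_add_one_self_le_self) auto
    finally show ?thesis by simp
  qed
  ultimately show ?thesis using gauss_entropy_eq[OF v_pos, of n] by linarith
qed

lemma (in noisy_codeword_pair) joint_density_cross_entropy_gauss:
  assumes J_centred: "centred n J \<iota>" and u_pos: "0 < u" and nontrivial: "\<alpha> \<noteq> 0 \<or> \<beta> \<noteq> 0"
    and x_power: "(\<Sum>a\<in>A. sqnorm n (x a)) = real (card A) * (real n * P)"
    and \<iota>_power: "(\<Sum>w\<in>J. sqnorm n (\<iota> w)) = real (card J) * (real n * Q)"
  shows "has_bochner_integral (lborelC2 n) (\<lambda>z. joint z * ln (gauss n u (scale \<alpha> (fst z) + scale \<beta> (snd z) + 0)))
    (- (real n * ((cmod (\<alpha> + \<beta> * g))\<^sup>2 * e + (cmod \<beta>)\<^sup>2 * v + (cmod \<alpha>)\<^sup>2 * P + (cmod \<beta>)\<^sup>2 * Q) / u) - real n * ln (pi * u))"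
proof -
  let ?K = "(cmod (\<alpha> + \<beta> * g))\<^sup>2 * real n * e + (cmod \<beta>)\<^sup>2 * real n * v + (cmod \<beta>)\<^sup>2 * (real n * Q)"
  have A_card: "real (card A) \<noteq> 0" and J_card: "0 < real (card J)" using A_fin J_fin by (auto simp: card_gt_0_iff)
  have "(\<Sum>w\<in>J. sqnorm n (scale \<alpha> y + scale \<beta> (0 + \<iota> w) + 0)) / real (card J) = (cmod \<alpha>)\<^sup>2 * sqnorm n y + (cmod \<beta>)\<^sup>2 * (real n * Q)"
    for y
    using centred_sum_sqnorm[OF J_centred, of "scale \<alpha> y" \<beta>] \<iota>_power J_card by (simp add: add_divide_distrib)
  then have "has_bochner_integral (lborelC2 n) (\<lambda>z. pair (x a) 0 z * ln (gauss n u (scale \<alpha> (fst z) + scale \<beta> (snd z) + 0)))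
      (- ((?K + (cmod \<alpha>)\<^sup>2 * sqnorm n (x a)) / u) - real n * ln (pi * u))" for a
    using pair_density_cross_entropy_gauss[OF u_pos nontrivial, of "x a" 0 0] by (simp add: add_ac)
  from has_bochner_integral_joint_density_mult[OF this]
  have "has_bochner_integral (lborelC2 n) (\<lambda>z. joint z * ln (gauss n u (scale \<alpha> (fst z) + scale \<beta> (snd z) + 0)))
      ((\<Sum>a\<in>A. - ((?K + (cmod \<alpha>)\<^sup>2 * sqnorm n (x a)) / u) - real n * ln (pi * u)) / real (card A))" .
  also have "(\<Sum>a\<in>A. - ((?K + (cmod \<alpha>)\<^sup>2 * sqnorm n (x a)) / u) - real n * ln (pi * u))
      = - ((real (card A) * ?K + (cmod \<alpha>)\<^sup>2 * (\<Sum>a\<in>A. sqnorm n (x a))) / u) - real (card A) * (real n * ln (pi * u))"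
    by (simp only: sum_subtractf sum_negf sum_divide_distrib[symmetric] sum.distrib sum_distrib_left[symmetric] sum_constant) (simp add: algebra_simps)
  also have "\<dots> = real (card A) * (- (real n * ((cmod (\<alpha> + \<beta> * g))\<^sup>2 * e + (cmod \<beta>)\<^sup>2 * v + (cmod \<alpha>)\<^sup>2 * P + (cmod \<beta>)\<^sup>2 * Q) / u) - real n * ln (pi * u))"
    unfolding x_power using u_pos by (simp add: field_simps)
  finally show ?thesis unfolding nonzero_mult_div_cancel_left[OF A_card] .
qed

context correlated_pair begin

lemma cov_entropy_le_gauss:
  assumes J_centred: "centred n J \<iota>" and P_nonneg: "0 \<le> P" and Q_nonneg: "0 \<le> Q"
    and x_power: "(\<Sum>a\<in>A. sqnorm n (x a)) = real (card A) * (real n * P)"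
    and \<iota>_power: "(\<Sum>w\<in>J. sqnorm n (\<iota> w)) = real (card J) * (real n * Q)"
  shows "cov_entropy n A x J \<iota> e w r \<le> gauss_entropy n (P + e) + gauss_entropy n (Q + w - (cmod r)\<^sup>2 / (P + e))"
proof -
  let ?e = "P + e" and ?v = "Q + w - (cmod r)\<^sup>2 / (P + e)" and ?k = "r / complex_of_real (P + e)"
  have e_pos: "0 < ?e" using fst_noise_pos P_nonneg by simp
  have "(cmod r)\<^sup>2 / ?e \<le> (cmod r)\<^sup>2 / e" using fst_noise_pos P_nonneg by (intro divide_left_mono) auto
  then have v_pos: "0 < ?v" using residual_pos Q_nonneg by linarith
  interpret reference: noisy_pair n ?e "{()}" "\<lambda>_. 0" ?v ?k by unfold_locales (use e_pos v_pos in auto)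
  let ?q = "reference.pair 0 0"
  have ln_q: "ln (?q z) = ln (gauss n ?e (scale 1 (fst z) + scale 0 (snd z) + 0)) + ln (gauss n ?v (scale (- ?k) (fst z) + scale 1 (snd z) + 0))"
    for z
    using reference.ln_pair_density[of 0 0 z] by simp
  have "- ?k + r / of_real e = r * of_real (1 / e - 1 / ?e)" by (simp add: right_diff_distrib)
  then have gain_diff: "(cmod (- ?k + r / of_real e))\<^sup>2 = (cmod r)\<^sup>2 * (1 / e - 1 / ?e)\<^sup>2"
    by (simp only: norm_mult norm_of_real power_mult_distrib power2_abs)
  have gain: "(cmod (- ?k))\<^sup>2 = (cmod r)\<^sup>2 / ?e\<^sup>2"
    by (simp only: norm_minus_cancel norm_divide norm_of_real power_divide power2_abs)
  have "s * (1 / e - 1 / p)\<^sup>2 * e + s / p\<^sup>2 * (p - e) = s / e - s / p" if "p \<noteq> 0" for s p :: real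
    using that fst_noise_pos by (simp add: field_simps power2_eq_square)
  from this[of ?e "(cmod r)\<^sup>2"]
  have snd_variance: "(cmod (- ?k + 1 * (r / of_real e)))\<^sup>2 * e + (cmod 1)\<^sup>2 * (w - (cmod r)\<^sup>2 / e) + (cmod (- ?k))\<^sup>2 * P + (cmod 1)\<^sup>2 * Q = ?v"
    using e_pos by (simp only: mult_1 gain_diff gain norm_one) simp
  have fst_variance: "(cmod (1 + 0 * (r / of_real e)))\<^sup>2 * e + (cmod 0)\<^sup>2 * (w - (cmod r)\<^sup>2 / e) + (cmod 1)\<^sup>2 * P + (cmod 0)\<^sup>2 * Q = ?e"
    by simp
  have "has_bochner_integral (lborelC2 n) (\<lambda>z. joint.joint z * ln (?q z)) (- (real n * ?e / ?e) - real n * ln (pi * ?e) + (- (real n * ?v / ?v) - real n * ln (pi * ?v)))"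
    unfolding ln_q distrib_left[of "joint.joint _"]
    by (intro has_bochner_integral_add joint.joint_density_cross_entropy_gauss[OF J_centred e_pos _ x_power \<iota>_power, of 1 0, unfolded fst_variance]
        joint.joint_density_cross_entropy_gauss[OF J_centred v_pos _ x_power \<iota>_power, of "- ?k" 1, unfolded snd_variance]) simp_all
  moreover have "(\<integral>z. joint.joint z * ln (?q z) \<partial>lborelC2 n) \<le> (\<integral>z. joint.joint z * ln (joint.joint z) \<partial>lborelC2 n)"
  proof (rule gibbs_inequality[OF pair_density_measurable joint.joint_density_pos reference.pair_density_pos])
    have "has_bochner_integral (lborelC2 n) ?q 1" by (rule reference.has_bochner_integral_pair_density)
    then show "(\<integral>\<^sup>+z. ennreal (?q z) \<partial>lborelC2 n) \<le> 1"
      using reference.pair_density_pos by (subst nn_integral_eq_integral) (auto simp: has_bochner_integral_iff less_imp_le)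
  qed (use joint.has_bochner_integral_joint_density joint.has_bochner_integral_joint_entropy calculation in \<open>simp_all only: has_bochner_integral_iff\<close>)
  ultimately show ?thesis
    using e_pos v_pos
    by (simp add: cov_entropy_def joint_entropy_def has_bochner_integral_iff gauss_entropy_eq[OF e_pos] gauss_entropy_eq[OF v_pos])
qed

end

lemma (in correlated_pair) information_ge_high_noise:
  assumes centred: "centred n A x" "centred n J \<iota>" and P_nonneg: "0 \<le> P" and Q_nonneg: "0 \<le> Q"
    and x_power: "(\<Sum>a\<in>A. sqnorm n (x a)) = real (card A) * (real n * P)"
    and \<iota>_power: "(\<Sum>a\<in>J. sqnorm n (\<iota> a)) = real (card J) * (real n * Q)"
    and M: "\<And>a b. a \<in> A \<Longrightarrow> b \<in> A \<Longrightarrow> \<bar>2 * re_inner n (x a) (x b)\<bar> \<le> M" "\<And>a b. a \<in> J \<Longrightarrow> b \<in> J \<Longrightarrow> \<bar>2 * re_inner n (\<iota> a) (\<iota> b)\<bar> \<le> M" "M \<le> e" "M \<le> w"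
  shows "- (real n * ln (1 - (cmod r)\<^sup>2 / ((P + e) * (Q + w)))) - (M / e)\<^sup>2 - (M / w)\<^sup>2 \<le> information n A x J \<iota> e w r"
proof -
  let ?\<rho> = "(cmod r)\<^sup>2 / ((P + e) * (Q + w))"
  have sums_pos: "0 < P + e" "0 < Q + w" using fst_noise_pos snd_noise_pos P_nonneg Q_nonneg by auto
  have "e * w \<le> (P + e) * (Q + w)" using fst_noise_pos snd_noise_pos P_nonneg Q_nonneg by (intro mult_mono) auto
  then have "0 < 1 - ?\<rho>" using cross_lt sums_pos by (simp add: pos_divide_less_eq)
  moreover have "Q + w - (cmod r)\<^sup>2 / (P + e) = (1 - ?\<rho>) * (Q + w)" using sums_pos by (simp add: left_diff_distrib)
  ultimately have "gauss_entropy n (Q + w - (cmod r)\<^sup>2 / (P + e)) = gauss_entropy n (Q + w) + real n * ln (1 - ?\<rho>)"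
    using sums_pos by (simp only: gauss_entropy_mult)
  then show ?thesis
    using entropy_ge_high_noise[OF signal_fin centred(1) fst_noise_pos P_nonneg x_power M(1,3)]
      entropy_ge_high_noise[OF interference_fin centred(2) snd_noise_pos Q_nonneg \<iota>_power M(2,4)]
      cov_entropy_le_gauss[OF centred(2) P_nonneg Q_nonneg x_power \<iota>_power] by (simp add: information_def)
qed

lemma finite_re_inner_bounded:
  assumes "finite A"
  obtains M where "0 \<le> M" "\<And>a b. a \<in> A \<Longrightarrow> b \<in> A \<Longrightarrow> \<bar>2 * re_inner n (x a) (x b)\<bar> \<le> M"
proof
  let ?S = "insert 0 ((\<lambda>(a, b). \<bar>2 * re_inner n (x a) (x b)\<bar>) ` (A \<times> A))"
  have "finite ?S" using assms by simp
  then show "0 \<le> Max ?S" "\<And>a b. a \<in> A \<Longrightarrow> b \<in> A \<Longrightarrow> \<bar>2 * re_inner n (x a) (x b)\<bar> \<le> Max ?S" by (auto intro!: Max_ge)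
qed

lemma nonneg_if_halving:
  fixes F :: "real \<Rightarrow> real"
  assumes step: "\<And>N. 1 \<le> N \<Longrightarrow> 2 * F (2 * N) \<le> F N" and lower: "\<And>N. 1 \<le> N \<Longrightarrow> K \<le> N \<Longrightarrow> - (C / N\<^sup>2) \<le> F N"
  shows "0 \<le> F 1"
proof (rule LIMSEQ_le_const2)
  have iterate: "2^k * F (2^k) \<le> F 1" for k :: nat
  proof (induction k)
    case (Suc k)
    have "2^k * (2 * F (2 * 2^k)) \<le> 2^k * F (2^k)" using step[of "2^k"] by (intro mult_left_mono) auto
    from order_trans[OF this Suc] show ?case by (simp only: power_Suc mult_ac)
  qed simp
  have "(\<lambda>k. C * (1/2)^k) \<longlonglongrightarrow> C * 0" by (intro tendsto_mult tendsto_const LIMSEQ_realpow_zero) auto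
  then show "(\<lambda>k. - (C * (1/2)^k)) \<longlonglongrightarrow> 0" using tendsto_minus by fastforce
  obtain m :: nat where m: "K < 2^m" using real_arch_pow[of 2 K] by auto
  show "\<exists>m. \<forall>k\<ge>m. - (C * (1/2)^k) \<le> F 1"
  proof (intro exI allI impI)
    fix k assume "m \<le> k"
    then have "(2::real)^m \<le> 2^k" by (intro power_increasing) auto
    then have "K \<le> 2^k" using m by linarith
    then have "2^k * (- (C / (2^k)\<^sup>2)) \<le> 2^k * F (2^k)" by (intro mult_left_mono lower) auto
    moreover have "2^k * (- (C / (2^k)\<^sup>2)) = - (C * (1/2)^k)" by (simp add: power2_eq_square power_divide)
    ultimately show "- (C * (1/2)^k) \<le> F 1" using iterate[of k] by linarith
  qed
qed

text \<open>Adding an independent Gaussian pair of the power of the codewords, the doubling inequality at least halves the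
  excess of the information over its Gaussian value. After \<open>k\<close> such steps the noise dominates the codebooks by
  a factor \<open>N = 2^k\<close>, where the excess is at least \<open>- C / N\<^sup>2\<close>, so the original excess is at least \<open>- C / N\<close>.\<close>

locale scaled_noise = correlated_pair n A x J \<iota> e w r
  for n and A :: "'a set" and x and J :: "'w set" and \<iota> and e w :: real and r :: complex +
  fixes P Q :: real
  assumes P_nonneg: "0 \<le> P" and Q_nonneg: "0 \<le> Q"
begin

abbreviation "fst_noise N \<equiv> N * (P + e) - P"
abbreviation "snd_noise N \<equiv> N * (Q + w) - Q"

definition excess :: "real \<Rightarrow> real" where
  "excess N = information n A x J \<iota> (fst_noise N) (snd_noise N) (of_real N * r) + real n * ln (1 - (cmod r)\<^sup>2 / ((P + e) * (Q + w)))"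

context
  fixes N :: real
  assumes N_ge_1: "1 \<le> N"
begin

lemma scaled_noise_pos: "0 < N * e" "0 < N * w"
  using N_ge_1 fst_noise_pos snd_noise_pos by auto

lemma scaled_noise_le: "N * e \<le> fst_noise N" "N * w \<le> snd_noise N" "N * e \<le> N * (P + e)" "N * w \<le> N * (Q + w)"
  using N_ge_1 P_nonneg Q_nonneg mult_right_mono[of 1 N P] mult_right_mono[of 1 N Q] by (auto simp: algebra_simps)

lemma scaled_cross_lt: "(cmod (of_real N * r))\<^sup>2 < (N * e) * (N * w)"
  using N_ge_1 cross_lt by (simp add: norm_mult power_mult_distrib power2_eq_square mult_ac)

lemma scaled_cross_quotient: "(cmod (of_real N * r))\<^sup>2 / (N * (P + e) * (N * (Q + w))) = (cmod r)\<^sup>2 / ((P + e) * (Q + w))"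
  using N_ge_1 by (simp add: norm_mult power_mult_distrib power2_eq_square)

lemma excess_halving: "2 * excess (2 * N) \<le> excess N"
proof -
  have "(N * e) * (N * w) \<le> min (fst_noise N) (N * (P + e)) * min (snd_noise N) (N * (Q + w))"
    using scaled_noise_le scaled_noise_pos by (intro mult_mono) auto
  with information_doubling_le[OF signal_fin interference_fin, of "fst_noise N" "N * (P + e)" "snd_noise N" "N * (Q + w)" "of_real N * r" n x \<iota>]
  have "2 * information n A x J \<iota> (fst_noise N + N * (P + e)) (snd_noise N + N * (Q + w)) (2 * (of_real N * r))
      \<le> information n A x J \<iota> (fst_noise N) (snd_noise N) (of_real N * r) - real n * ln (1 - (cmod r)\<^sup>2 / ((P + e) * (Q + w)))"
    using scaled_cross_lt scaled_noise_le scaled_noise_pos unfolding scaled_cross_quotient by linarith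
  moreover have "fst_noise (2 * N) = fst_noise N + N * (P + e)" "snd_noise (2 * N) = snd_noise N + N * (Q + w)" by simp_all
  ultimately show ?thesis by (simp add: excess_def mult.assoc)
qed

lemma excess_ge:
  assumes centred: "centred n A x" "centred n J \<iota>"
    and x_power: "(\<Sum>a\<in>A. sqnorm n (x a)) = real (card A) * (real n * P)"
    and \<iota>_power: "(\<Sum>a\<in>J. sqnorm n (\<iota> a)) = real (card J) * (real n * Q)"
    and M: "\<And>a b. a \<in> A \<Longrightarrow> b \<in> A \<Longrightarrow> \<bar>2 * re_inner n (x a) (x b)\<bar> \<le> M" "\<And>a b. a \<in> J \<Longrightarrow> b \<in> J \<Longrightarrow> \<bar>2 * re_inner n (\<iota> a) (\<iota> b)\<bar> \<le> M"
    and M_nonneg: "0 \<le> M" and N_ge: "max (M / e) (M / w) \<le> N"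
  shows "- (((M / e)\<^sup>2 + (M / w)\<^sup>2) / N\<^sup>2) \<le> excess N"
proof -
  have M_le: "M \<le> N * e" "M \<le> N * w" using N_ge fst_noise_pos snd_noise_pos by (auto simp: pos_divide_le_eq)
  have "(N * e) * (N * w) \<le> fst_noise N * snd_noise N" using scaled_noise_le scaled_noise_pos by (intro mult_mono) auto
  then interpret scaled: correlated_pair n A x J \<iota> "fst_noise N" "snd_noise N" "of_real N * r"
    by unfold_locales (use signal_fin interference_fin scaled_cross_lt scaled_noise_le scaled_noise_pos in auto)
  have square_le: "(M / v)\<^sup>2 \<le> (M / s)\<^sup>2 / N\<^sup>2" if "N * s \<le> v" "0 < s" for s v
  proof -
    have "M / v \<le> M / (N * s)"
      using that N_ge_1 M_nonneg by (intro divide_left_mono) (auto intro!: mult_pos_pos less_le_trans[of 0 "N * s" v])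
    then have "(M / v)\<^sup>2 \<le> (M / (N * s))\<^sup>2"
      using M_nonneg that N_ge_1 by (intro power_mono) (auto intro!: divide_nonneg_nonneg order_trans[of 0 "N * s" v])
    then show ?thesis by (simp add: power_divide power_mult_distrib mult.commute)
  qed
  have "P + fst_noise N = N * (P + e)" "Q + snd_noise N = N * (Q + w)" by simp_all
  then have "- (M / fst_noise N)\<^sup>2 - (M / snd_noise N)\<^sup>2 \<le> excess N"
    using scaled.information_ge_high_noise[OF centred P_nonneg Q_nonneg x_power \<iota>_power M] M_le scaled_noise_le scaled_cross_quotient
    by (simp add: excess_def)
  then show ?thesis
    using square_le[OF scaled_noise_le(1) fst_noise_pos] square_le[OF scaled_noise_le(2) snd_noise_pos]
    by (simp add: add_divide_distrib)
qed

end

lemma information_ge_gauss_exact_power: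
  assumes centred: "centred n A x" "centred n J \<iota>"
    and x_power: "(\<Sum>a\<in>A. sqnorm n (x a)) = real (card A) * (real n * P)"
    and \<iota>_power: "(\<Sum>a\<in>J. sqnorm n (\<iota> a)) = real (card J) * (real n * Q)"
  shows "- (real n * ln (1 - (cmod r)\<^sup>2 / ((P + e) * (Q + w)))) \<le> information n A x J \<iota> e w r"
proof -
  obtain MA MJ where MA: "0 \<le> MA" "\<And>a b. a \<in> A \<Longrightarrow> b \<in> A \<Longrightarrow> \<bar>2 * re_inner n (x a) (x b)\<bar> \<le> MA"
    and MJ: "\<And>a b. a \<in> J \<Longrightarrow> b \<in> J \<Longrightarrow> \<bar>2 * re_inner n (\<iota> a) (\<iota> b)\<bar> \<le> MJ"
    using finite_re_inner_bounded[OF signal_fin(1), of n x] finite_re_inner_bounded[OF interference_fin(1), of n \<iota>] by metis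
  define M where "M = max MA MJ"
  have M: "0 \<le> M" "\<And>a b. a \<in> A \<Longrightarrow> b \<in> A \<Longrightarrow> \<bar>2 * re_inner n (x a) (x b)\<bar> \<le> M" "\<And>a b. a \<in> J \<Longrightarrow> b \<in> J \<Longrightarrow> \<bar>2 * re_inner n (\<iota> a) (\<iota> b)\<bar> \<le> M"
    using MA MJ unfolding M_def by (auto intro: le_max_iff_disj[THEN iffD2])
  have "0 \<le> excess 1" using nonneg_if_halving[OF excess_halving excess_ge[OF _ centred x_power \<iota>_power M(2,3,1)]] .
  then show ?thesis by (simp add: excess_def)
qed

end

theorem information_ge_gauss:
  assumes n_pos: "0 < n" and x: "codebook n A x P" and \<iota>: "codebook n J \<iota> Q" and e_pos: "0 < e"
    and cross_lt: "(cmod r)\<^sup>2 < e * w"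
  shows "- (real n * ln (1 - (cmod r)\<^sup>2 / ((P + e) * (Q + w)))) \<le> information n A x J \<iota> e w r"
proof -
  define P' Q' where "P' = (\<Sum>a\<in>A. sqnorm n (x a)) / (real (card A) * real n)"
    and "Q' = (\<Sum>a\<in>J. sqnorm n (\<iota> a)) / (real (card J) * real n)"
  have cards: "0 < real (card A) * real n" "0 < real (card J) * real n"
    using x \<iota> n_pos by (auto simp: codebook_def card_gt_0_iff)
  have powers: "0 \<le> P'" "P' \<le> P" "0 \<le> Q'" "Q' \<le> Q" using x \<iota> cards
    by (auto simp: P'_def Q'_def codebook_def sum_nonneg pos_divide_le_eq mult_ac intro!: divide_nonneg_nonneg)
  have w_pos: "0 < w" using cross_lt e_pos by (smt (verit) zero_le_power2 zero_less_mult_pos)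
  have products: "e * w \<le> (P' + e) * (Q' + w)" "(P' + e) * (Q' + w) \<le> (P + e) * (Q + w)" "0 < e * w"
    using powers e_pos w_pos by (auto intro!: mult_mono)
  have "(cmod r)\<^sup>2 / ((P + e) * (Q + w)) \<le> (cmod r)\<^sup>2 / ((P' + e) * (Q' + w))"
    using products by (intro divide_left_mono) auto
  moreover have "(cmod r)\<^sup>2 / ((P' + e) * (Q' + w)) < 1" using products cross_lt by (simp add: pos_divide_less_eq)
  ultimately have "ln (1 - (cmod r)\<^sup>2 / ((P' + e) * (Q' + w))) \<le> ln (1 - (cmod r)\<^sup>2 / ((P + e) * (Q + w)))"
    by (subst ln_le_cancel_iff) auto
  then have "real n * ln (1 - (cmod r)\<^sup>2 / ((P' + e) * (Q' + w))) \<le> real n * ln (1 - (cmod r)\<^sup>2 / ((P + e) * (Q + w)))"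
    by (rule mult_left_mono) simp
  moreover interpret scaled_noise n A x J \<iota> e w r P' Q'
    by unfold_locales (use x \<iota> e_pos cross_lt powers in \<open>auto simp: codebook_def\<close>)
  have "- (real n * ln (1 - (cmod r)\<^sup>2 / ((P' + e) * (Q' + w)))) \<le> information n A x J \<iota> e w r"
    using x \<iota> cards by (intro information_ge_gauss_exact_power) (auto simp: codebook_def P'_def Q'_def)
  ultimately show ?thesis by linarith
qed

lemma rate_le_genie:
  assumes n_pos: "0 < n" and x: "codebook n {..<N} x P" and \<iota>: "codebook n J \<iota> Q" and dec: "decodable n N x J \<iota> \<psi> \<delta>"
    and e_pos: "0 < e" and v_pos: "0 < v" and unit_noise: "v + (cmod (1 + g))\<^sup>2 * e = 1" and w: "w = v + (cmod g)\<^sup>2 * e"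
  shows "fano_rate \<delta> N \<le> - entropy_gap n {..<N} x e P - entropy_gap n J \<iota> w Q + entropy_gap n J \<iota> v Q
     + real n * ln (((P + e) * (Q + w) - (cmod g)\<^sup>2 * e\<^sup>2) / (e * (Q + v)))"
proof -
  let ?r = "g * of_real e" and ?\<rho> = "(cmod g)\<^sup>2 * e\<^sup>2 / ((P + e) * (Q + w))"
  have J_fin: "finite J" "J \<noteq> {}" and powers: "0 \<le> P" "0 \<le> Q" using x \<iota> by (auto simp: codebook_def)
  have r_sq: "(cmod ?r)\<^sup>2 = (cmod g)\<^sup>2 * e\<^sup>2" by (simp add: norm_mult power_mult_distrib)
  have cross_lt: "(cmod ?r)\<^sup>2 < e * w" unfolding r_sq w using e_pos v_pos by (simp add: power2_eq_square algebra_simps)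
  have w_pos: "0 < w" using v_pos e_pos by (simp add: w add_pos_nonneg)
  have variances: "0 < P + e" "0 < Q + w" "0 < Q + v" using powers e_pos w_pos v_pos by auto
  have "e * w \<le> (P + e) * (Q + w)" using powers e_pos w_pos by (intro mult_mono) auto
  then have \<rho>_lt: "0 < 1 - ?\<rho>" using cross_lt r_sq variances by (simp add: pos_divide_less_eq)
  have "w - (cmod ?r)\<^sup>2 / e = v" unfolding r_sq w using e_pos by (simp add: power2_eq_square)
  then have "cov_entropy n {..<N} x J \<iota> e w ?r = joint_entropy n {..<N} x J \<iota> e v g"
    using e_pos by (simp add: cov_entropy_def)
  then have "fano_rate \<delta> N \<le> entropy n {..<N} x e + entropy n J \<iota> w + real n * ln (1 - ?\<rho>) - gauss_entropy n e - entropy n J \<iota> v"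
    using rate_le_genie_entropy[OF x J_fin dec e_pos v_pos unit_noise] information_ge_gauss[OF n_pos x \<iota> e_pos cross_lt]
    by (simp add: information_def r_sq)
  moreover have "((P + e) * (Q + w) - (cmod g)\<^sup>2 * e\<^sup>2) / (e * (Q + v)) = (P + e) * (Q + w) / (e * (Q + v)) * (1 - ?\<rho>)"
    using variances e_pos by (simp add: right_diff_distrib diff_divide_distrib)
  then have "real n * ln (((P + e) * (Q + w) - (cmod g)\<^sup>2 * e\<^sup>2) / (e * (Q + v))) = real n * ln ((P + e) * (Q + w) / (e * (Q + v))) + real n * ln (1 - ?\<rho>)"
    using variances e_pos \<rho>_lt
    by (simp only: ln_mult_pos divide_pos_pos mult_pos_pos distrib_left[of "real n" "ln _" "ln _"])
  ultimately show ?thesis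
    using gauss_entropy_quotient[OF variances(1,2) e_pos variances(3), of n] unfolding entropy_gap_def by linarith
qed

section \<open>Bounds for one user\<close>

text \<open>Throughout, \<open>Z\<close> is noise of unit variance and \<open>z = E[Z N\<^sup>*]\<close> for a further noise \<open>N\<close> of variance \<open>w\<close>;
  then \<open>diff_variance k w z\<close> is the variance of \<open>Z - k N\<close>.\<close>

definition diff_variance :: "complex \<Rightarrow> real \<Rightarrow> complex \<Rightarrow> real" where
  "diff_variance k w z = 1 + (cmod k)\<^sup>2 * w - 2 * Re (cnj k * z)"

lemma diff_variance_ge:
  assumes "cmod z \<le> s"
  shows "(1 - cmod k * s)\<^sup>2 \<le> diff_variance k (s\<^sup>2) z"
proof -
  have "Re (cnj k * z) \<le> cmod k * s"
    using complex_Re_le_cmod[of "cnj k * z"] mult_left_mono[OF assms, of "cmod k"] by (simp add: norm_mult)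
  then show ?thesis by (simp add: diff_variance_def power2_eq_square algebra_simps)
qed

lemma diff_variance_nonneg: "cmod z \<le> s \<Longrightarrow> 0 \<le> diff_variance k (s\<^sup>2) z"
  using diff_variance_ge[of z s k] zero_le_power2[of "1 - cmod k * s"] by linarith

lemma diff_variance_eq_0D: "cmod z \<le> s \<Longrightarrow> diff_variance k (s\<^sup>2) z = 0 \<Longrightarrow> cmod k * s = 1"
  using diff_variance_ge[of z s k] by simp

text \<open>\<open>N = g (Z - k N) + V\<close> with \<open>V\<close> of variance \<open>v\<close> independent of \<open>Z - k N\<close>.\<close>

lemma noise_split:
  fixes k z :: complex and w :: real
  defines "e \<equiv> diff_variance k w z"
  defines "v \<equiv> (w - (cmod z)\<^sup>2) / e" and "c \<equiv> cnj z - cnj k * of_real w"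
  defines "g \<equiv> c / of_real e"
  assumes e_pos: "0 < e"
  shows "v + (cmod g)\<^sup>2 * e = w"
    and "v = w - (cmod (z - k * of_real w))\<^sup>2 / e"
    and "(cmod (1 + \<mu> * g))\<^sup>2 * e + (cmod \<mu>)\<^sup>2 * v = e + 2 * Re (\<mu> * c) + (cmod \<mu>)\<^sup>2 * w"
    and "(cmod k)\<^sup>2 * v + (cmod (1 + k * g))\<^sup>2 * e = 1"
proof -
  have g_sq: "(cmod g)\<^sup>2 * e = (cmod c)\<^sup>2 / e" using e_pos by (simp add: g_def norm_divide power_divide power2_eq_square)
  have "w - (cmod z)\<^sup>2 + (cmod c)\<^sup>2 = w * e"
    unfolding c_def e_def diff_variance_def cmod_power2 by (simp add: algebra_simps power2_eq_square)
  then show variance: "v + (cmod g)\<^sup>2 * e = w" unfolding g_sq v_def add_divide_distrib[symmetric] using e_pos by simp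
  have "cmod c = cmod (z - k * of_real w)"
    by (metis c_def complex_cnj_complex_of_real complex_cnj_diff complex_cnj_mult complex_mod_cnj)
  then show "v = w - (cmod (z - k * of_real w))\<^sup>2 / e" using variance unfolding g_sq by simp
  show combination: "(cmod (1 + \<mu> * g))\<^sup>2 * e + (cmod \<mu>)\<^sup>2 * v = e + 2 * Re (\<mu> * c) + (cmod \<mu>)\<^sup>2 * w" for \<mu>
  proof -
    have "Re (1 * cnj (\<mu> * g)) * e = Re (\<mu> * c)" using e_pos by (simp add: g_def Re_divide_of_real)
    then have "(cmod (1 + \<mu> * g))\<^sup>2 * e = e + 2 * Re (\<mu> * c) + (cmod \<mu>)\<^sup>2 * ((cmod g)\<^sup>2 * e)"
      unfolding cmod_add_power2 by (simp add: norm_mult power_mult_distrib algebra_simps)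
    then show ?thesis by (simp add: variance[symmetric] algebra_simps)
  qed
  have "e + 2 * Re (k * c) + (cmod k)\<^sup>2 * w = 1"
    unfolding c_def e_def diff_variance_def cmod_power2 by (simp add: algebra_simps power2_eq_square)
  then show "(cmod k)\<^sup>2 * v + (cmod (1 + k * g))\<^sup>2 * e = 1" using combination[of k] by simp
qed

lemma complete_square:
  assumes "0 < s"
  shows "(cmod (c / of_real s))\<^sup>2 * s - 2 * Re (cnj (c / of_real s) * c) = - ((cmod c)\<^sup>2 / s)"
proof -
  have "cnj (c / of_real s) * c = of_real ((cmod c)\<^sup>2 / s)"
    by (simp add: complex_norm_square mult.commute del: of_real_power)
  then show ?thesis using assms by (simp add: norm_divide power_divide power2_eq_square)
qed

definition snr_bound :: "real \<Rightarrow> real \<Rightarrow> real \<Rightarrow> bool" where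
  "snr_bound P \<eta> m \<longleftrightarrow> 0 < \<eta> \<and> ln (1 + P / \<eta>) \<le> m"

text \<open>The noise left in \<open>Y + \<gamma> U\<close> besides the signal, where \<open>Y\<close> contains interference of power \<open>\<epsilon>\<close> and \<open>U\<close> is that interference plus \<open>W\<close>.\<close>

definition genie_noise :: "real \<Rightarrow> real \<Rightarrow> complex \<Rightarrow> complex \<Rightarrow> real" where
  "genie_noise \<epsilon> w z \<gamma> = (cmod (1 + \<gamma>))\<^sup>2 * \<epsilon> + (1 + (cmod \<gamma>)\<^sup>2 * w + 2 * Re (cnj \<gamma> * z))"

lemma genie_noise_optimal:
  assumes pos: "0 < \<epsilon> + w"
  shows "genie_noise \<epsilon> w z (- 1 - (z - of_real w) / of_real (\<epsilon> + w)) = diff_variance 1 w z - (cmod (z - of_real w))\<^sup>2 / (\<epsilon> + w)"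
proof -
  have "genie_noise \<epsilon> w z (- 1 - \<kappa>) = diff_variance 1 w z + ((cmod \<kappa>)\<^sup>2 * (\<epsilon> + w) - 2 * Re (cnj \<kappa> * (z - of_real w)))" for \<kappa>
    unfolding genie_noise_def diff_variance_def cmod_power2 by (simp add: algebra_simps power2_eq_square)
  then show ?thesis by (simp only: complete_square[OF pos])
qed

lemma rate_le_optimal_genie:
  fixes w :: real and z :: complex
  defines "e \<equiv> diff_variance 1 w z"
  defines "v \<equiv> w - (cmod (z - of_real w))\<^sup>2 / e"
  assumes n_pos: "0 < n" and x: "codebook n {..<N} x P" and \<iota>: "codebook n J \<iota> \<epsilon>" and dec: "decodable n N x J \<iota> \<psi> \<delta>"
    and w_pos: "0 < w" and e_pos: "0 < e" and v_pos: "0 < v" and snr: "\<And>\<gamma>. snr_bound P (genie_noise \<epsilon> w z \<gamma>) m"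
  shows "fano_rate \<delta> N \<le> - entropy_gap n {..<N} x e P - entropy_gap n J \<iota> w \<epsilon> + entropy_gap n J \<iota> v \<epsilon> + real n * m"
proof -
  let ?r = "z - of_real w"
  define \<eta> where "\<eta> = e - (cmod ?r)\<^sup>2 / (\<epsilon> + w)"
  define g where "g = (cnj z - cnj 1 * of_real w) / of_real e"
  have \<epsilon>w_pos: "0 < \<epsilon> + w" using \<iota> w_pos by (simp add: codebook_def)
  have \<eta>: "0 < \<eta>" "ln (1 + P / \<eta>) \<le> m"
    using snr[of "- 1 - ?r / of_real (\<epsilon> + w)"] unfolding genie_noise_optimal[OF \<epsilon>w_pos] \<eta>_def e_def snr_bound_def by blast+
  note split = noise_split[of 1 w z, folded e_def g_def, OF e_pos]
  have v_eq: "(w - (cmod z)\<^sup>2) / e = v" using split(2) by (simp add: v_def)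
  have w_eq: "w = v + (cmod g)\<^sup>2 * e" and unit_noise: "v + (cmod (1 + g))\<^sup>2 * e = 1"
    using split(1,4) unfolding v_eq by (simp_all add: g_def)
  have "(cmod g)\<^sup>2 * e\<^sup>2 = (w - v) * e" using w_eq by (simp add: power2_eq_square)
  also have "\<dots> = (cmod ?r)\<^sup>2" using e_pos by (simp add: v_def)
  finally have g_sq: "(cmod g)\<^sup>2 * e\<^sup>2 = (cmod ?r)\<^sup>2" .
  have denominator: "e * (\<epsilon> + v) = (\<epsilon> + w) * \<eta>" using e_pos \<epsilon>w_pos by (simp add: v_def \<eta>_def field_simps)
  have numerator: "(P + e) * (\<epsilon> + w) - (cmod ?r)\<^sup>2 = (\<epsilon> + w) * (P + \<eta>)" using \<epsilon>w_pos by (simp add: \<eta>_def field_simps)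
  have "((P + e) * (\<epsilon> + w) - (cmod g)\<^sup>2 * e\<^sup>2) / (e * (\<epsilon> + v)) = 1 + P / \<eta>"
    unfolding g_sq numerator denominator using \<epsilon>w_pos \<eta>(1) by (simp add: add_divide_distrib)
  then show ?thesis
    using rate_le_genie[OF n_pos x \<iota> dec e_pos v_pos unit_noise w_eq] mult_left_mono[OF \<eta>(2), of "real n"] by simp
qed

lemma entropy_gap_exchange:
  assumes \<iota>: "codebook n J \<iota> \<epsilon>" and v1: "0 < v1" "v1 \<le> 1" and w: "0 < w" "w \<le> 1" and v: "0 < v" "v \<le> w"
    and useful: "v1 \<le> v \<or> w \<le> v \<or> \<epsilon> = 0"
  shows "entropy_gap n J \<iota> 1 \<epsilon> + entropy_gap n J \<iota> v \<epsilon> \<le> entropy_gap n J \<iota> w \<epsilon> + entropy_gap n J \<iota> v1 \<epsilon>"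
  using useful
proof (elim disjE)
  assume "v1 \<le> v"
  then show ?thesis using entropy_gap_antimono[OF \<iota> v1(1)] entropy_gap_antimono[OF \<iota> w] by fastforce
next
  assume "w \<le> v"
  then have "v = w" using v by simp
  then show ?thesis using entropy_gap_antimono[OF \<iota> v1] by simp
next
  assume "\<epsilon> = 0"
  then show ?thesis using entropy_gap_zero_power[of n J \<iota>] \<iota> v1 w v by simp
qed

text \<open>\<open>W\<close> has variance \<open>w\<close>, \<open>v1\<close> is the variance of the noise \<open>N\<close> of the next user, and \<open>vbar\<close> the noise level at which that of the previous user measures the codeword.\<close>

lemma rate_noise_genie_le:
  fixes w :: real and z :: complex
  defines "e \<equiv> diff_variance 1 w z"
  assumes n_pos: "0 < n" and x: "codebook n {..<N} x P" and \<iota>: "codebook n J \<iota> \<epsilon>" and dec: "decodable n N x J \<iota> \<psi> \<delta>"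
    and w: "0 \<le> w" "w \<le> 1" and z: "(cmod z)\<^sup>2 \<le> w" and v1: "0 < v1" "v1 \<le> 1" and vbar: "0 < vbar" "0 < P \<Longrightarrow> e \<le> vbar"
    and m_nonneg: "0 \<le> m1" "0 \<le> m3" and snr_noise: "0 < P \<Longrightarrow> snr_bound P (\<epsilon> + 1) m1"
    and snr_genie: "\<And>\<gamma>. 0 < P \<Longrightarrow> snr_bound P (genie_noise \<epsilon> w z \<gamma>) m3"
    and useful: "v1 \<le> w - (cmod (z - of_real w))\<^sup>2 / e \<or> w \<le> w - (cmod (z - of_real w))\<^sup>2 / e \<or> \<epsilon> = 0"
  shows "2 * fano_rate \<delta> N + entropy_gap n {..<N} x vbar P \<le> entropy_gap n J \<iota> v1 \<epsilon> + real n * (m1 + m3)"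
proof (cases "P = 0")
  case True
  have J_fin: "finite J" "J \<noteq> {}" using \<iota> by (auto simp: codebook_def)
  have "fano_rate \<delta> N \<le> 0" "entropy_gap n {..<N} x vbar P = 0"
    using rate_le_zero_power[OF _ J_fin dec] entropy_gap_zero_power[OF _ vbar(1)] x True by simp_all
  moreover have "0 \<le> real n * (m1 + m3)" using m_nonneg by simp
  ultimately show ?thesis using entropy_gap_nonneg[OF \<iota> v1(1)] by linarith
next
  case False
  let ?v = "w - (cmod (z - of_real w))\<^sup>2 / e"
  have powers: "0 < P" "0 \<le> \<epsilon>" and J_fin: "finite J" "J \<noteq> {}" using x \<iota> False by (auto simp: codebook_def)
  have e_pos: "0 < e" and genie_le: "ln (1 + P / e) \<le> m3"
    using snr_genie[OF powers(1), of "- 1"] by (simp_all add: snr_bound_def genie_noise_def e_def diff_variance_def)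
  have x_gap: "entropy_gap n {..<N} x vbar P \<le> entropy_gap n {..<N} x e P"
    using entropy_gap_antimono[OF x e_pos] vbar powers by simp
  have "(P + \<epsilon> + 1) / (\<epsilon> + 1) = 1 + P / (\<epsilon> + 1)" using powers by (simp add: field_simps)
  then have noise_rate: "fano_rate \<delta> N \<le> entropy_gap n J \<iota> 1 \<epsilon> + real n * m1"
    using rate_le_interference_as_noise[OF x \<iota> dec] mult_left_mono[of _ m1 "real n"] snr_noise[OF powers(1)]
    by (fastforce simp: snr_bound_def)
  show ?thesis
  proof (cases "w = 0")
    case True
    then have "e = 1" using z by (simp add: e_def diff_variance_def)
    then have "real n * ln (P + 1) \<le> real n * m3" using genie_le by (intro mult_left_mono) (auto simp: add.commute)
    then show ?thesis
      using noise_rate rate_le_known_interference[OF x J_fin dec] x_gap entropy_gap_antimono[OF \<iota> v1] \<open>e = 1\<close>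
      by (simp add: distrib_left)
  next
    case False
    then have w_pos: "0 < w" using w by simp
    have v_pos: "0 < ?v"
    proof (cases "\<epsilon> = 0")
      case True
      have "0 < e - (cmod (z - of_real w))\<^sup>2 / w"
        using snr_genie[OF powers(1)] genie_noise_optimal[of 0 w z] w_pos unfolding True snr_bound_def e_def by (metis add_0)
      then show ?thesis using e_pos w_pos by (simp add: pos_divide_less_eq mult.commute)
    qed (use useful v1 w_pos in auto)
    have "?v \<le> w" using e_pos by simp
    note entropy_gap_exchange[OF \<iota> v1 w_pos w(2) v_pos this useful]
    moreover have "fano_rate \<delta> N \<le> - entropy_gap n {..<N} x e P - entropy_gap n J \<iota> w \<epsilon> + entropy_gap n J \<iota> ?v \<epsilon> + real n * m3"
      using rate_le_optimal_genie[OF n_pos x \<iota> dec w_pos] snr_genie[OF powers(1)] e_pos v_pos unfolding e_def by blast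
    ultimately show ?thesis using noise_rate x_gap by (simp add: distrib_left)
  qed
qed

lemma mixture_Times_const:
  assumes "finite A" "A \<noteq> {}"
  shows "mixture n (A \<times> B) (\<lambda>(a, b). c b) v y = mixture n B c v y"
proof -
  have "(\<Sum>w\<in>A \<times> B. gauss n v (y - (case w of (a, b) \<Rightarrow> c b))) = (\<Sum>a\<in>A. \<Sum>b\<in>B. gauss n v (y - c b))"
    by (simp only: sum.cartesian_product split_def)
  then show ?thesis using assms by (simp add: mixture_def card_cartesian_product)
qed

lemma entropy_gap_Times_zero_power:
  assumes x: "codebook n A x 0"
  shows "entropy_gap n (A \<times> B) (\<lambda>(a, b). scale j (x a) + c b) v \<epsilon> = entropy_gap n B c v \<epsilon>"
proof -
  have "entropy_gap n (A \<times> B) (\<lambda>(a, b). scale j (x a) + c b) v \<epsilon> = entropy_gap n (A \<times> B) (\<lambda>(a, b). c b) v \<epsilon>"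
    using codebook_zero_power[OF x] by (intro entropy_gap_cong) auto
  then show ?thesis using x by (simp add: entropy_gap_def entropy_def mixture_Times_const codebook_def)
qed

text \<open>The noise left in \<open>\<alpha> (Y - D) + \<gamma> S\<close> besides the signal, where \<open>Y - D = X + h12 X\<^sub>b + Z\<close> and \<open>S = h31 X + h32 X\<^sub>b + N\<close>;
  here \<open>s\<close> is the standard deviation of \<open>N\<close>.\<close>

definition side_noise :: "complex \<Rightarrow> complex \<Rightarrow> real \<Rightarrow> real \<Rightarrow> complex \<Rightarrow> complex \<Rightarrow> complex \<Rightarrow> real" where
  "side_noise h12 h32 Pb s z \<alpha> \<gamma> = (cmod (\<alpha> * h12 + \<gamma> * h32))\<^sup>2 * Pb + ((cmod \<alpha>)\<^sup>2 + (cmod \<gamma>)\<^sup>2 * s\<^sup>2 + 2 * Re (\<alpha> * cnj \<gamma> * z))"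

text \<open>If \<open>s = 0\<close>, the conditions of the theorem force all powers in \<open>S\<close> to vanish, and any positive noise level serves.\<close>

definition side_variance :: "real \<Rightarrow> real" where
  "side_variance s = (if s = 0 then 1 else s\<^sup>2)"

definition side_info_bounded :: "real \<Rightarrow> real \<Rightarrow> complex \<Rightarrow> complex \<Rightarrow> complex \<Rightarrow> real \<Rightarrow> real \<Rightarrow> real \<Rightarrow> bool" where
  "side_info_bounded P Pb h12 h31 h32 v m vbar \<longleftrightarrow>
    (\<forall>n N x (B :: nat set) \<beta> (C :: nat set) d \<psi> \<delta>. codebook n {..<N} x P \<longrightarrow> codebook n B \<beta> Pb \<longrightarrow> finite C \<longrightarrow> C \<noteq> {} \<longrightarrow>
      decodable n N x (B \<times> C) (\<lambda>(b, c). scale h12 (\<beta> b) + d c) \<psi> \<delta> \<longrightarrow>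
      fano_rate \<delta> N + entropy_gap n ({..<N} \<times> B) (\<lambda>(a, b). scale h31 (x a) + scale h32 (\<beta> b)) v ((cmod h31)\<^sup>2 * P + (cmod h32)\<^sup>2 * Pb)
        \<le> entropy_gap n B \<beta> vbar Pb + real n * m)"

lemma side_info_bounded_zero_power:
  assumes h32: "h32 \<noteq> 0" and v_pos: "0 < v" and m_nonneg: "0 \<le> m"
  shows "side_info_bounded 0 Pb h12 h31 h32 v m (v / (cmod h32)\<^sup>2)"
  unfolding side_info_bounded_def
proof (intro allI impI)
  fix n N x \<beta> d \<psi> \<delta> and B C :: "nat set"
  assume x: "codebook n {..<N} x 0" and \<beta>: "codebook n B \<beta> Pb" and C_fin: "finite C" "C \<noteq> {}"
    and dec: "decodable n N x (B \<times> C) (\<lambda>(b, c). scale h12 (\<beta> b) + d c) \<psi> \<delta>"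
  have B_fin: "finite B" "B \<noteq> {}" and Pb_nonneg: "0 \<le> Pb" using \<beta> by (auto simp: codebook_def)
  have "fano_rate \<delta> N \<le> 0" using rate_le_zero_power[OF x _ _ dec] B_fin C_fin by simp
  moreover have "entropy_gap n ({..<N} \<times> B) (\<lambda>(a, b). scale h31 (x a) + scale h32 (\<beta> b)) v ((cmod h32)\<^sup>2 * Pb) = entropy_gap n B \<beta> (v / (cmod h32)\<^sup>2) Pb"
    using entropy_gap_scale[OF B_fin _ h32 Pb_nonneg, of "v / (cmod h32)\<^sup>2" n \<beta>] v_pos h32
    by (simp add: entropy_gap_Times_zero_power[OF x])
  moreover have "0 \<le> real n * m" using m_nonneg by simp
  ultimately show "fano_rate \<delta> N + entropy_gap n ({..<N} \<times> B) (\<lambda>(a, b). scale h31 (x a) + scale h32 (\<beta> b)) v ((cmod h31)\<^sup>2 * 0 + (cmod h32)\<^sup>2 * Pb)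
      \<le> entropy_gap n B \<beta> (v / (cmod h32)\<^sup>2) Pb + real n * m" by simp
qed

text \<open>The premise for \<open>diff_variance = 0\<close> covers the case where \<open>N\<close> is a multiple of \<open>Z\<close>, in which the
  conditional variances of the theorem divide by zero.\<close>

locale side_info_user =
  fixes P Pb s t m :: real and h12 h31 h32 z :: complex
  assumes powers_nonneg: "0 \<le> P" "0 \<le> Pb" and h_nonzero: "h12 \<noteq> 0" "h31 \<noteq> 0" "h32 \<noteq> 0"
    and s_nonneg: "0 \<le> s" and z_le: "cmod z \<le> s" and m_nonneg: "0 \<le> m"
    and snr: "\<And>\<alpha> \<gamma>. 0 < P \<Longrightarrow> \<alpha> + \<gamma> * h31 = 1 \<Longrightarrow> snr_bound P (side_noise h12 h32 Pb s z \<alpha> \<gamma>) m"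
    and noise_cond: "diff_variance (h12 / h32) (s\<^sup>2) z \<noteq> 0 \<Longrightarrow> (cmod h32)\<^sup>2 * t \<le> (s\<^sup>2 - (cmod z)\<^sup>2) / diff_variance (h12 / h32) (s\<^sup>2) z"
    and noise_cond_degenerate: "diff_variance (h12 / h32) (s\<^sup>2) z = 0 \<Longrightarrow> t \<le> 1 / (cmod h12)\<^sup>2"
    and t_pos: "0 < Pb \<Longrightarrow> 0 < t"
begin

abbreviation "cross_ratio \<equiv> h12 / h32"
abbreviation "diff_var \<equiv> diff_variance cross_ratio (s\<^sup>2) z"

lemma diff_var_nonneg: "0 \<le> diff_var"
  using z_le by (rule diff_variance_nonneg)

lemma zero_side_noise: "s = 0 \<Longrightarrow> P = 0 \<and> Pb = 0"
proof -
  assume s: "s = 0"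
  then have z: "z = 0" using z_le by simp
  have "(cmod h32)\<^sup>2 * t \<le> 0" using noise_cond by (simp add: s z diff_variance_def)
  then have "Pb = 0" using t_pos powers_nonneg h_nonzero by (smt (verit) mult_pos_pos zero_less_norm_iff zero_less_power)
  moreover have "\<not> 0 < P"
    using snr[of 0 "1 / h31"] h_nonzero s z \<open>Pb = 0\<close> by (auto simp: snr_bound_def side_noise_def)
  ultimately show "P = 0 \<and> Pb = 0" using powers_nonneg by simp
qed

lemma t_le_side_variance: "t \<le> s\<^sup>2 / (cmod h32)\<^sup>2"
proof (cases "diff_var = 0")
  case True
  have "cmod cross_ratio * s = 1" using diff_variance_eq_0D[OF z_le True] .
  then have "s = cmod h32 / cmod h12" using h_nonzero by (simp add: norm_divide field_simps)
  then show ?thesis using noise_cond_degenerate[OF True] h_nonzero by (simp add: power_divide)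
next
  case False
  then have diff_var_pos: "0 < diff_var" using diff_var_nonneg by simp
  have "(s\<^sup>2 - (cmod z)\<^sup>2) / diff_var \<le> s\<^sup>2" unfolding noise_split(2)[OF diff_var_pos] using diff_var_pos by simp
  then show ?thesis using noise_cond[OF False] h_nonzero by (simp add: pos_le_divide_eq mult.commute)
qed

text \<open>Given \<open>X\<close> and \<open>D\<close>: the variances and covariance of \<open>Y\<close> and \<open>S\<close>, their determinant, and the variance of \<open>h31 Y - S\<close>.\<close>

definition var_Y :: "real" where
  "var_Y = (cmod h12)\<^sup>2 * Pb + 1"

definition var_S :: "real" where
  "var_S = (cmod h32)\<^sup>2 * Pb + s\<^sup>2"

definition cov_YS :: "complex" where
  "cov_YS = h12 * cnj h32 * of_real Pb + z"

definition cov_det :: "real" where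
  "cov_det = var_Y * var_S - (cmod cov_YS)\<^sup>2"

definition contrast :: "real" where
  "contrast = var_S - 2 * Re (cov_YS * h31) + (cmod h31)\<^sup>2 * var_Y"

lemma var_Y_pos: "0 < var_Y"
  using powers_nonneg by (auto simp: var_Y_def intro!: add_nonneg_pos)

lemma side_noise_eq: "side_noise h12 h32 Pb s z \<alpha> \<gamma> = (cmod \<alpha>)\<^sup>2 * var_Y + (cmod \<gamma>)\<^sup>2 * var_S + 2 * Re (\<alpha> * cnj \<gamma> * cov_YS)"
  unfolding side_noise_def var_Y_def var_S_def cov_YS_def cmod_power2 by (simp add: algebra_simps power2_eq_square)

lemma contrast_eq: "contrast = (cmod (h31 * h12 - h32))\<^sup>2 * Pb + ((cmod h31)\<^sup>2 + s\<^sup>2 - 2 * Re (h31 * z))"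
  unfolding contrast_def var_Y_def var_S_def cov_YS_def cmod_power2 by (simp add: algebra_simps power2_eq_square)

lemma contrast_noise_ge: "(cmod h31 - s)\<^sup>2 \<le> (cmod h31)\<^sup>2 + s\<^sup>2 - 2 * Re (h31 * z)"
  using complex_Re_le_cmod[of "h31 * z"] mult_left_mono[OF z_le, of "cmod h31"]
  by (simp add: norm_mult power2_eq_square algebra_simps)

lemma contrast_nonneg: "0 \<le> contrast"
proof -
  have "0 \<le> (cmod (h31 * h12 - h32))\<^sup>2 * Pb" using powers_nonneg by simp
  then show ?thesis unfolding contrast_eq using contrast_noise_ge zero_le_power2[of "cmod h31 - s"] by linarith
qed

lemma cov_det_eq: "cov_det = (cmod h32)\<^sup>2 * Pb * diff_var + (s\<^sup>2 - (cmod z)\<^sup>2)"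
proof -
  have expand: "((cmod (q * h32))\<^sup>2 * Pb + 1) * ((cmod h32)\<^sup>2 * Pb + w) - (cmod (q * h32 * cnj h32 * of_real Pb + z))\<^sup>2
      = (cmod h32)\<^sup>2 * Pb * (1 + (cmod q)\<^sup>2 * w - 2 * Re (cnj q * z)) + (w - (cmod z)\<^sup>2)" for q w
    unfolding cmod_power2 by (simp add: algebra_simps power2_eq_square)
  have "h12 = cross_ratio * h32" using h_nonzero by simp
  then show ?thesis using expand[of cross_ratio "s\<^sup>2"]
    unfolding cov_det_def var_Y_def var_S_def cov_YS_def diff_variance_def by (simp only:)
qed

lemma contrast_zeroD:
  assumes "contrast = 0"
  shows "cmod h31 = s" "Re (h31 * z) = s\<^sup>2" "Pb = 0 \<or> h32 = h31 * h12"
proof -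
  have "0 \<le> (cmod (h31 * h12 - h32))\<^sup>2 * Pb" using powers_nonneg by simp
  then have zero: "(cmod h31)\<^sup>2 + s\<^sup>2 - 2 * Re (h31 * z) = 0" "(cmod (h31 * h12 - h32))\<^sup>2 * Pb = 0"
    using assms contrast_noise_ge zero_le_power2[of "cmod h31 - s"] unfolding contrast_eq by linarith+
  show "cmod h31 = s" using contrast_noise_ge zero(1) by simp
  then show "Re (h31 * z) = s\<^sup>2" using zero(1) by simp
  show "Pb = 0 \<or> h32 = h31 * h12" using zero(2) by auto
qed

lemma side_info_bounded_degenerate:
  assumes P_pos: "0 < P" and contrast: "contrast = 0"
  shows "0 < Pb \<longrightarrow> t \<le> 1 / (cmod h12)\<^sup>2" and "side_info_bounded P Pb h12 h31 h32 (s\<^sup>2) m (1 / (cmod h12)\<^sup>2)"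
proof -
  note degenerate = contrast_zeroD[OF contrast]
  have s_pos: "0 < s" using zero_side_noise P_pos s_nonneg by fastforce
  show "0 < Pb \<longrightarrow> t \<le> 1 / (cmod h12)\<^sup>2"
  proof (intro impI noise_cond_degenerate)
    assume "0 < Pb"
    then have h32: "h32 = h31 * h12" using degenerate(3) by simp
    have "cnj cross_ratio * z = (h31 * z) / (h31 * cnj h31)" using h_nonzero by (simp add: h32 field_simps)
    also have "\<dots> = (h31 * z) / of_real ((cmod h31)\<^sup>2)" by (simp only: complex_norm_square)
    finally have "Re (cnj cross_ratio * z) = 1" using degenerate(1,2) s_pos by (simp only: Re_divide_of_real) simp
    moreover have "(cmod cross_ratio)\<^sup>2 * s\<^sup>2 = 1"
      using h_nonzero s_pos by (simp add: h32 norm_divide norm_mult power_divide power_mult_distrib degenerate(1))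
    ultimately show "diff_var = 0" by (simp only: diff_variance_def)
  qed
  have snr_le: "ln (1 + P / var_Y) \<le> m" using snr[OF P_pos, of 1 0] by (simp add: side_noise_eq snr_bound_def)
  have "(P + (cmod h12)\<^sup>2 * Pb + 1) / ((cmod h12)\<^sup>2 * Pb + 1) = 1 + P / var_Y"
    using var_Y_pos by (simp add: var_Y_def add_divide_distrib[symmetric] field_simps)
  then show "side_info_bounded P Pb h12 h31 h32 (s\<^sup>2) m (1 / (cmod h12)\<^sup>2)"
    using rate_le_side_info_degenerate[OF _ _ _ _ _ h_nonzero(2,1) disjI2[OF refl] degenerate(3)] mult_left_mono[OF snr_le]
    unfolding side_info_bounded_def degenerate(1) by (smt (verit) of_nat_0_le_iff)
qed

lemma snr_contrast:
  assumes P_pos: "0 < P" and contrast_pos: "0 < contrast"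
  shows "0 < cov_det" "ln (1 + P * contrast / cov_det) \<le> m"
proof -
  let ?a = "of_real var_S - cnj h31 * cnj cov_YS" and ?c = "cnj h31 * of_real var_Y - cov_YS"
  have sum: "?a + ?c * h31 = of_real contrast"
    unfolding contrast_def cmod_power2 complex_eq_iff by (simp add: algebra_simps power2_eq_square)
  have unit_gain: "?a / of_real contrast + ?c / of_real contrast * h31 = 1"
    unfolding times_divide_eq_left add_divide_distrib[symmetric] sum using contrast_pos by simp
  have "side_noise h12 h32 Pb s z ?a ?c = cov_det * contrast"
    unfolding side_noise_eq cov_det_def contrast_def cmod_power2 by (simp add: algebra_simps power2_eq_square)
  moreover have "side_noise h12 h32 Pb s z (?a / of_real contrast) (?c / of_real contrast) = side_noise h12 h32 Pb s z ?a ?c / contrast\<^sup>2"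
  proof -
    have "?a / of_real contrast * cnj (?c / of_real contrast) * cov_YS = ?a * cnj ?c * cov_YS / of_real (contrast\<^sup>2)"
      by (simp add: power2_eq_square)
    then show ?thesis unfolding side_noise_eq
      by (simp only: Re_divide_of_real norm_divide norm_of_real power_divide power2_abs add_divide_distrib times_divide_eq_left times_divide_eq_right)
  qed
  ultimately have "side_noise h12 h32 Pb s z (?a / of_real contrast) (?c / of_real contrast) = cov_det / contrast"
    using contrast_pos by (simp add: power2_eq_square)
  then have "snr_bound P (cov_det / contrast) m" using snr[OF P_pos unit_gain] by (simp only:)
  then show "0 < cov_det" "ln (1 + P * contrast / cov_det) \<le> m"
    using contrast_pos by (auto simp: snr_bound_def zero_less_divide_iff)
qed

lemma diff_var_pos:
  assumes P_pos: "0 < P" and contrast_pos: "0 < contrast"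
  shows "0 < diff_var"
proof (rule ccontr)
  assume "\<not> 0 < diff_var"
  then have diff_var_zero: "diff_var = 0" using diff_var_nonneg by simp
  have gain: "cmod cross_ratio * s = 1" using diff_variance_eq_0D[OF z_le diff_var_zero] .
  then have "(cmod cross_ratio)\<^sup>2 * s\<^sup>2 = 1" by (simp only: power_mult_distrib[symmetric] one_power2)
  then have "Re (cnj cross_ratio * z) = 1" using diff_var_zero unfolding diff_variance_def by simp
  then have "cmod cross_ratio * s \<le> cmod cross_ratio * cmod z"
    using complex_Re_le_cmod[of "cnj cross_ratio * z"] gain by (simp only: norm_mult complex_mod_cnj)
  then have "s \<le> cmod z" using h_nonzero by simp
  then have "s\<^sup>2 \<le> (cmod z)\<^sup>2" using s_nonneg by (intro power_mono) auto
  then show False using snr_contrast(1)[OF assms] cov_det_eq diff_var_zero by simp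
qed

text \<open>The best linear estimate of \<open>Y - D\<close> from \<open>S\<close>.\<close>

lemma estimation_error:
  defines "v \<equiv> (s\<^sup>2 - (cmod z)\<^sup>2) / diff_var" and "g \<equiv> (cnj z - cnj cross_ratio * of_real (s\<^sup>2)) / of_real diff_var"
  defines "\<kappa> \<equiv> (cnj h31 * of_real P + cov_YS) / of_real ((cmod h31)\<^sup>2 * P + var_S)"
  defines "\<tau> \<equiv> (cmod (1 + (cross_ratio - \<kappa>) * g))\<^sup>2 * diff_var + (cmod (cross_ratio - \<kappa>))\<^sup>2 * v + (cmod (1 - \<kappa> * h31))\<^sup>2 * P + (cmod (cross_ratio * h32 - \<kappa> * h32))\<^sup>2 * Pb"
  assumes diff_var_pos: "0 < diff_var" and S_pos: "0 < (cmod h31)\<^sup>2 * P + var_S"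
  shows "((cmod h31)\<^sup>2 * P + var_S) * \<tau> = cov_det + P * contrast"
proof -
  let ?S = "(cmod h31)\<^sup>2 * P + var_S" and ?c = "cnj h31 * of_real P + cov_YS"
    and ?d = "cnj z - cnj cross_ratio * of_real (s\<^sup>2)"
  have h12: "cross_ratio * h32 = h12" using h_nonzero by simp
  have expand: "1 + (cmod q)\<^sup>2 * w - 2 * Re (cnj q * z) + 2 * Re ((q - l) * (cnj z - cnj q * of_real w)) + (cmod (q - l))\<^sup>2 * w + (cmod (1 - l * h31))\<^sup>2 * P + (cmod (h12 - l * h32))\<^sup>2 * Pb
      = P + ((cmod h12)\<^sup>2 * Pb + 1) + ((cmod l)\<^sup>2 * ((cmod h31)\<^sup>2 * P + ((cmod h32)\<^sup>2 * Pb + w)) - 2 * Re (cnj l * (cnj h31 * of_real P + (h12 * cnj h32 * of_real Pb + z))))" for q l w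
    unfolding cmod_power2 by (simp add: algebra_simps power2_eq_square)
  have "\<tau> = diff_var + 2 * Re ((cross_ratio - \<kappa>) * ?d) + (cmod (cross_ratio - \<kappa>))\<^sup>2 * s\<^sup>2 + (cmod (1 - \<kappa> * h31))\<^sup>2 * P + (cmod (h12 - \<kappa> * h32))\<^sup>2 * Pb"
    unfolding \<tau>_def g_def v_def noise_split(3)[OF diff_var_pos] h12 ..
  also have "\<dots> = P + var_Y + ((cmod \<kappa>)\<^sup>2 * ?S - 2 * Re (cnj \<kappa> * ?c))"
    using expand[of cross_ratio "s\<^sup>2" \<kappa>] unfolding diff_variance_def[of cross_ratio] var_Y_def var_S_def cov_YS_def .
  also have "\<dots> = P + var_Y - (cmod ?c)\<^sup>2 / ?S" unfolding \<kappa>_def complete_square[OF S_pos] by simp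
  finally have "?S * \<tau> = (P + var_Y) * ?S - (cmod ?c)\<^sup>2" using S_pos by (simp add: right_diff_distrib mult.commute)
  then show ?thesis unfolding cov_det_def contrast_def cmod_power2 by (simp add: algebra_simps power2_eq_square)
qed

lemma side_info_bounded_contrast:
  assumes P_pos: "0 < P" and contrast_pos: "0 < contrast"
  defines "v \<equiv> (s\<^sup>2 - (cmod z)\<^sup>2) / diff_var"
  shows "0 < v" "t \<le> v / (cmod h32)\<^sup>2" and "side_info_bounded P Pb h12 h31 h32 (s\<^sup>2) m (v / (cmod h32)\<^sup>2)"
proof -
  note det = snr_contrast[OF P_pos contrast_pos] and diff_var_pos = diff_var_pos[OF P_pos contrast_pos]
  let ?S = "(cmod h31)\<^sup>2 * P + (cmod h32)\<^sup>2 * Pb + s\<^sup>2"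
  define g \<kappa> where "g = (cnj z - cnj cross_ratio * of_real (s\<^sup>2)) / of_real diff_var"
    and "\<kappa> = (cnj h31 * of_real P + cov_YS) / of_real ((cmod h31)\<^sup>2 * P + var_S)"
  define \<tau>
    where "\<tau> = (cmod (1 + (cross_ratio - \<kappa>) * g))\<^sup>2 * diff_var + (cmod (cross_ratio - \<kappa>))\<^sup>2 * v + (cmod (1 - \<kappa> * h31))\<^sup>2 * P + (cmod (cross_ratio * h32 - \<kappa> * h32))\<^sup>2 * Pb"
  note split = noise_split[OF diff_var_pos, folded v_def g_def]
  have h12: "cross_ratio * h32 = h12" using h_nonzero by simp
  have v_diff_var: "v * diff_var = s\<^sup>2 - (cmod z)\<^sup>2" using diff_var_pos by (simp add: v_def)
  show v_pos: "0 < v"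
  proof (cases "Pb = 0")
    case True
    then show ?thesis using det(1) cov_det_eq diff_var_pos by (simp add: v_def)
  next
    case False
    then have "0 < (cmod h32)\<^sup>2 * t" using t_pos powers_nonneg h_nonzero by simp
    then show ?thesis using noise_cond diff_var_pos by (simp add: v_def)
  qed
  show "t \<le> v / (cmod h32)\<^sup>2" using noise_cond diff_var_pos h_nonzero by (simp add: v_def pos_le_divide_eq mult_ac)
  have "0 < s" using zero_side_noise P_pos s_nonneg by fastforce
  then have S_pos: "0 < ?S" using powers_nonneg by (simp add: add_nonneg_pos)
  have S\<tau>: "?S * \<tau> = cov_det + P * contrast"
    using estimation_error[OF diff_var_pos, folded v_def g_def \<kappa>_def] S_pos unfolding \<tau>_def var_S_def add.assoc by blast
  have "0 < cov_det + P * contrast" using det(1) P_pos contrast_pos by (simp add: add_pos_pos)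
  then have \<tau>_pos: "0 < \<tau>" using S_pos unfolding S\<tau>[symmetric] by (simp add: zero_less_mult_iff)
  have "diff_var * ((cmod h32)\<^sup>2 * Pb + v) = cov_det" unfolding cov_det_eq v_diff_var[symmetric] by (simp add: algebra_simps)
  then have snr_eq: "?S * \<tau> / (diff_var * ((cmod h32)\<^sup>2 * Pb + v)) = 1 + P * contrast / cov_det"
    unfolding S\<tau> using det(1) by (simp add: add_divide_distrib)
  show "side_info_bounded P Pb h12 h31 h32 (s\<^sup>2) m (v / (cmod h32)\<^sup>2)"
    unfolding side_info_bounded_def
  proof (intro allI impI)
    fix n N x \<beta> d \<psi> \<delta> and B C :: "nat set"
    assume user: "codebook n {..<N} x P" "codebook n B \<beta> Pb" "finite C" "C \<noteq> {}" "decodable n N x (B \<times> C) (\<lambda>(b, c). scale h12 (\<beta> b) + d c) \<psi> \<delta>"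
    then have "decodable n N x (B \<times> C) (\<lambda>(b, c). scale (cross_ratio * h32) (\<beta> b) + d c) \<psi> \<delta>" by (simp only: h12)
    from rate_le_side_info[OF user(1-4) this diff_var_pos v_pos h_nonzero(3) split(4,1) \<tau>_def \<tau>_pos] mult_left_mono[OF det(2), of "real n"]
    show "fano_rate \<delta> N + entropy_gap n ({..<N} \<times> B) (\<lambda>(a, b). scale h31 (x a) + scale h32 (\<beta> b)) (s\<^sup>2) ((cmod h31)\<^sup>2 * P + (cmod h32)\<^sup>2 * Pb)
      \<le> entropy_gap n B \<beta> (v / (cmod h32)\<^sup>2) Pb + real n * m" unfolding snr_eq by linarith
  qed
qed

theorem side_info_bounded_ex: "\<exists>vbar>0. (0 < Pb \<longrightarrow> t \<le> vbar) \<and> side_info_bounded P Pb h12 h31 h32 (side_variance s) m vbar"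
proof -
  consider (no_signal) "P = 0" | (degenerate) "0 < P" "contrast = 0" | (regular) "0 < P" "0 < contrast"
    using powers_nonneg(1) contrast_nonneg by linarith
  then show ?thesis
  proof cases
    case no_signal
    have variance_pos: "0 < side_variance s" by (simp add: side_variance_def)
    have "t \<le> side_variance s / (cmod h32)\<^sup>2" if "0 < Pb"
    proof -
      have "s \<noteq> 0" using zero_side_noise that by auto
      then show ?thesis using t_le_side_variance s_nonneg by (simp add: side_variance_def)
    qed
    moreover have "0 < side_variance s / (cmod h32)\<^sup>2" using variance_pos h_nonzero by simp
    ultimately show ?thesis
      using side_info_bounded_zero_power[OF h_nonzero(3) variance_pos m_nonneg] no_signal by blast
  next
    case degenerate
    have "s \<noteq> 0" using zero_side_noise degenerate(1) by auto
    moreover have "0 < 1 / (cmod h12)\<^sup>2" using h_nonzero by simp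
    ultimately show ?thesis
      using side_info_bounded_degenerate[OF degenerate] by (simp only: side_variance_def if_False) blast
  next
    case regular
    have "s \<noteq> 0" using zero_side_noise regular(1) by auto
    moreover have "0 < (s\<^sup>2 - (cmod z)\<^sup>2) / diff_var / (cmod h32)\<^sup>2"
      using h_nonzero by (intro divide_pos_pos[OF side_info_bounded_contrast(1)[OF regular]]) simp
    ultimately show ?thesis
      using side_info_bounded_contrast(2,3)[OF regular] by (simp only: side_variance_def if_False) blast
  qed
qed

end

section \<open>From codes to centred codebooks\<close>

lemma cgauss_1: "cgauss 1 = density lborel (\<lambda>z. ennreal (gauss1 1 z))"
  unfolding cgauss_def gauss1_def ..

lemma prob_space_cgauss: "prob_space (cgauss 1)"
  unfolding cgauss_1 by (rule prob_spaceI) (use nn_integral_gauss1[of 1] in \<open>simp add: emeasure_density\<close>)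

lemma sets_cgauss [simp]: "sets (cgauss 1) = sets borel" by (simp add: cgauss_def)

lemma prob_space_noiseM: "prob_space (noiseM n)"
  unfolding noiseM_def by (intro prob_space_PiM prob_space_cgauss)

lemma PiM_cgauss: "PiM {..<n} (\<lambda>_. cgauss 1) = density (lborelC n) (\<lambda>y. ennreal (gauss n 1 y))"
proof -
  interpret prob_space "cgauss 1" by (rule prob_space_cgauss)
  interpret product_sigma_finite "\<lambda>_::nat. cgauss 1" by unfold_locales
  have lborel_product: "product_sigma_finite (\<lambda>_::nat. lborel :: complex measure)" by unfold_locales
  show ?thesis
  proof (rule PiM_eqI[symmetric])
    show "sets (density (lborelC n) (\<lambda>y. ennreal (gauss n 1 y))) = sets (PiM {..<n} (\<lambda>_. cgauss 1))"
      unfolding lborelC_def sets_density by (intro sets_PiM_cong) auto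
    fix A :: "nat \<Rightarrow> complex set" assume A: "\<And>t. t \<in> {..<n} \<Longrightarrow> A t \<in> sets (cgauss 1)"
    have "PiE {..<n} A \<in> sets (lborelC n)" unfolding lborelC_def using A by (intro sets_PiM_I_finite) auto
    then have "emeasure (density (lborelC n) (\<lambda>y. ennreal (gauss n 1 y))) (PiE {..<n} A) = (\<integral>\<^sup>+y. ennreal (gauss n 1 y) * indicator (PiE {..<n} A) y \<partial>lborelC n)"
      by (intro emeasure_density density_measurable)
    also have "\<dots> = (\<integral>\<^sup>+y. (\<Prod>t<n. ennreal (gauss1 1 (y t)) * indicator (A t) (y t)) \<partial>lborelC n)"
    proof (rule nn_integral_cong)
      fix y assume y: "y \<in> space (lborelC n)"
      have "indicator (PiE {..<n} A) y = (\<Prod>t<n. indicator (A t) (y t) :: ennreal)"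
        using y by (auto simp: space_lborelC PiE_iff indicator_def prod_zero_iff)
      moreover have "ennreal (gauss n 1 y) = (\<Prod>t<n. ennreal (gauss1 1 (y t)))"
        unfolding gauss_eq_prod by (rule prod_ennreal[symmetric]) (simp add: gauss1_nonneg)
      ultimately show "ennreal (gauss n 1 y) * indicator (PiE {..<n} A) y = (\<Prod>t<n. ennreal (gauss1 1 (y t)) * indicator (A t) (y t))"
        by (simp add: prod.distrib)
    qed
    also have "\<dots> = (\<Prod>t<n. \<integral>\<^sup>+z. ennreal (gauss1 1 z) * indicator (A t) z \<partial>lborel)"
      unfolding lborelC_def using A by (intro product_sigma_finite.product_nn_integral_prod[OF lborel_product]) auto
    also have "\<dots> = (\<Prod>t<n. emeasure (cgauss 1) (A t))"
      using A by (intro prod.cong refl) (auto simp: cgauss_1 emeasure_density)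
    finally show "emeasure (density (lborelC n) (\<lambda>y. ennreal (gauss n 1 y))) (PiE {..<n} A) = (\<Prod>t<n. emeasure (cgauss 1) (A t))" .
  qed simp
qed

definition noise_block :: "nat \<Rightarrow> nat \<Rightarrow> (nat \<times> nat \<Rightarrow> complex) \<Rightarrow> cvec" where
  "noise_block n k z = (\<lambda>t\<in>{..<n}. z (k, t))"

lemma distr_noise_block:
  assumes "k \<in> users"
  shows "distr (noiseM n) (lborelC n) (noise_block n k) = density (lborelC n) (\<lambda>y. ennreal (gauss n 1 y))"
proof -
  have "distr (noiseM n) (PiM {..<n} (\<lambda>_. cgauss 1)) (noise_block n k) = PiM {..<n} (\<lambda>_. cgauss 1)"
    unfolding noiseM_def noise_block_def using assms by (intro distr_PiM_reindex prob_space_cgauss) (auto simp: inj_on_def)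
  moreover have "sets (PiM {..<n} (\<lambda>_. cgauss 1)) = sets (lborelC n)" unfolding lborelC_def by (intro sets_PiM_cong) auto
  ultimately show ?thesis
    using PiM_cgauss distr_cong[OF refl, of "PiM {..<n} (\<lambda>_. cgauss 1)" "lborelC n" "noiseM n"] by metis
qed

lemma noise_block_measurable: "k \<in> users \<Longrightarrow> noise_block n k \<in> measurable (noiseM n) (lborelC n)"
  unfolding noiseM_def lborelC_def noise_block_def
  by (intro measurable_restrict measurable_compose[OF measurable_component_singleton]) (auto simp: measurable_def)

lemma received_block_measurable:
  "k \<in> users \<Longrightarrow> \<phi> \<in> measurable (lborelC n) (count_space UNIV) \<Longrightarrow> (\<lambda>z. \<phi> (trunc n (s + noise_block n k z))) \<in> measurable (noiseM n) (count_space UNIV)"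
  by (rule measurable_compose[OF measurable_trunc]) (intro vec_measurableI vec_measurable_lborelC noise_block_measurable)

lemma measure_decode_noiseM:
  assumes k: "k \<in> users" and \<phi>: "\<phi> \<in> measurable (lborelC n) (count_space UNIV)"
  shows "measure (noiseM n) {z \<in> space (noiseM n). \<phi> (trunc n (s + noise_block n k z)) = a} = decode_prob n \<phi> a s"
proof -
  let ?E = "{y \<in> space (lborelC n). \<phi> (trunc n (y + s)) = a}"
  have "(\<lambda>y. \<phi> (trunc n (y + s))) \<in> measurable (lborelC n) (count_space UNIV)"
    by (rule measurable_compose[OF measurable_trunc \<phi>]) (intro density_measurable)
  from measurable_sets[OF this, of "{a}"] have E: "?E \<in> sets (lborelC n)" by (auto simp: vimage_def Int_def conj_commute)
  have "measure (noiseM n) {z \<in> space (noiseM n). \<phi> (trunc n (s + noise_block n k z)) = a} = measure (distr (noiseM n) (lborelC n) (noise_block n k)) ?E"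
    using measurable_space[OF noise_block_measurable[OF k]]
    by (subst measure_distr[OF noise_block_measurable[OF k] E]) (auto simp: add.commute intro!: arg_cong[where f="measure _"])
  also have "\<dots> = (\<integral>y. gauss n 1 y * indicator ?E y \<partial>lborelC n)"
    unfolding distr_noise_block[OF k]
    using E integral_eq_nn_integral[of "\<lambda>y. gauss n 1 y * indicator ?E y" "lborelC n"] gauss_measurable[OF vec_measurable_proj(1), of n 1]
    by (simp add: measure_def emeasure_density ennreal_mult' ennreal_indicator)
  also have "\<dots> = (\<integral>y. (\<lambda>y. gauss n 1 (y - s) * indicator {y. \<phi> y = a} y) (trunc n (y + s)) \<partial>lborelC n)"
  proof (rule Bochner_Integration.integral_cong[OF refl])
    fix y assume "y \<in> space (lborelC n)"
    moreover have "gauss n 1 (trunc n (y + s) - s) = gauss n 1 y" by (rule gauss_cong) simp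
    ultimately show "gauss n 1 y * indicator ?E y = (\<lambda>y. gauss n 1 (y - s) * indicator {y. \<phi> y = a} y) (trunc n (y + s))"
      by (simp add: indicator_def)
  qed
  also have "\<dots> = decode_prob n \<phi> a s"
    unfolding decode_prob_def
    using borel_measurable_indicator_eq[OF \<phi>, of a] by (intro integral_lborelC_translate(2) density_measurable)
  finally show ?thesis .
qed

lemma sum_PiE_users:
  assumes users: "users = {k, v, t}" "k \<noteq> v" "k \<noteq> t" "v \<noteq> t"
  shows "(\<Sum>m\<in>PiE users (\<lambda>k. {..<M k}). F (m k) (m v) (m t)) = (\<Sum>a<M k. \<Sum>w\<in>{..<M v} \<times> {..<M t}. F a (fst w) (snd w) :: real)"
proof -
  have "(\<Sum>m\<in>PiE users (\<lambda>k. {..<M k}). F (m k) (m v) (m t)) = (\<Sum>q\<in>{..<M k} \<times> ({..<M v} \<times> {..<M t}). F (fst q) (fst (snd q)) (snd (snd q)))"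
    by (rule sum.reindex_bij_witness[where i="\<lambda>q. \<lambda>j\<in>users. if j = k then fst q else if j = v then fst (snd q) else snd (snd q)" and j="\<lambda>m. (m k, (m v, m t))"])
      (use users in \<open>auto simp: PiE_iff extensional_def fun_eq_iff restrict_def\<close>)
  then show ?thesis by (simp add: sum.cartesian_product split_def)
qed

lemma msize_ge: "2 powr (real n * R k) \<le> real (msize n R k)" "1 \<le> msize n R k"
proof -
  show "2 powr (real n * R k) \<le> real (msize n R k)"
    unfolding msize_def by (smt (verit) of_nat_nat powr_ge_zero real_nat_ceiling_ge)
  have "0 < 2 powr (real n * R k)" by simp
  then show "1 \<le> msize n R k" unfolding msize_def by (simp add: Suc_le_eq)
qed

locale ic_code =
  fixes h :: "nat \<Rightarrow> nat \<Rightarrow> complex" and P :: "nat \<Rightarrow> real" and n :: nat and M :: "nat \<Rightarrow> nat"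
    and enc :: "nat \<Rightarrow> nat \<Rightarrow> cvec" and dec :: "nat \<Rightarrow> cvec \<Rightarrow> nat"
  assumes code: "is_code P n M enc dec" and M_ge_1: "\<And>k. 1 \<le> M k" and P_nonneg: "\<And>k. k \<in> users \<Longrightarrow> 0 \<le> P k"
begin

definition enc_mean :: "nat \<Rightarrow> cvec" where
  "enc_mean k = (\<lambda>t. (\<Sum>w<M k. enc k w t) / of_nat (M k))"

definition centred_enc :: "nat \<Rightarrow> nat \<Rightarrow> cvec" where
  "centred_enc k w = enc k w - enc_mean k"

definition centred_dec :: "nat \<Rightarrow> cvec \<Rightarrow> nat" where
  "centred_dec k y = dec k (trunc n (y + (enc_mean k + (\<lambda>t. \<Sum>j\<in>users - {k}. h k j * enc_mean j t))))"

lemma centred_enc_codebook: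
  assumes k: "k \<in> users"
  shows "codebook n {..<M k} (centred_enc k) (P k)"
proof -
  have "of_nat (M k) \<noteq> (0::complex)" using M_ge_1[of k] by simp
  then have centred: "centred n {..<M k} (centred_enc k)"
    by (auto simp: centred_def centred_enc_def enc_mean_def sum_subtractf)
  have "(\<Sum>w<M k. sqnorm n (enc k w)) = (\<Sum>w<M k. sqnorm n (enc_mean k + scale 1 (centred_enc k w)))"
    by (simp add: centred_enc_def)
  also have "\<dots> = real (M k) * sqnorm n (enc_mean k) + (\<Sum>w<M k. sqnorm n (centred_enc k w))"
    using centred_sum_sqnorm[OF centred, of "enc_mean k" 1] by simp
  finally have "(\<Sum>w<M k. sqnorm n (centred_enc k w)) \<le> (\<Sum>w<M k. sqnorm n (enc k w))" by simp
  also have "\<dots> \<le> (\<Sum>w<M k. real n * P k)" using code k by (intro sum_mono) (auto simp: is_code_def sqnorm_def)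
  finally show ?thesis using centred M_ge_1[of k] P_nonneg[OF k] by (auto simp: codebook_def lessThan_empty_iff)
qed

lemma dec_measurable: "k \<in> users \<Longrightarrow> dec k \<in> measurable (lborelC n) (count_space UNIV)"
proof -
  have sets_eq: "sets (PiM {..<n} (\<lambda>_. borel :: complex measure)) = sets (lborelC n)"
    unfolding lborelC_def by (intro sets_PiM_cong) auto
  show "k \<in> users \<Longrightarrow> dec k \<in> measurable (lborelC n) (count_space UNIV)"
    using code unfolding is_code_def measurable_cong_sets[OF sets_eq refl] by blast
qed

lemma centred_dec_measurable: "k \<in> users \<Longrightarrow> centred_dec k \<in> measurable (lborelC n) (count_space UNIV)"
  unfolding centred_dec_def[abs_def]
  by (rule measurable_compose[OF measurable_trunc dec_measurable]) (intro density_measurable)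

lemma rx_eq: "rx h n enc m z k = trunc n ((enc k (m k) + (\<lambda>t. \<Sum>j\<in>users - {k}. h k j * enc j (m j) t)) + noise_block n k z)"
  unfolding rx_def noise_block_def by (auto simp: fun_eq_iff restrict_def)

definition error_event :: "(nat \<Rightarrow> nat) \<Rightarrow> (nat \<times> nat \<Rightarrow> complex) set" where
  "error_event m = {z \<in> space (noiseM n). \<exists>k\<in>users. dec k (rx h n enc m z k) \<noteq> m k}"

lemma error_event_measurable: "error_event m \<in> sets (noiseM n)"
proof -
  have "{z \<in> space (noiseM n). dec j (rx h n enc m z j) \<noteq> m j} \<in> sets (noiseM n)" if "j \<in> users" for j
    using measurable_sets[OF received_block_measurable[OF that dec_measurable[OF that]], of "- {m j}"]
    unfolding rx_eq by (auto simp: vimage_def Int_def conj_commute)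
  moreover have "error_event m = (\<Union>j\<in>users. {z \<in> space (noiseM n). dec j (rx h n enc m z j) \<noteq> m j})"
    by (auto simp: error_event_def)
  ultimately show ?thesis by (auto simp: users_def)
qed

context
  fixes k v t :: nat
  assumes users: "users = {k, v, t}" "k \<noteq> v" "k \<noteq> t" "v \<noteq> t"
begin

abbreviation "centred_signal a b c \<equiv> centred_enc k a + (scale (h k v) (centred_enc v b) + scale (h k t) (centred_enc t c))"

lemma dec_rx_eq: "dec k (rx h n enc m z k) = centred_dec k (trunc n (centred_signal (m k) (m v) (m t) + noise_block n k z))"
proof -
  have "users - {k} = {v, t}" using users by auto
  then show ?thesis
    unfolding centred_dec_def rx_eq
    by (intro arg_cong[where f="dec k"]) (use users in \<open>auto simp: fun_eq_iff restrict_def centred_enc_def noise_block_def algebra_simps\<close>)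
qed

lemma decode_prob_ge: "1 - decode_prob n (centred_dec k) (m k) (centred_signal (m k) (m v) (m t)) \<le> measure (noiseM n) (error_event m)"
proof -
  interpret prob_space "noiseM n" by (rule prob_space_noiseM)
  let ?ok = "{z \<in> space (noiseM n). centred_dec k (trunc n (centred_signal (m k) (m v) (m t) + noise_block n k z)) = m k}"
  have k: "k \<in> users" using users by auto
  have "?ok \<in> sets (noiseM n)"
    using measurable_sets[OF received_block_measurable[OF k centred_dec_measurable[OF k]], of "{m k}"]
    by (auto simp: vimage_def Int_def conj_commute)
  then have "1 - decode_prob n (centred_dec k) (m k) (centred_signal (m k) (m v) (m t)) = prob (space (noiseM n) - ?ok)"
    using prob_compl[of ?ok] measure_decode_noiseM[OF k centred_dec_measurable[OF k]] by simp
  also have "\<dots> \<le> prob (error_event m)"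
    using k by (intro finite_measure_mono error_event_measurable) (auto simp: error_event_def dec_rx_eq[symmetric])
  finally show ?thesis .
qed

lemma centred_dec_decodable:
  "decodable n (M k) (centred_enc k) ({..<M v} \<times> {..<M t}) (\<lambda>(b, c). scale (h k v) (centred_enc v b) + scale (h k t) (centred_enc t c)) (centred_dec k) (err h n M enc dec)"
proof -
  let ?PE = "PiE users (\<lambda>k. {..<M k})" and ?p = "\<lambda>a b c. decode_prob n (centred_dec k) a (centred_signal a b c)"
  have k: "k \<in> users" using users by auto
  have "card ?PE = (\<Prod>j\<in>users. M j)" by (simp add: card_PiE users_def)
  also have "\<dots> = M k * (M v * M t)" unfolding users(1) using users(2-4) by simp
  finally have card: "real (card ?PE) = real (M k) * (real (M v) * real (M t))" by simp
  then have card_pos: "0 < real (card ?PE)" using M_ge_1[of k] M_ge_1[of v] M_ge_1[of t] by simp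
  have card_users: "real (M 1 * M 2 * M 3) = real (card ?PE)" by (simp add: card_PiE users_def)
  have "(\<Sum>m\<in>?PE. 1 - ?p (m k) (m v) (m t)) \<le> (\<Sum>m\<in>?PE. measure (noiseM n) (error_event m))"
    by (intro sum_mono decode_prob_ge)
  also have "\<dots> = err h n M enc dec * real (card ?PE)"
    unfolding err_def card_users error_event_def using card_pos by simp
  finally have "(1 - err h n M enc dec) * real (card ?PE) \<le> (\<Sum>m\<in>?PE. ?p (m k) (m v) (m t))"
    by (simp add: sum_subtractf algebra_simps)
  then show ?thesis
    unfolding decodable_def sum_PiE_users[OF users, where F="?p"]
    using centred_dec_measurable[OF k] by (simp add: card card_cartesian_product split_def)
qed

end

end

section \<open>Gaussian mutual informations\<close>

lemma finite_users [simp]: "finite users" by (simp add: users_def)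

lemma sum_gbase: "(\<Sum>i\<in>gbase. f i) = (\<Sum>k\<in>users. \<Sum>i\<in>{GX k, GZ k, GW k, GN k, GV k, GV' k}. f i :: 'a::comm_monoid_add)"
  unfolding gbase_def by (rule sum.UNION_disjoint) auto

text \<open>The covariances \<open>K0\<close> and \<open>Kf\<close> differ only in the variances \<open>f\<close>, \<open>f'\<close> of \<open>GV\<close> and \<open>GV'\<close>.\<close>

definition base_cov :: "prm \<Rightarrow> (nat \<Rightarrow> real) \<Rightarrow> (nat \<Rightarrow> real) \<Rightarrow> gv \<Rightarrow> gv \<Rightarrow> complex" where
  "base_cov Q f f' i j = (case (i, j) of
      (GV k, GV l) \<Rightarrow> if k = l then complex_of_real (f k) else 0
    | (GV' k, GV' l) \<Rightarrow> if k = l then complex_of_real (f' k) else 0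
    | _ \<Rightarrow> K0 Q i j)"

lemma K0_eq_base_cov: "K0 Q = base_cov Q (\<lambda>_. 0) (\<lambda>_. 0)"
  by (intro ext) (auto simp: base_cov_def K0_def split: gv.splits)

lemma Kf_eq_base_cov: "Kf Q p = base_cov Q (vVN Q p) (vVN' Q p)"
  by (intro ext) (auto simp: base_cov_def Kf_def split: gv.splits)

definition user_cov :: "prm \<Rightarrow> (nat \<Rightarrow> real) \<Rightarrow> (nat \<Rightarrow> real) \<Rightarrow> lin \<Rightarrow> lin \<Rightarrow> nat \<Rightarrow> complex" where
  "user_cov Q f f' a b k = a (GX k) * cnj (b (GX k)) * of_real (ch_P Q k) + a (GZ k) * cnj (b (GZ k)) + a (GW k) * cnj (b (GW k)) * of_real ((sW Q k)\<^sup>2)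
    + a (GN k) * cnj (b (GN k)) * of_real ((sN Q k)\<^sup>2) + a (GZ k) * cnj (b (GW k)) * (rW Q k * of_real (sW Q k)) + a (GW k) * cnj (b (GZ k)) * (cnj (rW Q k) * of_real (sW Q k))
    + a (GZ k) * cnj (b (GN k)) * (rN Q k * of_real (sN Q k)) + a (GN k) * cnj (b (GZ k)) * (cnj (rN Q k) * of_real (sN Q k))
    + a (GV k) * cnj (b (GV k)) * of_real (f k) + a (GV' k) * cnj (b (GV' k)) * of_real (f' k)"

lemma gcov_base_cov: "gcov (base_cov Q f f') a b = (\<Sum>k\<in>users. user_cov Q f f' a b k)"
proof -
  define B where "B k l = (\<Sum>i\<in>{GX k, GZ k, GW k, GN k, GV k, GV' k}. \<Sum>j\<in>{GX l, GZ l, GW l, GN l, GV l, GV' l}. a i * cnj (b j) * base_cov Q f f' i j)"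
    for k l
  have off_diagonal: "B k l = 0" if "k \<noteq> l" for k l using that by (simp add: B_def base_cov_def K0_def)
  have diagonal: "B k k = user_cov Q f f' a b k" for k by (simp add: B_def base_cov_def K0_def user_cov_def algebra_simps)
  have "gcov (base_cov Q f f') a b = (\<Sum>k\<in>users. \<Sum>l\<in>users. B k l)"
    unfolding gcov_def sum_gbase B_def by (intro sum.cong refl) (rule sum.swap)
  also have "\<dots> = (\<Sum>k\<in>users. B k k)"
  proof (intro sum.cong refl)
    fix k assume "k \<in> users"
    then show "(\<Sum>l\<in>users. B k l) = B k k" using off_diagonal by (subst sum.remove[of _ k]) (auto intro: sum.neutral)
  qed
  finally show ?thesis by (simp add: diagonal)
qed

definition user_var :: "prm \<Rightarrow> (nat \<Rightarrow> real) \<Rightarrow> (nat \<Rightarrow> real) \<Rightarrow> lin \<Rightarrow> nat \<Rightarrow> real" where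
  "user_var Q f f' a k = (cmod (a (GX k)))\<^sup>2 * ch_P Q k + (cmod (a (GZ k)))\<^sup>2 + (cmod (a (GW k)))\<^sup>2 * (sW Q k)\<^sup>2
    + (cmod (a (GN k)))\<^sup>2 * (sN Q k)\<^sup>2 + 2 * Re (a (GZ k) * cnj (a (GW k)) * (rW Q k * of_real (sW Q k)))
    + 2 * Re (a (GZ k) * cnj (a (GN k)) * (rN Q k * of_real (sN Q k))) + (cmod (a (GV k)))\<^sup>2 * f k + (cmod (a (GV' k)))\<^sup>2 * f' k"

lemma gvar_base_cov: "gvar (base_cov Q f f') a = (\<Sum>k\<in>users. user_var Q f f' a k)"
proof -
  have "Re (user_cov Q f f' a a k) = user_var Q f f' a k" for k
    unfolding user_cov_def user_var_def cmod_power2 by (simp add: algebra_simps power2_eq_square)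
  then show ?thesis by (simp add: gvar_def gcov_base_cov)
qed

lemma correlated_variance_nonneg:
  assumes "0 \<le> s" "cmod r \<le> 1"
  shows "0 \<le> (cmod x)\<^sup>2 + (cmod y)\<^sup>2 * s\<^sup>2 + 2 * Re (x * cnj y * (r * of_real s))"
proof -
  have "- Re (x * cnj y * (r * of_real s)) \<le> cmod (x * cnj y * (r * of_real s))"
    using complex_Re_le_cmod[of "- (x * cnj y * (r * of_real s))"] by simp
  also have "\<dots> = (cmod x * (cmod y * s)) * cmod r" using assms by (simp add: norm_mult)
  also have "\<dots> \<le> (cmod x * (cmod y * s)) * 1" using assms by (intro mult_left_mono) auto
  finally have "(cmod x - cmod y * s)\<^sup>2 \<le> (cmod x)\<^sup>2 + (cmod y)\<^sup>2 * s\<^sup>2 + 2 * Re (x * cnj y * (r * of_real s))"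
    by (simp add: power2_eq_square algebra_simps)
  then show ?thesis using zero_le_power2 order_trans by blast
qed

lemma user_var_ge_signal:
  assumes bounds: "0 \<le> ch_P Q k" "0 \<le> sW Q k" "cmod (rW Q k) \<le> 1" "0 \<le> sN Q k" "cmod (rN Q k) \<le> 1" "0 \<le> f k" "0 \<le> f' k"
    and a: "a (GW k) = 0 \<or> a (GN k) = 0"
  shows "(cmod (a (GX k)))\<^sup>2 * ch_P Q k \<le> user_var Q f f' a k"
proof -
  have "0 \<le> (cmod (a (GV k)))\<^sup>2 * f k" "0 \<le> (cmod (a (GV' k)))\<^sup>2 * f' k" using bounds by auto
  then show ?thesis
    using a correlated_variance_nonneg[OF bounds(4,5), of "a (GZ k)" "a (GN k)"] correlated_variance_nonneg[OF bounds(2,3), of "a (GZ k)" "a (GW k)"]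
    by (elim disjE) (simp_all add: user_var_def)
qed

abbreviation "lin_residual a cs c \<equiv> (\<lambda>v. a v - (\<Sum>i<length cs. c i * (cs ! i) v))"

lemma condvar_bounds:
  assumes "\<And>c. B \<le> gvar K (lin_residual a cs c)"
  shows "B \<le> condvar K a cs" "condvar K a cs \<le> gvar K (lin_residual a cs c)"
  unfolding condvar_def by (intro cINF_greatest assms cINF_lower bdd_belowI[of _ B]; use assms in auto)+

lemma gmi_zero:
  assumes "\<And>c. 0 \<le> gvar K (lin_residual a cs c)" "gvar K a = 0"
  shows "gmi K a bs cs = 0"
proof -
  have "condvar K a cs = 0" using condvar_bounds(1)[OF assms(1)] condvar_bounds(2)[OF assms(1), of "\<lambda>_. 0"] assms(2) by simp
  then show ?thesis by (simp add: gmi_def)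
qed

lemma gmi_nonneg_single:
  assumes "\<And>c. 0 \<le> gvar K (\<lambda>v. a v - c * b v)"
  shows "0 \<le> gmi K a [b] []"
proof -
  have nonneg: "\<And>c. 0 \<le> gvar K (lin_residual a [b] c)" using assms by simp
  have "0 \<le> condvar K a [b]" "condvar K a [b] \<le> gvar K a"
    using condvar_bounds(1)[OF nonneg] condvar_bounds(2)[OF nonneg, of "\<lambda>_. 0"] by simp_all
  moreover have "condvar K a [] = gvar K a" by (simp add: condvar_def)
  ultimately show ?thesis by (auto simp: gmi_def Let_def)
qed

abbreviation "gmi_nats K a bs cs \<equiv> ln 2 * real_of_ereal (gmi K a bs cs)"

lemma ln_le_gmi_nats:
  assumes P_pos: "0 < P" and signal: "\<And>c. P \<le> gvar K (lin_residual a cs c)"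
    and nonneg: "\<And>c. 0 \<le> gvar K (lin_residual a (bs @ cs) c)"
    and finite: "gmi K a bs cs \<noteq> \<infinity>" and V: "gvar K (lin_residual a (bs @ cs) c) = V"
  shows "0 < V" "ln (P / V) \<le> gmi_nats K a bs cs"
proof -
  let ?s1 = "condvar K a cs" and ?s2 = "condvar K a (bs @ cs)"
  have s1: "P \<le> ?s1" by (rule condvar_bounds(1)[OF signal])
  have s2: "0 \<le> ?s2" "?s2 \<le> V" using condvar_bounds(1)[OF nonneg] condvar_bounds(2)[OF nonneg, of c] V by auto
  have "?s2 \<noteq> 0" using finite s1 P_pos by (auto simp: gmi_def Let_def)
  then have s2_pos: "0 < ?s2" using s2 by simp
  then show V_pos: "0 < V" using s2 by simp
  have "real_of_ereal (gmi K a bs cs) = log 2 (?s1 / ?s2)" using s2_pos s1 P_pos by (auto simp: gmi_def Let_def)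
  then have "gmi_nats K a bs cs = ln (?s1 / ?s2)" by (simp add: log_def)
  moreover have "P / V \<le> ?s1 / ?s2" using s1 s2 s2_pos P_pos by (intro frac_le) auto
  moreover have "0 < P / V" using P_pos V_pos by simp
  ultimately show "ln (P / V) \<le> gmi_nats K a bs cs" by simp
qed

text \<open>If scaling the coefficients \<open>c\<close> by \<open>k\<close> leaves the signal with gain \<open>1 - k\<close> and noise \<open>k\<^sup>2 \<eta>\<close>, then the optimal \<open>k\<close> gives the signal-to-noise ratio \<open>P / \<eta>\<close>.\<close>

lemma gmi_snr_bound:
  assumes P_pos: "0 < P" and signal: "\<And>c. P \<le> gvar K (lin_residual a cs c)"
    and nonneg: "\<And>c. 0 \<le> gvar K (lin_residual a (bs @ cs) c)"
    and finite: "gmi K a bs cs \<noteq> \<infinity>"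
    and scaled: "\<And>k::real. gvar K (lin_residual a (bs @ cs) (\<lambda>i. of_real k * c i)) = (1 - k)\<^sup>2 * P + k\<^sup>2 * \<eta>"
  shows "snr_bound P \<eta> (gmi_nats K a bs cs)"
proof -
  have \<eta>_nonneg: "0 \<le> \<eta>" using nonneg[of "\<lambda>i. of_real 1 * c i"] unfolding scaled by simp
  then have "gvar K (lin_residual a (bs @ cs) (\<lambda>i. of_real (P / (P + \<eta>)) * c i)) = P * \<eta> / (P + \<eta>)"
    unfolding scaled using P_pos by (intro mmse_eq) simp
  note mmse = ln_le_gmi_nats[OF P_pos signal nonneg finite this]
  have "0 < \<eta>" using mmse(1) \<eta>_nonneg P_pos by (auto simp: zero_less_divide_iff zero_less_mult_iff)
  moreover from this have "P / (P * \<eta> / (P + \<eta>)) = 1 + P / \<eta>" using P_pos by (simp add: field_simps)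
  ultimately show ?thesis using mmse(2) by (simp add: snr_bound_def)
qed

locale gaussian_ic =
  fixes Q :: prm
  assumes power_nonneg: "\<forall>k\<in>users. 0 \<le> ch_P Q k"
    and cross_nonzero: "\<forall>j\<in>users. \<forall>k\<in>users. j \<noteq> k \<longrightarrow> ch_h Q j k \<noteq> 0"
    and W_bounds: "\<forall>k\<in>users. 0 \<le> sW Q k \<and> sW Q k \<le> 1 \<and> cmod (rW Q k) \<le> 1"
    and N_bounds: "\<forall>k\<in>users. 0 \<le> sN Q k \<and> sN Q k \<le> 1 \<and> cmod (rN Q k) \<le> 1"
begin

abbreviation "P \<equiv> ch_P Q"
abbreviation "h \<equiv> ch_h Q"
abbreviation "zW k \<equiv> rW Q k * complex_of_real (sW Q k)"
abbreviation "zN k \<equiv> rN Q k * complex_of_real (sN Q k)"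

lemma gvar_ge_signal:
  assumes a: "\<And>k. k \<in> users \<Longrightarrow> a (GW k) = 0 \<or> a (GN k) = 0" and f: "\<And>k. k \<in> users \<Longrightarrow> 0 \<le> f k" "\<And>k. k \<in> users \<Longrightarrow> 0 \<le> f' k"
  shows "0 \<le> gvar (base_cov Q f f') a" and "u \<in> users \<Longrightarrow> (cmod (a (GX u)))\<^sup>2 * P u \<le> gvar (base_cov Q f f') a"
proof -
  have signal: "(cmod (a (GX k)))\<^sup>2 * P k \<le> user_var Q f f' a k" if "k \<in> users" for k
    using power_nonneg W_bounds N_bounds f a that by (intro user_var_ge_signal) auto
  moreover have "0 \<le> (cmod (a (GX k)))\<^sup>2 * P k" if "k \<in> users" for k using power_nonneg that by simp
  ultimately have nonneg: "0 \<le> user_var Q f f' a k" if "k \<in> users" for k using that by fastforce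
  show "0 \<le> gvar (base_cov Q f f') a" unfolding gvar_base_cov using nonneg by (intro sum_nonneg)
  assume u: "u \<in> users"
  show "(cmod (a (GX u)))\<^sup>2 * P u \<le> gvar (base_cov Q f f') a"
    unfolding gvar_base_cov using signal[OF u] member_le_sum[of u users "user_var Q f f' a"] nonneg u by fastforce
qed

lemma gvar_lbase_GX: "u \<in> users \<Longrightarrow> gvar (K0 Q) (lbase (GX u)) = P u"
  unfolding K0_eq_base_cov gvar_base_cov by (subst sum.remove[of _ u]) (auto simp: user_var_def lbase_def intro: sum.neutral)

lemma gmi_nats_nonneg:
  assumes u: "u \<in> users" and signal: "\<And>c. P u \<le> gvar (K0 Q) (lin_residual (lbase (GX u)) cs c)"
    and nonneg: "\<And>c. 0 \<le> gvar (K0 Q) (lin_residual (lbase (GX u)) (bs @ cs) c)"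
    and finite: "gmi (K0 Q) (lbase (GX u)) bs cs \<noteq> \<infinity>"
  shows "0 \<le> gmi_nats (K0 Q) (lbase (GX u)) bs cs"
proof (cases "P u = 0")
  case True
  then have "gmi (K0 Q) (lbase (GX u)) bs cs = 0" using signal gvar_lbase_GX[OF u] by (intro gmi_zero) auto
  then show ?thesis by simp
next
  case False
  then have P_pos: "0 < P u" using power_nonneg u by force
  have "ln (P u / P u) \<le> gmi_nats (K0 Q) (lbase (GX u)) bs cs"
    by (rule ln_le_gmi_nats(2)[OF P_pos signal nonneg finite, where c="\<lambda>_. 0"]) (simp add: gvar_lbase_GX[OF u])
  then show ?thesis using P_pos by simp
qed

lemmas lin_defs = lbase_def ladd_def lsub_def lsc_def lI_def lY_def lU_def lS_def

context
  fixes u v t :: nat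
  assumes users: "users = {u, v, t}" "u \<noteq> v" "u \<noteq> t" "v \<noteq> t"
begin

lemma users_mem: "u \<in> users" "v \<in> users" "t \<in> users" using users by auto

lemma users_distinct: "v \<noteq> u" "t \<noteq> u" "t \<noteq> v" using users by auto

lemma gvar_three_users: "gvar (K0 Q) a = user_var Q (\<lambda>_. 0) (\<lambda>_. 0) a u + user_var Q (\<lambda>_. 0) (\<lambda>_. 0) a v + user_var Q (\<lambda>_. 0) (\<lambda>_. 0) a t"
  unfolding K0_eq_base_cov gvar_base_cov users(1) using users(2-4) by simp

abbreviation "interference_power \<equiv> (cmod (h u v))\<^sup>2 * P v + (cmod (h u t))\<^sup>2 * P t"
abbreviation "forwarded \<equiv> ladd (lI Q t) (lbase (GN u))"

lemma gvar_K0_ge: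
  assumes "\<And>k. k \<in> users \<Longrightarrow> a (GW k) = 0 \<or> a (GN k) = 0"
  shows "0 \<le> gvar (K0 Q) a" and "a (GX u) = 1 \<Longrightarrow> P u \<le> gvar (K0 Q) a"
  unfolding K0_eq_base_cov
  using gvar_ge_signal(1)[OF assms, of "\<lambda>_. 0" "\<lambda>_. 0"] gvar_ge_signal(2)[OF assms, of "\<lambda>_. 0" "\<lambda>_. 0" u] users_mem by auto

lemma gvar_residual_noise: "gvar (K0 Q) (\<lambda>x. lbase (GX u) x - of_real k * lY Q u x) = (1 - k)\<^sup>2 * P u + k\<^sup>2 * (interference_power + 1)"
  unfolding gvar_three_users user_var_def cmod_power2
  using users(2-4) users_mem users_distinct by (simp add: lin_defs algebra_simps power2_eq_square)

lemma gvar_residual_genie: "gvar (K0 Q) (\<lambda>x. lbase (GX u) x - (of_real k * lY Q u x + of_real k * \<gamma> * lU Q u x))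
    = (1 - k)\<^sup>2 * P u + k\<^sup>2 * genie_noise interference_power ((sW Q u)\<^sup>2) (zW u) \<gamma>"
  unfolding gvar_three_users user_var_def genie_noise_def cmod_power2
  using users(2-4) users_mem users_distinct by (simp add: lin_defs algebra_simps power2_eq_square)

lemma gvar_residual_side_info:
  assumes "\<alpha> + \<gamma> * h t u = 1"
  shows "gvar (K0 Q) (\<lambda>x. lbase (GX u) x - (of_real k * \<alpha> * lY Q u x + of_real k * \<gamma> * forwarded x + - (of_real k * \<alpha> * h u t) * lbase (GX t) x))
    = (1 - k)\<^sup>2 * P u + k\<^sup>2 * side_noise (h u v) (h t v) (P v) (sN Q u) (zN u) \<alpha> \<gamma>"
proof -
  have \<alpha>: "\<alpha> = 1 - \<gamma> * h t u" using assms by (simp add: algebra_simps)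
  show ?thesis
    unfolding gvar_three_users user_var_def side_noise_def cmod_power2 \<alpha>
    using users(2-4) users_mem users_distinct by (simp add: lin_defs algebra_simps power2_eq_square)
qed

lemma gmi_noise_bounds:
  assumes finite: "gmi (K0 Q) (lbase (GX u)) [lY Q u] [] \<noteq> \<infinity>"
  shows "0 \<le> gmi_nats (K0 Q) (lbase (GX u)) [lY Q u] []"
    and "0 < P u \<Longrightarrow> snr_bound (P u) (interference_power + 1) (gmi_nats (K0 Q) (lbase (GX u)) [lY Q u] [])"
proof -
  have signal: "P u \<le> gvar (K0 Q) (lin_residual (lbase (GX u)) [] c)" for c
    by (rule gvar_K0_ge(2)) (simp_all add: lin_defs)
  have nonneg: "0 \<le> gvar (K0 Q) (lin_residual (lbase (GX u)) ([lY Q u] @ []) c)" for c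
    by (rule gvar_K0_ge(1)) (simp add: lin_defs)
  show "0 \<le> gmi_nats (K0 Q) (lbase (GX u)) [lY Q u] []" by (rule gmi_nats_nonneg[OF users_mem(1) signal nonneg finite])
  show "snr_bound (P u) (interference_power + 1) (gmi_nats (K0 Q) (lbase (GX u)) [lY Q u] [])" if "0 < P u"
    using gmi_snr_bound[OF that signal nonneg finite, where c="\<lambda>_. 1"] gvar_residual_noise by simp
qed

lemma gmi_genie_bounds:
  assumes finite: "gmi (K0 Q) (lbase (GX u)) [lY Q u] [lU Q u] \<noteq> \<infinity>"
  shows "0 \<le> gmi_nats (K0 Q) (lbase (GX u)) [lY Q u] [lU Q u]"
    and "0 < P u \<Longrightarrow> snr_bound (P u) (genie_noise interference_power ((sW Q u)\<^sup>2) (zW u) \<gamma>) (gmi_nats (K0 Q) (lbase (GX u)) [lY Q u] [lU Q u])"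
proof -
  have signal: "P u \<le> gvar (K0 Q) (lin_residual (lbase (GX u)) [lU Q u] c)" for c
    by (rule gvar_K0_ge(2)) (simp_all add: lin_defs)
  have nonneg: "0 \<le> gvar (K0 Q) (lin_residual (lbase (GX u)) ([lY Q u] @ [lU Q u]) c)" for c
    by (rule gvar_K0_ge(1)) (simp add: lin_defs)
  show "0 \<le> gmi_nats (K0 Q) (lbase (GX u)) [lY Q u] [lU Q u]" by (rule gmi_nats_nonneg[OF users_mem(1) signal nonneg finite])
  show "snr_bound (P u) (genie_noise interference_power ((sW Q u)\<^sup>2) (zW u) \<gamma>) (gmi_nats (K0 Q) (lbase (GX u)) [lY Q u] [lU Q u])"
    if "0 < P u"
    using gmi_snr_bound[OF that signal nonneg finite, where c="\<lambda>i. if i = 0 then 1 else \<gamma>"] gvar_residual_genie by simp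
qed

lemma gmi_side_info_bounds:
  assumes finite: "gmi (K0 Q) (lbase (GX u)) [lY Q u, forwarded] [lbase (GX t)] \<noteq> \<infinity>"
  shows "0 \<le> gmi_nats (K0 Q) (lbase (GX u)) [lY Q u, forwarded] [lbase (GX t)]"
    and "0 < P u \<Longrightarrow> \<alpha> + \<gamma> * h t u = 1 \<Longrightarrow>
      snr_bound (P u) (side_noise (h u v) (h t v) (P v) (sN Q u) (zN u) \<alpha> \<gamma>) (gmi_nats (K0 Q) (lbase (GX u)) [lY Q u, forwarded] [lbase (GX t)])"
proof -
  have signal: "P u \<le> gvar (K0 Q) (lin_residual (lbase (GX u)) [lbase (GX t)] c)" for c
    by (rule gvar_K0_ge(2)) (use users in \<open>simp_all add: lin_defs\<close>)
  have nonneg: "0 \<le> gvar (K0 Q) (lin_residual (lbase (GX u)) ([lY Q u, forwarded] @ [lbase (GX t)]) c)" for c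
    by (rule gvar_K0_ge(1)) (simp add: lin_defs)
  show "0 \<le> gmi_nats (K0 Q) (lbase (GX u)) [lY Q u, forwarded] [lbase (GX t)]"
    by (rule gmi_nats_nonneg[OF users_mem(1) signal nonneg finite])
  show "snr_bound (P u) (side_noise (h u v) (h t v) (P v) (sN Q u) (zN u) \<alpha> \<gamma>) (gmi_nats (K0 Q) (lbase (GX u)) [lY Q u, forwarded] [lbase (GX t)])"
    if P_pos: "0 < P u" and gain: "\<alpha> + \<gamma> * h t u = 1"
    using gmi_snr_bound[OF P_pos signal nonneg finite, where c="\<lambda>i. if i = 0 then \<alpha> else if i = 1 then \<gamma> else - (\<alpha> * h u t)"] gvar_residual_side_info[OF gain]
    by (simp add: mult.assoc)
qed

end

lemma single_user_covariances:
  assumes k: "k \<in> users" and a: "\<And>j. j \<noteq> k \<Longrightarrow> a (GX j) = 0 \<and> a (GZ j) = 0 \<and> a (GW j) = 0 \<and> a (GN j) = 0"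
  shows "gcov (K0 Q) a b = user_cov Q (\<lambda>_. 0) (\<lambda>_. 0) a b k" and "gvar (K0 Q) a = user_var Q (\<lambda>_. 0) (\<lambda>_. 0) a k"
proof -
  have "user_cov Q (\<lambda>_. 0) (\<lambda>_. 0) a b j = 0" "user_var Q (\<lambda>_. 0) (\<lambda>_. 0) a j = 0" if "j \<noteq> k" for j
    using a[OF that] by (simp_all add: user_cov_def user_var_def)
  then show "gcov (K0 Q) a b = user_cov Q (\<lambda>_. 0) (\<lambda>_. 0) a b k" "gvar (K0 Q) a = user_var Q (\<lambda>_. 0) (\<lambda>_. 0) a k"
    unfolding K0_eq_base_cov gcov_base_cov gvar_base_cov using k by (subst sum.remove[of _ k]; auto intro: sum.neutral)+
qed

lemma vZW_eq: "k \<in> users \<Longrightarrow> vZW Q k = diff_variance 1 ((sW Q k)\<^sup>2) (zW k)"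
  unfolding vZW_def by (subst single_user_covariances(2)) (auto simp: lin_defs user_var_def diff_variance_def)

lemma vVW_eq: assumes k: "k \<in> users" shows "vVW Q k = (sW Q k)\<^sup>2 - (cmod (zW k - of_real ((sW Q k)\<^sup>2)))\<^sup>2 / vZW Q k"
proof -
  have "gvar (K0 Q) (lbase (GW k)) = (sW Q k)\<^sup>2"
    by (subst single_user_covariances(2)[OF k]) (auto simp: lin_defs user_var_def)
  moreover have "gcov (K0 Q) (lbase (GW k)) (lsub (lbase (GZ k)) (lbase (GW k))) = cnj (zW k - of_real ((sW Q k)\<^sup>2))"
    by (subst single_user_covariances(1)[OF k]) (auto simp: lin_defs user_cov_def)
  ultimately show ?thesis unfolding vVW_def csv_def vZW_def[symmetric] by (simp only: complex_mod_cnj)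
qed

lemma zN_le: "k \<in> users \<Longrightarrow> cmod (zN k) \<le> sN Q k"
  using N_bounds mult_right_mono[of "cmod (rN Q k)" 1 "sN Q k"] by (auto simp: norm_mult)

end

section \<open>The sum rate bound\<close>

lemma nxt_prv_users:
  assumes "i \<in> users"
  shows "nxt i \<in> users" "prv i \<in> users" "users = {i, nxt i, prv i}" "i \<noteq> nxt i" "i \<noteq> prv i" "nxt i \<noteq> prv i"
  using assms by (auto simp: users_def nxt_def prv_def)

lemma nxt_prv_cancel:
  assumes "i \<in> users"
  shows "nxt (prv i) = i" "prv (nxt i) = i" "prv (prv i) = nxt i"
  using assms by (auto simp: users_def nxt_def prv_def)

lemma sum_nxt: "(\<Sum>i\<in>users. f (nxt i)) = (\<Sum>i\<in>users. f i :: 'a::comm_monoid_add)"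
  by (rule sum.reindex_bij_witness[where i=prv and j=nxt]) (auto simp: nxt_prv_users nxt_prv_cancel)

lemma sum_prv: "(\<Sum>i\<in>users. f (prv i)) = (\<Sum>i\<in>users. f i :: 'a::comm_monoid_add)"
  unfolding prv_def sum_nxt[where f="\<lambda>i. f (nxt i)"] by (rule sum_nxt)

lemma users_permuted:
  assumes p: "p permutes users" and i: "i \<in> users"
  shows "users = {p i, p (nxt i), p (prv i)}" "p i \<noteq> p (nxt i)" "p i \<noteq> p (prv i)" "p (nxt i) \<noteq> p (prv i)"
proof -
  have "users = p ` users" using permutes_image[OF p] by simp
  also have "\<dots> = p ` {i, nxt i, prv i}" by (rule arg_cong[OF nxt_prv_users(3)[OF i]])
  finally show "users = {p i, p (nxt i), p (prv i)}" by simp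
  show "p i \<noteq> p (nxt i)" "p i \<noteq> p (prv i)" "p (nxt i) \<noteq> p (prv i)"
    using nxt_prv_users(4-6)[OF i] permutes_inj[OF p] by (auto simp: inj_def)
qed

lemma gmi_finite_eq: "gmi K a bs cs \<noteq> \<infinity> \<Longrightarrow> gmi K a bs cs = ereal (real_of_ereal (gmi K a bs cs))"
  by (simp add: gmi_def Let_def split: if_splits)

lemma rate_le_if_fano_le:
  assumes \<delta>: "\<delta> \<longlonglongrightarrow> 0" and fano: "\<And>n. 0 < n \<Longrightarrow> (\<Sum>k\<in>K. fano_rate (\<delta> n) (msize n R k)) \<le> real n * T"
  shows "ln 2 * (\<Sum>k\<in>K. R k) \<le> T"
proof -
  have block: "(1 - \<delta> n) * (ln 2 * (\<Sum>k\<in>K. R k)) - real (card K) * ln 2 * (1 / real n) \<le> T" if n_pos: "0 < n"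
    and \<delta>_le: "\<delta> n < 1" for n
  proof -
    have "(1 - \<delta> n) * (real n * R k * ln 2) - ln 2 \<le> fano_rate (\<delta> n) (msize n R k)" for k
    proof -
      have "ln (2 powr (real n * R k)) \<le> ln (real (msize n R k))" using msize_ge[of n R k] by (subst ln_le_cancel_iff) auto
      then show ?thesis using \<delta>_le unfolding fano_rate_def by (intro diff_right_mono mult_left_mono) (auto simp: ln_powr)
    qed
    then have "(\<Sum>k\<in>K. (1 - \<delta> n) * (real n * R k * ln 2) - ln 2) \<le> real n * T"
      using fano[OF n_pos] by (meson order_trans sum_mono)
    moreover have "(\<Sum>k\<in>K. (1 - \<delta> n) * (real n * R k * ln 2) - ln 2) = real n * ((1 - \<delta> n) * (ln 2 * (\<Sum>k\<in>K. R k)) - real (card K) * ln 2 * (1 / real n))"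
      using n_pos by (simp add: sum_subtractf sum_distrib_left sum_distrib_right right_diff_distrib mult_ac)
    ultimately show ?thesis using n_pos by simp
  qed
  have "(\<lambda>n. (1 - \<delta> n) * (ln 2 * (\<Sum>k\<in>K. R k)) - real (card K) * ln 2 * (1 / real n)) \<longlonglongrightarrow> (1 - 0) * (ln 2 * (\<Sum>k\<in>K. R k)) - real (card K) * ln 2 * 0"
    by (intro tendsto_intros \<delta> lim_1_over_n)
  moreover have "eventually (\<lambda>n. (1 - \<delta> n) * (ln 2 * (\<Sum>k\<in>K. R k)) - real (card K) * ln 2 * (1 / real n) \<le> T) sequentially"
    using eventually_gt_at_top[of 0] order_tendstoD(2)[OF \<delta> zero_less_one] by eventually_elim (rule block)
  ultimately show ?thesis using tendsto_upperbound trivial_limit_sequentially by fastforce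
qed

context gaussian_ic
begin

lemma csv_side_noise:
  fixes k u
  defines "e \<equiv> diff_variance k ((sN Q u)\<^sup>2) (zN u)"
  assumes u: "u \<in> users"
  shows "csv (K0 Q) (lbase (GN u)) (lsub (lbase (GZ u)) (lsc k (lbase (GN u)))) = (if e = 0 then (sN Q u)\<^sup>2 else ((sN Q u)\<^sup>2 - (cmod (zN u))\<^sup>2) / e)"
proof -
  have variance: "gvar (K0 Q) (lbase (GN u)) = (sN Q u)\<^sup>2"
    by (subst single_user_covariances(2)[OF u]) (auto simp: lin_defs user_var_def)
  have covariance: "gcov (K0 Q) (lbase (GN u)) (lsub (lbase (GZ u)) (lsc k (lbase (GN u)))) = cnj (zN u - k * of_real ((sN Q u)\<^sup>2))"
    by (subst single_user_covariances(1)[OF u]) (auto simp: lin_defs user_cov_def)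
  have difference: "gvar (K0 Q) (lsub (lbase (GZ u)) (lsc k (lbase (GN u)))) = e"
    by (subst single_user_covariances(2)[OF u]) (auto simp: lin_defs user_var_def e_def diff_variance_def)
  have "0 \<le> e" unfolding e_def by (rule diff_variance_nonneg[OF zN_le[OF u]])
  then show ?thesis
    using noise_split(2)[of k "(sN Q u)\<^sup>2" "zN u"]
    unfolding csv_def variance covariance difference complex_mod_cnj e_def[symmetric] by (cases "e = 0") auto
qed

lemma csv_channel_noise:
  fixes k u
  defines "e \<equiv> diff_variance k ((sN Q u)\<^sup>2) (zN u)"
  assumes u: "u \<in> users" and k: "k \<noteq> 0"
  shows "csv (K0 Q) (lbase (GZ u)) (lsub (lbase (GN u)) (lsc (1 / k) (lbase (GZ u)))) = (if e = 0 then 1 else ((sN Q u)\<^sup>2 - (cmod (zN u))\<^sup>2) / e * (cmod k)\<^sup>2)"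
proof -
  define d where "d = 1 / k"
  define e' where "e' = (sN Q u)\<^sup>2 + (cmod d)\<^sup>2 - 2 * Re (d * zN u)"
  have variance: "gvar (K0 Q) (lbase (GZ u)) = 1"
    by (subst single_user_covariances(2)[OF u]) (auto simp: lin_defs user_var_def)
  have covariance: "gcov (K0 Q) (lbase (GZ u)) (lsub (lbase (GN u)) (lsc d (lbase (GZ u)))) = zN u - cnj d"
    by (subst single_user_covariances(1)[OF u]) (auto simp: lin_defs user_cov_def)
  have difference: "gvar (K0 Q) (lsub (lbase (GN u)) (lsc d (lbase (GZ u)))) = e'"
    by (subst single_user_covariances(2)[OF u]) (auto simp: lin_defs user_var_def e'_def)
  have "(cmod (zN u - cnj d))\<^sup>2 = (cmod (zN u))\<^sup>2 + (cmod d)\<^sup>2 - 2 * Re (d * zN u)"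
    unfolding cmod_power2 by (simp add: algebra_simps power2_eq_square)
  then have residual: "e' - (cmod (zN u - cnj d))\<^sup>2 = (sN Q u)\<^sup>2 - (cmod (zN u))\<^sup>2" by (simp add: e'_def)
  have "cnj k = of_real ((cmod k)\<^sup>2) * d" using k unfolding complex_norm_square by (simp add: d_def)
  then have "Re (cnj k * zN u) = (cmod k)\<^sup>2 * Re (d * zN u)" by (simp add: mult.assoc del: of_real_power)
  moreover have "(cmod k)\<^sup>2 * (cmod d)\<^sup>2 = 1" using k by (simp add: d_def norm_divide power_divide)
  ultimately have e: "e = (cmod k)\<^sup>2 * e'" by (simp add: e_def e'_def diff_variance_def algebra_simps)
  show ?thesis
    unfolding d_def[symmetric] csv_def variance covariance difference
    using k by (auto simp: e residual[symmetric] diff_divide_distrib left_diff_distrib)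
qed

end

locale ordered_gaussian_ic = gaussian_ic +
  fixes p :: "nat \<Rightarrow> nat"
  assumes p: "p permutes users"
begin

abbreviation "cross_ratio i \<equiv> h (p i) (p (nxt i)) / h (p (prv i)) (p (nxt i))"
abbreviation "diff_var i \<equiv> diff_variance (cross_ratio i) ((sN Q (p i))\<^sup>2) (zN (p i))"

lemma cross_coeffs_nonzero:
  assumes i: "i \<in> users"
  shows "h (p i) (p (nxt i)) \<noteq> 0" "h (p (prv i)) (p i) \<noteq> 0" "h (p (prv i)) (p (nxt i)) \<noteq> 0"
  using cross_nonzero users_permuted[OF p i] users_mem[OF users_permuted[OF p i]] by auto

lemma p_users: "i \<in> users \<Longrightarrow> p i \<in> users"
  using permutes_in_image[OF p] by blast

lemma vVN_eq: "i \<in> users \<Longrightarrow> vVN Q p i = (if diff_var i = 0 then (sN Q (p i))\<^sup>2 else ((sN Q (p i))\<^sup>2 - (cmod (zN (p i)))\<^sup>2) / diff_var i)"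
  unfolding vVN_def by (rule csv_side_noise[OF p_users])

lemma vVN'_eq: "i \<in> users \<Longrightarrow> vVN' Q p i = (if diff_var i = 0 then 1 else ((sN Q (p i))\<^sup>2 - (cmod (zN (p i)))\<^sup>2) / diff_var i * (cmod (cross_ratio i))\<^sup>2)"
  using csv_channel_noise[OF p_users, of i "cross_ratio i"] cross_coeffs_nonzero[of i] by (simp add: vVN'_def)

lemma vVN_nonneg:
  assumes i: "i \<in> users"
  shows "0 \<le> vVN Q p i" "0 \<le> vVN' Q p i"
proof -
  have "(cmod (zN (p i)))\<^sup>2 \<le> (sN Q (p i))\<^sup>2" using zN_le[OF p_users[OF i]] by (intro power_mono) auto
  moreover have "0 \<le> diff_var i" by (rule diff_variance_nonneg[OF zN_le[OF p_users[OF i]]])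
  ultimately show "0 \<le> vVN Q p i" "0 \<le> vVN' Q p i"
    by (auto simp: vVN_eq[OF i] vVN'_eq[OF i] intro!: divide_nonneg_nonneg mult_nonneg_nonneg)
qed

lemma noise_condition:
  assumes i: "i \<in> users"
    and cond: "(cmod (h (p (prv i)) (p (nxt i))))\<^sup>2 * t \<le> vVN Q p i \<or> (cmod (h (p i) (p (nxt i))))\<^sup>2 * t \<le> vVN' Q p i"
  shows "diff_var i \<noteq> 0 \<Longrightarrow> (cmod (h (p (prv i)) (p (nxt i))))\<^sup>2 * t \<le> ((sN Q (p i))\<^sup>2 - (cmod (zN (p i)))\<^sup>2) / diff_var i"
    and "diff_var i = 0 \<Longrightarrow> t \<le> 1 / (cmod (h (p i) (p (nxt i))))\<^sup>2"
proof -
  let ?a = "(cmod (h (p i) (p (nxt i))))\<^sup>2" and ?b = "(cmod (h (p (prv i)) (p (nxt i))))\<^sup>2"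
  have pos: "0 < ?a" "0 < ?b" using cross_coeffs_nonzero[OF i] by auto
  have k_sq: "(cmod (cross_ratio i))\<^sup>2 = ?a / ?b" by (simp add: norm_divide power_divide)
  show "?b * t \<le> ((sN Q (p i))\<^sup>2 - (cmod (zN (p i)))\<^sup>2) / diff_var i" if "diff_var i \<noteq> 0"
  proof -
    define v where "v = ((sN Q (p i))\<^sup>2 - (cmod (zN (p i)))\<^sup>2) / diff_var i"
    have "?b * t \<le> v \<or> ?a * t \<le> v * (?a / ?b)"
      using cond that unfolding vVN_eq[OF i] vVN'_eq[OF i] k_sq v_def by (simp only: if_False)
    then show ?thesis using pos unfolding v_def[symmetric] by (auto simp: field_simps)
  qed
  show "t \<le> 1 / ?a" if "diff_var i = 0"
  proof -
    have "cmod (cross_ratio i) * sN Q (p i) = 1" by (rule diff_variance_eq_0D[OF zN_le[OF p_users[OF i]] that])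
    then have "?a / ?b * (sN Q (p i))\<^sup>2 = 1" by (simp only: k_sq[symmetric] power_mult_distrib[symmetric] one_power2)
    then have "(sN Q (p i))\<^sup>2 = ?b / ?a" using pos by (simp add: field_simps)
    moreover have "?b * t \<le> (sN Q (p i))\<^sup>2 \<or> ?a * t \<le> 1" using cond unfolding vVN_eq[OF i] vVN'_eq[OF i] if_P[OF that] .
    ultimately have "?b * t \<le> ?b / ?a \<or> ?a * t \<le> 1" by simp
    then show ?thesis using pos by (auto simp: field_simps)
  qed
qed

lemma I_terms_nonneg: "0 \<le> I0term Q p" "0 \<le> I1term Q p"
proof -
  have "0 \<le> gmi (Kf Q p) (lU Q k) [ladd (lY Q k) (lsc c (lbase (GV j)))] []" "0 \<le> gmi (Kf Q p) (lU Q k) [ladd (lY Q k) (lsc c (lbase (GV' j)))] []"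
    for k c j
    unfolding Kf_eq_base_cov by (intro gmi_nonneg_single gvar_ge_signal(1) vVN_nonneg; simp add: lin_defs)+
  then show "0 \<le> I0term Q p" "0 \<le> I1term Q p" unfolding I0term_def I1term_def by (auto intro!: ereal_0_le_mult sum_nonneg)
qed

abbreviation "mi_noise j \<equiv> gmi (K0 Q) (lbase (GX (p j))) [lY Q (p j)] []"
abbreviation "mi_side j \<equiv> gmi (K0 Q) (lbase (GX (p j))) [lY Q (p j), lS Q p j] [lbase (GX (p (prv j)))]"
abbreviation "mi_genie j \<equiv> gmi (K0 Q) (lbase (GX (p j))) [lY Q (p j)] [lU Q (p j)]"

lemma Aterm_eq: "Aterm Q p = ereal (1/3) * (\<Sum>j\<in>users. mi_noise j + mi_side j + mi_genie j)"
proof -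
  have "Aterm Q p = ereal (1/3) * (\<Sum>j\<in>users. mi_noise j + mi_side (nxt j) + mi_genie (prv j))"
    unfolding Aterm_def by (intro arg_cong2[where f="(*)"] sum.cong refl) (simp add: nxt_prv_cancel)
  then show ?thesis by (simp only: sum.distrib sum_nxt[of mi_side] sum_prv[of mi_genie])
qed

end

locale bounded_gaussian_ic = ordered_gaussian_ic +
  assumes cond: "cond_a Q p \<or> cond_b Q p" and Aterm_finite: "Aterm Q p \<noteq> \<infinity>"
begin

definition nats_noise :: "nat \<Rightarrow> real" where
  "nats_noise j = ln 2 * real_of_ereal (mi_noise j)"

definition nats_side :: "nat \<Rightarrow> real" where
  "nats_side j = ln 2 * real_of_ereal (mi_side j)"

definition nats_genie :: "nat \<Rightarrow> real" where
  "nats_genie j = ln 2 * real_of_ereal (mi_genie j)"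

lemma mi_finite:
  assumes j: "j \<in> users"
  shows "mi_noise j \<noteq> \<infinity>" "mi_side j \<noteq> \<infinity>" "mi_genie j \<noteq> \<infinity>"
proof -
  have "(\<Sum>j\<in>users. mi_noise j + mi_side j + mi_genie j) \<noteq> \<infinity>" using Aterm_finite unfolding Aterm_eq by auto
  then have "mi_noise j + mi_side j + mi_genie j \<noteq> \<infinity>" using j by (auto simp: sum_Pinfty)
  then show "mi_noise j \<noteq> \<infinity>" "mi_side j \<noteq> \<infinity>" "mi_genie j \<noteq> \<infinity>" by auto
qed

lemma Aterm_eq_nats: "Aterm Q p = ereal ((\<Sum>j\<in>users. nats_noise j + nats_side j + nats_genie j) / (3 * ln 2))"
proof -
  have "mi_noise j + mi_side j + mi_genie j = ereal ((nats_noise j + nats_side j + nats_genie j) / ln 2)" if "j \<in> users"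
    for j
  proof -
    have "mi_noise j + mi_side j + mi_genie j = ereal (real_of_ereal (mi_noise j) + real_of_ereal (mi_side j) + real_of_ereal (mi_genie j))"
      using mi_finite[OF that] by (metis gmi_finite_eq plus_ereal.simps(1))
    then show ?thesis by (simp add: nats_noise_def nats_side_def nats_genie_def add_divide_distrib)
  qed
  then have "(\<Sum>j\<in>users. mi_noise j + mi_side j + mi_genie j) = ereal (\<Sum>j\<in>users. (nats_noise j + nats_side j + nats_genie j) / ln 2)"
    unfolding sum_ereal[symmetric] by (intro sum.cong refl)
  then show ?thesis unfolding Aterm_eq by (simp add: sum_divide_distrib[symmetric])
qed

definition \<epsilon> :: "nat \<Rightarrow> real" where
  "\<epsilon> j = interference_power (p j) (p (nxt j)) (p (prv j))"

lemma nats_noise_bounds: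
  assumes j: "j \<in> users"
  shows "0 \<le> nats_noise j" and "0 < P (p j) \<Longrightarrow> snr_bound (P (p j)) (\<epsilon> j + 1) (nats_noise j)"
  using gmi_noise_bounds[OF users_permuted[OF p j] mi_finite(1)[OF j]] by (simp_all only: nats_noise_def \<epsilon>_def)

lemma nats_genie_bounds:
  assumes j: "j \<in> users"
  shows "0 \<le> nats_genie j"
    and "0 < P (p j) \<Longrightarrow> snr_bound (P (p j)) (genie_noise (\<epsilon> j) ((sW Q (p j))\<^sup>2) (zW (p j)) \<gamma>) (nats_genie j)"
  using gmi_genie_bounds[OF users_permuted[OF p j] mi_finite(3)[OF j]] by (simp_all only: nats_genie_def \<epsilon>_def)

lemma nats_side_bounds:
  assumes j: "j \<in> users"
  shows "0 \<le> nats_side j" and "0 < P (p j) \<Longrightarrow> \<alpha> + \<gamma> * h (p (prv j)) (p j) = 1 \<Longrightarrow>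
    snr_bound (P (p j)) (side_noise (h (p j) (p (nxt j))) (h (p (prv j)) (p (nxt j))) (P (p (nxt j))) (sN Q (p j)) (zN (p j)) \<alpha> \<gamma>) (nats_side j)"
  using gmi_side_info_bounds[OF users_permuted[OF p j], folded lS_def, OF mi_finite(2)[OF j]]
  by (simp_all only: nats_side_def)

lemma vZW_pos: "j \<in> users \<Longrightarrow> 0 < P (p j) \<Longrightarrow> 0 < vZW Q (p j)"
  using nats_genie_bounds(2)[of j "- 1"] vZW_eq[OF p_users] by (simp add: snr_bound_def genie_noise_def diff_variance_def)

lemma noise_conditions:
  assumes j: "j \<in> users"
  shows "(cmod (h (p (prv j)) (p (nxt j))))\<^sup>2 * vZW Q (p (nxt j)) \<le> vVN Q p j \<or> (cmod (h (p j) (p (nxt j))))\<^sup>2 * vZW Q (p (nxt j)) \<le> vVN' Q p j"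
  using cond nxt_prv_users(2)[OF j] unfolding cond_a_def cond_b_def by (metis nxt_prv_cancel(1,3)[OF j])

lemma user_side_info:
  assumes j: "j \<in> users"
  shows "side_info_user (P (p j)) (P (p (nxt j))) (sN Q (p j)) (vZW Q (p (nxt j))) (nats_side j) (h (p j) (p (nxt j))) (h (p (prv j)) (p j)) (h (p (prv j)) (p (nxt j))) (zN (p j))"
proof unfold_locales
  have nxt: "nxt j \<in> users" by (rule nxt_prv_users(1)[OF j])
  show "0 \<le> P (p j)" "0 \<le> P (p (nxt j))" "0 \<le> sN Q (p j)" using power_nonneg N_bounds p_users j nxt by auto
qed (use cross_coeffs_nonzero[OF j] zN_le[OF p_users[OF j]] nats_side_bounds[OF j] noise_condition[OF j noise_conditions[OF j]]
    vZW_pos[OF nxt_prv_users(1)[OF j]] in auto)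

definition vbar :: "nat \<Rightarrow> real" where
  "vbar j = (SOME v. 0 < v \<and> (0 < P (p (nxt j)) \<longrightarrow> vZW Q (p (nxt j)) \<le> v) \<and>
  side_info_bounded (P (p j)) (P (p (nxt j))) (h (p j) (p (nxt j))) (h (p (prv j)) (p j)) (h (p (prv j)) (p (nxt j))) (side_variance (sN Q (p j))) (nats_side j) v)"

lemma vbar_bounds:
  assumes "j \<in> users"
  shows "0 < vbar j" "0 < P (p (nxt j)) \<Longrightarrow> vZW Q (p (nxt j)) \<le> vbar j"
    and "side_info_bounded (P (p j)) (P (p (nxt j))) (h (p j) (p (nxt j))) (h (p (prv j)) (p j)) (h (p (prv j)) (p (nxt j))) (side_variance (sN Q (p j))) (nats_side j) (vbar j)"
  using someI_ex[OF side_info_user.side_info_bounded_ex[OF user_side_info[OF assms]]] unfolding vbar_def by blast+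

lemma genie_useful:
  assumes j: "j \<in> users"
  shows "side_variance (sN Q (p (nxt j))) \<le> vVW Q (p j) \<or> (sW Q (p j))\<^sup>2 \<le> vVW Q (p j) \<or> \<epsilon> j = 0"
proof (cases "cond_b Q p \<or> sN Q (p (nxt j)) \<noteq> 0")
  case True
  then show ?thesis using cond j by (auto simp: cond_a_def cond_b_def side_variance_def)
next
  case False
  then show ?thesis
    using side_info_user.zero_side_noise[OF user_side_info[OF nxt_prv_users(1)[OF j]]] by (simp add: \<epsilon>_def prv_def)
qed

end

locale coded_gaussian_ic = bounded_gaussian_ic + ic_code "ch_h Q" "ch_P Q" n M enc dec
  for n and M :: "nat \<Rightarrow> nat" and enc dec +
  assumes n_pos: "0 < n"
begin

abbreviation "\<delta> \<equiv> err h n M enc dec"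

abbreviation "interference j \<equiv> (\<lambda>(b, c). scale (h (p j) (p (nxt j))) (centred_enc (p (nxt j)) b) + scale (h (p j) (p (prv j))) (centred_enc (p (prv j)) c))"

definition signal_gap :: "nat \<Rightarrow> real \<Rightarrow> real" where
  "signal_gap j v = entropy_gap n {..<M (p j)} (centred_enc (p j)) v (P (p j))"

definition interference_gap :: "nat \<Rightarrow> real \<Rightarrow> real" where
  "interference_gap j v = entropy_gap n ({..<M (p (nxt j))} \<times> {..<M (p (prv j))}) (interference j) v (\<epsilon> j)"

lemma decodable_permuted:
  assumes "j \<in> users"
  shows "decodable n (M (p j)) (centred_enc (p j)) ({..<M (p (nxt j))} \<times> {..<M (p (prv j))}) (interference j) (centred_dec (p j)) \<delta>"
  by (rule centred_dec_decodable[OF users_permuted[OF p assms]])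

lemma rate_noise_genie:
  assumes j: "j \<in> users"
  shows "2 * fano_rate \<delta> (M (p j)) + signal_gap j (vbar (prv j)) \<le> interference_gap j (side_variance (sN Q (p (nxt j)))) + real n * (nats_noise j + nats_genie j)"
  unfolding signal_gap_def interference_gap_def
proof (rule rate_noise_genie_le[OF n_pos centred_enc_codebook[OF p_users[OF j]] _ decodable_permuted[OF j], where w="(sW Q (p j))\<^sup>2" and z="zW (p j)"])
  have sW_bounds: "0 \<le> sW Q (p j)" "sW Q (p j) \<le> 1" "cmod (rW Q (p j)) \<le> 1" using W_bounds p_users[OF j] by auto
  then show "0 \<le> (sW Q (p j))\<^sup>2" "(sW Q (p j))\<^sup>2 \<le> 1" by (auto simp: power_le_one)
  have "cmod (zW (p j)) \<le> sW Q (p j)"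
    using sW_bounds mult_right_mono[of "cmod (rW Q (p j))" 1 "sW Q (p j)"] by (simp add: norm_mult)
  then show "(cmod (zW (p j)))\<^sup>2 \<le> (sW Q (p j))\<^sup>2" by (intro power_mono) auto
  show "codebook n ({..<M (p (nxt j))} \<times> {..<M (p (prv j))}) (interference j) (\<epsilon> j)"
    unfolding \<epsilon>_def using nxt_prv_users[OF j] by (intro codebook_pair(1) centred_enc_codebook p_users)
  show "0 < side_variance (sN Q (p (nxt j)))" "side_variance (sN Q (p (nxt j))) \<le> 1"
    using N_bounds p_users[OF nxt_prv_users(1)[OF j]] by (auto simp: side_variance_def power_le_one)
  show "0 < vbar (prv j)" by (rule vbar_bounds(1)[OF nxt_prv_users(2)[OF j]])
  show "diff_variance 1 ((sW Q (p j))\<^sup>2) (zW (p j)) \<le> vbar (prv j)" if "0 < P (p j)"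
    using vbar_bounds(2)[OF nxt_prv_users(2)[OF j]] vZW_eq[OF p_users[OF j]] nxt_prv_cancel(1)[OF j] that by simp
  show "side_variance (sN Q (p (nxt j))) \<le> (sW Q (p j))\<^sup>2 - (cmod (zW (p j) - of_real ((sW Q (p j))\<^sup>2)))\<^sup>2 / diff_variance 1 ((sW Q (p j))\<^sup>2) (zW (p j))
      \<or> (sW Q (p j))\<^sup>2 \<le> (sW Q (p j))\<^sup>2 - (cmod (zW (p j) - of_real ((sW Q (p j))\<^sup>2)))\<^sup>2 / diff_variance 1 ((sW Q (p j))\<^sup>2) (zW (p j)) \<or> \<epsilon> j = 0"
    using genie_useful[OF j] unfolding vVW_eq[OF p_users[OF j]] vZW_eq[OF p_users[OF j]] .
qed (use nats_noise_bounds[OF j] nats_genie_bounds[OF j] in auto)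

lemma rate_side_info:
  assumes j: "j \<in> users"
  shows "fano_rate \<delta> (M (p j)) + interference_gap (prv j) (side_variance (sN Q (p j))) \<le> signal_gap (nxt j) (vbar j) + real n * nats_side j"
proof -
  have "{..<M (p (prv j))} \<noteq> {}" using M_ge_1[of "p (prv j)"] by (auto simp: lessThan_empty_iff)
  from vbar_bounds(3)[OF j, unfolded side_info_bounded_def, rule_format,
      OF centred_enc_codebook[OF p_users[OF j]] centred_enc_codebook[OF p_users[OF nxt_prv_users(1)[OF j]]] finite_lessThan this decodable_permuted[OF j]]
  show ?thesis unfolding signal_gap_def interference_gap_def \<epsilon>_def nxt_prv_cancel[OF j] .
qed

lemma sum_fano_rate_le: "3 * (\<Sum>k\<in>users. fano_rate \<delta> (M k)) \<le> real n * (\<Sum>j\<in>users. nats_noise j + nats_side j + nats_genie j)"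
proof -
  let ?L = "\<Sum>j\<in>users. fano_rate \<delta> (M (p j))" and ?D = "\<Sum>j\<in>users. interference_gap (prv j) (side_variance (sN Q (p j)))"
    and ?X = "\<Sum>j\<in>users. signal_gap (nxt j) (vbar j)"
  have "(\<Sum>j\<in>users. interference_gap (prv j) (side_variance (sN Q (p (nxt (prv j)))))) = ?D"
    by (intro sum.cong refl) (simp add: nxt_prv_cancel)
  then have reindex_interference: "(\<Sum>j\<in>users. interference_gap j (side_variance (sN Q (p (nxt j))))) = ?D"
    using sum_prv[of "\<lambda>j. interference_gap j (side_variance (sN Q (p (nxt j))))"] by simp
  have "(\<Sum>j\<in>users. signal_gap (nxt j) (vbar (prv (nxt j)))) = ?X" by (intro sum.cong refl) (simp add: nxt_prv_cancel)
  then have reindex_signal: "(\<Sum>j\<in>users. signal_gap j (vbar (prv j))) = ?X"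
    using sum_nxt[of "\<lambda>j. signal_gap j (vbar (prv j))"] by simp
  have "(\<Sum>j\<in>users. 2 * fano_rate \<delta> (M (p j)) + signal_gap j (vbar (prv j)))
      \<le> (\<Sum>j\<in>users. interference_gap j (side_variance (sN Q (p (nxt j)))) + real n * (nats_noise j + nats_genie j))"
    by (rule sum_mono[OF rate_noise_genie])
  then have "2 * ?L + ?X \<le> ?D + real n * (\<Sum>j\<in>users. nats_noise j + nats_genie j)"
    by (simp only: sum.distrib[of "\<lambda>j. 2 * fano_rate \<delta> (M (p j))"] sum.distrib[of "\<lambda>j. interference_gap j (side_variance (sN Q (p (nxt j))))"] sum_distrib_left[symmetric] reindex_interference reindex_signal)
  moreover have "?L + ?D \<le> ?X + real n * (\<Sum>j\<in>users. nats_side j)"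
    using sum_mono[OF rate_side_info] by (simp add: sum.distrib sum_distrib_left)
  moreover have "?L = (\<Sum>k\<in>users. fano_rate \<delta> (M k))"
    using sum.permute[OF p, of "\<lambda>k. fano_rate \<delta> (M k)"] by (simp add: comp_def)
  ultimately show ?thesis by (simp add: sum.distrib distrib_left)
qed

end

theorem (in ordered_gaussian_ic) sum_rate_le_Aterm:
  assumes cond: "cond_a Q p \<or> cond_b Q p" and achievable: "achievable h P R"
  shows "ereal (R 1 + R 2 + R 3) \<le> Aterm Q p"
proof (cases "Aterm Q p = \<infinity>")
  case False
  with cond interpret bounded_gaussian_ic Q p by unfold_locales
  let ?S = "\<Sum>j\<in>users. nats_noise j + nats_side j + nats_genie j"
  obtain enc dec where code: "\<And>n. is_code P n (msize n R) (enc n) (dec n)"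
    and error: "(\<lambda>n. err h n (msize n R) (enc n) (dec n)) \<longlonglongrightarrow> 0"
    using achievable unfolding achievable_def by blast
  have "(\<Sum>k\<in>users. fano_rate (err h n (msize n R) (enc n) (dec n)) (msize n R k)) \<le> real n * (?S / 3)" if "0 < n" for n
  proof -
    interpret coded_gaussian_ic Q p n "msize n R" "enc n" "dec n"
      using code msize_ge(2) power_nonneg that by unfold_locales auto
    show ?thesis using sum_fano_rate_le by simp
  qed
  then have "ln 2 * (\<Sum>k\<in>users. R k) \<le> ?S / 3" by (rule rate_le_if_fano_le[OF error])
  moreover have "(\<Sum>k\<in>users. R k) = R 1 + R 2 + R 3" by (simp add: users_def)
  ultimately show ?thesis unfolding Aterm_eq_nats by (simp add: field_simps)
qed simp

theorem theorem3:
  fixes Q :: prm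
  assumes "\<forall>k\<in>users. 0 \<le> ch_P Q k"
      and "\<forall>j\<in>users. \<forall>k\<in>users. j \<noteq> k \<longrightarrow> ch_h Q j k \<noteq> 0"
      and "\<forall>k\<in>users. 0 \<le> sW Q k \<and> sW Q k \<le> 1 \<and> cmod (rW Q k) \<le> 1"
      and "\<forall>k\<in>users. 0 \<le> sN Q k \<and> sN Q k \<le> 1 \<and> cmod (rN Q k) \<le> 1"
  shows "\<forall>p. p permutes users \<longrightarrow>
           (cond_a Q p \<longrightarrow> (\<forall>R. achievable (ch_h Q) (ch_P Q) R \<longrightarrow>
               ereal (R 1 + R 2 + R 3) \<le> Aterm Q p + I0term Q p)) \<and>
           (cond_b Q p \<longrightarrow> (\<forall>R. achievable (ch_h Q) (ch_P Q) R \<longrightarrow>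
               ereal (R 1 + R 2 + R 3) \<le> Aterm Q p + I1term Q p)) \<and>
           (cond_a Q p \<and> cond_b Q p \<longrightarrow>
               sum_capacity (ch_h Q) (ch_P Q) \<le> Aterm Q p + min (I0term Q p) (I1term Q p))"
proof (intro allI impI conjI)
  fix p :: "nat \<Rightarrow> nat" assume p: "p permutes users"
  interpret ordered_gaussian_ic Q p using assms p by unfold_locales
  have bound: "ereal (R 1 + R 2 + R 3) \<le> Aterm Q p + I" if "cond_a Q p \<or> cond_b Q p" "achievable h P R" "0 \<le> I" for R I
    using add_mono[OF sum_rate_le_Aterm[OF that(1,2)] that(3)] by simp
  show "ereal (R 1 + R 2 + R 3) \<le> Aterm Q p + I0term Q p" if "cond_a Q p" "achievable h P R" for R
    using bound that I_terms_nonneg by blast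
  show "ereal (R 1 + R 2 + R 3) \<le> Aterm Q p + I1term Q p" if "cond_b Q p" "achievable h P R" for R
    using bound that I_terms_nonneg by blast
  show "sum_capacity h P \<le> Aterm Q p + min (I0term Q p) (I1term Q p)" if "cond_a Q p \<and> cond_b Q p"
    unfolding sum_capacity_def using bound that I_terms_nonneg by (intro SUP_least) auto
qed

end
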